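(* For any partitions $\lambda,\mu,\nu$ the dual Littlewood--Richardson polynomial is given by $$\widehat c_{\lambda\mu}^{\,\nu}(a)=\sum_{\alpha,\beta,\gamma}(-1)^{n(\alpha/\lambda)+n(\beta/\mu)+m(\nu/\gamma)}\,c_{\alpha\beta}^{\gamma}\,\varphi_{\alpha/\lambda}(a)\,\varphi_{\beta/\mu}(a)\,\psi_{\nu/\gamma}(a),$$ summed over diagrams $\alpha,\beta,\gamma$, where $c_{\alpha\beta}^{\gamma}$ are the classical Littlewood--Richardson coefficients. In particular, $\widehat c_{\lambda\mu}^{\,\nu}(a)=0$ unless $\lambda\subseteq\nu$ and $\mu\subseteq\nu$.
   Context: Let $a=(a_i)_{i\in\mathbb Z}$ be a sequence of commuting indeterminates and $\mathbb Q[a]$ the polynomial ring in the $a_i$. The ring $\Lambda(x\|a)$: its elements are sequences $P=(P_0,P_1,P_2,\dots)$, where $P_n$ is a symmetric polynomial in $x_1,\dots,x_n$ with coefficients in $\mathbb Q[a]$, the total degrees of the $P_n$ in the $x_i$ are bounded, and $P_n(x_1,\dots,x_{n-1},a_n)=P_{n-1}(x_1,\dots,x_{n-1})$ for all $n\geqslant 1$; multiplication is componentwise. It is freely generated over $\mathbb Q[a]$ by the double power sums $p_k(x\|a)=\sum_{i\geqslant 1}(x_i^k-a_i^k)$, $k\geqslant 1$. Double Schur functions: for a partition $\lambda$ with length $\ell(\lambda)\leqslant n$, $$s_\lambda(x_1,\dots,x_n\|a)=\frac{\det\big[(x_i\|a)^{\lambda_j+n-j}\big]_{i,j=1}^n}{\prod_{1\leqslant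 i<j\leqslant n}(x_i-x_j)},\qquad (x_i\|a)^r=(x_i-a_n)(x_i-a_{n-1})\cdots(x_i-a_{n-r+1}),\ (x_i\|a)^0=1,$$ and $0$ if $\ell(\lambda)>n$. This sequence is $s_\lambda(x\|a)\in\Lambda(x\|a)$; the $s_\lambda(x\|a)$ form a $\mathbb Q[a]$-basis. Dual Littlewood--Richardson polynomials: let $\Delta:\Lambda(x\|a)\to\Lambda(x\|a)\otimes_{\mathbb Q[a]}\Lambda(x\|a)$ be the $\mathbb Q[a]$-linear ring homomorphism with $\Delta(p_k(x\|a))=p_k(x\|a)\otimes 1+1\otimes p_k(x\|a)$. The $\widehat c_{\lambda\mu}^{\,\nu}(a)\in\mathbb Q[a]$ are defined by $\Delta(s_\nu(x\|a))=\sum_{\lambda,\mu}\widehat c_{\lambda\mu}^{\,\nu}(a)\,s_\lambda(x\|a)\otimes s_\mu(x\|a)$. The polynomials $\varphi$ and $\psi$: suppose $\mu\subseteq\lambda$ are diagrams with the same number $d$ of boxes on their main diagonals; $\lambda'$ denotes the conjugate of $\lambda$. - A hook $\lambda/\mu$-tableau is a filling $T$ of the boxes of $\lambda/\mu$ with integers such that: the entries in the first $d$ rows weakly increase along the rows and strictly increase down the columns, and all entries in row $i$ belong to $\{i-\mu_i,\dots,-1,0\}$ for $i=1,\dots,d$; the entries in the first $d$ columns weakly decrease down the columns and strictly decrease along the rows, and all entries in column $j$ belong to $\{1,2,\dots,\mu'_j-j+1\}$ for $j=1,\dots,d$. Set $\varphi_{\lambda/\mu}(a)=\sum_T\prod_{\alpha\in\lambda/\mu}a_{T(\alpha)}$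 over hook $\lambda/\mu$-tableaux. - A dual hook $\lambda/\mu$-tableau is a filling $T$ of the boxes of $\lambda/\mu$ with integers such that: the entries in the first $d$ rows strictly decrease along the rows and weakly decrease down the columns, and all entries in row $i$ belong to $\{0,-1,\dots,i-\lambda_i+1\}$ for $i=1,\dots,d$; the entries in the first $d$ columns strictly increase down the columns and weakly increase along the rows, and all entries in column $j$ belong to $\{1,2,\dots,\lambda'_j-j\}$ for $j=1,\dots,d$. Set $\psi_{\lambda/\mu}(a)=\sum_T\prod_{\alpha\in\lambda/\mu}a_{T(\alpha)}$ over dual hook $\lambda/\mu$-tableaux. - $m(\lambda/\mu)$ is the number of boxes of $\lambda/\mu$ in rows $1,\dots,d$, and $n(\lambda/\mu)$ is the number of boxes of $\lambda/\mu$ in rows $d+1,d+2,\dots$. - $\varphi_{\lambda/\mu}(a)=\psi_{\lambda/\mu}(a)=0$ unless $\mu\subseteq\lambda$ and the diagrams $\lambda,\mu$ have the same number of boxes on their main diagonals. The coefficients $c_{\alpha\beta}^{\gamma}$ are defined by $s_\alpha(x)s_\beta(x)=\sum_\gamma c_{\alpha\beta}^{\gamma}s_\gamma(x)$ for the ordinary Schur functions. *)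

theory Defs
  imports
    "HOL-Library.Poly_Mapping"
    "HOL-Library.FuncSet"
    "HOL-Combinatorics.Permutations"
    "Jordan_Normal_Form.Determinant"
begin

lifting_forget poly_mapping.lifting

section \<open>Polynomial rings\<close>

text \<open>
  Multivariate polynomials are finitely supported maps from monomials (finitely supported
  exponent vectors) to coefficients, with the convolution product of
  \<^theory>\<open>HOL-Library.Poly_Mapping\<close>.
\<close>

type_synonym ('v, 'r) mvpoly = "('v \<Rightarrow>\<^sub>0 nat) \<Rightarrow>\<^sub>0 'r"

type_synonym Qa = "(int, rat) mvpoly"

type_synonym Qax = "(nat, Qa) mvpoly"

definition mvar :: "'v \<Rightarrow> ('v, 'r::comm_ring_1) mvpoly" where
  "mvar i = Poly_Mapping.single (Poly_Mapping.single i 1) 1"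

definition mconst :: "'r \<Rightarrow> ('v, 'r::comm_ring_1) mvpoly" where
  "mconst c = Poly_Mapping.single 0 c"

definition avar :: "int \<Rightarrow> Qa" where
  "avar i = mvar i"

definition msubst :: "('v \<Rightarrow> ('w, 'r) mvpoly) \<Rightarrow> ('v, 'r::comm_ring_1) mvpoly \<Rightarrow> ('w, 'r) mvpoly" where
  "msubst \<sigma> p = (\<Sum>m\<in>Poly_Mapping.keys p. mconst (Poly_Mapping.lookup p m) *
     (\<Prod>i\<in>Poly_Mapping.keys m. \<sigma> i ^ Poly_Mapping.lookup m i))"

definition monom_degree :: "('v \<Rightarrow>\<^sub>0 nat) \<Rightarrow> nat" where
  "monom_degree m = (\<Sum>i\<in>Poly_Mapping.keys m. Poly_Mapping.lookup m i)"

lemma mconst_simps [simp]: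
  "mconst 0 = 0" "mconst 1 = 1"
  "mconst (c + d) = mconst c + mconst d" "mconst (c * d) = mconst c * mconst d"
  "mconst (- c) = - mconst c"
  by (simp_all add: mconst_def single_add mult_single single_uminus)

lemma keys_mvar: "Poly_Mapping.keys (mvar i :: ('v, 'r::comm_ring_1) mvpoly) = {Poly_Mapping.single i 1}"
  by (simp add: mvar_def)

lemma keys_mconst: "Poly_Mapping.keys (mconst c) \<subseteq> {0}"
  by (simp add: mconst_def)

lemma monom_degree_superset:
  assumes "finite A" "Poly_Mapping.keys m \<subseteq> A"
  shows "monom_degree m = (\<Sum>i\<in>A. Poly_Mapping.lookup m i)"
  unfolding monom_degree_def using assms
  by (intro sum.mono_neutral_left) (auto simp: in_keys_iff)

lemma monom_degree_add: "monom_degree (m + m') = monom_degree m + monom_degree m'"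
proof -
  let ?A = "Poly_Mapping.keys m \<union> Poly_Mapping.keys m'"
  have "Poly_Mapping.keys (m + m') \<subseteq> ?A" by (rule keys_add)
  then show ?thesis
    by (simp add: monom_degree_superset[of ?A] lookup_add sum.distrib)
qed

lemma monom_degree_simps [simp]:
  "monom_degree 0 = 0" "monom_degree (Poly_Mapping.single i k) = k"
  by (simp_all add: monom_degree_def)

lemma msubst_superset:
  assumes "finite A" "Poly_Mapping.keys p \<subseteq> A"
  shows "msubst \<sigma> p = (\<Sum>m\<in>A. mconst (Poly_Mapping.lookup p m) *
     (\<Prod>i\<in>Poly_Mapping.keys m. \<sigma> i ^ Poly_Mapping.lookup m i))"
  unfolding msubst_def using assms
  by (intro sum.mono_neutral_left) (auto simp: in_keys_iff)

lemma msubst_add [simp]: "msubst \<sigma> (p + q) = msubst \<sigma> p + msubst \<sigma> q"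
proof -
  let ?A = "Poly_Mapping.keys p \<union> Poly_Mapping.keys q"
  have "Poly_Mapping.keys (p + q) \<subseteq> ?A" by (rule keys_add)
  then show ?thesis
    by (simp add: msubst_superset[of ?A] lookup_add sum.distrib distrib_right)
qed

lemma msubst_0 [simp]: "msubst \<sigma> 0 = 0"
  by (simp add: msubst_def)

lemma msubst_uminus [simp]: "msubst \<sigma> (- p) = - msubst \<sigma> p"
  using msubst_add[of \<sigma> p "- p"] by (simp add: eq_neg_iff_add_eq_0 add.commute)

lemma msubst_diff [simp]: "msubst \<sigma> (p - q) = msubst \<sigma> p - msubst \<sigma> q"
  using msubst_add[of \<sigma> p "- q"] by simp

lemma msubst_sum: "msubst \<sigma> (sum f A) = (\<Sum>i\<in>A. msubst \<sigma> (f i))"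
  by (induction A rule: infinite_finite_induct) auto

lemma msubst_single:
  "msubst \<sigma> (Poly_Mapping.single m c) =
     mconst c * (\<Prod>i\<in>Poly_Mapping.keys m. \<sigma> i ^ Poly_Mapping.lookup m i)"
  by (cases "c = 0") (simp_all add: msubst_def)

lemma msubst_monom_add:
  fixes \<sigma> :: "'v \<Rightarrow> ('w, 'r::comm_ring_1) mvpoly"
  shows "(\<Prod>i\<in>Poly_Mapping.keys (m + m'). \<sigma> i ^ Poly_Mapping.lookup (m + m') i) =
    (\<Prod>i\<in>Poly_Mapping.keys m. \<sigma> i ^ Poly_Mapping.lookup m i) *
    (\<Prod>i\<in>Poly_Mapping.keys m'. \<sigma> i ^ Poly_Mapping.lookup m' i)"
proof -
  let ?A = "Poly_Mapping.keys m \<union> Poly_Mapping.keys m'"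
  have *: "(\<Prod>i\<in>Poly_Mapping.keys n. \<sigma> i ^ Poly_Mapping.lookup n i) =
      (\<Prod>i\<in>?A. \<sigma> i ^ Poly_Mapping.lookup n i)" if "Poly_Mapping.keys n \<subseteq> ?A" for n
    using that by (intro prod.mono_neutral_left) (auto simp: in_keys_iff)
  have "(\<Prod>i\<in>Poly_Mapping.keys (m + m'). \<sigma> i ^ Poly_Mapping.lookup (m + m') i) =
      (\<Prod>i\<in>?A. \<sigma> i ^ Poly_Mapping.lookup (m + m') i)"
    by (rule *[OF keys_add])
  then show ?thesis
    using *[of m] *[of m'] by (simp add: lookup_add power_add prod.distrib)
qed

lemma mvpoly_induct [case_names zero add_single]:
  fixes p :: "('v, 'r::comm_ring_1) mvpoly"
  assumes "P 0" "\<And>m c p. P p \<Longrightarrow> P (Poly_Mapping.single m c + p)"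
  shows "P p"
proof (induction p rule: update_induct)
  case const
  show ?case using assms(1) by simp
next
  case (update p m c)
  then have "Poly_Mapping.update m c p = Poly_Mapping.single m c + p"
    by (intro poly_mapping_eqI) (auto simp: lookup_update lookup_add lookup_single in_keys_iff when_def)
  then show ?case using assms(2) update by simp
qed

lemma msubst_mult_single:
  "msubst \<sigma> (Poly_Mapping.single m c * q) = msubst \<sigma> (Poly_Mapping.single m c) * msubst \<sigma> q"
  by (induction q rule: mvpoly_induct)
    (simp_all add: distrib_left mult_single msubst_single msubst_monom_add mult_ac)

lemma msubst_mult [simp]: "msubst \<sigma> (p * q) = msubst \<sigma> p * msubst \<sigma> q"
  by (induction p rule: mvpoly_induct) (simp_all add: distrib_right msubst_mult_single)

lemma msubst_mconst [simp]: "msubst \<sigma> (mconst c) = mconst c"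
  using msubst_single[of \<sigma> 0 c] by (simp add: mconst_def)

lemma msubst_1 [simp]: "msubst \<sigma> 1 = 1"
  using msubst_mconst[of \<sigma> 1] by simp

lemma msubst_mvar [simp]: "msubst \<sigma> (mvar i) = \<sigma> i"
  by (simp add: mvar_def msubst_single)

lemma msubst_power [simp]: "msubst \<sigma> (p ^ k) = msubst \<sigma> p ^ k"
  by (induction k) simp_all

section \<open>The ring \<open>\<Lambda>(x\<parallel>a)\<close>\<close>

text \<open>
  The variables are \<open>mvar 1, mvar 2, \<dots>\<close>; the index \<open>0\<close> of \<^typ>\<open>Qax\<close> is never used.
\<close>

definition vars_in :: "nat \<Rightarrow> Qax \<Rightarrow> bool" where
  "vars_in n p \<longleftrightarrow> (\<forall>m\<in>Poly_Mapping.keys p. Poly_Mapping.keys m \<subseteq> {1..n})"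

definition symmetric_in :: "nat \<Rightarrow> Qax \<Rightarrow> bool" where
  "symmetric_in n p \<longleftrightarrow> (\<forall>\<pi>. \<pi> permutes {1..n} \<longrightarrow> msubst (\<lambda>i. mvar (\<pi> i)) p = p)"

definition degree_le :: "nat \<Rightarrow> Qax \<Rightarrow> bool" where
  "degree_le d p \<longleftrightarrow> (\<forall>m\<in>Poly_Mapping.keys p. monom_degree m \<le> d)"

definition Lambda_carrier :: "(nat \<Rightarrow> Qax) set" where
  "Lambda_carrier = {P.
     (\<forall>n. vars_in n (P n) \<and> symmetric_in n (P n)) \<and>
     (\<exists>d. \<forall>n. degree_le d (P n)) \<and>
     (\<forall>n\<ge>1. msubst (mvar(n := mconst (avar (int n)))) (P n) = P (n - 1))}"

lemma vars_in_closed [simp]: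
  "vars_in n 0" "vars_in n (mconst c)" "vars_in n 1"
  "vars_in n p \<Longrightarrow> vars_in n (- p)"
  "vars_in n p \<Longrightarrow> vars_in n q \<Longrightarrow> vars_in n (p + q)"
  "vars_in n p \<Longrightarrow> vars_in n q \<Longrightarrow> vars_in n (p - q)"
  "vars_in n p \<Longrightarrow> vars_in n q \<Longrightarrow> vars_in n (p * q)"
proof -
  show "vars_in n 0" "vars_in n 1" by (simp_all add: vars_in_def)
  show "vars_in n (mconst c)" using keys_mconst[of c] by (auto simp: vars_in_def)
  show "vars_in n p \<Longrightarrow> vars_in n (- p)" by (simp add: vars_in_def in_keys_iff)
  show add: "vars_in n p \<Longrightarrow> vars_in n q \<Longrightarrow> vars_in n (p + q)" for p q
    using keys_add[of p q] unfolding vars_in_def by blast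
  show "vars_in n p \<Longrightarrow> vars_in n q \<Longrightarrow> vars_in n (p - q)"
    using add[of p "- q"] by (simp add: vars_in_def in_keys_iff)
  show "vars_in n (p * q)" if pq: "vars_in n p" "vars_in n q"
    unfolding vars_in_def
  proof
    fix m assume "m \<in> Poly_Mapping.keys (p * q)"
    then obtain k l where "m = k + l" "k \<in> Poly_Mapping.keys p" "l \<in> Poly_Mapping.keys q"
      using keys_mult[of p q] by auto
    then show "Poly_Mapping.keys m \<subseteq> {1..n}"
      using pq keys_add[of k l] unfolding vars_in_def by blast
  qed
qed

lemma vars_in_mvar: "1 \<le> i \<Longrightarrow> i \<le> n \<Longrightarrow> vars_in n (mvar i)"
  by (simp add: vars_in_def keys_mvar)

lemma vars_in_power: "vars_in n p \<Longrightarrow> vars_in n (p ^ k)"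
  by (induction k) simp_all

lemma vars_in_sum: "(\<And>i. i \<in> A \<Longrightarrow> vars_in n (f i)) \<Longrightarrow> vars_in n (sum f A)"
  by (induction A rule: infinite_finite_induct) simp_all

lemma symmetric_in_closed [simp]:
  "symmetric_in n 0" "symmetric_in n (mconst c)" "symmetric_in n 1"
  "symmetric_in n p \<Longrightarrow> symmetric_in n (- p)"
  "symmetric_in n p \<Longrightarrow> symmetric_in n q \<Longrightarrow> symmetric_in n (p + q)"
  "symmetric_in n p \<Longrightarrow> symmetric_in n q \<Longrightarrow> symmetric_in n (p - q)"
  "symmetric_in n p \<Longrightarrow> symmetric_in n q \<Longrightarrow> symmetric_in n (p * q)"
  by (simp_all add: symmetric_in_def)

lemma degree_le_mono: "degree_le d p \<Longrightarrow> d \<le> e \<Longrightarrow> degree_le e p"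
  by (force simp: degree_le_def)

lemma degree_le_closed [simp]:
  "degree_le d 0" "degree_le d (mconst c)" "degree_le d 1"
  "degree_le d p \<Longrightarrow> degree_le d (- p)"
proof -
  show "degree_le d 0" "degree_le d 1" by (simp_all add: degree_le_def)
  show "degree_le d (mconst c)" using keys_mconst[of c] by (auto simp: degree_le_def)
  show "degree_le d p \<Longrightarrow> degree_le d (- p)" by (simp add: degree_le_def in_keys_iff)
qed

lemma degree_le_add: "degree_le d p \<Longrightarrow> degree_le d q \<Longrightarrow> degree_le d (p + q)"
  using keys_add[of p q] unfolding degree_le_def by blast

lemma degree_le_diff: "degree_le d p \<Longrightarrow> degree_le d q \<Longrightarrow> degree_le d (p - q)"
  using degree_le_add[of d p "- q"] by simp

lemma degree_le_mult: "degree_le d p \<Longrightarrow> degree_le e q \<Longrightarrow> degree_le (d + e) (p * q)"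
  unfolding degree_le_def using keys_mult[of p q] by (fastforce simp: monom_degree_add intro: add_mono)

lemma degree_le_power: "degree_le d p \<Longrightarrow> degree_le (k * d) (p ^ k)"
  by (induction k) (simp_all add: degree_le_mult)

lemma degree_le_sum: "(\<And>i. i \<in> A \<Longrightarrow> degree_le d (f i)) \<Longrightarrow> degree_le d (sum f A)"
  by (induction A rule: infinite_finite_induct) (simp_all add: degree_le_add)

typedef Lambda = Lambda_carrier
  morphisms component Abs_Lambda
  by (rule exI[of _ "\<lambda>_. 0"]) (simp add: Lambda_carrier_def)

setup_lifting type_definition_Lambda

instantiation Lambda :: comm_ring_1
begin

lift_definition zero_Lambda :: Lambda is "\<lambda>_. 0"
  by (simp add: Lambda_carrier_def)

lift_definition one_Lambda :: Lambda is "\<lambda>_. 1"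
  by (simp add: Lambda_carrier_def)

lift_definition uminus_Lambda :: "Lambda \<Rightarrow> Lambda" is "\<lambda>P n. - P n"
  by (simp add: Lambda_carrier_def) (metis degree_le_closed(4))

lift_definition plus_Lambda :: "Lambda \<Rightarrow> Lambda \<Rightarrow> Lambda" is "\<lambda>P Q n. P n + Q n"
proof -
  fix P Q assume PQ: "P \<in> Lambda_carrier" "Q \<in> Lambda_carrier"
  then obtain d e where "\<forall>n. degree_le d (P n)" "\<forall>n. degree_le e (Q n)"
    by (auto simp: Lambda_carrier_def)
  then have "\<forall>n. degree_le (max d e) (P n + Q n)"
    by (meson degree_le_add degree_le_mono max.cobounded1 max.cobounded2)
  then show "(\<lambda>n. P n + Q n) \<in> Lambda_carrier"
    using PQ by (auto simp: Lambda_carrier_def)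
qed

lift_definition minus_Lambda :: "Lambda \<Rightarrow> Lambda \<Rightarrow> Lambda" is "\<lambda>P Q n. P n - Q n"
proof -
  fix P Q assume PQ: "P \<in> Lambda_carrier" "Q \<in> Lambda_carrier"
  then obtain d e where "\<forall>n. degree_le d (P n)" "\<forall>n. degree_le e (Q n)"
    by (auto simp: Lambda_carrier_def)
  then have "\<forall>n. degree_le (max d e) (P n - Q n)"
    by (meson degree_le_diff degree_le_mono max.cobounded1 max.cobounded2)
  then show "(\<lambda>n. P n - Q n) \<in> Lambda_carrier"
    using PQ by (auto simp: Lambda_carrier_def)
qed

lift_definition times_Lambda :: "Lambda \<Rightarrow> Lambda \<Rightarrow> Lambda" is "\<lambda>P Q n. P n * Q n"
proof -
  fix P Q assume PQ: "P \<in> Lambda_carrier" "Q \<in> Lambda_carrier"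
  then obtain d e where "\<forall>n. degree_le d (P n)" "\<forall>n. degree_le e (Q n)"
    by (auto simp: Lambda_carrier_def)
  then have "\<forall>n. degree_le (d + e) (P n * Q n)"
    by (simp add: degree_le_mult)
  then show "(\<lambda>n. P n * Q n) \<in> Lambda_carrier"
    using PQ by (auto simp: Lambda_carrier_def)
qed

instance
proof
  show "(0::Lambda) \<noteq> 1"
    by transfer (metis zero_neq_one)
qed (transfer; simp add: algebra_simps)+

end

lift_definition scale_Lambda :: "Qa \<Rightarrow> Lambda \<Rightarrow> Lambda" is "\<lambda>c P n. mconst c * P n"
proof -
  fix c P assume P: "P \<in> Lambda_carrier"
  then obtain d where "\<forall>n. degree_le d (P n)"
    by (auto simp: Lambda_carrier_def)
  then have "\<forall>n. degree_le (0 + d) (mconst c * P n)"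
    by (meson degree_le_closed(2) degree_le_mult)
  then show "(\<lambda>n. mconst c * P n) \<in> Lambda_carrier"
    using P by (auto simp: Lambda_carrier_def)
qed

lift_definition power_sum :: "nat \<Rightarrow> Lambda" is
  "\<lambda>k n. \<Sum>i = 1..n. mvar i ^ k - mconst (avar (int i) ^ k)"
proof -
  fix k
  let ?P = "\<lambda>n. \<Sum>i = 1..n. (mvar i ^ k - mconst (avar (int i) ^ k) :: Qax)"
  have vars: "vars_in n (?P n)" for n
    by (auto intro!: vars_in_sum vars_in_closed vars_in_power vars_in_mvar)
  have sym: "symmetric_in n (?P n)" for n
    unfolding symmetric_in_def
  proof (intro allI impI)
    fix \<pi> assume "\<pi> permutes {1..n}"
    then have "(\<Sum>i = 1..n. mvar (\<pi> i) ^ k) = (\<Sum>i = 1..n. mvar i ^ k :: Qax)"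
      using sum.permute[of \<pi> "{1..n}" "\<lambda>i. mvar i ^ k :: Qax"] by (simp add: o_def)
    then show "msubst (\<lambda>i. mvar (\<pi> i)) (?P n) = ?P n"
      by (simp add: msubst_sum sum_subtractf)
  qed
  have "degree_le 1 (mvar i)" for i
    by (simp add: degree_le_def keys_mvar)
  from degree_le_power[OF this, of k]
  have deg: "degree_le k (?P n)" for n
    by (intro degree_le_sum degree_le_diff) simp_all
  have "msubst (mvar(n := mconst (avar (int n)))) (?P n) = ?P (n - 1)" if "n \<ge> 1" for n
  proof -
    have mc: "mconst (c ^ k) = (mconst c :: Qax) ^ k" for c
      by (induction k) simp_all
    from that obtain l where n: "n = Suc l" by (cases n) auto
    show ?thesis
      by (simp add: n msubst_sum mc)
  qed
  then show "?P \<in> Lambda_carrier"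
    using vars sym deg by (auto simp: Lambda_carrier_def)
qed

section \<open>The tensor square \<open>\<Lambda>(x\<parallel>a) \<otimes> \<Lambda>(x\<parallel>a)\<close> over \<open>\<rat>[a]\<close>\<close>

text \<open>
  The tensor square is the free \<open>\<rat>[a]\<close>-module on the pairs \<open>(p, q)\<close> modulo the submodule
  spanned by the bilinearity relations. The multiplicative monoid of pairs is
  written additively, so that the convolution product of \<open>pair \<Rightarrow>\<^sub>0 Qa\<close> is the bilinear
  extension of \<open>(p, q) (p', q') = (p p', q q')\<close>.
\<close>

datatype pair = Pair_of (left: Lambda) (right: Lambda)

instantiation pair :: comm_monoid_add
begin

definition zero_pair :: pair where
  "0 = Pair_of 1 1"

definition plus_pair :: "pair \<Rightarrow> pair \<Rightarrow> pair" where
  "x + y = Pair_of (left x * left y) (right x * right y)"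

instance
  by standard (simp_all add: zero_pair_def plus_pair_def mult_ac)

end

definition free_tensor :: "Lambda \<Rightarrow> Lambda \<Rightarrow> pair \<Rightarrow>\<^sub>0 Qa" where
  "free_tensor p q = Poly_Mapping.single (Pair_of p q) 1"

definition free_scale :: "Qa \<Rightarrow> (pair \<Rightarrow>\<^sub>0 Qa) \<Rightarrow> (pair \<Rightarrow>\<^sub>0 Qa)" where
  "free_scale c f = Poly_Mapping.map ((*) c) f"

lemma free_scale_conv_mult: "free_scale c f = Poly_Mapping.single 0 c * f"
  by (simp add: free_scale_def mult_map_scale_conv_mult)

interpretation free_module: Modules.module free_scale
  by standard (simp_all add: free_scale_conv_mult algebra_simps single_add mult_single flip: mult.assoc)

definition bilinearity_relations :: "(pair \<Rightarrow>\<^sub>0 Qa) set" where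
  "bilinearity_relations =
     {free_tensor (p + p') q - free_tensor p q - free_tensor p' q | p p' q. True} \<union>
     {free_tensor p (q + q') - free_tensor p q - free_tensor p q' | p q q'. True} \<union>
     {free_tensor (scale_Lambda c p) q - free_scale c (free_tensor p q) | c p q. True} \<union>
     {free_tensor p (scale_Lambda c q) - free_scale c (free_tensor p q) | c p q. True}"

definition tensor_eq :: "(pair \<Rightarrow>\<^sub>0 Qa) \<Rightarrow> (pair \<Rightarrow>\<^sub>0 Qa) \<Rightarrow> bool" where
  "tensor_eq f g \<longleftrightarrow> f - g \<in> free_module.span bilinearity_relations"

lemma equivp_tensor_eq: "equivp tensor_eq"
proof (rule equivpI)
  show "reflp tensor_eq"
    by (auto intro!: reflpI simp: tensor_eq_def free_module.span_zero)
  show "symp tensor_eq"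
    by (rule sympI) (metis tensor_eq_def free_module.span_neg minus_diff_eq)
  show "transp tensor_eq"
  proof (rule transpI)
    fix f g h assume "tensor_eq f g" "tensor_eq g h"
    then have "(f - g) + (g - h) \<in> free_module.span bilinearity_relations"
      unfolding tensor_eq_def by (rule free_module.span_add)
    then show "tensor_eq f h" by (simp add: tensor_eq_def)
  qed
qed

lemma free_tensor_mult: "free_tensor p q * free_tensor p' q' = free_tensor (p * p') (q * q')"
  by (simp add: free_tensor_def mult_single plus_pair_def)

lemma scale_Lambda_mult: "scale_Lambda c p * q = scale_Lambda c (p * q)"
  by transfer (simp add: mult.assoc)

lemma bilinearity_relations_mult:
  assumes "r \<in> bilinearity_relations"
  shows "free_tensor u v * r \<in> bilinearity_relations"
proof -
  have sc: "free_tensor u v * free_scale c f = free_scale c (free_tensor u v * f)" for c f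
    by (simp add: free_scale_conv_mult mult_ac)
  have cs: "u * scale_Lambda c p = scale_Lambda c (u * p)" for u c p
    by (metis scale_Lambda_mult mult.commute)
  from assms show ?thesis
    unfolding bilinearity_relations_def Un_iff
    apply (elim disjE)
    subgoal by (intro disjI1) (fastforce simp: right_diff_distrib free_tensor_mult distrib_left)
    subgoal by (intro disjI1 disjI2) (fastforce simp: right_diff_distrib free_tensor_mult distrib_left)
    subgoal by (rule disjI1, rule disjI2) (fastforce simp: right_diff_distrib free_tensor_mult sc cs)
    subgoal by (rule disjI2) (fastforce simp: right_diff_distrib free_tensor_mult sc cs)
    done
qed

lemma span_relations_mult:
  assumes "r \<in> free_module.span bilinearity_relations"
  shows "f * r \<in> free_module.span bilinearity_relations"
proof -
  have gen: "free_tensor u v * r \<in> free_module.span bilinearity_relations" for u v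
    using assms
  proof (induction rule: free_module.span_induct_alt)
    case base
    show ?case by (simp add: free_module.span_zero)
  next
    case (step c x y)
    have "free_tensor u v * (free_scale c x + y) =
        free_scale c (free_tensor u v * x) + free_tensor u v * y"
      by (simp add: free_scale_conv_mult algebra_simps)
    then show ?case
      using step by (simp add: bilinearity_relations_mult free_module.span_add
          free_module.span_scale free_module.span_base)
  qed
  show ?thesis
  proof (induction f rule: update_induct)
    case const
    show ?case by (simp add: free_module.span_zero)
  next
    case (update f k c)
    have "Poly_Mapping.update k c f = free_scale c (free_tensor (left k) (right k)) + f"
      using update by (intro poly_mapping_eqI)
        (auto simp: lookup_update lookup_add free_scale_def free_tensor_def lookup_single in_keys_iff when_def)
    then have "Poly_Mapping.update k c f * r =
        free_scale c (free_tensor (left k) (right k) * r) + f * r"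
      by (simp add: free_scale_conv_mult algebra_simps)
    then show ?case
      using update gen by (simp add: free_module.span_add free_module.span_scale)
  qed
qed

text \<open>The functional \<open>p \<otimes> q \<mapsto> p\<^sub>0 q\<^sub>0\<close>, showing that the tensor square is not the zero ring.\<close>

definition counit :: "Lambda \<Rightarrow> Qa" where
  "counit P = Poly_Mapping.lookup (component P 0) 0"

definition free_counit :: "(pair \<Rightarrow>\<^sub>0 Qa) \<Rightarrow> Qa" where
  "free_counit f = (\<Sum>k\<in>Poly_Mapping.keys f. Poly_Mapping.lookup f k * (counit (left k) * counit (right k)))"

lemma free_counit_superset:
  assumes "finite A" "Poly_Mapping.keys f \<subseteq> A"
  shows "free_counit f = (\<Sum>k\<in>A. Poly_Mapping.lookup f k * (counit (left k) * counit (right k)))"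
  unfolding free_counit_def using assms
  by (intro sum.mono_neutral_left) (auto simp: in_keys_iff)

lemma free_counit_add: "free_counit (f + g) = free_counit f + free_counit g"
proof -
  let ?A = "Poly_Mapping.keys f \<union> Poly_Mapping.keys g"
  have "Poly_Mapping.keys (f + g) \<subseteq> ?A" by (rule keys_add)
  then show ?thesis
    by (simp add: free_counit_superset[of ?A] lookup_add sum.distrib distrib_right)
qed

lemma free_counit_diff: "free_counit (f - g) = free_counit f - free_counit g"
  using free_counit_add[of "f - g" g] by simp

lemma free_counit_scale: "free_counit (free_scale c f) = c * free_counit f"
proof -
  have "Poly_Mapping.keys (free_scale c f) \<subseteq> Poly_Mapping.keys f"
    by (auto simp: in_keys_iff free_scale_def map.rep_eq when_def)
  then show ?thesis
    by (simp add: free_counit_superset[of "Poly_Mapping.keys f"] free_scale_def map.rep_eq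
        sum_distrib_left mult.assoc when_def in_keys_iff cong: if_cong)
qed

lemma free_counit_tensor: "free_counit (free_tensor p q) = counit p * counit q"
  by (simp add: free_counit_def free_tensor_def)

lemma counit_simps:
  "counit (p + q) = counit p + counit q" "counit (scale_Lambda c p) = c * counit p" "counit 1 = 1"
proof -
  show "counit (p + q) = counit p + counit q"
    by (simp add: counit_def plus_Lambda.rep_eq lookup_add)
  show "counit 1 = 1"
    by (simp add: counit_def one_Lambda.rep_eq)
  show "counit (scale_Lambda c p) = c * counit p"
    by (auto simp: counit_def scale_Lambda.rep_eq mconst_def map.rep_eq when_def
        simp flip: mult_map_scale_conv_mult)
qed

lemma one_not_in_span: "1 \<notin> free_module.span bilinearity_relations"
proof
  have rel: "free_counit r = 0" if "r \<in> bilinearity_relations" for r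
  proof -
    have "(\<exists>p p' q. r = free_tensor (p + p') q - free_tensor p q - free_tensor p' q) \<or>
        (\<exists>p q q'. r = free_tensor p (q + q') - free_tensor p q - free_tensor p q') \<or>
        (\<exists>c p q. r = free_tensor (scale_Lambda c p) q - free_scale c (free_tensor p q)) \<or>
        (\<exists>c p q. r = free_tensor p (scale_Lambda c q) - free_scale c (free_tensor p q))"
      using that unfolding bilinearity_relations_def by blast
    then show ?thesis
      by (elim disjE exE) (simp_all only: free_counit_diff free_counit_scale free_counit_tensor
          counit_simps, simp_all add: algebra_simps)
  qed
  have "free_counit r = 0" if "r \<in> free_module.span bilinearity_relations" for r
    using that by (induction rule: free_module.span_induct_alt)
      (auto simp: free_counit_add free_counit_scale rel, simp add: free_counit_def)
  moreover assume "1 \<in> free_module.span bilinearity_relations"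
  moreover have "1 = free_tensor 1 1"
    by (simp add: free_tensor_def flip: zero_pair_def)
  ultimately show False
    by (metis free_counit_tensor counit_simps(3) mult_1 zero_neq_one)
qed

quotient_type Lambda2 = "pair \<Rightarrow>\<^sub>0 Qa" / tensor_eq
  by (rule equivp_tensor_eq)

instantiation Lambda2 :: comm_ring_1
begin

lift_definition zero_Lambda2 :: Lambda2 is 0 .

lift_definition one_Lambda2 :: Lambda2 is 1 .

lift_definition uminus_Lambda2 :: "Lambda2 \<Rightarrow> Lambda2" is "\<lambda>f. - f"
proof -
  fix f g :: "pair \<Rightarrow>\<^sub>0 Qa"
  assume "tensor_eq f g"
  then have "- (f - g) \<in> free_module.span bilinearity_relations"
    unfolding tensor_eq_def by (rule free_module.span_neg)
  then show "tensor_eq (- f) (- g)" by (simp add: tensor_eq_def)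
qed

lift_definition plus_Lambda2 :: "Lambda2 \<Rightarrow> Lambda2 \<Rightarrow> Lambda2" is "\<lambda>f g. f + g"
proof -
  fix f f' g g' :: "pair \<Rightarrow>\<^sub>0 Qa"
  assume "tensor_eq f f'" "tensor_eq g g'"
  moreover have "f + g - (f' + g') = (f - f') + (g - g')" by simp
  ultimately show "tensor_eq (f + g) (f' + g')"
    unfolding tensor_eq_def by (metis free_module.span_add)
qed

lift_definition minus_Lambda2 :: "Lambda2 \<Rightarrow> Lambda2 \<Rightarrow> Lambda2" is "\<lambda>f g. f - g"
proof -
  fix f f' g g' :: "pair \<Rightarrow>\<^sub>0 Qa"
  assume "tensor_eq f f'" "tensor_eq g g'"
  moreover have "f - g - (f' - g') = (f - f') - (g - g')" by simp
  ultimately show "tensor_eq (f - g) (f' - g')"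
    unfolding tensor_eq_def by (metis free_module.span_diff)
qed

lift_definition times_Lambda2 :: "Lambda2 \<Rightarrow> Lambda2 \<Rightarrow> Lambda2" is "\<lambda>f g. f * g"
proof -
  fix f f' g g' :: "pair \<Rightarrow>\<^sub>0 Qa"
  assume "tensor_eq f f'" "tensor_eq g g'"
  moreover have "f * g - f' * g' = g * (f - f') + f' * (g - g')" by (simp add: algebra_simps)
  ultimately show "tensor_eq (f * g) (f' * g')"
    unfolding tensor_eq_def by (metis free_module.span_add span_relations_mult)
qed

instance
proof
  show "(0::Lambda2) \<noteq> 1"
  proof transfer
    show "\<not> tensor_eq 0 1"
      using one_not_in_span free_module.span_neg[of "- 1"] by (auto simp: tensor_eq_def)
  qed
qed (transfer; simp add: algebra_simps tensor_eq_def free_module.span_zero)+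

end

lift_definition scale_Lambda2 :: "Qa \<Rightarrow> Lambda2 \<Rightarrow> Lambda2" is free_scale
  by (metis tensor_eq_def free_module.span_scale free_module.scale_right_diff_distrib)

lift_definition tensor :: "Lambda \<Rightarrow> Lambda \<Rightarrow> Lambda2" is free_tensor .

section \<open>Partitions and diagrams\<close>

text \<open>
  The partition called lambda in the literature is written \<open>\<kappa>\<close>, as \<open>\<lambda>\<close> is the binder.
  Rows, columns and parts are counted from \<open>1\<close>.
\<close>

typedef partition = "{xs :: nat list. sorted_wrt (\<ge>) xs \<and> 0 \<notin> set xs}"
  morphisms parts Abs_partition
  by (rule exI[of _ "[]"]) simp

definition part :: "partition \<Rightarrow> nat \<Rightarrow> nat" where
  "part \<kappa> i = (if 1 \<le> i \<and> i \<le> length (parts \<kappa>) then parts \<kappa> ! (i - 1) else 0)"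

definition diagram :: "partition \<Rightarrow> (nat \<times> nat) set" where
  "diagram \<kappa> = {(i, j). 1 \<le> i \<and> 1 \<le> j \<and> j \<le> part \<kappa> i}"

definition conjugate_part :: "partition \<Rightarrow> nat \<Rightarrow> nat" where
  "conjugate_part \<kappa> j = card {i. (i, j) \<in> diagram \<kappa>}"

definition diagonal :: "partition \<Rightarrow> nat" where
  "diagonal \<kappa> = card {i. (i, i) \<in> diagram \<kappa>}"

definition skew :: "partition \<Rightarrow> partition \<Rightarrow> (nat \<times> nat) set" where
  "skew \<kappa> \<mu> = diagram \<kappa> - diagram \<mu>"

definition contained :: "partition \<Rightarrow> partition \<Rightarrow> bool" where
  "contained \<mu> \<kappa> \<longleftrightarrow> diagram \<mu> \<subseteq> diagram \<kappa>"

section \<open>Schur functions and Littlewood--Richardson coefficients\<close>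

definition vandermonde :: "nat \<Rightarrow> (nat, 'r::comm_ring_1) mvpoly" where
  "vandermonde n = (\<Prod>(i, j) \<in> {(i, j). 1 \<le> i \<and> i < j \<and> j \<le> n}. mvar i - mvar j)"

text \<open>
  Matrices are indexed from \<open>0\<close>, so the entry at \<open>(i, j)\<close> belongs to \<open>x\<^bsub>i+1\<^esub>\<close> and the
  part \<open>j + 1\<close>. Polynomials over an integral domain form an integral domain, so the quotient by
  \<^const>\<open>vandermonde\<close> is the unique polynomial with the stated product.
\<close>

definition schur_poly :: "nat \<Rightarrow> partition \<Rightarrow> (nat, int) mvpoly" where
  "schur_poly n \<kappa> =
     (if length (parts \<kappa>) \<le> n
      then THE s. s * vandermonde n =
        det (mat n n (\<lambda>(i, j). mvar (i + 1) ^ (part \<kappa> (j + 1) + n - (j + 1))))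
      else 0)"

definition LR_coeff :: "partition \<Rightarrow> partition \<Rightarrow> partition \<Rightarrow> int" where
  "LR_coeff \<alpha> \<beta> = Poly_Mapping.lookup (THE c :: partition \<Rightarrow>\<^sub>0 int. \<forall>n.
     schur_poly n \<alpha> * schur_poly n \<beta> =
       (\<Sum>\<gamma>\<in>Poly_Mapping.keys c. of_int (Poly_Mapping.lookup c \<gamma>) * schur_poly n \<gamma>))"

definition double_power :: "nat \<Rightarrow> nat \<Rightarrow> nat \<Rightarrow> Qax" where
  "double_power n i r = (\<Prod>k<r. mvar i - mconst (avar (int n - int k)))"

definition double_schur_poly :: "nat \<Rightarrow> partition \<Rightarrow> Qax" where
  "double_schur_poly n \<kappa> =
     (if length (parts \<kappa>) \<le> n
      then THE s. s * vandermonde n =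
        det (mat n n (\<lambda>(i, j). double_power n (i + 1) (part \<kappa> (j + 1) + n - (j + 1))))
      else 0)"

text \<open>
  The sequence below does belong to \<^const>\<open>Lambda_carrier\<close>: it is stable because the factor
  \<open>(x\<^sub>n\<parallel>a)\<^sup>r\<close> vanishes at \<open>x\<^sub>n = a\<^sub>n\<close> for \<open>r > 0\<close>.
\<close>

definition double_schur :: "partition \<Rightarrow> Lambda" where
  "double_schur \<kappa> = Abs_Lambda (\<lambda>n. double_schur_poly n \<kappa>)"

definition is_comultiplication :: "(Lambda \<Rightarrow> Lambda2) \<Rightarrow> bool" where
  "is_comultiplication D \<longleftrightarrow>
     D 1 = 1 \<and>
     (\<forall>p q. D (p + q) = D p + D q) \<and>
     (\<forall>p q. D (p * q) = D p * D q) \<and>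
     (\<forall>c p. D (scale_Lambda c p) = scale_Lambda2 c (D p)) \<and>
     (\<forall>k\<ge>1. D (power_sum k) = tensor (power_sum k) 1 + tensor 1 (power_sum k))"

text \<open>
  The double power sums generate \<^typ>\<open>Lambda\<close> freely over \<^typ>\<open>Qa\<close> and the double Schur
  functions are a basis, so the descriptions below (and that of \<^const>\<open>LR_coeff\<close>) are unique.
\<close>

definition comultiplication :: "Lambda \<Rightarrow> Lambda2" where
  "comultiplication = (THE D. is_comultiplication D)"

definition dual_LR :: "partition \<Rightarrow> partition \<Rightarrow> partition \<Rightarrow> Qa" where
  "dual_LR \<kappa> \<mu> \<nu> = Poly_Mapping.lookup (THE c :: partition \<times> partition \<Rightarrow>\<^sub>0 Qa.
     comultiplication (double_schur \<nu>) =
       (\<Sum>(\<alpha>, \<beta>)\<in>Poly_Mapping.keys c. scale_Lambda2 (Poly_Mapping.lookup c (\<alpha>, \<beta>))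
          (tensor (double_schur \<alpha>) (double_schur \<beta>)))) (\<kappa>, \<mu>)"

section \<open>Hook tableaux\<close>

text \<open>
  Fillings are extensional functions, so that each filling of \<open>\<kappa>/\<mu>\<close> is counted once. These sets
  are only used when \<open>\<kappa>\<close> and \<open>\<mu>\<close> have the same number \<open>d\<close> of diagonal boxes; then every box of
  \<open>\<kappa>/\<mu>\<close> lies either in one of the first \<open>d\<close> rows or in one of the first \<open>d\<close> columns.
\<close>

definition hook_tableaux :: "partition \<Rightarrow> partition \<Rightarrow> (nat \<times> nat \<Rightarrow> int) set" where
  "hook_tableaux \<kappa> \<mu> = {T \<in> skew \<kappa> \<mu> \<rightarrow>\<^sub>E UNIV.
     (\<forall>i j j'. i \<le> diagonal \<mu> \<and> j < j' \<and> (i, j) \<in> skew \<kappa> \<mu> \<and> (i, j') \<in> skew \<kappa> \<mu>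
        \<longrightarrow> T (i, j) \<le> T (i, j')) \<and>
     (\<forall>i i' j. i < i' \<and> i' \<le> diagonal \<mu> \<and> (i, j) \<in> skew \<kappa> \<mu> \<and> (i', j) \<in> skew \<kappa> \<mu>
        \<longrightarrow> T (i, j) < T (i', j)) \<and>
     (\<forall>i j. i \<le> diagonal \<mu> \<and> (i, j) \<in> skew \<kappa> \<mu>
        \<longrightarrow> T (i, j) \<in> {int i - int (part \<mu> i)..0}) \<and>
     (\<forall>i i' j. j \<le> diagonal \<mu> \<and> i < i' \<and> (i, j) \<in> skew \<kappa> \<mu> \<and> (i', j) \<in> skew \<kappa> \<mu>
        \<longrightarrow> T (i, j) \<ge> T (i', j)) \<and>
     (\<forall>i j j'. j < j' \<and> j' \<le> diagonal \<mu> \<and> (i, j) \<in> skew \<kappa> \<mu> \<and> (i, j') \<in> skew \<kappa> \<mu>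
        \<longrightarrow> T (i, j) > T (i, j')) \<and>
     (\<forall>i j. j \<le> diagonal \<mu> \<and> (i, j) \<in> skew \<kappa> \<mu>
        \<longrightarrow> T (i, j) \<in> {1..int (conjugate_part \<mu> j) - int j + 1})}"

definition dual_hook_tableaux :: "partition \<Rightarrow> partition \<Rightarrow> (nat \<times> nat \<Rightarrow> int) set" where
  "dual_hook_tableaux \<kappa> \<mu> = {T \<in> skew \<kappa> \<mu> \<rightarrow>\<^sub>E UNIV.
     (\<forall>i j j'. i \<le> diagonal \<mu> \<and> j < j' \<and> (i, j) \<in> skew \<kappa> \<mu> \<and> (i, j') \<in> skew \<kappa> \<mu>
        \<longrightarrow> T (i, j) > T (i, j')) \<and>
     (\<forall>i i' j. i < i' \<and> i' \<le> diagonal \<mu> \<and> (i, j) \<in> skew \<kappa> \<mu> \<and> (i', j) \<in> skew \<kappa> \<mu>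
        \<longrightarrow> T (i, j) \<ge> T (i', j)) \<and>
     (\<forall>i j. i \<le> diagonal \<mu> \<and> (i, j) \<in> skew \<kappa> \<mu>
        \<longrightarrow> T (i, j) \<in> {int i - int (part \<kappa> i) + 1..0}) \<and>
     (\<forall>i i' j. j \<le> diagonal \<mu> \<and> i < i' \<and> (i, j) \<in> skew \<kappa> \<mu> \<and> (i', j) \<in> skew \<kappa> \<mu>
        \<longrightarrow> T (i, j) < T (i', j)) \<and>
     (\<forall>i j j'. j < j' \<and> j' \<le> diagonal \<mu> \<and> (i, j) \<in> skew \<kappa> \<mu> \<and> (i, j') \<in> skew \<kappa> \<mu>
        \<longrightarrow> T (i, j) \<le> T (i, j')) \<and>
     (\<forall>i j. j \<le> diagonal \<mu> \<and> (i, j) \<in> skew \<kappa> \<mu>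
        \<longrightarrow> T (i, j) \<in> {1..int (conjugate_part \<kappa> j) - int j})}"

definition phi :: "partition \<Rightarrow> partition \<Rightarrow> Qa" where
  "phi \<kappa> \<mu> = (if contained \<mu> \<kappa> \<and> diagonal \<mu> = diagonal \<kappa>
     then \<Sum>T\<in>hook_tableaux \<kappa> \<mu>. \<Prod>b\<in>skew \<kappa> \<mu>. avar (T b) else 0)"

definition psi :: "partition \<Rightarrow> partition \<Rightarrow> Qa" where
  "psi \<kappa> \<mu> = (if contained \<mu> \<kappa> \<and> diagonal \<mu> = diagonal \<kappa>
     then \<Sum>T\<in>dual_hook_tableaux \<kappa> \<mu>. \<Prod>b\<in>skew \<kappa> \<mu>. avar (T b) else 0)"

text \<open>These are the numbers \<open>m(\<kappa>/\<mu>)\<close> and \<open>n(\<kappa>/\<mu>)\<close>.\<close>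

definition boxes_upper :: "partition \<Rightarrow> partition \<Rightarrow> nat" where
  "boxes_upper \<kappa> \<mu> = card {(i, j) \<in> skew \<kappa> \<mu>. i \<le> diagonal \<mu>}"

definition boxes_lower :: "partition \<Rightarrow> partition \<Rightarrow> nat" where
  "boxes_lower \<kappa> \<mu> = card {(i, j) \<in> skew \<kappa> \<mu>. i > diagonal \<mu>}"

end

theory Submission
  imports Defs "HOL-Computational_Algebra.Formal_Power_Series"
begin

text \<open>
  Let \<open>h\<^sub>r\<close> be the complete functions attached to the double power sums by Newton's identities. Their
  generating series is group-like, so \<open>\<Delta>\<close> acts on the Jacobi--Trudi determinants
  \<open>det [h\<^bsub>\<gamma>\<^sub>i-i+j\<^esub>]\<close> through the classical Littlewood--Richardson coefficients. It remains to compare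
  these determinants with the double Schur functions. In \<open>n\<close> variables the series is
  \<open>\<Prod>\<^sub>k (1 - a\<^sub>k t) / (1 - x\<^sub>k t)\<close>, and by Cauchy--Binet the transition coefficients are minors of the
  matrix that expands the powers \<open>(x\<parallel>a)\<^sup>r\<close>. This matrix splits at the exponent \<open>n\<close>
  into elementary symmetric polynomials of \<open>a\<^sub>0, a\<^bsub>-1\<^esub>, \<dots>\<close> and complete symmetric polynomials of
  \<open>a\<^sub>1, a\<^sub>2, \<dots>\<close>. Therefore a minor vanishes unless the two diagonals have the same length, and otherwise
  it is a product of two flagged determinants in Frobenius coordinates: the arms give the part of a
  dual hook tableau in the first \<open>d\<close> rows, the legs its part in the first \<open>d\<close> columns. The inverse
  matrix exchanges elementary and complete polynomials and yields the hook tableaux.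
\<close>

section \<open>Determinants of functions\<close>

text \<open>Every notion in the statement is a description by \<open>THE\<close>, so each formula
  needs a uniqueness proof beside it. The determinants \<open>schurL\<close> serve as a module
  basis: the comultiplication is defined linearly on them, and it is multiplicative because
  Jacobi--Trudi determinants of any series with constant term 1, over any commutative ring, multiply
  by the same integers; Newton's identities then give its values on the power sums. Uniqueness of
  expansions comes from functionals that read the coefficient of x^(\<mu>+\<delta>) in P_n times the
  Vandermonde product. They are unitriangular on both bases and, being \<rat>[a]-linear, pass to the
  tensor square. The split at the exponent n arises because the factors 1 - a_k t of the complete
  series are divided out of the product that belongs to (x\<parallel>a)^r: for r \<ge> n factors
  with a_0, a_(-1), ... are left over, for r < n some of a_1, a_2, ... remain in the denominator.
  The minors are taken in n variables, but in Frobenius coordinates they become tableau sums free of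
  n, so the expansions for all n come from one expansion in the ring.\<close>

definition dt :: "nat \<Rightarrow> (nat \<Rightarrow> nat \<Rightarrow> 'a::comm_ring_1) \<Rightarrow> 'a" where
  "dt n f = det (mat n n (\<lambda>(i, j). f i j))"

lemma permutes_less: "p permutes {..<n} \<Longrightarrow> i < n \<Longrightarrow> p i < (n::nat)"
  using permutes_in_image[of p "{..<n}" i] by simp

lemma dt_leibniz: "dt n f = (\<Sum>p | p permutes {..<n}. of_int (sign p) * (\<Prod>i<n. f i (p i)))"
proof -
  have "(\<Prod>i<n. mat n n (\<lambda>(i, j). f i j) $$ (i, p i)) = (\<Prod>i<n. f i (p i))" if "p permutes {..<n}" for p
    using that by (intro prod.cong) (auto simp: permutes_less)
  then show ?thesis
    unfolding dt_def
    by (subst det_def'[of _ n]) (auto simp: atLeast0LessThan intro!: sum.cong)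
qed

lemma dt_cong: "(\<And>i j. i < n \<Longrightarrow> j < n \<Longrightarrow> f i j = g i j) \<Longrightarrow> dt n f = dt n g"
  unfolding dt_def by (intro arg_cong[of _ _ det] cong_mat) auto

lemma dt_0 [simp]: "dt 0 f = 1"
  by (simp add: dt_def)

lemma dt_transpose: "dt n (\<lambda>i j. f j i) = dt n f"
proof -
  have "mat n n (\<lambda>(i, j). f j i) = transpose_mat (mat n n (\<lambda>(i, j). f i j))"
    by (intro eq_matI) auto
  then show ?thesis unfolding dt_def by (metis det_transpose mat_carrier)
qed

lemma dt_mult: "dt n (\<lambda>i j. \<Sum>k<n. f i k * g k j) = dt n f * dt n g"
proof -
  have "mat n n (\<lambda>(i, j). \<Sum>k<n. f i k * g k j) = mat n n (\<lambda>(i, j). f i j) * mat n n (\<lambda>(i, j). g i j)"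
    by (intro eq_matI) (auto simp: scalar_prod_def atLeast0LessThan)
  then show ?thesis unfolding dt_def by (metis det_mult mat_carrier)
qed

lemma dt_permute_rows: "p permutes {..<n} \<Longrightarrow> dt n (\<lambda>i j. f (p i) j) = of_int (sign p) * dt n f"
proof -
  assume p: "p permutes {..<n}"
  have "mat n n (\<lambda>(i, j). f (p i) j) = mat n n (\<lambda>(i, j). mat n n (\<lambda>(i, j). f i j) $$ (p i, j))"
    using p by (intro eq_matI) (auto simp: permutes_less)
  then show ?thesis
    using det_permute_rows[of "mat n n (\<lambda>(i, j). f i j)" n p] p
    by (simp add: dt_def atLeast0LessThan)
qed

lemma dt_permute_cols: "p permutes {..<n} \<Longrightarrow> dt n (\<lambda>i j. f i (p j)) = of_int (sign p) * dt n f"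
  using dt_permute_rows[of p n "\<lambda>i j. f j i"] dt_transpose[of n "\<lambda>i j. f i (p j)"] dt_transpose[of n f]
  by simp

lemma dt_identical_rows:
  assumes "i < n" "k < n" "i \<noteq> k" "\<And>j. j < n \<Longrightarrow> f i j = f k j"
  shows "dt n f = 0"
proof -
  let ?A = "mat n n (\<lambda>(i, j). f i j)"
  have "row ?A i = row ?A k" using assms by (intro eq_vecI) simp_all
  then show ?thesis
    unfolding dt_def using assms(1-3) by (intro det_identical_rows[of ?A n i k]) simp_all
qed

text \<open>A permutation avoiding the block would map \<open>I\<close> injectively into the
  complement of \<open>J\<close>, which has fewer than \<open>card I\<close> elements. Hence every
  Leibniz term has a zero factor. Most vanishing statements for determinants below rest on
  this.\<close>

lemma dt_zero_block:
  assumes "I \<subseteq> {..<n}" "J \<subseteq> {..<n}" "card I + card J > n" "\<And>i j. i \<in> I \<Longrightarrow> j \<in> J \<Longrightarrow> f i j = 0"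
  shows "dt n f = 0"
  unfolding dt_leibniz
proof (rule sum.neutral, safe)
  fix p assume p: "p permutes {..<n}"
  have "\<exists>i\<in>I. p i \<in> J"
  proof (rule ccontr)
    assume "\<not> ?thesis"
    then have disj: "p ` I \<inter> J = {}" by auto
    have "p ` I \<subseteq> {..<n}" using assms(1) p by (auto simp: permutes_less subset_iff)
    then have "card (p ` I \<union> J) \<le> n"
      using assms(2) by (metis Un_least card_lessThan card_mono finite_lessThan)
    moreover have "card (p ` I) = card I"
      using p by (meson card_image inj_on_subset permutes_inj subset_UNIV)
    moreover have "finite (p ` I)" "finite J"
      using assms(1,2) by (auto intro: finite_subset)
    ultimately show False using assms(3) disj by (simp add: card_Un_disjoint)
  qed
  then obtain i where "i \<in> I" "p i \<in> J" by blast
  then have "(\<Prod>i<n. f i (p i)) = 0"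
    using assms(1,4) by (intro prod_zero bexI[of _ i]) auto
  then show "of_int (sign p) * (\<Prod>i<n. f i (p i)) = 0" by simp
qed

lemma dt_upper_triangular:
  assumes "\<And>i j. i < n \<Longrightarrow> j < i \<Longrightarrow> f i j = 0"
  shows "dt n f = (\<Prod>i<n. f i i)"
proof -
  have "dt n f = prod_list (diag_mat (mat n n (\<lambda>(i, j). f i j)))"
    unfolding dt_def by (rule det_upper_triangular) (use assms in auto)
  also have "diag_mat (mat n n (\<lambda>(i, j). f i j)) = map (\<lambda>i. f i i) [0..<n]"
    by (auto simp: diag_mat_def)
  also have "prod_list \<dots> = (\<Prod>i<n. f i i)"
    by (simp add: prod.list_conv_set_nth atLeast0LessThan)
  finally show ?thesis .
qed

lemma dt_lower_triangular:
  assumes "\<And>i j. i < j \<Longrightarrow> j < n \<Longrightarrow> f i j = 0"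
  shows "dt n f = (\<Prod>i<n. f i i)"
  by (subst dt_transpose[symmetric], subst dt_upper_triangular) (use assms in auto)

lemma dt_last_row:
  assumes "\<And>j. j < n \<Longrightarrow> f n j = 0"
  shows "dt (Suc n) f = f n n * dt n f"
proof -
  let ?A = "mat (Suc n) (Suc n) (\<lambda>(i, j). f i j)"
  have "det ?A = (\<Sum>j<Suc n. ?A $$ (n, j) * cofactor ?A n j)"
    by (rule laplace_expansion_row) auto
  also have "\<dots> = f n n * cofactor ?A n n"
    using assms by simp
  also have "mat_delete ?A n n = mat n n (\<lambda>(i, j). f i j)"
    by (intro eq_matI) (auto simp: mat_delete_def)
  then have "cofactor ?A n n = dt n f"
    by (simp add: cofactor_def dt_def)
  finally show ?thesis by (simp add: dt_def)
qed

lemma dt_first_col: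
  assumes "\<And>i. 0 < i \<Longrightarrow> i \<le> n \<Longrightarrow> f i 0 = 0"
  shows "dt (Suc n) f = f 0 0 * dt n (\<lambda>i j. f (Suc i) (Suc j))"
proof -
  let ?A = "mat (Suc n) (Suc n) (\<lambda>(i, j). f i j)"
  have "det ?A = (\<Sum>i<Suc n. ?A $$ (i, 0) * cofactor ?A i 0)"
    by (rule laplace_expansion_column) auto
  also have "\<dots> = f 0 0 * cofactor ?A 0 0"
    using assms by (subst sum.lessThan_Suc_shift) simp
  also have "mat_delete ?A 0 0 = mat n n (\<lambda>(i, j). f (Suc i) (Suc j))"
    by (intro eq_matI) (auto simp: mat_delete_def)
  then have "cofactor ?A 0 0 = dt n (\<lambda>i j. f (Suc i) (Suc j))"
    by (simp add: cofactor_def dt_def)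
  finally show ?thesis by (simp add: dt_def)
qed

lemma dt_last_rows:
  assumes "\<And>i j. m \<le> i \<Longrightarrow> i < m + k \<Longrightarrow> j < m + k \<Longrightarrow> f i j = (if i = j then 1 else 0)"
  shows "dt (m + k) f = dt m f"
  using assms
proof (induction k)
  case (Suc k)
  then show ?case using dt_last_row[of "m + k" f] by simp
qed simp

lemma dt_first_rows:
  assumes "\<And>i j. i < m \<Longrightarrow> j < m + k \<Longrightarrow> f i j = (if i = j then 1 else 0)"
    and "\<And>i j. m \<le> i \<Longrightarrow> i < m + k \<Longrightarrow> j < m \<Longrightarrow> f i j = 0"
  shows "dt (m + k) f = dt k (\<lambda>i j. f (m + i) (m + j))"
  using assms
proof (induction m arbitrary: f)
  case (Suc m)
  have "dt (Suc (m + k)) f = f 0 0 * dt (m + k) (\<lambda>i j. f (Suc i) (Suc j))"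
    by (rule dt_first_col) (use Suc.prems(1)[of _ 0] Suc.prems(2)[of _ 0] in \<open>metis add_Suc less_Suc_eq_le not_less zero_less_Suc less_irrefl\<close>)
  also have "\<dots> = dt k (\<lambda>i j. f (Suc m + i) (Suc m + j))"
    using Suc.prems by (subst Suc.IH) auto
  finally show ?case by simp
qed simp

text \<open>Block factorisation: with diagonal blocks A, D and upper right block B, the matrix is
  diag(1, D) times the matrix with block rows (A, B) and (0, 1). These two factors are
  \<open>g\<close> and \<open>h\<close>.\<close>

lemma dt_block_triangular:
  assumes "\<And>i j. m \<le> i \<Longrightarrow> i < m + k \<Longrightarrow> j < m \<Longrightarrow> f i j = 0"
  shows "dt (m + k) f = dt m f * dt k (\<lambda>i j. f (m + i) (m + j))"
proof -
  define g where "g i j = (if i < m then if i = j then 1 else 0 else if j < m then 0 else f i j)" for i j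
  define h where "h i j = (if i < m then f i j else if i = j then 1 else 0)" for i j
  have "dt (m + k) f = dt (m + k) (\<lambda>i j. \<Sum>l<m + k. g i l * h l j)"
  proof (rule dt_cong)
    fix i j assume ij: "i < m + k" "j < m + k"
    show "f i j = (\<Sum>l<m + k. g i l * h l j)"
    proof (cases "i < m")
      case True
      then have "(\<Sum>l<m + k. g i l * h l j) = (\<Sum>l<m + k. if i = l then h l j else 0)"
        by (intro sum.cong) (auto simp: g_def)
      then show ?thesis using True ij by (simp add: h_def)
    next
      case False
      have "(\<Sum>l<m + k. g i l * h l j) = (\<Sum>l<m + k. if l = j then g i j else 0)"
        by (intro sum.cong) (use False in \<open>auto simp: g_def h_def\<close>)
      then show ?thesis using False ij assms by (simp add: g_def)
    qed
  qed
  also have "\<dots> = dt (m + k) g * dt (m + k) h" by (rule dt_mult)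
  also have "dt (m + k) h = dt m h" by (rule dt_last_rows) (auto simp: h_def)
  also have "\<dots> = dt m f" by (rule dt_cong) (auto simp: h_def)
  also have "dt (m + k) g = dt k (\<lambda>i j. g (m + i) (m + j))" by (rule dt_first_rows) (auto simp: g_def)
  also have "\<dots> = dt k (\<lambda>i j. f (m + i) (m + j))" by (rule dt_cong) (auto simp: g_def)
  finally show ?thesis by (simp add: mult.commute)
qed

lemma (in comm_ring_hom) hom_dt: "hom (dt n f) = dt n (\<lambda>i j. hom (f i j))"
proof -
  have "map_mat hom (mat n n (\<lambda>(i, j). f i j)) = mat n n (\<lambda>(i, j). hom (f i j))"
    by (intro eq_matI) auto
  then show ?thesis unfolding dt_def using hom_det[of "mat n n (\<lambda>(i, j). f i j)"] by simp
qed

lemma dt_scale_rows: "dt n (\<lambda>i j. c i * f i j) = (\<Prod>i<n. c i) * dt n f"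
  by (simp add: dt_leibniz prod.distrib sum_distrib_left mult_ac)

section \<open>Partitions as strictly decreasing sequences\<close>

lemma parts_sorted: "sorted_wrt (\<ge>) (parts \<kappa>)" and parts_pos: "0 \<notin> set (parts \<kappa>)"
  using parts[of \<kappa>] by auto

lemma part_Suc: "part \<kappa> (Suc i) = (if i < length (parts \<kappa>) then parts \<kappa> ! i else 0)"
  by (auto simp: part_def)

lemma part_mono: "1 \<le> i \<Longrightarrow> i \<le> j \<Longrightarrow> part \<kappa> j \<le> part \<kappa> i"
proof -
  assume "1 \<le> i" "i \<le> j"
  then obtain k l where kl: "i = Suc k" "j = Suc l" "k \<le> l" by (cases i; cases j) auto
  show ?thesis
    unfolding kl part_Suc using kl sorted_wrt_nth_less[OF parts_sorted[of \<kappa>], of k l]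
    by (cases "k = l") auto
qed

lemma part_pos_iff: "part \<kappa> (Suc i) > 0 \<longleftrightarrow> i < length (parts \<kappa>)"
  using parts_pos[of \<kappa>] by (metis gr0I nth_mem part_Suc less_irrefl)

lemma partition_eqI:
  assumes "\<And>i. part \<kappa> (Suc i) = part \<mu> (Suc i)"
  shows "\<kappa> = \<mu>"
proof -
  have "i < length (parts \<kappa>) \<longleftrightarrow> i < length (parts \<mu>)" for i
    by (metis assms part_pos_iff)
  then have len: "length (parts \<kappa>) = length (parts \<mu>)" by (metis nat_neq_iff)
  have "parts \<kappa> = parts \<mu>"
  proof (rule nth_equalityI[OF len])
    fix i assume "i < length (parts \<kappa>)"
    then show "parts \<kappa> ! i = parts \<mu> ! i" using assms[of i] len by (simp add: part_Suc)
  qed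
  then show ?thesis by (simp add: parts_inject)
qed

text \<open>In a weakly decreasing list the zeros form a tail, so deleting them moves no other
  entry.\<close>

lemma filter_pos_nth:
  assumes "sorted_wrt (\<ge>) (xs :: nat list)"
  shows "(if i < length (filter (\<lambda>k. 0 < k) xs) then filter (\<lambda>k. 0 < k) xs ! i else 0) =
    (if i < length xs then xs ! i else 0)"
  using assms
proof (induction xs arbitrary: i)
  case (Cons x xs)
  show ?case
  proof (cases "x = 0")
    case True
    then have all: "\<forall>y\<in>set (x # xs). y = 0" using Cons.prems by auto
    then have "filter (\<lambda>k. 0 < k) (x # xs) = []" by (simp add: filter_empty_conv)
    moreover have "(x # xs) ! i = 0" if "i < length (x # xs)"
      using all nth_mem[OF that] by blast
    ultimately show ?thesis by (metis less_zeroE list.size(3))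
  next
    case False
    have "(if k < length (filter (\<lambda>k. 0 < k) xs) then filter (\<lambda>k. 0 < k) xs ! k else 0) =
        (if k < length xs then xs ! k else 0)" for k
      by (rule Cons.IH) (use Cons.prems in simp)
    from this[of "i - 1"] show ?thesis using False by (cases i) auto
  qed
qed simp

lemma ex_partition:
  fixes f :: "nat \<Rightarrow> nat"
  assumes "\<And>i j. i \<le> j \<Longrightarrow> f j \<le> f i" "\<And>i. n \<le> i \<Longrightarrow> f i = 0"
  shows "\<exists>\<kappa>. length (parts \<kappa>) \<le> n \<and> (\<forall>i. part \<kappa> (Suc i) = f i)"
proof -
  define xs where "xs = map f [0..<n]"
  have xs: "sorted_wrt (\<ge>) xs" using assms(1) by (auto simp: xs_def sorted_wrt_iff_nth_less)
  define \<kappa> where "\<kappa> = Abs_partition (filter (\<lambda>k. 0 < k) xs)"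
  have p: "parts \<kappa> = filter (\<lambda>k. 0 < k) xs"
    unfolding \<kappa>_def by (rule Abs_partition_inverse) (use xs in \<open>auto intro: sorted_wrt_filter\<close>)
  have "part \<kappa> (Suc i) = f i" for i
    unfolding part_Suc p filter_pos_nth[OF xs] using assms(2) by (auto simp: xs_def)
  moreover have "length (parts \<kappa>) \<le> n"
    unfolding p using length_filter_le[of _ xs] by (simp add: xs_def)
  ultimately show ?thesis by blast
qed

lemma contained_iff: "contained \<mu> \<kappa> \<longleftrightarrow> (\<forall>i. part \<mu> (Suc i) \<le> part \<kappa> (Suc i))"
proof
  assume c: "contained \<mu> \<kappa>"
  show "\<forall>i. part \<mu> (Suc i) \<le> part \<kappa> (Suc i)"
  proof
    fix i
    show "part \<mu> (Suc i) \<le> part \<kappa> (Suc i)"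
    proof (cases "part \<mu> (Suc i) = 0")
      case False
      then have "(Suc i, part \<mu> (Suc i)) \<in> diagram \<mu>" by (simp add: diagram_def)
      then show ?thesis using c by (auto simp: contained_def diagram_def)
    qed simp
  qed
next
  assume "\<forall>i. part \<mu> (Suc i) \<le> part \<kappa> (Suc i)"
  then show "contained \<mu> \<kappa>"
    unfolding contained_def diagram_def
    by (auto, metis Suc_pred' le_trans less_eq_Suc_le One_nat_def)
qed

lemma contained_refl [simp]: "contained \<kappa> \<kappa>"
  by (simp add: contained_def)

lemma contained_trans: "contained \<kappa> \<mu> \<Longrightarrow> contained \<mu> \<nu> \<Longrightarrow> contained \<kappa> \<nu>"
  by (auto simp: contained_def)

lemma contained_antisym: "contained \<kappa> \<mu> \<Longrightarrow> contained \<mu> \<kappa> \<Longrightarrow> \<kappa> = \<mu>"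
  by (meson contained_iff le_antisym partition_eqI)

lemma contained_length: "contained \<mu> \<kappa> \<Longrightarrow> length (parts \<mu>) \<le> length (parts \<kappa>)"
  by (metis contained_iff le_less_trans less_irrefl not_le part_pos_iff le_zero_eq not_less)

text \<open>The exponents \<lambda> + \<delta> of the alternants, with rows counted from 0. For
  \<open>i < n\<close> the subtraction is exact, and the values determine the partition once its
  length is at most n.\<close>

definition pos :: "nat \<Rightarrow> partition \<Rightarrow> nat \<Rightarrow> nat" where
  "pos n \<kappa> i = part \<kappa> (i + 1) + n - (i + 1)"

definition empty_partition :: partition where
  "empty_partition = Abs_partition []"

lemma parts_empty [simp]: "parts empty_partition = []"
  unfolding empty_partition_def by (rule Abs_partition_inverse) simp

lemma part_empty [simp]: "part empty_partition i = 0"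
  by (simp add: part_def)

lemma pos_empty [simp]: "pos n empty_partition i = n - Suc i"
  by (simp add: pos_def)

lemma pos_strict: "i < j \<Longrightarrow> j < n \<Longrightarrow> pos n \<kappa> j < pos n \<kappa> i"
  using part_mono[of "i + 1" "j + 1" \<kappa>] by (auto simp: pos_def)

lemma pos_eq_iff: "i < n \<Longrightarrow> j < n \<Longrightarrow> pos n \<kappa> i = pos n \<kappa> j \<longleftrightarrow> i = j"
  by (metis nat_neq_iff pos_strict)

lemma part_eq_pos: "i < n \<Longrightarrow> int (part \<kappa> (Suc i)) = int (pos n \<kappa> i) - int n + int i + 1"
  by (simp add: pos_def)

lemma part_beyond: "length (parts \<kappa>) \<le> i \<Longrightarrow> part \<kappa> (Suc i) = 0"
  by (simp add: part_Suc)

lemma pos_inject: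
  assumes "length (parts \<kappa>) \<le> n" "length (parts \<mu>) \<le> n" "\<And>i. i < n \<Longrightarrow> pos n \<kappa> i = pos n \<mu> i"
  shows "\<kappa> = \<mu>"
proof (rule partition_eqI)
  fix i
  show "part \<kappa> (Suc i) = part \<mu> (Suc i)"
    using assms part_eq_pos[of i n \<kappa>] part_eq_pos[of i n \<mu>]
    by (cases "i < n") (auto simp: part_beyond)
qed

lemma contained_iff_pos:
  assumes "length (parts \<mu>) \<le> n"
  shows "contained \<mu> \<kappa> \<longleftrightarrow> (\<forall>i<n. pos n \<mu> i \<le> pos n \<kappa> i)"
  unfolding contained_iff
proof safe
  fix i assume *: "\<forall>i<n. pos n \<mu> i \<le> pos n \<kappa> i"
  show "part \<mu> (Suc i) \<le> part \<kappa> (Suc i)"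
  proof (cases "i < n")
    case True
    then show ?thesis
      using * part_eq_pos[OF True, of \<mu>] part_eq_pos[OF True, of \<kappa>] by fastforce
  next
    case False
    then show ?thesis using assms by (simp add: part_beyond)
  qed
qed (auto simp: pos_def diff_le_mono)

text \<open>A strictly decreasing sequence of n naturals lies pointwise above n - 1, ..., 0 (fact
  \<open>ge\<close>), so subtracting this staircase leaves a partition.\<close>

lemma ex_partition_pos:
  fixes l :: "nat \<Rightarrow> nat"
  assumes "\<And>i j. i < j \<Longrightarrow> j < n \<Longrightarrow> l j < l i"
  shows "\<exists>\<kappa>. length (parts \<kappa>) \<le> n \<and> (\<forall>i<n. pos n \<kappa> i = l i)"
proof -
  define f where "f i = (if i < n then l i + i + 1 - n else 0)" for i
  have ge: "n \<le> l i + i + 1" if "i < n" for i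
  proof -
    have "l i \<ge> n - 1 - i"
      using that
    proof (induction "n - 1 - i" arbitrary: i)
      case (Suc k)
      then have "k = n - 1 - Suc i" "Suc i < n" by auto
      then have "k \<le> l (Suc i)" using Suc.hyps(1) by metis
      then show ?case using assms[of i "Suc i"] Suc \<open>Suc i < n\<close> by simp
    qed simp
    then show ?thesis by simp
  qed
  have step: "f (Suc i) \<le> f i" for i
    using assms[of i "Suc i"] by (auto simp: f_def)
  have "f j \<le> f i" if "i \<le> j" for i j
    using that lift_Suc_antimono_le[of f, OF step] by blast
  then obtain \<kappa> where k: "length (parts \<kappa>) \<le> n" "\<And>i. part \<kappa> (Suc i) = f i"
    using ex_partition[of f n] by (auto simp: f_def)
  have "pos n \<kappa> i = l i" if "i < n" for i
    using that ge[OF that] k(2)[of i] by (simp add: pos_def f_def)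
  then show ?thesis using k by blast
qed

text \<open>Stands for the n-element subsets of \<open>{..<L}\<close>: such a subset, listed
  decreasingly, is \<lambda> + \<delta> for exactly one partition with at most n parts.\<close>

definition parts_below :: "nat \<Rightarrow> nat \<Rightarrow> partition set" where
  "parts_below n L = {\<kappa>. length (parts \<kappa>) \<le> n \<and> (\<forall>i<n. pos n \<kappa> i < L)}"

lemma strict_seq_unique:
  fixes l l' :: "nat \<Rightarrow> nat"
  assumes "\<And>i j. i < j \<Longrightarrow> j < n \<Longrightarrow> l j < l i" "\<And>i j. i < j \<Longrightarrow> j < n \<Longrightarrow> l' j < l' i"
    "l ` {..<n} = l' ` {..<n}" "i < n"
  shows "l i = l' i"
proof -
  have s: "sorted_wrt (<) (rev (map f [0..<n]))" if "\<And>i j. i < j \<Longrightarrow> j < n \<Longrightarrow> f j < f i" for f :: "nat \<Rightarrow> nat"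
    unfolding sorted_wrt_rev using that by (auto simp: sorted_wrt_iff_nth_less)
  have "rev (map l [0..<n]) = rev (map l' [0..<n])"
    by (rule strict_sorted_equal[OF s s]) (use assms in \<open>auto simp: atLeast0LessThan\<close>)
  then show ?thesis using assms(4) by simp
qed

text \<open>Sorting: the image of an injective function, listed decreasingly, gives \<kappa>, and
  the order in which the function runs through it gives \<pi>. The pair is unique because a strictly
  decreasing sequence is determined by its image.\<close>

lemma inj_decomposition:
  "bij_betw (\<lambda>(\<kappa>, \<pi>). \<lambda>i\<in>{..<n}. pos n \<kappa> (\<pi> i)) (parts_below n L \<times> {\<pi>. \<pi> permutes {..<n}})
     {f \<in> {..<n} \<rightarrow>\<^sub>E {..<L}. inj_on f {..<n}}"
  unfolding bij_betw_def
proof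
  show "inj_on (\<lambda>(\<kappa>, \<pi>). \<lambda>i\<in>{..<n}. pos n \<kappa> (\<pi> i)) (parts_below n L \<times> {\<pi>. \<pi> permutes {..<n}})"
  proof (rule inj_onI, clarify)
    fix \<kappa> \<mu> \<pi> \<rho>
    assume k: "\<kappa> \<in> parts_below n L" and m: "\<mu> \<in> parts_below n L"
      and p: "\<pi> permutes {..<n}" and r: "\<rho> permutes {..<n}"
      and eq: "(\<lambda>i\<in>{..<n}. pos n \<kappa> (\<pi> i)) = (\<lambda>i\<in>{..<n}. pos n \<mu> (\<rho> i))"
    have eq': "pos n \<kappa> (\<pi> i) = pos n \<mu> (\<rho> i)" if "i < n" for i
      using fun_cong[OF eq, of i] that by simp
    have "pos n \<kappa> ` {..<n} = (\<lambda>i. pos n \<kappa> (\<pi> i)) ` {..<n}"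
      by (metis image_image permutes_image[OF p])
    also have "\<dots> = (\<lambda>i. pos n \<mu> (\<rho> i)) ` {..<n}"
      by (rule image_cong) (auto simp: eq')
    also have "\<dots> = pos n \<mu> ` {..<n}"
      by (metis image_image permutes_image[OF r])
    finally have im: "pos n \<kappa> ` {..<n} = pos n \<mu> ` {..<n}" .
    have "\<kappa> = \<mu>"
      by (rule pos_inject[of _ n])
        (use k m strict_seq_unique[OF pos_strict pos_strict im] in \<open>auto simp: parts_below_def\<close>)
    moreover have "\<pi> i = \<rho> i" for i
    proof (cases "i < n")
      case True
      then have "\<pi> i < n" "\<rho> i < n" using p r True by (auto simp: permutes_less)
      then show ?thesis using eq'[OF True] \<open>\<kappa> = \<mu>\<close> by (simp add: pos_eq_iff)
    next
      case False
      then show ?thesis using p r by (simp add: permutes_not_in)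
    qed
    ultimately show "\<kappa> = \<mu> \<and> \<pi> = \<rho>" by auto
  qed
  show "(\<lambda>(\<kappa>, \<pi>). \<lambda>i\<in>{..<n}. pos n \<kappa> (\<pi> i)) ` (parts_below n L \<times> {\<pi>. \<pi> permutes {..<n}}) =
      {f \<in> {..<n} \<rightarrow>\<^sub>E {..<L}. inj_on f {..<n}}" (is "?F ` ?A = ?B")
  proof
    show "?F ` ?A \<subseteq> ?B"
    proof clarify
      fix \<kappa> \<pi> assume k: "\<kappa> \<in> parts_below n L" and p: "\<pi> permutes {..<n}"
      have pi: "\<pi> i < n" if "i < n" for i using p that by (rule permutes_less)
      have "inj_on (\<lambda>i\<in>{..<n}. pos n \<kappa> (\<pi> i)) {..<n}"
        by (rule inj_onI) (use pi in \<open>auto simp: pos_eq_iff dest: permutes_inj[OF p, THEN injD]\<close>)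
      then show "(\<lambda>i\<in>{..<n}. pos n \<kappa> (\<pi> i)) \<in> {..<n} \<rightarrow>\<^sub>E {..<L} \<and> inj_on (\<lambda>i\<in>{..<n}. pos n \<kappa> (\<pi> i)) {..<n}"
        using k pi by (auto simp: parts_below_def)
    qed
    show "?B \<subseteq> ?F ` ?A"
    proof
      fix f assume "f \<in> ?B"
      then have f: "f \<in> {..<n} \<rightarrow>\<^sub>E {..<L}" "inj_on f {..<n}" by auto
      define xs where "xs = rev (sorted_list_of_set (f ` {..<n}))"
      have len: "length xs = n" using f(2) by (simp add: xs_def card_image)
      have set: "set xs = f ` {..<n}" by (simp add: xs_def)
      have xs_less: "xs ! j < xs ! i" if "i < j" "j < n" for i j
      proof -
        have "sorted_wrt (>) xs"
          unfolding xs_def sorted_wrt_rev using strict_sorted_list_of_set[of "f ` {..<n}"] by simp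
        then show ?thesis using that len by (simp add: sorted_wrt_iff_nth_less)
      qed
      then obtain \<kappa> where k: "length (parts \<kappa>) \<le> n" "\<And>i. i < n \<Longrightarrow> pos n \<kappa> i = xs ! i"
        using ex_partition_pos[of n "\<lambda>i. xs ! i"] by blast
      have bij: "bij_betw (pos n \<kappa>) {..<n} (f ` {..<n})"
        unfolding bij_betw_def
      proof
        show "inj_on (pos n \<kappa>) {..<n}" by (rule inj_onI) (simp add: pos_eq_iff)
        have "pos n \<kappa> ` {..<n} = (!) xs ` {..<n}" using k(2) by auto
        also have "\<dots> = set xs" unfolding len[symmetric] using nth_image[of "length xs" xs]
          by (simp add: atLeast0LessThan)
        finally show "pos n \<kappa> ` {..<n} = f ` {..<n}" using set by simp
      qed
      define \<pi> where "\<pi> i = (if i < n then inv_into {..<n} (pos n \<kappa>) (f i) else i)" for i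
      have "bij_betw (inv_into {..<n} (pos n \<kappa>) \<circ> f) {..<n} {..<n}"
        using bij_betw_trans[OF inj_on_imp_bij_betw[OF f(2)] bij_betw_inv_into[OF bij]] .
      then have "bij_betw \<pi> {..<n} {..<n}"
        by (rule bij_betw_cong[THEN iffD1, rotated]) (auto simp: \<pi>_def)
      then have p: "\<pi> permutes {..<n}"
        by (rule bij_imp_permutes) (simp add: \<pi>_def)
      have pos: "pos n \<kappa> (\<pi> i) = f i" if "i < n" for i
        using that bij unfolding \<pi>_def by (simp add: bij_betw_inv_into_right)
      have fk: "f = ?F (\<kappa>, \<pi>)"
      proof
        fix i show "f i = ?F (\<kappa>, \<pi>) i"
          using f(1) pos by (cases "i < n") (auto simp: PiE_def extensional_def)
      qed
      have "pos n \<kappa> i < L" if "i < n" for i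
      proof -
        have "pos n \<kappa> i \<in> f ` {..<n}" using bij that by (auto simp: bij_betw_def)
        then show ?thesis using f(1) by (auto simp: PiE_def)
      qed
      then have "\<kappa> \<in> parts_below n L" using k by (simp add: parts_below_def)
      then show "f \<in> ?F ` ?A" using fk p by blast
    qed
  qed
qed

lemma finite_parts_below [simp]: "finite (parts_below n L)"
proof -
  have "finite {f \<in> {..<n} \<rightarrow>\<^sub>E {..<L}. inj_on f {..<n}}"
    by (rule finite_subset[of _ "{..<n} \<rightarrow>\<^sub>E {..<L}"]) (auto intro: finite_PiE)
  then have "finite (parts_below n L \<times> {\<pi>. \<pi> permutes {..<n}})"
    using inj_decomposition[of n L] by (simp add: bij_betw_finite)
  moreover have "id \<in> {\<pi>. \<pi> permutes {..<n}}" by (simp add: permutes_id)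
  ultimately show ?thesis by (metis empty_iff finite_cartesian_productD1)
qed

text \<open>Expanding every row sum gives one determinant for each choice function f. A
  non-injective f repeats a row and drops out; an injective one is a partition with a permutation,
  whose sign reassembles the minor of \<open>A\<close>.\<close>

theorem cauchy_binet:
  "dt n (\<lambda>i k. \<Sum>p<L. A i p * v p k) =
    (\<Sum>\<beta>\<in>parts_below n L. dt n (\<lambda>i j. A i (pos n \<beta> j)) * dt n (\<lambda>j k. v (pos n \<beta> j) k))"
proof -
  let ?P = "{\<pi>. \<pi> permutes {..<n}}"
  let ?F = "{..<n} \<rightarrow>\<^sub>E {..<L}"
  have "dt n (\<lambda>i k. \<Sum>p<L. A i p * v p k) =
      (\<Sum>\<pi>\<in>?P. of_int (sign \<pi>) * (\<Sum>f\<in>?F. \<Prod>i<n. A i (f i) * v (f i) (\<pi> i)))"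
    unfolding dt_leibniz by (simp add: prod_sum_PiE)
  also have "\<dots> = (\<Sum>f\<in>?F. (\<Prod>i<n. A i (f i)) * dt n (\<lambda>i k. v (f i) k))"
    unfolding dt_leibniz sum_distrib_left by (subst sum.swap) (simp add: prod.distrib mult_ac)
  also have "\<dots> = (\<Sum>f\<in>{f \<in> ?F. inj_on f {..<n}}. (\<Prod>i<n. A i (f i)) * dt n (\<lambda>i k. v (f i) k))"
  proof (rule sum.mono_neutral_right)
    show "\<forall>f\<in>?F - {f \<in> ?F. inj_on f {..<n}}. (\<Prod>i<n. A i (f i)) * dt n (\<lambda>i k. v (f i) k) = 0"
    proof
      fix f assume "f \<in> ?F - {f \<in> ?F. inj_on f {..<n}}"
      then obtain i k where "i < n" "k < n" "i \<noteq> k" "f i = f k" by (auto simp: inj_on_def)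
      then have "dt n (\<lambda>i k. v (f i) k) = 0" by (intro dt_identical_rows[of i n k]) auto
      then show "(\<Prod>i<n. A i (f i)) * dt n (\<lambda>i k. v (f i) k) = 0" by simp
    qed
  qed (auto intro: finite_PiE)
  also have "\<dots> = (\<Sum>(\<beta>, \<pi>)\<in>parts_below n L \<times> ?P.
      (\<Prod>i<n. A i (pos n \<beta> (\<pi> i))) * dt n (\<lambda>i k. v (pos n \<beta> (\<pi> i)) k))"
    by (subst sum.reindex_bij_betw[OF inj_decomposition, symmetric])
      (auto intro!: sum.cong prod.cong arg_cong2[of _ _ _ _ "(*)"] dt_cong)
  also have "\<dots> = (\<Sum>\<beta>\<in>parts_below n L. \<Sum>\<pi>\<in>?P.
      (\<Prod>i<n. A i (pos n \<beta> (\<pi> i))) * (of_int (sign \<pi>) * dt n (\<lambda>i k. v (pos n \<beta> i) k)))"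
    unfolding sum.cartesian_product[symmetric]
    by (intro sum.cong refl arg_cong2[of _ _ _ _ "(*)"])
      (simp add: dt_permute_rows[where f = "\<lambda>i k. v (pos n \<beta> i) k" for \<beta>])
  also have "\<dots> = (\<Sum>\<beta>\<in>parts_below n L. dt n (\<lambda>i j. A i (pos n \<beta> j)) * dt n (\<lambda>j k. v (pos n \<beta> j) k))"
    by (intro sum.cong refl) (simp add: dt_leibniz[of n "\<lambda>i j. A i (pos n _ j)"] sum_distrib_right mult.assoc mult.left_commute)
  finally show ?thesis .
qed

section \<open>Minors indexed by partitions\<close>

text \<open>For a Toeplitz kernel this is the skew Jacobi--Trudi determinant of
  \<gamma>/\<alpha>.\<close>

definition minor :: "nat \<Rightarrow> (nat \<Rightarrow> nat \<Rightarrow> 'a::comm_ring_1) \<Rightarrow> partition \<Rightarrow> partition \<Rightarrow> 'a" where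
  "minor n A \<gamma> \<alpha> = dt n (\<lambda>i j. A (pos n \<gamma> i) (pos n \<alpha> j))"

lemma pos_mono: "i \<le> j \<Longrightarrow> j < n \<Longrightarrow> pos n \<kappa> j \<le> pos n \<kappa> i"
  using pos_strict[of i j n \<kappa>] by (cases "i = j") auto

text \<open>If \<gamma> + \<delta> falls below \<alpha> + \<delta> at the index i, the rows from i
  on and the columns up to i meet in zeros; together they number (n - i) + (i + 1) > n.\<close>

lemma minor_not_contained:
  assumes "\<And>a b. a < b \<Longrightarrow> A a b = 0" "length (parts \<alpha>) \<le> n" "\<not> contained \<alpha> \<gamma>"
  shows "minor n A \<gamma> \<alpha> = 0"
proof -
  obtain i where i: "i < n" "pos n \<gamma> i < pos n \<alpha> i"
    using assms(2,3) contained_iff_pos[of \<alpha> n \<gamma>] by (auto simp: not_le)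
  have "pos n \<gamma> i' < pos n \<alpha> j" if "i \<le> i'" "i' < n" "j \<le> i" for i' j
    using pos_mono[of i i' n \<gamma>] pos_mono[of j i n \<alpha>] that i by linarith
  then show ?thesis
    unfolding minor_def by (intro dt_zero_block[of "{i..<n}" _ "{..i}"]) (use i assms(1) in auto)
qed

lemma minor_diagonal:
  assumes "\<And>a b. a < b \<Longrightarrow> A a b = 0" "\<And>a. A a a = 1"
  shows "minor n A \<gamma> \<gamma> = 1"
  unfolding minor_def by (subst dt_upper_triangular) (simp_all add: assms pos_strict)

lemma pos_less: "i < n \<Longrightarrow> pos n \<kappa> i < part \<kappa> (Suc 0) + n"
  using part_mono[of 1 "i + 1" \<kappa>] by (auto simp: pos_def)

lemma contained_parts_below:
  assumes "contained \<beta> \<gamma>" "length (parts \<gamma>) \<le> n" "\<And>i. i < n \<Longrightarrow> pos n \<gamma> i < L"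
  shows "\<beta> \<in> parts_below n L"
proof -
  have "length (parts \<beta>) \<le> n" using contained_length[OF assms(1)] assms(2) by simp
  then show ?thesis
    unfolding parts_below_def using assms contained_iff_pos[of \<beta> n \<gamma>] by (auto intro: le_less_trans)
qed

lemma finite_contained [simp]: "finite {\<beta>. contained \<beta> \<gamma>}"
  by (rule finite_subset[OF _ finite_parts_below[of "length (parts \<gamma>)" "part \<gamma> (Suc 0) + length (parts \<gamma>)"]])
    (auto intro: contained_parts_below pos_less)

text \<open>Cauchy--Binet for a lower triangular \<open>A\<close>: the intermediate partitions are
  confined to those inside \<gamma>, so the index set does not depend on the cut-off
  \<open>L\<close>.\<close>

lemma minor_mult:
  assumes "\<And>a b. a < b \<Longrightarrow> A a b = 0" "length (parts \<gamma>) \<le> n"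
  shows "minor n (\<lambda>a c. \<Sum>b\<le>a. A a b * B b c) \<gamma> \<alpha> =
    (\<Sum>\<beta> | contained \<beta> \<gamma>. minor n A \<gamma> \<beta> * minor n B \<beta> \<alpha>)"
proof -
  define L where "L = part \<gamma> (Suc 0) + n"
  have "minor n (\<lambda>a c. \<Sum>b\<le>a. A a b * B b c) \<gamma> \<alpha> =
      dt n (\<lambda>i k. \<Sum>p<L. A (pos n \<gamma> i) p * B p (pos n \<alpha> k))"
    unfolding minor_def
  proof (rule dt_cong)
    fix i j assume "i < n" "j < n"
    show "(\<Sum>b\<le>pos n \<gamma> i. A (pos n \<gamma> i) b * B b (pos n \<alpha> j)) =
        (\<Sum>p<L. A (pos n \<gamma> i) p * B p (pos n \<alpha> j))"
      by (rule sum.mono_neutral_left)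
        (use pos_less[OF \<open>i < n\<close>, of \<gamma>] assms(1) in \<open>auto simp: L_def\<close>)
  qed
  also have "\<dots> = (\<Sum>\<beta>\<in>parts_below n L. minor n A \<gamma> \<beta> * minor n B \<beta> \<alpha>)"
    unfolding cauchy_binet minor_def by (rule refl)
  also have "\<dots> = (\<Sum>\<beta> | contained \<beta> \<gamma>. minor n A \<gamma> \<beta> * minor n B \<beta> \<alpha>)"
  proof (rule sum.mono_neutral_right)
    show "{\<beta>. contained \<beta> \<gamma>} \<subseteq> parts_below n L"
      unfolding L_def using assms(2) by (auto intro: contained_parts_below pos_less)
    show "\<forall>\<beta>\<in>parts_below n L - {\<beta>. contained \<beta> \<gamma>}. minor n A \<gamma> \<beta> * minor n B \<beta> \<alpha> = 0"
      using minor_not_contained[of A _ n \<gamma>] assms(1) by (auto simp: parts_below_def)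
  qed simp
  finally show ?thesis .
qed

text \<open>Row a carries the coefficients of \<open>F a\<close>, read from the diagonal to the
  left. Each row may have its own series, yet multiplication by a Toeplitz matrix on the right is
  still multiplication of series (\<open>row_series_mult\<close>). This covers the double powers,
  whose factors depend on the exponent.\<close>

definition row_series :: "(nat \<Rightarrow> 'a::comm_ring_1 fps) \<Rightarrow> nat \<Rightarrow> nat \<Rightarrow> 'a" where
  "row_series F a b = (if b \<le> a then fps_nth (F a) (a - b) else 0)"

abbreviation toeplitz :: "'a::comm_ring_1 fps \<Rightarrow> nat \<Rightarrow> nat \<Rightarrow> 'a" where
  "toeplitz H \<equiv> row_series (\<lambda>_. H)"

lemma row_series_upper [simp]: "a < b \<Longrightarrow> row_series F a b = 0"
  by (simp add: row_series_def)

lemma row_series_mult: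
  "(\<Sum>b\<le>a. row_series F a b * toeplitz G b c) = row_series (\<lambda>a. F a * G) a c"
proof (cases "c \<le> a")
  case True
  have "(\<Sum>b\<le>a. row_series F a b * toeplitz G b c) =
      (\<Sum>b\<in>{c..a}. fps_nth (F a) (a - b) * fps_nth G (b - c))"
    by (rule sum.mono_neutral_cong_right) (auto simp: row_series_def)
  also have "\<dots> = (\<Sum>i\<in>{0..a - c}. fps_nth (F a) i * fps_nth G (a - c - i))"
    by (rule sum.reindex_bij_witness[of _ "\<lambda>i. a - i" "\<lambda>b. a - b"]) (use True in auto)
  finally show ?thesis using True by (simp add: row_series_def fps_mult_nth)
next
  case False
  have "(\<Sum>b\<le>a. row_series F a b * toeplitz G b c) = 0"
    by (rule sum.neutral) (use False in \<open>auto simp: row_series_def\<close>)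
  then show ?thesis using False by (simp add: row_series_def)
qed

lemma minor_series_mult:
  assumes "length (parts \<gamma>) \<le> n"
  shows "minor n (row_series (\<lambda>a. F a * G)) \<gamma> \<alpha> =
    (\<Sum>\<beta> | contained \<beta> \<gamma>. minor n (row_series F) \<gamma> \<beta> * minor n (toeplitz G) \<beta> \<alpha>)"
  using minor_mult[of "row_series F" \<gamma> n "toeplitz G" \<alpha>] assms
  by (simp add: row_series_mult)

lemma pos_Suc: "i < n \<Longrightarrow> pos (Suc n) \<kappa> i = Suc (pos n \<kappa> i)"
  by (simp add: pos_def)

text \<open>Passing to n + 1 raises the old positions by 1, which a Toeplitz matrix does not see,
  and adds the position 0 to both sequences; the new last row is (0, ..., 0, 1).\<close>

lemma minor_toeplitz_Suc:
  assumes "fps_nth H 0 = 1" "length (parts \<gamma>) \<le> n" "length (parts \<alpha>) \<le> n"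
  shows "minor (Suc n) (toeplitz H) \<gamma> \<alpha> = minor n (toeplitz H) \<gamma> \<alpha>"
proof -
  have 0: "pos (Suc n) \<gamma> n = 0" "pos (Suc n) \<alpha> n = 0"
    using assms by (simp_all add: pos_def part_beyond)
  have "minor (Suc n) (toeplitz H) \<gamma> \<alpha> =
      toeplitz H 0 0 * dt n (\<lambda>i j. toeplitz H (pos (Suc n) \<gamma> i) (pos (Suc n) \<alpha> j))"
    unfolding minor_def by (subst dt_last_row) (simp_all add: 0 pos_Suc)
  also have "dt n (\<lambda>i j. toeplitz H (pos (Suc n) \<gamma> i) (pos (Suc n) \<alpha> j)) = minor n (toeplitz H) \<gamma> \<alpha>"
    unfolding minor_def by (rule dt_cong) (simp add: pos_Suc row_series_def)
  finally have "minor (Suc n) (toeplitz H) \<gamma> \<alpha> = toeplitz H 0 0 * minor n (toeplitz H) \<gamma> \<alpha>" .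
  moreover have "toeplitz H 0 0 = 1" using assms(1) by (simp add: row_series_def)
  ultimately show ?thesis by simp
qed

lemma minor_toeplitz_stable:
  assumes "fps_nth H 0 = 1" "length (parts \<gamma>) \<le> n" "length (parts \<alpha>) \<le> n" "n \<le> m"
  shows "minor m (toeplitz H) \<gamma> \<alpha> = minor n (toeplitz H) \<gamma> \<alpha>"
  using assms(4)
proof (induction m rule: dec_induct)
  case (step m)
  then show ?case using assms minor_toeplitz_Suc[of H \<gamma> m \<alpha>] by simp
qed simp

text \<open>Jacobi--Trudi determinants with entries \<open>h\<^bsub>\<gamma>\<^sub>i-i+j\<^esub>\<close>, where \<open>H\<close> is the generating series of
  the \<open>h\<^sub>r\<close>.\<close>

definition schur_det :: "'a::comm_ring_1 fps \<Rightarrow> partition \<Rightarrow> 'a" where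
  "schur_det H \<gamma> = minor (length (parts \<gamma>)) (toeplitz H) \<gamma> empty_partition"

lemma schur_det_eq:
  assumes "fps_nth H 0 = 1" "length (parts \<gamma>) \<le> n"
  shows "minor n (toeplitz H) \<gamma> empty_partition = schur_det H \<gamma>"
  unfolding schur_det_def by (rule minor_toeplitz_stable) (use assms in auto)

text \<open>The rule s_\<gamma>[G H] = \<Sum> s_(\<gamma>/\<beta>)[G] s_\<beta>[H], which is
  Cauchy--Binet for a product of two Toeplitz matrices.\<close>

lemma schur_det_mult:
  assumes "fps_nth G 0 = 1" "fps_nth H 0 = 1" "length (parts \<gamma>) \<le> n"
  shows "schur_det (G * H) \<gamma> = (\<Sum>\<beta> | contained \<beta> \<gamma>. minor n (toeplitz G) \<gamma> \<beta> * schur_det H \<beta>)"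
proof -
  have "schur_det (G * H) \<gamma> = minor n (toeplitz (G * H)) \<gamma> empty_partition"
    using assms by (subst schur_det_eq) simp_all
  also have "\<dots> = (\<Sum>\<beta> | contained \<beta> \<gamma>. minor n (toeplitz G) \<gamma> \<beta> * minor n (toeplitz H) \<beta> empty_partition)"
    using assms by (rule_tac minor_series_mult)
  also have "\<dots> = (\<Sum>\<beta> | contained \<beta> \<gamma>. minor n (toeplitz G) \<gamma> \<beta> * schur_det H \<beta>)"
  proof (intro sum.cong refl)
    fix \<beta> assume "\<beta> \<in> {\<beta>. contained \<beta> \<gamma>}"
    then have "length (parts \<beta>) \<le> n" using contained_length[of \<beta> \<gamma>] assms(3) by simp
    then show "minor n (toeplitz G) \<gamma> \<beta> * minor n (toeplitz H) \<beta> empty_partition =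
        minor n (toeplitz G) \<gamma> \<beta> * schur_det H \<beta>"
      using assms(2) by (simp add: schur_det_eq)
  qed
  finally show ?thesis .
qed

section \<open>Alternants\<close>

definition geo :: "'a::comm_ring_1 \<Rightarrow> 'a fps" where
  "geo x = Abs_fps (\<lambda>k. x ^ k)"

definition linfac :: "'a::comm_ring_1 \<Rightarrow> 'a fps" where
  "linfac x = 1 - fps_const x * fps_X"

text \<open>The generating series of the complete homogeneous polynomials in x_0, ..., x_(n-1);
  \<open>geo\<close> and \<open>linfac\<close> are the mutually inverse series 1/(1 - x t) and 1 - x
  t.\<close>

definition eta :: "nat \<Rightarrow> (nat \<Rightarrow> 'a::comm_ring_1) \<Rightarrow> 'a fps" where
  "eta n x = (\<Prod>k<n. geo (x k))"

lemma linfac_nth: "fps_nth (linfac x * F) k = fps_nth F k - (if k = 0 then 0 else x * fps_nth F (k - 1))"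
  by (simp add: linfac_def left_diff_distrib mult.assoc)

lemma linfac_geo [simp]: "linfac x * geo x = 1"
  by (rule fps_ext) (auto simp: linfac_nth geo_def simp flip: power_Suc)

lemma geo_linfac [simp]: "geo x * linfac x = 1"
  using linfac_geo[of x] by (simp add: mult.commute)

lemma linfac_prod_eta: "(\<Prod>k<n. linfac (x k)) * eta n x = 1"
  unfolding eta_def by (simp flip: prod.distrib)

lemma eta_0 [simp]: "fps_nth (eta n x) 0 = 1"
proof -
  have "fps_nth (\<Prod>k<n. geo (x k)) 0 = 1" by (induction n) (simp_all add: geo_def)
  then show ?thesis by (simp add: eta_def)
qed

lemma linfac_0 [simp]: "fps_nth (\<Prod>k\<in>A. linfac (x k)) 0 = 1"
  by (induction A rule: infinite_finite_induct) (simp_all add: linfac_def)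

lemma linfac_prod_nth:
  "finite A \<Longrightarrow> card A < k \<Longrightarrow> fps_nth (\<Prod>l\<in>A. linfac (x l)) k = 0"
  by (induction A arbitrary: k rule: finite_induct) (auto simp: linfac_nth)

lemma prod_diff_expand:
  "finite A \<Longrightarrow> (\<Prod>l\<in>A. z - x l) = (\<Sum>s\<le>card A. fps_nth (\<Prod>l\<in>A. linfac (x l)) s * z ^ (card A - s))"
proof (induction A rule: finite_induct)
  case (insert a A)
  let ?F = "\<Prod>l\<in>A. linfac (x l)"
  let ?c = "card A"
  have "(\<Sum>s\<le>Suc ?c. fps_nth (linfac (x a) * ?F) s * z ^ (Suc ?c - s)) =
      (\<Sum>s\<le>Suc ?c. fps_nth ?F s * z ^ (Suc ?c - s)) -
      (\<Sum>s\<le>Suc ?c. (if s = 0 then 0 else x a * fps_nth ?F (s - 1)) * z ^ (Suc ?c - s))"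
    by (simp only: linfac_nth left_diff_distrib sum_subtractf)
  also have "(\<Sum>s\<le>Suc ?c. fps_nth ?F s * z ^ (Suc ?c - s)) = z * (\<Sum>s\<le>?c. fps_nth ?F s * z ^ (?c - s))"
    using linfac_prod_nth[of A "Suc ?c" x] insert.hyps
    by (simp add: sum_distrib_left Suc_diff_le mult_ac)
  also have "(\<Sum>s\<le>Suc ?c. (if s = 0 then 0 else x a * fps_nth ?F (s - 1)) * z ^ (Suc ?c - s)) =
      x a * (\<Sum>s\<le>?c. fps_nth ?F s * z ^ (?c - s))"
    by (subst sum.atMost_Suc_shift) (simp add: sum_distrib_left mult_ac)
  finally show ?case using insert by (simp add: left_diff_distrib)
qed simp

text \<open>Since 1/(1 - x_k t) is \<open>eta n x\<close> times the product of 1 - x_l t over l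
  \<noteq> k, a power of x_k is a combination of complete polynomials whose coefficients do not
  depend on the exponent. That product has degree n - 1, which bounds b by n.\<close>

lemma power_eq_toeplitz:
  assumes "k < n"
  shows "x k ^ p = (\<Sum>b<n. toeplitz (eta n x) p b * fps_nth (\<Prod>l\<in>{..<n} - {k}. linfac (x l)) b)"
proof -
  let ?Q = "\<Prod>l\<in>{..<n} - {k}. linfac (x l)"
  have "(\<Prod>l<n. linfac (x l)) = linfac (x k) * ?Q"
    using assms by (simp add: prod.remove)
  then have "geo (x k) = geo (x k) * (linfac (x k) * ?Q * eta n x)"
    using linfac_prod_eta[where n = n and x = x] by simp
  also have "\<dots> = ?Q * eta n x"
    by (simp add: mult.assoc[symmetric])
  finally have "x k ^ p = fps_nth (?Q * eta n x) p"
    by (metis fps_nth_Abs_fps geo_def)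
  also have "\<dots> = (\<Sum>b\<le>p. fps_nth ?Q b * fps_nth (eta n x) (p - b))"
    by (simp add: fps_mult_nth atLeast0AtMost)
  also have "\<dots> = (\<Sum>b<n. toeplitz (eta n x) p b * fps_nth ?Q b)"
    by (rule sum.mono_neutral_cong)
      (use assms in \<open>auto simp: row_series_def linfac_prod_nth mult.commute\<close>)
  finally show ?thesis .
qed

text \<open>The second factor \<open>K\<close> is the same for every exponent sequence. For the
  staircase the first factor is unitriangular, which identifies the determinant of \<open>K\<close>
  with the Vandermonde determinant.\<close>

theorem alternant_jacobi_trudi:
  "dt n (\<lambda>i k. x k ^ l i) =
    dt n (\<lambda>i j. toeplitz (eta n x) (l i) (n - Suc j)) * dt n (\<lambda>i k. x k ^ (n - Suc i))"
proof -
  define K where "K j k = fps_nth (\<Prod>l\<in>{..<n} - {k}. linfac (x l)) (n - Suc j)" for j k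
  have *: "dt n (\<lambda>i k. x k ^ l i) = dt n (\<lambda>i j. toeplitz (eta n x) (l i) (n - Suc j)) * dt n K" for l
  proof -
    have "dt n (\<lambda>i k. x k ^ l i) = dt n (\<lambda>i k. \<Sum>j<n. toeplitz (eta n x) (l i) (n - Suc j) * K j k)"
      unfolding K_def
      by (rule dt_cong, subst power_eq_toeplitz[of _ n], assumption, subst sum.nat_diff_reindex[symmetric]) simp
    then show ?thesis by (simp add: dt_mult)
  qed
  have "dt n (\<lambda>i j. toeplitz (eta n x) (n - Suc i) (n - Suc j)) = 1"
    by (subst dt_upper_triangular) (auto simp: row_series_def)
  then show ?thesis using *[of l] *[of "\<lambda>i. n - Suc i"] by simp
qed

text \<open>Row operations with the unitriangular \<open>C\<close> replace row i by the values at z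
  = x_k of the product of z - x_l over l > i. These vanish for k > i, so the result is lower
  triangular.\<close>

lemma vandermonde_determinant:
  "dt n (\<lambda>i k. x k ^ (n - Suc i)) = (\<Prod>i<n. \<Prod>l\<in>{i<..<n}. x i - x l)"
proof -
  define C where "C i j = (if i \<le> j then fps_nth (\<Prod>l\<in>{i<..<n}. linfac (x l)) (j - i) else 0)" for i j
  have "dt n (\<lambda>i k. \<Prod>l\<in>{i<..<n}. x k - x l) = dt n (\<lambda>i k. \<Sum>j<n. C i j * x k ^ (n - Suc j))"
  proof (rule dt_cong)
    fix i k assume "i < n" "k < n"
    then have card: "card {i<..<n} = n - Suc i" by simp
    have "(\<Prod>l\<in>{i<..<n}. x k - x l) =
        (\<Sum>s\<le>n - Suc i. fps_nth (\<Prod>l\<in>{i<..<n}. linfac (x l)) s * x k ^ (n - Suc i - s))"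
      by (subst prod_diff_expand) (simp_all add: card)
    also have "\<dots> = (\<Sum>j\<in>{i..<n}. C i j * x k ^ (n - Suc j))"
      by (rule sum.reindex_bij_witness[of _ "\<lambda>j. j - i" "\<lambda>s. s + i"]) (use \<open>i < n\<close> in \<open>auto simp: C_def add.commute\<close>)
    also have "\<dots> = (\<Sum>j<n. C i j * x k ^ (n - Suc j))"
      by (rule sum.mono_neutral_left) (auto simp: C_def)
    finally show "(\<Prod>l\<in>{i<..<n}. x k - x l) = (\<Sum>j<n. C i j * x k ^ (n - Suc j))" .
  qed
  also have "\<dots> = dt n C * dt n (\<lambda>i k. x k ^ (n - Suc i))" by (rule dt_mult)
  also have "dt n C = 1" by (subst dt_upper_triangular) (auto simp: C_def)
  also have "dt n (\<lambda>i k. \<Prod>l\<in>{i<..<n}. x k - x l) = (\<Prod>i<n. \<Prod>l\<in>{i<..<n}. x i - x l)"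
    by (rule dt_lower_triangular) (auto intro!: prod_zero)
  finally show ?thesis by simp
qed

lemma alternant_schur_det:
  assumes "length (parts \<gamma>) \<le> n"
  shows "dt n (\<lambda>i k. x k ^ pos n \<gamma> i) = schur_det (eta n x) \<gamma> * dt n (\<lambda>i k. x k ^ (n - Suc i))"
  using alternant_jacobi_trudi[of n x "pos n \<gamma>"] schur_det_eq[of "eta n x" \<gamma> n] assms
  by (simp add: minor_def)

text \<open>Replacing the last column of the identity by v gives a matrix of determinant 1 whose
  product with f has a zero last column. No division is involved, so this works over any commutative
  ring.\<close>

lemma dt_kernel_last:
  assumes "\<And>i. i \<le> n \<Longrightarrow> (\<Sum>j\<le>n. f i j * v j) = 0" "v n = 1"
  shows "dt (Suc n) f = 0"
proof -
  define V where "V i j = (if j = n then v i else if i = j then 1 else 0)" for i j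
  have "dt (Suc n) (\<lambda>i j. \<Sum>k<Suc n. f i k * V k j) = dt (Suc n) f * dt (Suc n) V" by (rule dt_mult)
  also have "dt (Suc n) V = (\<Prod>i<Suc n. V i i)" by (rule dt_upper_triangular) (auto simp: V_def)
  also have "\<dots> = 1" using assms(2) by (intro prod.neutral) (auto simp: V_def)
  also have "dt (Suc n) (\<lambda>i j. \<Sum>k<Suc n. f i k * V k j) = 0"
    by (rule dt_zero_block[of "{..<Suc n}" _ "{n}"])
      (use assms(1) in \<open>auto simp: V_def lessThan_Suc_atMost\<close>)
  finally show ?thesis by simp
qed

text \<open>The coefficients of \<open>Q\<close>, a polynomial of degree n \<le> N, form a kernel
  vector: each row pairs with them to a coefficient of \<open>Q * eta n x\<close> = 1, and its index
  is positive because every part is.\<close>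

lemma schur_det_eta_zero:
  assumes "n < length (parts \<gamma>)"
  shows "schur_det (eta n x) \<gamma> = 0"
proof -
  define Q where "Q = (\<Prod>k<n. linfac (x k))"
  define N where "N = length (parts \<gamma>) - 1"
  have N: "length (parts \<gamma>) = Suc N" using assms by (simp add: N_def)
  have "dt (Suc N) (\<lambda>i j. toeplitz (eta n x) (pos (Suc N) \<gamma> i) (N - j)) = 0"
  proof (rule dt_kernel_last[where v = "\<lambda>j. fps_nth Q (N - j)"])
    fix i assume "i \<le> N"
    then have "part \<gamma> (Suc i) > 0" using part_pos_iff N by simp
    then have p: "pos (Suc N) \<gamma> i > 0" using \<open>i \<le> N\<close> by (simp add: pos_def)
    have "(\<Sum>j\<le>N. toeplitz (eta n x) (pos (Suc N) \<gamma> i) (N - j) * fps_nth Q (N - j)) =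
        (\<Sum>b\<le>N. toeplitz (eta n x) (pos (Suc N) \<gamma> i) b * fps_nth Q b)"
      by (rule sum.reindex_bij_witness[of _ "\<lambda>b. N - b" "\<lambda>j. N - j"]) auto
    also have "\<dots> = (\<Sum>b\<le>pos (Suc N) \<gamma> i. fps_nth Q b * fps_nth (eta n x) (pos (Suc N) \<gamma> i - b))"
      by (rule sum.mono_neutral_cong)
        (use assms N in \<open>auto simp: row_series_def Q_def linfac_prod_nth mult.commute\<close>)
    also have "\<dots> = fps_nth (Q * eta n x) (pos (Suc N) \<gamma> i)"
      by (simp add: fps_mult_nth atLeast0AtMost)
    also have "\<dots> = 0" using p by (simp add: Q_def linfac_prod_eta)
    finally show "(\<Sum>j\<le>N. toeplitz (eta n x) (pos (Suc N) \<gamma> i) (N - j) * fps_nth Q (N - j)) = 0" .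
  qed (simp add: Q_def)
  then show ?thesis by (simp add: schur_det_def N minor_def)
qed

context comm_ring_hom begin

lemma hom_prod_geo:
  fixes n :: nat
  shows "hom (fps_nth (\<Prod>k<n. geo (x k)) r) = fps_nth (\<Prod>k<n. geo (hom (x k))) r"
proof (induction n arbitrary: r)
  case (Suc n)
  have "hom (fps_nth (geo y) k) = fps_nth (geo (hom y)) k" for y k
    by (simp add: geo_def hom_power)
  then show ?case by (simp add: fps_mult_nth hom_sum hom_mult Suc)
qed simp

lemma hom_eta: "hom (fps_nth (eta n x) r) = fps_nth (eta n (\<lambda>k. hom (x k))) r"
  unfolding eta_def by (rule hom_prod_geo)

lemma hom_schur_det:
  assumes "\<And>r. fps_nth G r = hom (fps_nth H r)"
  shows "hom (schur_det H \<gamma>) = schur_det G \<gamma>"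
  unfolding schur_det_def minor_def hom_dt by (rule dt_cong) (simp add: row_series_def assms)

end

section \<open>Coefficient extraction from alternants\<close>

definition mon :: "nat \<Rightarrow> (nat \<Rightarrow> nat) \<Rightarrow> (nat \<Rightarrow>\<^sub>0 nat)" where
  "mon n l = (\<Sum>k<n. Poly_Mapping.single (Suc k) (l k))"

abbreviation xv :: "nat \<Rightarrow> (nat, 'r::comm_ring_1) mvpoly" where
  "xv k \<equiv> mvar (Suc k)"

lemma lookup_mon: "k < n \<Longrightarrow> Poly_Mapping.lookup (mon n l) (Suc k) = l k"
  by (simp add: mon_def lookup_sum lookup_single when_def)

lemma mon_inject: "mon n l = mon n l' \<Longrightarrow> k < n \<Longrightarrow> l k = l' k"
  by (metis lookup_mon)

lemma mvar_power: "mvar i ^ k = Poly_Mapping.single (Poly_Mapping.single i k) (1 :: 'r::comm_ring_1)"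
  by (induction k) (simp_all add: mvar_def mult_single flip: single_add)

lemma prod_monomial:
  "(\<Prod>k<n. mconst (c k) * xv k ^ f k) = Poly_Mapping.single (mon n f) (\<Prod>k<n. c k :: 'r::comm_ring_1)"
  by (induction n) (simp_all add: mon_def mvar_power mconst_def mult_single mult.commute add.commute)

lemma lookup_mconst_mult:
  "Poly_Mapping.lookup (mconst c * p) m = c * Poly_Mapping.lookup p m" for p :: "('v, 'r::comm_ring_1) mvpoly"
  by (auto simp: mconst_def map.rep_eq when_def simp flip: mult_map_scale_conv_mult)

lemma of_int_mvpoly: "(of_int s :: ('v, 'r::comm_ring_1) mvpoly) = mconst (of_int s)"
  by (simp add: mconst_def)

lemma lookup_of_int_mult:
  "Poly_Mapping.lookup (of_int s * p) m = of_int s * Poly_Mapping.lookup p m" for p :: "('v, 'r::comm_ring_1) mvpoly"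
  by (simp add: of_int_mvpoly lookup_mconst_mult)

text \<open>Column k involves only the variable x_(k+1), so taking the coefficient of a monomial
  acts on the columns one at a time.\<close>

lemma lookup_det_univariate:
  fixes F :: "nat \<Rightarrow> nat \<Rightarrow> 'r::comm_ring_1"
  assumes "\<And>k. k < n \<Longrightarrow> l k < L"
  shows "Poly_Mapping.lookup (dt n (\<lambda>i k. \<Sum>p<L. mconst (F i p) * xv k ^ p)) (mon n l) = dt n (\<lambda>i k. F i (l k))"
proof -
  let ?F = "{..<n} \<rightarrow>\<^sub>E {..<L}"
  have "Poly_Mapping.lookup (\<Prod>k<n. \<Sum>p<L. mconst (F (\<pi> k) p) * xv k ^ p) (mon n l) =
      (\<Prod>k<n. F (\<pi> k) (l k))" for \<pi>
  proof -
    have "(\<Prod>k<n. \<Sum>p<L. mconst (F (\<pi> k) p) * xv k ^ p) =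
        (\<Sum>f\<in>?F. Poly_Mapping.single (mon n f) (\<Prod>k<n. F (\<pi> k) (f k)))"
      by (simp add: prod_sum_PiE prod_monomial)
    also have "Poly_Mapping.lookup \<dots> (mon n l) =
        (\<Sum>f\<in>?F. if f = restrict l {..<n} then (\<Prod>k<n. F (\<pi> k) (f k)) else 0)"
      unfolding lookup_sum
    proof (intro sum.cong refl)
      fix f assume f: "f \<in> ?F"
      have "mon n f = mon n l \<longleftrightarrow> f = restrict l {..<n}"
      proof
        assume "mon n f = mon n l"
        then show "f = restrict l {..<n}"
          using f mon_inject[of n f l] by (intro ext) (auto simp: restrict_def PiE_def extensional_def)
      qed (simp add: mon_def)
      then show "Poly_Mapping.lookup (Poly_Mapping.single (mon n f) (\<Prod>k<n. F (\<pi> k) (f k))) (mon n l) =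
          (if f = restrict l {..<n} then (\<Prod>k<n. F (\<pi> k) (f k)) else 0)"
        by (simp add: lookup_single when_def)
    qed
    also have "\<dots> = (\<Prod>k<n. F (\<pi> k) (l k))"
      using assms by (subst sum.delta) (auto intro!: finite_PiE)
    finally show ?thesis .
  qed
  then show ?thesis
    unfolding dt_transpose[of n "\<lambda>k i. \<Sum>p<L. mconst (F i p) * xv k ^ p"] dt_transpose[of n "\<lambda>k i. F i (l k)"]
    by (simp add: dt_leibniz lookup_sum lookup_of_int_mult)
qed

definition alt :: "nat \<Rightarrow> (nat \<Rightarrow> nat) \<Rightarrow> (nat, 'r::comm_ring_1) mvpoly" where
  "alt n l = dt n (\<lambda>i k. xv k ^ l i)"

text \<open>The identity matrix is triangular in both senses, so its minor vanishes unless each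
  partition contains the other.\<close>

lemma minor_identity:
  assumes "length (parts \<gamma>) \<le> n" "length (parts \<mu>) \<le> n"
  shows "minor n (\<lambda>a b. if a = b then 1 else 0) \<gamma> \<mu> = (if \<gamma> = \<mu> then 1 else (0 :: 'r::comm_ring_1))"
proof -
  let ?I = "\<lambda>a b :: nat. if a = b then 1 else (0 :: 'r)"
  have "minor n ?I \<gamma> \<mu> = minor n ?I \<mu> \<gamma>"
    unfolding minor_def
    by (subst dt_transpose[symmetric]) (rule dt_cong, auto)
  then have "minor n ?I \<gamma> \<mu> = 0" if "\<gamma> \<noteq> \<mu>"
    using minor_not_contained[of ?I \<gamma> n \<mu>] minor_not_contained[of ?I \<mu> n \<gamma>] assms
      contained_antisym[of \<mu> \<gamma>] that by (cases "contained \<mu> \<gamma>") auto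
  moreover have "minor n ?I \<gamma> \<gamma> = 1" by (rule minor_diagonal) auto
  ultimately show ?thesis by auto
qed

text \<open>The coefficients at the exponents \<mu> + \<delta> are functionals dual to the
  alternants; coefficients of Schur expansions are read with them.\<close>

lemma lookup_alt:
  assumes "length (parts \<gamma>) \<le> n" "length (parts \<mu>) \<le> n"
  shows "Poly_Mapping.lookup (alt n (pos n \<gamma>)) (mon n (pos n \<mu>)) = (if \<gamma> = \<mu> then 1 else (0 :: 'r::comm_ring_1))"
proof -
  define L where "L = part \<gamma> (Suc 0) + part \<mu> (Suc 0) + n"
  have L: "pos n \<gamma> i < L" "pos n \<mu> i < L" if "i < n" for i
    using pos_less[OF that, of \<gamma>] pos_less[OF that, of \<mu>] by (auto simp: L_def)
  have "alt n (pos n \<gamma>) = dt n (\<lambda>i k. \<Sum>p<L. mconst (if p = pos n \<gamma> i then 1 else (0 :: 'r)) * xv k ^ p)"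
    unfolding alt_def
  proof (rule dt_cong)
    fix i k assume "i < n" "k < n"
    have "(\<Sum>p<L. mconst (if p = pos n \<gamma> i then 1 else (0 :: 'r)) * xv k ^ p) =
        (\<Sum>p<L. if p = pos n \<gamma> i then xv k ^ p else 0)"
      by (intro sum.cong) auto
    then show "xv k ^ pos n \<gamma> i = (\<Sum>p<L. mconst (if p = pos n \<gamma> i then 1 else (0 :: 'r)) * xv k ^ p)"
      using L(1)[OF \<open>i < n\<close>] by simp
  qed
  then have "Poly_Mapping.lookup (alt n (pos n \<gamma>)) (mon n (pos n \<mu>)) =
      dt n (\<lambda>i k. if pos n \<mu> k = pos n \<gamma> i then 1 else (0 :: 'r))"
    using L(2) by (simp only: lookup_det_univariate)
  also have "\<dots> = minor n (\<lambda>a b. if a = b then 1 else (0 :: 'r)) \<gamma> \<mu>"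
    unfolding minor_def by (rule dt_cong) auto
  finally show ?thesis using assms by (simp add: minor_identity)
qed

lemma keys_alt: "m \<in> Poly_Mapping.keys (alt n l :: (nat, 'a::comm_ring_1) mvpoly) \<Longrightarrow> \<exists>\<pi>. \<pi> permutes {..<n} \<and> m = mon n (\<lambda>k. l (\<pi> k))"
proof -
  assume m: "m \<in> Poly_Mapping.keys (alt n l :: (nat, 'a) mvpoly)"
  have "(alt n l :: (nat, 'a) mvpoly) = (\<Sum>\<pi> | \<pi> permutes {..<n}. Poly_Mapping.single (mon n (\<lambda>k. l (\<pi> k))) (of_int (sign \<pi>)))"
    unfolding alt_def
    unfolding dt_transpose[of n "\<lambda>k i. xv k ^ l i"]
    unfolding dt_leibniz
    using prod_monomial[of "\<lambda>_. 1 :: 'a"]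
    by (intro sum.cong refl) (simp add: mult_single flip: single_of_int)
  then have "Poly_Mapping.keys (alt n l :: (nat, 'a) mvpoly) \<subseteq>
      (\<Union>\<pi>\<in>{\<pi>. \<pi> permutes {..<n}}. Poly_Mapping.keys (Poly_Mapping.single (mon n (\<lambda>k. l (\<pi> k))) (of_int (sign \<pi>) :: 'a)))"
    by (simp only: keys_sum)
  then have "m \<in> (\<Union>\<pi>\<in>{\<pi>. \<pi> permutes {..<n}}. Poly_Mapping.keys (Poly_Mapping.single (mon n (\<lambda>k. l (\<pi> k))) (of_int (sign \<pi>) :: 'a)))"
    using m by (rule subsetD)
  then show ?thesis by (auto split: if_splits)
qed

text \<open>The exponents of a monomial of the product dominate some rearrangement \<pi> of \<rho> +
  \<delta>. If \<theta> + \<delta> were smaller than \<rho> + \<delta> at i, then \<pi> would map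
  \<open>{i..<n}\<close> injectively into \<open>{i<..<n}\<close>.\<close>

lemma lookup_alt_mult_contained:
  assumes "Poly_Mapping.lookup (alt n (pos n \<rho>) * f) (mon n (pos n \<theta>)) \<noteq> 0" "length (parts \<rho>) \<le> n"
  shows "contained \<rho> \<theta>"
proof (rule ccontr)
  assume "\<not> ?thesis"
  then obtain i where i: "i < n" "pos n \<theta> i < pos n \<rho> i"
    using assms(2) contained_iff_pos by (auto simp: not_le)
  have "mon n (pos n \<theta>) \<in> Poly_Mapping.keys (alt n (pos n \<rho>) * f)"
    using assms(1) by (simp add: in_keys_iff)
  then obtain a b where ab: "mon n (pos n \<theta>) = a + b" "a \<in> Poly_Mapping.keys (alt n (pos n \<rho>) :: (nat, 'a) mvpoly)"
    using keys_mult by blast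
  then obtain \<pi> where p: "\<pi> permutes {..<n}" "a = mon n (\<lambda>k. pos n \<rho> (\<pi> k))"
    using keys_alt by blast
  have le: "pos n \<rho> (\<pi> k) \<le> pos n \<theta> k" if "k < n" for k
    using ab(1) that lookup_mon[OF that, of "pos n \<theta>"] lookup_mon[OF that, of "\<lambda>k. pos n \<rho> (\<pi> k)"]
    by (simp add: p(2) lookup_add)
  have "\<pi> ` {i..<n} \<subseteq> {i<..<n}"
  proof safe
    fix k assume k: "k \<in> {i..<n}"
    then have pk: "\<pi> k < n" using p(1) by (simp add: permutes_less)
    have "pos n \<rho> (\<pi> k) < pos n \<rho> i"
      using le[of k] pos_mono[of i k n \<theta>] k i by simp
    then show "\<pi> k \<in> {i<..<n}"
      using pk pos_mono[of "\<pi> k" i n \<rho>] i(1) by (cases "\<pi> k \<le> i") auto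
  qed
  then have "card (\<pi> ` {i..<n}) \<le> card {i<..<n}" by (intro card_mono) auto
  moreover have "card (\<pi> ` {i..<n}) = card {i..<n}"
    using p(1) by (meson card_image inj_on_subset permutes_inj subset_UNIV)
  ultimately show False using i(1) by simp
qed

lemma alt_schur_det:
  "length (parts \<gamma>) \<le> n \<Longrightarrow> alt n (pos n \<gamma>) = schur_det (eta n xv) \<gamma> * alt n (\<lambda>i. n - Suc i)"
  unfolding alt_def by (rule alternant_schur_det)

lemma vandermonde_eq_alt: "vandermonde n = (alt n (\<lambda>i. n - Suc i) :: (nat, 'r::comm_ring_1) mvpoly)"
proof -
  have "vandermonde n = (\<Prod>(i, l)\<in>(SIGMA i:{..<n}. {i<..<n}). xv i - xv l :: (nat, 'r) mvpoly)"
    unfolding vandermonde_def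
    by (rule prod.reindex_bij_witness[of _ "\<lambda>(i, l). (Suc i, Suc l)" "\<lambda>(i, l). (i - 1, l - 1)"]) auto
  also have "\<dots> = alt n (\<lambda>i. n - Suc i)"
    unfolding alt_def vandermonde_determinant by (simp add: prod.Sigma)
  finally show ?thesis .
qed

lemma mvar_inject: "mvar i = (mvar j :: ('v, 'r::comm_ring_1) mvpoly) \<longleftrightarrow> i = j"
proof
  assume "mvar i = (mvar j :: ('v, 'r) mvpoly)"
  then have "Poly_Mapping.single i (1::nat) = Poly_Mapping.single j 1"
    by (metis keys_mvar singleton_inject)
  then show "i = j" by (metis keys_single one_neq_zero singleton_inject)
qed simp

lemma vandermonde_nonzero: "vandermonde n \<noteq> (0 :: (nat, 'r::idom) mvpoly)"
proof -
  have "finite {(i, j). 1 \<le> i \<and> i < j \<and> j \<le> n}"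
    by (rule finite_subset[of _ "{..n} \<times> {..n}"]) auto
  then show ?thesis unfolding vandermonde_def by (auto simp: prod_zero_iff mvar_inject)
qed

lemma schur_poly_eq: "schur_poly n \<kappa> = schur_det (eta n xv) \<kappa>"
proof (cases "length (parts \<kappa>) \<le> n")
  case True
  have "det (mat n n (\<lambda>(i, j). mvar (i + 1) ^ (part \<kappa> (j + 1) + n - (j + 1)))) =
      (alt n (pos n \<kappa>) :: (nat, int) mvpoly)"
    unfolding alt_def by (subst dt_transpose[symmetric]) (simp add: dt_def pos_def)
  also have "\<dots> = schur_det (eta n xv) \<kappa> * vandermonde n"
    using True by (simp add: alt_schur_det vandermonde_eq_alt)
  finally have det: "det (mat n n (\<lambda>(i, j). mvar (i + 1) ^ (part \<kappa> (j + 1) + n - (j + 1)))) =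
      schur_det (eta n xv) \<kappa> * (vandermonde n :: (nat, int) mvpoly)" .
  show ?thesis
    unfolding schur_poly_def det using True vandermonde_nonzero[of n, where 'r = int]
    by (auto intro!: the_equality)
next
  case False
  then show ?thesis by (simp add: schur_poly_def schur_det_eta_zero)
qed

section \<open>Skew Schur functions and Littlewood--Richardson coefficients\<close>

lemma comm_ring_hom_map_of_int:
  "comm_ring_hom (Poly_Mapping.map of_int :: ('v, int) mvpoly \<Rightarrow> ('v, 'r::comm_ring_1) mvpoly)"
proof -
  let ?h = "Poly_Mapping.map of_int :: ('v, int) mvpoly \<Rightarrow> ('v, 'r) mvpoly"
  have lookup: "Poly_Mapping.lookup (?h p) m = of_int (Poly_Mapping.lookup p m)" for p m
    by (simp add: map.rep_eq when_def)
  have add: "?h (p + q) = ?h p + ?h q" for p q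
    by (rule poly_mapping_eqI) (simp add: lookup lookup_add)
  have single: "?h (Poly_Mapping.single m c) = Poly_Mapping.single m (of_int c)" for m c
    by (rule poly_mapping_eqI) (simp add: lookup lookup_single when_def)
  have zero: "?h 0 = 0" by (rule poly_mapping_eqI) (simp add: lookup)
  have ms: "?h (Poly_Mapping.single m c * q) = ?h (Poly_Mapping.single m c) * ?h q" for m c q
    by (induction q rule: mvpoly_induct) (simp_all add: zero add single mult_single distrib_left)
  have mult: "?h (p * q) = ?h p * ?h q" for p q
    by (induction p rule: mvpoly_induct) (simp_all add: zero add ms distrib_right)
  have "?h 1 = 1" using single[of 0 1] by simp
  then show ?thesis by unfold_locales (simp_all add: zero add mult)
qed

text \<open>The coefficient of s_\<theta> in s_\<rho> s_\<sigma>, read in n variables from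
  a_(\<rho>+\<delta>) s_\<sigma>. The number n remains a parameter until
  \<open>lr_eq_LR_coeff\<close>.\<close>

definition lr :: "nat \<Rightarrow> partition \<Rightarrow> partition \<Rightarrow> partition \<Rightarrow> int" where
  "lr n \<rho> \<sigma> \<theta> = Poly_Mapping.lookup (alt n (pos n \<rho>) * schur_det (eta n xv) \<sigma>) (mon n (pos n \<theta>))"

text \<open>The polynomial is the image under \<open>of_int\<close> of the same polynomial over the
  integers, so one family of integers serves in every coefficient ring.\<close>

lemma lookup_alt_schur_det:
  "Poly_Mapping.lookup (alt n (pos n \<rho>) * schur_det (eta n xv) \<sigma>) (mon n (pos n \<theta>)) =
    (of_int (lr n \<rho> \<sigma> \<theta>) :: 'r::comm_ring_1)"
proof -
  let ?h = "Poly_Mapping.map of_int :: (nat, int) mvpoly \<Rightarrow> (nat, 'r) mvpoly"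
  interpret comm_ring_hom ?h by (rule comm_ring_hom_map_of_int)
  have x: "?h (xv k) = xv k" for k
    by (rule poly_mapping_eqI) (simp add: map.rep_eq when_def mvar_def lookup_single)
  have "?h (alt n (pos n \<rho>)) = alt n (pos n \<rho>)"
    unfolding alt_def hom_dt hom_power x ..
  moreover have "?h (schur_det (eta n xv) \<sigma>) = schur_det (eta n xv) \<sigma>"
    by (rule hom_schur_det) (simp add: hom_eta x)
  ultimately have "alt n (pos n \<rho>) * schur_det (eta n xv) \<sigma> = ?h (alt n (pos n \<rho>) * schur_det (eta n xv) \<sigma>)"
    by (simp add: hom_mult)
  then show ?thesis by (simp add: lr_def map.rep_eq when_def)
qed

text \<open>The second inclusion follows from the first by a_(\<rho>+\<delta>) s_\<sigma> =
  a_(\<sigma>+\<delta>) s_\<rho>.\<close>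

lemma lr_contained:
  assumes "lr n \<rho> \<sigma> \<theta> \<noteq> 0" "length (parts \<rho>) \<le> n" "length (parts \<sigma>) \<le> n"
  shows "contained \<rho> \<theta>" "contained \<sigma> \<theta>"
proof -
  show "contained \<rho> \<theta>"
    using assms unfolding lr_def by (rule_tac lookup_alt_mult_contained)
  have "alt n (pos n \<rho>) * schur_det (eta n xv) \<sigma> = alt n (pos n \<sigma>) * schur_det (eta n xv :: (nat, int) mvpoly fps) \<rho>"
    using assms by (simp add: alt_schur_det mult_ac)
  then show "contained \<sigma> \<theta>"
    using assms unfolding lr_def by (rule_tac lookup_alt_mult_contained) auto
qed

lemma dt_mult_cols: "dt n (\<lambda>i k. f i k * c k) = dt n f * (\<Prod>k<n. c k)"
  using dt_scale_rows[of n c "\<lambda>k i. f i k"] dt_transpose[of n "\<lambda>i k. c i * f k i"] dt_transpose[of n f]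
  by (simp add: mult.commute)

text \<open>The Cauchy kernel, the product of H(x_k) over k, is multiplied by two alternants. With
  a_(\<rho>+\<delta>) its coefficient at \<theta> + \<delta> is the skew determinant; with
  a_\<delta> it expands into alternants a_(\<sigma>+\<delta>) with the coefficients
  \<open>schur_det H \<sigma>\<close>. Multiplying the second expansion by s_\<rho> and comparing
  gives the claim.\<close>

theorem skew_schur_expansion:
  fixes H :: "'r::comm_ring_1 fps"
  assumes "fps_nth H 0 = 1" "length (parts \<theta>) \<le> n" "length (parts \<rho>) \<le> n"
  shows "minor n (toeplitz H) \<theta> \<rho> = (\<Sum>\<sigma> | contained \<sigma> \<theta>. of_int (lr n \<rho> \<sigma> \<theta>) * schur_det H \<sigma>)"
proof -
  define L where "L = part \<theta> (Suc 0) + part \<rho> (Suc 0) + n"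
  have L: "pos n \<theta> i < L" "pos n \<rho> i < L" "n - Suc i < L" if "i < n" for i
    using pos_less[OF that, of \<theta>] pos_less[OF that, of \<rho>] that by (auto simp: L_def)
  \<comment> \<open>The series is cut off at degree \<open>L\<close> so that \<open>G k\<close> is a
    polynomial. The cut-off is invisible in the entries for \<theta> and for partitions inside
    \<theta>, whose positions are below \<open>L\<close>.\<close>
  define T where "T p q = (if p \<le> q \<and> q - p < L then fps_nth H (q - p) else 0)" for p q
  define G where "G k = (\<Sum>r<L. mconst (fps_nth H r) * xv k ^ r :: (nat, 'r) mvpoly)" for k
  have shift: "xv k ^ p * G k = (\<Sum>q<L + L. mconst (T p q) * xv k ^ q)" if "p < L" for p k
  proof -
    have "xv k ^ p * G k = (\<Sum>r<L. mconst (fps_nth H r) * xv k ^ (p + r))"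
      unfolding G_def by (simp add: sum_distrib_left power_add mult_ac)
    also have "\<dots> = (\<Sum>q\<in>{p..<p + L}. mconst (T p q) * xv k ^ q)"
      by (rule sum.reindex_bij_witness[of _ "\<lambda>q. q - p" "\<lambda>r. r + p"]) (auto simp: T_def add.commute)
    also have "\<dots> = (\<Sum>q<L + L. mconst (T p q) * xv k ^ q)"
      by (rule sum.mono_neutral_left) (use that in \<open>auto simp: T_def\<close>)
    finally show ?thesis .
  qed
  have alt_G: "alt n l * (\<Prod>k<n. G k) = dt n (\<lambda>i k. \<Sum>q<L + L. mconst (T (l i) q) * xv k ^ q)"
    if "\<And>i. i < n \<Longrightarrow> l i < L" for l
    unfolding alt_def dt_mult_cols[symmetric] by (rule dt_cong) (simp add: shift that)
  have "Poly_Mapping.lookup (alt n (pos n \<rho>) * (\<Prod>k<n. G k)) (mon n (pos n \<theta>)) =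
      dt n (\<lambda>i k. T (pos n \<rho> i) (pos n \<theta> k))"
    using L by (subst alt_G) (simp_all add: lookup_det_univariate trans_less_add1)
  also have "\<dots> = minor n (toeplitz H) \<theta> \<rho>"
    unfolding minor_def
    by (subst dt_transpose[symmetric], rule dt_cong) (use L(1) in \<open>auto simp: T_def row_series_def less_imp_diff_less\<close>)
  finally have 1: "minor n (toeplitz H) \<theta> \<rho> =
      Poly_Mapping.lookup (alt n (pos n \<rho>) * (\<Prod>k<n. G k)) (mon n (pos n \<theta>))" ..
  define S where "S \<sigma> = dt n (\<lambda>i j. T (n - Suc i) (pos n \<sigma> j))" for \<sigma>
  have "alt n (\<lambda>i. n - Suc i) * (\<Prod>k<n. G k) = (\<Sum>\<sigma>\<in>parts_below n (L + L). mconst (S \<sigma>) * alt n (pos n \<sigma>))"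
  proof -
    have mc: "dt n (\<lambda>i j. mconst (f i j) :: (nat, 'r) mvpoly) = mconst (dt n f)" for f
    proof -
      interpret comm_ring_hom "mconst :: 'r \<Rightarrow> (nat, 'r) mvpoly" by unfold_locales simp_all
      show ?thesis by (simp add: hom_dt)
    qed
    show ?thesis
      using L(3) by (subst alt_G) (simp_all add: cauchy_binet mc alt_def S_def)
  qed
  \<comment> \<open>On the left a_(\<rho>+\<delta>) = s_\<rho> a_\<delta>, on the right s_\<rho>
    a_(\<sigma>+\<delta>) = a_(\<rho>+\<delta>) s_\<sigma>; the last product is the one whose
    coefficients are \<open>lr\<close>.\<close>
  then have "alt n (pos n \<rho>) * (\<Prod>k<n. G k) =
      (\<Sum>\<sigma>\<in>parts_below n (L + L). mconst (S \<sigma>) * (alt n (pos n \<rho>) * schur_det (eta n xv) \<sigma>))"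
    using assms(3) 
    by (simp add: alt_schur_det mult.assoc sum_distrib_left)
      (rule sum.cong, simp, simp add: parts_below_def alt_schur_det mult_ac)
  then have "minor n (toeplitz H) \<theta> \<rho> = (\<Sum>\<sigma>\<in>parts_below n (L + L). S \<sigma> * of_int (lr n \<rho> \<sigma> \<theta>))"
    unfolding 1 by (simp add: lookup_sum lookup_mconst_mult lookup_alt_schur_det)
  also have "\<dots> = (\<Sum>\<sigma> | contained \<sigma> \<theta>. S \<sigma> * of_int (lr n \<rho> \<sigma> \<theta>))"
  proof (rule sum.mono_neutral_right)
    show "{\<sigma>. contained \<sigma> \<theta>} \<subseteq> parts_below n (L + L)"
      using contained_parts_below[of _ \<theta> n "L + L"] assms(2) L(1) by (auto simp: trans_less_add1)
    show "\<forall>\<sigma>\<in>parts_below n (L + L) - {\<sigma>. contained \<sigma> \<theta>}. S \<sigma> * of_int (lr n \<rho> \<sigma> \<theta>) = 0"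
    proof
      fix \<sigma> assume "\<sigma> \<in> parts_below n (L + L) - {\<sigma>. contained \<sigma> \<theta>}"
      then have "lr n \<rho> \<sigma> \<theta> = 0"
        using lr_contained(2)[of n \<rho> \<sigma> \<theta>] assms(3) by (auto simp: parts_below_def)
      then show "S \<sigma> * of_int (lr n \<rho> \<sigma> \<theta>) = 0" by simp
    qed
  qed simp
  also have "\<dots> = (\<Sum>\<sigma> | contained \<sigma> \<theta>. of_int (lr n \<rho> \<sigma> \<theta>) * schur_det H \<sigma>)"
  proof (intro sum.cong refl)
    fix \<sigma> assume "\<sigma> \<in> {\<sigma>. contained \<sigma> \<theta>}"
    then have c: "contained \<sigma> \<theta>" by simp
    then have len: "length (parts \<sigma>) \<le> n" using contained_length[OF c] assms(2) by simp
    have lt: "pos n \<sigma> i < L" if "i < n" for i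
      using contained_iff_pos[OF len, of \<theta>] c L(1)[OF that] that by (auto intro: le_less_trans)
    have "S \<sigma> = minor n (toeplitz H) \<sigma> empty_partition"
      unfolding S_def minor_def
    proof (subst dt_transpose[symmetric], rule dt_cong)
      fix i j assume "i < n" "j < n"
      have "pos n \<sigma> i - (n - Suc j) < L" using lt[OF \<open>i < n\<close>] by (rule less_imp_diff_less)
      then show "T (n - Suc j) (pos n \<sigma> i) = toeplitz H (pos n \<sigma> i) (pos n empty_partition j)"
        unfolding T_def row_series_def pos_empty by simp
    qed
    then show "S \<sigma> * of_int (lr n \<rho> \<sigma> \<theta>) = of_int (lr n \<rho> \<sigma> \<theta>) * schur_det H \<sigma>"
      using assms(1) len by (simp add: schur_det_eq)
  qed
  finally show ?thesis .
qed

text \<open>The product of two Schur functions is the skew Schur function of a disconnected shape: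
  \<open>\<alpha>\<close> translated to the right past \<open>\<beta>\<close> and placed above it.\<close>

lemma schur_det_product_skew:
  assumes H: "fps_nth H 0 = 1" and mk: "m = length (parts \<alpha>)" "k = length (parts \<beta>)"
    and \<theta>: "\<And>i. part \<theta> (Suc i) = (if i < m then part \<alpha> (Suc i) + part \<beta> (Suc 0) else part \<beta> (Suc (i - m)))"
    and \<rho>: "\<And>i. part \<rho> (Suc i) = (if i < m then part \<beta> (Suc 0) else 0)"
  shows "minor (m + k) (toeplitz H) \<theta> \<rho> = schur_det H \<alpha> * schur_det H \<beta>"
proof -
  let ?f = "\<lambda>i j. toeplitz H (pos (m + k) \<theta> i) (pos (m + k) \<rho> j)"
  have "minor (m + k) (toeplitz H) \<theta> \<rho> = dt m ?f * dt k (\<lambda>i j. ?f (m + i) (m + j))"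
    unfolding minor_def
  proof (rule dt_block_triangular)
    fix i j assume ij: "m \<le> i" "i < m + k" "j < m"
    \<comment> \<open>No row of \<beta> reaches past a translation by its first part, which is why
      the lower left block vanishes.\<close>
    have "part \<beta> (Suc (i - m)) \<le> part \<beta> (Suc 0)" by (rule part_mono) auto
    then show "?f i j = 0" using ij by (intro row_series_upper) (simp add: pos_def \<theta> \<rho>)
  qed
  also have "dt m ?f = schur_det H \<alpha>"
    unfolding schur_det_def minor_def mk(1)[symmetric]
    by (rule dt_cong) (auto simp: row_series_def pos_def \<theta> \<rho>)
  also have "dt k (\<lambda>i j. ?f (m + i) (m + j)) = schur_det H \<beta>"
    unfolding schur_det_def minor_def mk(2)[symmetric]
    by (rule dt_cong) (auto simp: row_series_def pos_def \<theta> \<rho>)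
  finally show ?thesis .
qed

text \<open>Multiplication by the Vandermonde product turns Schur polynomials into alternants, so
  each coefficient can be read off once n is at least the length of \<mu>; an expansion valid for
  all n is therefore unique.\<close>

lemma lookup_schur_combination:
  fixes c :: "partition \<Rightarrow>\<^sub>0 int"
  assumes "length (parts \<mu>) \<le> n"
  shows "Poly_Mapping.lookup (vandermonde n * (\<Sum>\<gamma>\<in>Poly_Mapping.keys c.
    of_int (Poly_Mapping.lookup c \<gamma>) * schur_poly n \<gamma>)) (mon n (pos n \<mu>)) = Poly_Mapping.lookup c \<mu>"
proof -
  have "Poly_Mapping.lookup (vandermonde n * (of_int z * schur_poly n \<gamma>)) (mon n (pos n \<mu>)) =
      (if \<gamma> = \<mu> then z else 0)" for z \<gamma>
  proof (cases "length (parts \<gamma>) \<le> n")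
    case True
    then have eq: "vandermonde n * (of_int z * schur_poly n \<gamma>) = of_int z * alt n (pos n \<gamma>)"
      by (simp only: alt_schur_det schur_poly_eq vandermonde_eq_alt mult_ac)
    show ?thesis unfolding eq lookup_of_int_mult lookup_alt[OF True assms] by simp
  next
    case False
    then show ?thesis using assms by (auto simp: schur_poly_def)
  qed
  then have "Poly_Mapping.lookup (vandermonde n * (\<Sum>\<gamma>\<in>Poly_Mapping.keys c.
      of_int (Poly_Mapping.lookup c \<gamma>) * schur_poly n \<gamma>)) (mon n (pos n \<mu>)) =
      (\<Sum>\<gamma>\<in>Poly_Mapping.keys c. if \<gamma> = \<mu> then Poly_Mapping.lookup c \<gamma> else 0)"
    by (simp only: sum_distrib_left lookup_sum)
  then show ?thesis by (simp add: in_keys_iff)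
qed

lemma LR_coeff_spec:
  assumes "\<And>n. schur_poly n \<alpha> * schur_poly n \<beta> =
    (\<Sum>\<gamma>\<in>Poly_Mapping.keys c. of_int (Poly_Mapping.lookup c \<gamma>) * schur_poly n \<gamma>)"
  shows "LR_coeff \<alpha> \<beta> = Poly_Mapping.lookup c"
proof -
  have "(THE c. \<forall>n. schur_poly n \<alpha> * schur_poly n \<beta> =
    (\<Sum>\<gamma>\<in>Poly_Mapping.keys c. of_int (Poly_Mapping.lookup c \<gamma>) * schur_poly n \<gamma>)) = c"
  proof (rule the_equality)
    fix c' assume c': "\<forall>n. schur_poly n \<alpha> * schur_poly n \<beta> =
      (\<Sum>\<gamma>\<in>Poly_Mapping.keys c'. of_int (Poly_Mapping.lookup c' \<gamma>) * schur_poly n \<gamma>)"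
    show "c' = c"
    proof (rule poly_mapping_eqI)
      fix \<mu>
      show "Poly_Mapping.lookup c' \<mu> = Poly_Mapping.lookup c \<mu>"
        using lookup_schur_combination[of \<mu> "length (parts \<mu>)" c]
          lookup_schur_combination[of \<mu> "length (parts \<mu>)" c'] c' assms by simp
    qed
  qed (use assms in blast)
  then show ?thesis unfolding LR_coeff_def by simp
qed

text \<open>The number n of rows is fixed by the disconnected shape \<theta>/\<rho>, but the
  expansion of its skew determinant holds for every series, in particular for the complete series in
  l variables for each l, as the definition of \<open>LR_coeff\<close> demands. Containment in
  \<theta> makes the support finite.\<close>

lemma ex_schur_product:
  obtains \<theta> n \<rho> where
    "\<And>\<sigma>. LR_coeff \<alpha> \<beta> \<sigma> = (if contained \<sigma> \<theta> then lr n \<rho> \<sigma> \<theta> else 0)"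
    "length (parts \<theta>) \<le> n" "length (parts \<rho>) \<le> n" "n = length (parts \<alpha>) + length (parts \<beta>)"
    "\<And>i. part \<theta> (Suc i) = (if i < length (parts \<alpha>) then part \<alpha> (Suc i) + part \<beta> (Suc 0)
       else part \<beta> (Suc (i - length (parts \<alpha>))))"
    "\<And>i. part \<rho> (Suc i) = (if i < length (parts \<alpha>) then part \<beta> (Suc 0) else 0)"
proof -
  define m k n where "m = length (parts \<alpha>)" and "k = length (parts \<beta>)" and "n = m + k"
  have "\<exists>\<kappa>. length (parts \<kappa>) \<le> n \<and> (\<forall>i. part \<kappa> (Suc i) =
      (if i < m then part \<alpha> (Suc i) + part \<beta> (Suc 0) else part \<beta> (Suc (i - m))))"
  proof (rule ex_partition)
    fix i j :: nat assume "i \<le> j"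
    then show "(if j < m then part \<alpha> (Suc j) + part \<beta> (Suc 0) else part \<beta> (Suc (j - m))) \<le>
        (if i < m then part \<alpha> (Suc i) + part \<beta> (Suc 0) else part \<beta> (Suc (i - m)))"
      using part_mono[of "Suc i" "Suc j" \<alpha>] part_mono[of "Suc 0" "Suc (j - m)" \<beta>]
        part_mono[of "Suc (i - m)" "Suc (j - m)" \<beta>] by auto
  qed (auto simp: n_def k_def part_beyond)
  then obtain \<theta> where \<theta>: "length (parts \<theta>) \<le> n" "\<And>i. part \<theta> (Suc i) =
      (if i < m then part \<alpha> (Suc i) + part \<beta> (Suc 0) else part \<beta> (Suc (i - m)))" by blast
  have "\<exists>\<kappa>. length (parts \<kappa>) \<le> n \<and> (\<forall>i. part \<kappa> (Suc i) = (if i < m then part \<beta> (Suc 0) else 0))"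
    by (rule ex_partition) (auto simp: n_def)
  then obtain \<rho> where \<rho>: "length (parts \<rho>) \<le> n"
    "\<And>i. part \<rho> (Suc i) = (if i < m then part \<beta> (Suc 0) else 0)" by blast
  define c where "c = Abs_poly_mapping (\<lambda>\<sigma>. if contained \<sigma> \<theta> then lr n \<rho> \<sigma> \<theta> else 0)"
  have c: "Poly_Mapping.lookup c = (\<lambda>\<sigma>. if contained \<sigma> \<theta> then lr n \<rho> \<sigma> \<theta> else 0)"
    unfolding c_def by (rule lookup_Abs_poly_mapping) (rule finite_subset[OF _ finite_contained[of \<theta>]], auto)
  have "LR_coeff \<alpha> \<beta> = Poly_Mapping.lookup c"
  proof (rule LR_coeff_spec)
    fix l
    have "schur_poly l \<alpha> * schur_poly l \<beta> = minor n (toeplitz (eta l xv)) \<theta> \<rho>"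
      by (simp add: schur_poly_eq n_def schur_det_product_skew[OF eta_0 m_def k_def \<theta>(2) \<rho>(2)])
    also have "\<dots> = (\<Sum>\<sigma> | contained \<sigma> \<theta>. of_int (lr n \<rho> \<sigma> \<theta>) * schur_poly l \<sigma>)"
      by (simp add: skew_schur_expansion \<theta>(1) \<rho>(1) schur_poly_eq)
    also have "\<dots> = (\<Sum>\<gamma>\<in>Poly_Mapping.keys c. of_int (Poly_Mapping.lookup c \<gamma>) * schur_poly l \<gamma>)"
      by (rule sum.mono_neutral_cong_right) (auto simp: in_keys_iff c split: if_splits)
    finally show "schur_poly l \<alpha> * schur_poly l \<beta> =
      (\<Sum>\<gamma>\<in>Poly_Mapping.keys c. of_int (Poly_Mapping.lookup c \<gamma>) * schur_poly l \<gamma>)" .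
  qed
  then show ?thesis
    using that[of \<theta> n \<rho>] \<theta> \<rho> unfolding c n_def m_def k_def by simp
qed

lemma finite_LR_coeff: "finite {\<sigma>. LR_coeff \<alpha> \<beta> \<sigma> \<noteq> 0}"
proof -
  obtain n \<rho> \<theta> where "\<And>\<sigma>. LR_coeff \<alpha> \<beta> \<sigma> = (if contained \<sigma> \<theta> then lr n \<rho> \<sigma> \<theta> else 0)"
    using ex_schur_product[of \<alpha> \<beta>] by metis
  then show ?thesis by (intro finite_subset[OF _ finite_contained[of \<theta>]]) (auto split: if_splits)
qed

text \<open>The disconnected shape argument for an arbitrary series: the structure constants depend
  neither on the series nor on the ring. This is used both in \<Lambda> and in its tensor
  square.\<close>

theorem schur_det_product:
  fixes H :: "'r::comm_ring_1 fps"
  assumes "fps_nth H 0 = 1"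
  shows "schur_det H \<alpha> * schur_det H \<beta> =
    (\<Sum>\<sigma> | LR_coeff \<alpha> \<beta> \<sigma> \<noteq> 0. of_int (LR_coeff \<alpha> \<beta> \<sigma>) * schur_det H \<sigma>)"
proof -
  obtain n \<rho> \<theta> where *:
    "\<And>\<sigma>. LR_coeff \<alpha> \<beta> \<sigma> = (if contained \<sigma> \<theta> then lr n \<rho> \<sigma> \<theta> else 0)"
    "length (parts \<theta>) \<le> n" "length (parts \<rho>) \<le> n" "n = length (parts \<alpha>) + length (parts \<beta>)"
    "\<And>i. part \<theta> (Suc i) = (if i < length (parts \<alpha>) then part \<alpha> (Suc i) + part \<beta> (Suc 0)
       else part \<beta> (Suc (i - length (parts \<alpha>))))"
    "\<And>i. part \<rho> (Suc i) = (if i < length (parts \<alpha>) then part \<beta> (Suc 0) else 0)"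
    by (rule ex_schur_product[of \<alpha> \<beta>]) (rule that)
  have "schur_det H \<alpha> * schur_det H \<beta> = minor n (toeplitz H) \<theta> \<rho>"
    using schur_det_product_skew[OF assms refl refl *(5,6)] *(4) by simp
  also have "\<dots> = (\<Sum>\<sigma> | contained \<sigma> \<theta>. of_int (lr n \<rho> \<sigma> \<theta>) * schur_det H \<sigma>)"
    using assms *(2,3) by (rule skew_schur_expansion)
  also have "\<dots> = (\<Sum>\<sigma> | LR_coeff \<alpha> \<beta> \<sigma> \<noteq> 0. of_int (LR_coeff \<alpha> \<beta> \<sigma>) * schur_det H \<sigma>)"
    by (rule sum.mono_neutral_cong_right) (auto simp: *(1) split: if_splits)
  finally show ?thesis .
qed

text \<open>So far \<open>LR_coeff\<close> is known as \<open>lr\<close> for one special shape only.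
  Expanding s_\<alpha> s_\<beta> in n variables and reading the coefficient at \<gamma> + \<delta>
  identifies the two for all shapes within n rows.\<close>

lemma lr_eq_LR_coeff:
  assumes "length (parts \<alpha>) \<le> n" "length (parts \<gamma>) \<le> n"
  shows "lr n \<alpha> \<beta> \<gamma> = LR_coeff \<alpha> \<beta> \<gamma>"
proof -
  define c where "c = Abs_poly_mapping (LR_coeff \<alpha> \<beta>)"
  have c: "Poly_Mapping.lookup c = LR_coeff \<alpha> \<beta>"
    unfolding c_def by (rule lookup_Abs_poly_mapping) (rule finite_LR_coeff)
  have keys: "Poly_Mapping.keys c = {\<sigma>. LR_coeff \<alpha> \<beta> \<sigma> \<noteq> 0}"
    by (auto simp: in_keys_iff c)
  have "alt n (pos n \<alpha>) * schur_det (eta n xv) \<beta> = vandermonde n * (schur_poly n \<alpha> * schur_poly n \<beta>)"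
    using assms(1) by (simp add: alt_schur_det schur_poly_eq vandermonde_eq_alt mult_ac)
  also have "schur_poly n \<alpha> * schur_poly n \<beta> = (\<Sum>\<gamma>\<in>Poly_Mapping.keys c.
      of_int (Poly_Mapping.lookup c \<gamma>) * schur_poly n \<gamma>)"
    by (simp add: schur_poly_eq schur_det_product keys c)
  finally show ?thesis
    using lookup_schur_combination[OF assms(2), of c] by (simp add: lr_def c)
qed

lemma LR_coeff_contained:
  assumes "LR_coeff \<alpha> \<beta> \<gamma> \<noteq> 0"
  shows "contained \<alpha> \<gamma>" "contained \<beta> \<gamma>"
proof -
  define n where "n = length (parts \<alpha>) + length (parts \<beta>) + length (parts \<gamma>)"
  have "lr n \<alpha> \<beta> \<gamma> \<noteq> 0" using assms by (subst lr_eq_LR_coeff) (simp_all add: n_def)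
  then show "contained \<alpha> \<gamma>" "contained \<beta> \<gamma>"
    using lr_contained[of n \<alpha> \<beta> \<gamma>] by (auto simp: n_def)
qed

text \<open>Combines \<open>schur_det_mult\<close> with the expansion of skew determinants. For two
  commuting copies of one series this is the classical coproduct of Schur functions.\<close>

theorem schur_det_coproduct:
  fixes G H :: "'r::comm_ring_1 fps"
  assumes "fps_nth G 0 = 1" "fps_nth H 0 = 1"
  shows "schur_det (G * H) \<gamma> = (\<Sum>\<alpha> | contained \<alpha> \<gamma>. \<Sum>\<beta> | contained \<beta> \<gamma>.
    of_int (LR_coeff \<beta> \<alpha> \<gamma>) * schur_det G \<alpha> * schur_det H \<beta>)"
proof -
  define n where "n = length (parts \<gamma>)"
  have "schur_det (G * H) \<gamma> = (\<Sum>\<beta> | contained \<beta> \<gamma>. minor n (toeplitz G) \<gamma> \<beta> * schur_det H \<beta>)"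
    using assms by (rule schur_det_mult) (simp add: n_def)
  also have "\<dots> = (\<Sum>\<beta> | contained \<beta> \<gamma>. \<Sum>\<alpha> | contained \<alpha> \<gamma>.
      of_int (LR_coeff \<beta> \<alpha> \<gamma>) * schur_det G \<alpha> * schur_det H \<beta>)"
  proof (intro sum.cong refl)
    fix \<beta> assume "\<beta> \<in> {\<beta>. contained \<beta> \<gamma>}"
    then have len: "length (parts \<beta>) \<le> n" using contained_length by (simp add: n_def)
    have "minor n (toeplitz G) \<gamma> \<beta> = (\<Sum>\<alpha> | contained \<alpha> \<gamma>. of_int (lr n \<beta> \<alpha> \<gamma>) * schur_det G \<alpha>)"
      using assms(1) len by (intro skew_schur_expansion) (simp_all add: n_def)
    then show "minor n (toeplitz G) \<gamma> \<beta> * schur_det H \<beta> = (\<Sum>\<alpha> | contained \<alpha> \<gamma>.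
        of_int (LR_coeff \<beta> \<alpha> \<gamma>) * schur_det G \<alpha> * schur_det H \<beta>)"
      using len by (simp add: lr_eq_LR_coeff n_def sum_distrib_right)
  qed
  finally show ?thesis by (subst sum.swap)
qed

section \<open>Flagged determinants as sums over tableaux\<close>

text \<open>
  A strictly decreasing sequence \<open>x\<^sub>0 > \<dots> > x\<^bsub>d-1\<^esub>\<close> stands for the Frobenius coordinates of a
  shape, and the box \<open>(i, p)\<close> lies in row \<open>i\<close> on the diagonal of content \<open>p\<close>, so that boxes in one
  column have equal \<open>i + p\<close>. The bound \<open>t\<close> restricts the entries; the recursions remove the entry \<open>t\<close>.
\<close>

definition strict_seq :: "nat \<Rightarrow> (nat \<Rightarrow> nat) \<Rightarrow> bool" where
  "strict_seq d x \<longleftrightarrow> (\<forall>i j. i < j \<longrightarrow> j < d \<longrightarrow> x j < x i)"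

definition boxes :: "nat \<Rightarrow> (nat \<Rightarrow> nat) \<Rightarrow> (nat \<Rightarrow> nat) \<Rightarrow> (nat \<times> nat) set" where
  "boxes d x y = {(i, p). i < d \<and> y i < p \<and> p \<le> x i}"

lemma boxes_iff: "(i, p) \<in> boxes d x y \<longleftrightarrow> i < d \<and> y i < p \<and> p \<le> x i"
  by (simp add: boxes_def)

lemma boxes_Sigma: "boxes d x y = (SIGMA i:{..<d}. {y i<..x i})"
  by (auto simp: boxes_def)

lemma finite_boxes [simp]: "finite (boxes d x y)"
  by (simp add: boxes_Sigma)

lemma strict_seq_gap: "strict_seq d x \<Longrightarrow> i \<le> j \<Longrightarrow> j < d \<Longrightarrow> x j + (j - i) \<le> x i"
proof (induction "j - i" arbitrary: j)
  case (Suc k)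
  then obtain l where l: "j = Suc l" "i \<le> l" by (cases j) auto
  have "x l + (l - i) \<le> x i" using Suc l by (intro Suc.hyps(1)) auto
  moreover have "x j < x l" using Suc.prems l unfolding strict_seq_def by blast
  ultimately show ?case using l by linarith
qed simp

lemma strict_seq_le: "strict_seq d x \<Longrightarrow> i \<le> j \<Longrightarrow> j < d \<Longrightarrow> x j \<le> x i"
  using strict_seq_gap[of d x i j] by simp

lemma dt_not_le:
  assumes "strict_seq d x" "strict_seq d y" "\<And>a b. a < b \<Longrightarrow> A a b = 0" "i < d" "x i < y i"
  shows "dt d (\<lambda>i j. A (x i) (y j)) = 0"
proof -
  have "x i' < y j" if "i \<le> i'" "i' < d" "j \<le> i" for i' j
    using strict_seq_gap[OF assms(1), of i i'] strict_seq_gap[OF assms(2), of j i] that assms(4,5) by linarith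
  then show ?thesis
    by (intro dt_zero_block[of "{i..<d}" _ "{..i}"]) (use assms(3,4) in auto)
qed

lemma dt_identity:
  assumes "strict_seq d x" "strict_seq d y"
  shows "dt d (\<lambda>i j. if x i = y j then 1 else 0) = (if \<forall>i<d. x i = y i then 1 else 0 :: 'a::comm_ring_1)"
proof (cases "\<forall>i<d. x i = y i")
  case True
  have "dt d (\<lambda>i j. if x i = y j then 1 else 0 :: 'a) = (\<Prod>i<d. if x i = y i then 1 else 0)"
  proof (rule dt_upper_triangular)
    fix i j assume "i < d" "j < i"
    then show "(if x i = y j then 1 else 0 :: 'a) = 0"
      using True assms(2) unfolding strict_seq_def by (metis less_irrefl)
  qed
  then show ?thesis using True by simp
next
  case False
  then obtain i where i: "i < d" "x i < y i \<or> y i < x i" by (auto simp: nat_neq_iff)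
  let ?A = "\<lambda>a b :: nat. if a = b then 1 else 0 :: 'a"
  have "dt d (\<lambda>i j. ?A (x i) (y j)) = 0"
    using i(2)
  proof
    assume "x i < y i"
    with assms i(1) show ?thesis by (intro dt_not_le) auto
  next
    assume "y i < x i"
    with assms i(1) have "dt d (\<lambda>i j. ?A (y i) (x j)) = 0" by (intro dt_not_le) auto
    moreover have "dt d (\<lambda>i j. ?A (x i) (y j)) = dt d (\<lambda>i j. ?A (y i) (x j))"
      by (subst dt_transpose[symmetric], rule dt_cong) auto
    ultimately show ?thesis by simp
  qed
  then show ?thesis using False by simp
qed

text \<open>This is e_(x-y) in the variables c_k with k < min x t, the minus sign turning
  \<open>linfac\<close> into 1 + c_k z; \<open>h_trunc\<close> is h_(x-y) with k < min (y + 1) t.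
  The number of variables depends on the row for e and on the column for h, and t caps the alphabet
  for the induction.\<close>

definition e_trunc :: "(nat \<Rightarrow> 'a::comm_ring_1) \<Rightarrow> nat \<Rightarrow> nat \<Rightarrow> nat \<Rightarrow> 'a" where
  "e_trunc c t x y = (if y \<le> x then fps_nth (\<Prod>k<min x t. linfac (- c k)) (x - y) else 0)"

definition h_trunc :: "(nat \<Rightarrow> 'a::comm_ring_1) \<Rightarrow> nat \<Rightarrow> nat \<Rightarrow> nat \<Rightarrow> 'a" where
  "h_trunc c t x y = (if y \<le> x then fps_nth (\<Prod>k<min (Suc y) t. geo (c k)) (x - y) else 0)"

text \<open>The last condition is the flag: row i of the determinant has only the variables c_k with
  k < \<open>x i\<close>. In \<open>h_fillings\<close> the columns carry the variables, and the flag
  is k \<le> \<open>y i\<close>.\<close>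

definition e_fillings :: "nat \<Rightarrow> (nat \<Rightarrow> nat) \<Rightarrow> (nat \<Rightarrow> nat) \<Rightarrow> nat \<Rightarrow> (nat \<times> nat \<Rightarrow> nat) set" where
  "e_fillings d x y t = {f \<in> boxes d x y \<rightarrow>\<^sub>E {..<t}.
     (\<forall>i p p'. p < p' \<and> (i, p) \<in> boxes d x y \<and> (i, p') \<in> boxes d x y \<longrightarrow> f (i, p) < f (i, p')) \<and>
     (\<forall>i i' p p'. i < i' \<and> i + p = i' + p' \<and> (i, p) \<in> boxes d x y \<and> (i', p') \<in> boxes d x y
        \<longrightarrow> f (i, p) \<le> f (i', p')) \<and>
     (\<forall>i p. (i, p) \<in> boxes d x y \<longrightarrow> f (i, p) < x i)}"

definition h_fillings :: "nat \<Rightarrow> (nat \<Rightarrow> nat) \<Rightarrow> (nat \<Rightarrow> nat) \<Rightarrow> nat \<Rightarrow> (nat \<times> nat \<Rightarrow> nat) set" where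
  "h_fillings d x y t = {f \<in> boxes d x y \<rightarrow>\<^sub>E {..<t}.
     (\<forall>i p p'. p < p' \<and> (i, p) \<in> boxes d x y \<and> (i, p') \<in> boxes d x y \<longrightarrow> f (i, p') \<le> f (i, p)) \<and>
     (\<forall>i i' p p'. i < i' \<and> i + p = i' + p' \<and> (i, p) \<in> boxes d x y \<and> (i', p') \<in> boxes d x y
        \<longrightarrow> f (i', p') < f (i, p)) \<and>
     (\<forall>i p. (i, p) \<in> boxes d x y \<longrightarrow> f (i, p) \<le> y i)}"

definition weight :: "(nat \<Rightarrow> 'a::comm_ring_1) \<Rightarrow> (nat \<times> nat) set \<Rightarrow> (nat \<times> nat \<Rightarrow> nat) \<Rightarrow> 'a" where
  "weight c B f = (\<Prod>b\<in>B. c (f b))"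

lemma finite_fillings [simp]: "finite (e_fillings d x y t)" "finite (h_fillings d x y t)"
proof -
  have "finite (boxes d x y \<rightarrow>\<^sub>E {..<t})" by (intro finite_PiE) auto
  then show "finite (e_fillings d x y t)" "finite (h_fillings d x y t)"
    by (auto simp: e_fillings_def h_fillings_def elim!: finite_subset[rotated])
qed

text \<open>The factor 1 + c_t z is split off: the new variable occurs at most once and lowers the
  row index x by 1.\<close>

lemma e_trunc_Suc: "e_trunc c (Suc t) x y = e_trunc c t x y + (if t < x then c t * e_trunc c t (x - 1) y else 0)"
proof (cases "t < x \<and> y \<le> x")
  case True
  let ?F = "\<Prod>k<t. linfac (- c k)"
  have "min x (Suc t) = Suc t" "min x t = t" "min (x - 1) t = t" using True by auto
  then have "e_trunc c (Suc t) x y = fps_nth (linfac (- c t) * ?F) (x - y)" "e_trunc c t x y = fps_nth ?F (x - y)"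
    "e_trunc c t (x - 1) y = (if y \<le> x - 1 then fps_nth ?F (x - 1 - y) else 0)"
    using True by (simp_all add: e_trunc_def mult.commute)
  then show ?thesis using True by (auto simp: linfac_nth)
next
  case False
  then show ?thesis by (auto simp: e_trunc_def min_def not_less less_Suc_eq le_Suc_eq)
qed

lemma geo_mult_nth: "fps_nth (geo x * F) r = (\<Sum>k\<le>r. x ^ k * fps_nth F (r - k))"
  by (simp add: fps_mult_nth geo_def atLeast0AtMost)

text \<open>The geometric series in c_t spreads over the new column indices q \<ge> y. The recursion
  for e moves rows and this one moves columns, hence the different treatment of the two
  determinants.\<close>

lemma h_trunc_Suc:
  assumes "t \<le> y"
  shows "h_trunc c (Suc t) x y = (\<Sum>q\<in>{y..x}. c t ^ (q - y) * h_trunc c t x q)"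
proof (cases "y \<le> x")
  case True
  let ?F = "\<Prod>k<t. geo (c k)"
  have "h_trunc c (Suc t) x y = fps_nth (geo (c t) * ?F) (x - y)"
    using True assms by (simp add: h_trunc_def min_absorb2 mult.commute)
  also have "\<dots> = (\<Sum>k\<le>x - y. c t ^ k * fps_nth ?F (x - y - k))" by (rule geo_mult_nth)
  also have "\<dots> = (\<Sum>q\<in>{y..x}. c t ^ (q - y) * h_trunc c t x q)"
    by (rule sum.reindex_bij_witness[of _ "\<lambda>q. q - y" "\<lambda>k. k + y"])
      (use True assms in \<open>auto simp: h_trunc_def min_absorb2 add.commute\<close>)
  finally show ?thesis .
qed (simp add: h_trunc_def)

lemma h_trunc_stable: "y < t \<Longrightarrow> h_trunc c (Suc t) x y = h_trunc c t x y"
  by (simp add: h_trunc_def min_absorb1)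

section \<open>Elementary case: removing the largest entry along vertical strips\<close>

definition lower :: "(nat \<Rightarrow> nat) \<Rightarrow> nat set \<Rightarrow> nat \<Rightarrow> nat" where
  "lower x I i = (if i \<in> I then x i - 1 else x i)"

text \<open>The set \<open>I\<close> collects the rows whose outermost box carries the entry t.
  Strictness of the lowered sequence says that a shape remains after the removal, and
  \<open>t < x i\<close> is the flag.\<close>

definition strips :: "nat \<Rightarrow> (nat \<Rightarrow> nat) \<Rightarrow> (nat \<Rightarrow> nat) \<Rightarrow> nat \<Rightarrow> nat set set" where
  "strips d x y t = {I. I \<subseteq> {..<d} \<and> (\<forall>i\<in>I. t < x i) \<and> strict_seq d (lower x I) \<and> (\<forall>i<d. y i \<le> lower x I i)}"

lemma finite_strips [simp]: "finite (strips d x y t)"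
  by (rule finite_subset[of _ "Pow {..<d}"]) (auto simp: strips_def)

lemma boxes_lower:
  assumes "I \<in> strips d x y t"
  shows "boxes d x y = boxes d (lower x I) y \<union> (\<lambda>i. (i, x i)) ` I"
    and "boxes d (lower x I) y \<inter> (\<lambda>i. (i, x i)) ` I = {}"
proof -
  have I: "i < d" "t < x i" "y i < x i" "lower x I i = x i - 1" if "i \<in> I" for i
  proof -
    show *: "i < d" "t < x i" "lower x I i = x i - 1" using assms that by (auto simp: strips_def lower_def)
    then have "y i \<le> x i - 1" using assms by (auto simp: strips_def)
    then show "y i < x i" using *(2) by linarith
  qed
  show "boxes d x y = boxes d (lower x I) y \<union> (\<lambda>i. (i, x i)) ` I"
  proof (intro equalityI subsetI)
    fix b assume b: "b \<in> boxes d x y"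
    obtain i p where [simp]: "b = (i, p)" by (cases b)
    have ip: "i < d" "y i < p" "p \<le> x i" using b by (auto simp: boxes_iff)
    show "b \<in> boxes d (lower x I) y \<union> (\<lambda>i. (i, x i)) ` I"
      using ip I(4)[of i] by (cases "i \<in> I"; cases "p = x i") (auto simp: boxes_iff lower_def)
  next
    fix b assume "b \<in> boxes d (lower x I) y \<union> (\<lambda>i. (i, x i)) ` I"
    then show "b \<in> boxes d x y"
      using I by (cases b) (auto simp: boxes_iff lower_def split: if_splits)
  qed
  show "boxes d (lower x I) y \<inter> (\<lambda>i. (i, x i)) ` I = {}"
    using I by (fastforce simp: boxes_iff)
qed

text \<open>Rows increase strictly, so the largest entry t can only stand in the outermost box of a
  row.\<close>

lemma e_fillings_remove:
  assumes x: "strict_seq d x" and y: "strict_seq d y" and le: "\<And>i. i < d \<Longrightarrow> y i \<le> x i"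
    and f: "f \<in> e_fillings d x y (Suc t)"
  defines "I \<equiv> {i. i < d \<and> y i < x i \<and> f (i, x i) = t}"
  shows "I \<in> strips d x y t" and "restrict f (boxes d (lower x I) y) \<in> e_fillings d (lower x I) y t"
proof -
  note f' = f[unfolded e_fillings_def, simplified]
  have lt: "f (i, p) < Suc t" if "(i, p) \<in> boxes d x y" for i p
    using f' that by (auto dest: PiE_mem)
  have row: "f (i, p) < f (i, p')" if "p < p'" "(i, p) \<in> boxes d x y" "(i, p') \<in> boxes d x y" for i p p'
    using f' that by blast
  have col: "f (i, p) \<le> f (i', p')"
    if "i < i'" "i + p = i' + p'" "(i, p) \<in> boxes d x y" "(i', p') \<in> boxes d x y" for i i' p p'
    using f' that by blast
  have flag: "f (i, p) < x i" if "(i, p) \<in> boxes d x y" for i p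
    using f' that by blast
  have I: "i < d" "y i < x i" "f (i, x i) = t" "(i, x i) \<in> boxes d x y" "lower x I i = x i - 1" "t < x i"
    if "i \<in> I" for i
  proof -
    show *: "i < d" "y i < x i" "f (i, x i) = t" "(i, x i) \<in> boxes d x y" "lower x I i = x i - 1"
      using that by (auto simp: I_def boxes_iff lower_def)
    show "t < x i" using flag[OF *(4)] *(3) by simp
  qed
  have strict: "strict_seq d (lower x I)"
    unfolding strict_seq_def
  proof (intro allI impI)
    fix i j assume ij: "i < j" "j < d"
    have xij: "x j < x i" and yij: "y j < y i" using x y ij unfolding strict_seq_def by blast+
    \<comment> \<open>Otherwise row i loses a box, j is the next row and keeps its outermost box,
      which lies directly below the removed one. Weak increase down the column forces the entry t
      there too, so row j would belong to \<open>I\<close>.\<close>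
    show "lower x I j < lower x I i"
    proof (rule ccontr)
      assume "\<not> lower x I j < lower x I i"
      then have iI: "i \<in> I" and jI: "j \<notin> I" and xeq: "x j = x i - 1"
        using xij I(6)[of j] by (auto simp: lower_def split: if_splits)
      have "x j + (j - i) \<le> x i" using strict_seq_gap[OF x] ij by simp
      then have j: "j = Suc i" using ij xij xeq by linarith
      have yj: "y j < x j" using I(2)[OF iI] yij xeq by linarith
      then have bj: "(j, x j) \<in> boxes d x y" using ij by (simp add: boxes_iff)
      have "t \<le> f (j, x j)" using col[of i j "x i" "x j"] iI I bj j xeq xij by simp
      then have "f (j, x j) = t" using lt[OF bj] by simp
      then show False using jI ij yj by (simp add: I_def)
    qed
  qed
  have "y i \<le> lower x I i" if "i < d" for i
    using I(2)[of i] le[OF that] by (auto simp: lower_def)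
  then show strip: "I \<in> strips d x y t"
    unfolding strips_def using I strict by auto
  have sub: "(i, p) \<in> boxes d x y" if "(i, p) \<in> boxes d (lower x I) y" for i p
    using that boxes_lower(1)[OF strip] by blast
  have small: "f (i, p) < t \<and> f (i, p) < lower x I i" if b: "(i, p) \<in> boxes d (lower x I) y" for i p
  proof (cases "i \<in> I")
    case True
    then have "p < x i" using b I(2)[OF True] I(5)[OF True] by (auto simp: boxes_iff)
    then have "f (i, p) < t" using row[OF _ sub[OF b] I(4)[OF True]] I(3)[OF True] by simp
    then show ?thesis using I(5,6)[OF True] by simp
  next
    case False
    have bi: "(i, x i) \<in> boxes d x y" using sub[OF b] by (auto simp: boxes_iff)
    then have "f (i, x i) \<noteq> t" using False by (auto simp: I_def boxes_iff)
    then have "f (i, x i) < t" using lt[OF bi] by simp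
    moreover have "f (i, p) \<le> f (i, x i)"
      using row[OF _ sub[OF b] bi] sub[OF b] by (cases "p = x i") (auto simp: boxes_iff)
    ultimately show ?thesis using flag[OF sub[OF b]] False by (simp add: lower_def)
  qed
  show "restrict f (boxes d (lower x I) y) \<in> e_fillings d (lower x I) y t"
    unfolding e_fillings_def using small sub row col by auto
qed

lemma e_fillings_insert:
  assumes x: "strict_seq d x" and I: "I \<in> strips d x y t" and g: "g \<in> e_fillings d (lower x I) y t"
  defines "f \<equiv> (\<lambda>b\<in>boxes d x y. if b \<in> boxes d (lower x I) y then g b else t)"
  shows "f \<in> e_fillings d x y (Suc t)"
    and "{i. i < d \<and> y i < x i \<and> f (i, x i) = t} = I"
    and "restrict f (boxes d (lower x I) y) = g"
proof -
  let ?w = "lower x I"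
  note g' = g[unfolded e_fillings_def, simplified]
  have lt: "g (i, p) < t" if "(i, p) \<in> boxes d ?w y" for i p
    using g' that by (auto dest: PiE_mem)
  have row: "g (i, p) < g (i, p')" if "p < p'" "(i, p) \<in> boxes d ?w y" "(i, p') \<in> boxes d ?w y" for i p p'
    using g' that by blast
  have col: "g (i, p) \<le> g (i', p')"
    if "i < i'" "i + p = i' + p'" "(i, p) \<in> boxes d ?w y" "(i', p') \<in> boxes d ?w y" for i i' p p'
    using g' that by blast
  have flag: "g (i, p) < ?w i" if "(i, p) \<in> boxes d ?w y" for i p
    using g' that by blast
  have w: "strict_seq d ?w" and It: "i < d \<and> t < x i" if "i \<in> I" for i
    using I that by (auto simp: strips_def)
  have wle: "?w i \<le> x i" for i by (simp add: lower_def)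
  have sub: "b \<in> boxes d x y" if "b \<in> boxes d ?w y" for b
    using that boxes_lower(1)[OF I] by blast
  have new: "i \<in> I \<and> p = x i \<and> ?w i = x i - 1" if "(i, p) \<in> boxes d x y" "(i, p) \<notin> boxes d ?w y" for i p
    using that boxes_lower(1)[OF I] by (auto simp: lower_def)
  have fg: "f (i, p) = (if (i, p) \<in> boxes d ?w y then g (i, p) else t)" if "(i, p) \<in> boxes d x y" for i p
    using that by (simp add: f_def)
  show "f \<in> e_fillings d x y (Suc t)"
    unfolding e_fillings_def mem_Collect_eq
  proof (intro conjI allI impI)
    show "f \<in> boxes d x y \<rightarrow>\<^sub>E {..<Suc t}"
      unfolding f_def using lt by (auto simp: less_SucI)
  next
    fix i p p' assume *: "p < p' \<and> (i, p) \<in> boxes d x y \<and> (i, p') \<in> boxes d x y"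
    show "f (i, p) < f (i, p')"
    proof (cases "(i, p') \<in> boxes d ?w y")
      case True
      then have "(i, p) \<in> boxes d ?w y" using * by (auto simp: boxes_iff)
      then show ?thesis using True * row by (simp add: fg)
    next
      case False
      then have "(i, p) \<in> boxes d ?w y" using * new[of i p'] by (auto simp: boxes_iff)
      then show ?thesis using False * lt by (simp add: fg)
    qed
  next
    fix i i' p p' assume *: "i < i' \<and> i + p = i' + p' \<and> (i, p) \<in> boxes d x y \<and> (i', p') \<in> boxes d x y"
    show "f (i, p) \<le> f (i', p')"
    proof (cases "(i', p') \<in> boxes d ?w y")
      case True
      \<comment> \<open>A newly added box cannot stand above an old one of the same column: the
        lowered sequence is strict, so its values in rows i and i' differ by at least i' -
        i.\<close>
      have "(i, p) \<in> boxes d ?w y"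
      proof (rule ccontr)
        assume "(i, p) \<notin> boxes d ?w y"
        then have n: "p = x i" "?w i = x i - 1" "i \<in> I" using new * by auto
        have "i' < d" using * by (auto simp: boxes_iff)
        then have "?w i' + (i' - i) \<le> x i - 1"
          using strict_seq_gap[OF w[OF n(3)], of i i'] * n(2) by simp
        moreover have "p' \<le> ?w i'" using True by (simp add: boxes_iff)
        moreover have "0 < x i" using It[OF n(3)] by simp
        ultimately show False using * n(1) by linarith
      qed
      then show ?thesis using True * col by (simp add: fg)
    next
      case False
      then show ?thesis using * lt[of i p] by (auto simp: fg less_imp_le)
    qed
  next
    fix i p assume *: "(i, p) \<in> boxes d x y"
    show "f (i, p) < x i"
      using * flag[of i p] wle[of i] new[OF *] It[of i] by (auto simp: fg)
  qed
  show "{i. i < d \<and> y i < x i \<and> f (i, x i) = t} = I"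
  proof (intro equalityI subsetI)
    fix i assume "i \<in> {i. i < d \<and> y i < x i \<and> f (i, x i) = t}"
    then have i: "(i, x i) \<in> boxes d x y" "f (i, x i) = t" by (auto simp: boxes_iff)
    then have "(i, x i) \<notin> boxes d ?w y" using lt[of i "x i"] by (auto simp: fg)
    then show "i \<in> I" using new[OF i(1)] by simp
  next
    fix i assume i: "i \<in> I"
    then have "(i, x i) \<in> boxes d x y" "(i, x i) \<notin> boxes d ?w y"
      using boxes_lower[OF I] by blast+
    then show "i \<in> {i. i < d \<and> y i < x i \<and> f (i, x i) = t}" by (simp add: fg) (simp add: boxes_iff)
  qed
  show "restrict f (boxes d ?w y) = g"
  proof
    fix b
    have ext: "g \<in> extensional (boxes d ?w y)" using g by (simp add: e_fillings_def PiE_def)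
    show "restrict f (boxes d ?w y) b = g b"
      by (cases "b \<in> boxes d ?w y") (simp_all add: f_def sub extensional_arb[OF ext])
  qed
qed

lemma e_fillings_determined:
  assumes "f \<in> e_fillings d x y (Suc t)" "strict_seq d x" "strict_seq d y" "\<And>i. i < d \<Longrightarrow> y i \<le> x i"
  defines "I \<equiv> {i. i < d \<and> y i < x i \<and> f (i, x i) = t}"
  shows "(\<lambda>b\<in>boxes d x y. if b \<in> boxes d (lower x I) y then restrict f (boxes d (lower x I) y) b else t) = f"
proof
  fix b
  have I: "I \<in> strips d x y t" unfolding I_def using assms(1-4) by (intro e_fillings_remove(1)) auto
  have ext: "f \<in> extensional (boxes d x y)" using assms(1) by (auto simp: e_fillings_def PiE_def)
  show "(\<lambda>b\<in>boxes d x y. if b \<in> boxes d (lower x I) y then restrict f (boxes d (lower x I) y) b else t) b = f b"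
  proof (cases "b \<in> boxes d x y")
    case True
    have "f b = t" if "b \<notin> boxes d (lower x I) y"
    proof -
      have "b \<in> (\<lambda>i. (i, x i)) ` I" using True that boxes_lower(1)[OF I] by blast
      then show ?thesis by (auto simp: I_def)
    qed
    then show ?thesis using True by simp
  next
    case False
    then show ?thesis by (simp add: extensional_arb[OF ext])
  qed
qed

lemma e_fillings_Suc:
  assumes x: "strict_seq d x" and y: "strict_seq d y" and le: "\<And>i. i < d \<Longrightarrow> y i \<le> x i"
  shows "(\<Sum>f\<in>e_fillings d x y (Suc t). weight c (boxes d x y) f) =
    (\<Sum>I\<in>strips d x y t. c t ^ card I *
       (\<Sum>g\<in>e_fillings d (lower x I) y t. weight c (boxes d (lower x I) y) g))"
proof -
  define J where "J f = {i. i < d \<and> y i < x i \<and> f (i, x i) = t}" for f :: "nat \<times> nat \<Rightarrow> nat"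
  define F where "F I g = (\<lambda>b\<in>boxes d x y. if b \<in> boxes d (lower x I) y then g b else t)"
    for I and g :: "nat \<times> nat \<Rightarrow> nat"
  have "(\<Sum>f\<in>e_fillings d x y (Suc t). weight c (boxes d x y) f) =
      (\<Sum>(I, g)\<in>(SIGMA I:strips d x y t. e_fillings d (lower x I) y t).
         c t ^ card I * weight c (boxes d (lower x I) y) g)"
  proof (rule sum.reindex_bij_witness[of _ "\<lambda>(I, g). F I g"
        "\<lambda>f. (J f, restrict f (boxes d (lower x (J f)) y))"], goal_cases)
    case (1 f)
    then show ?case using e_fillings_determined[OF _ x y le] by (simp add: F_def J_def)
  next
    case (2 f)
    then show ?case using e_fillings_remove[OF x y le] by (simp add: J_def)
  next
    case (3 q)
    then obtain I g where q: "q = (I, g)" "I \<in> strips d x y t" "g \<in> e_fillings d (lower x I) y t" by auto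
    have "J (F I g) = I" unfolding J_def F_def by (rule e_fillings_insert(2)[OF x q(2,3)])
    moreover have "restrict (F I g) (boxes d (lower x I) y) = g"
      unfolding F_def by (rule e_fillings_insert(3)[OF x q(2,3)])
    ultimately show ?case by (simp add: q(1))
  next
    case (4 q)
    then show ?case using e_fillings_insert(1)[OF x] by (auto simp: F_def)
  next
    case (5 f)
    then have I: "J f \<in> strips d x y t" using e_fillings_remove[OF x y le] by (simp add: J_def)
    have "finite (J f)" by (simp add: J_def)
    have "weight c (boxes d x y) f =
        weight c (boxes d (lower x (J f)) y) f * (\<Prod>b\<in>(\<lambda>i. (i, x i)) ` J f. c (f b))"
      unfolding weight_def boxes_lower(1)[OF I]
      by (rule prod.union_disjoint) (use boxes_lower(2)[OF I] \<open>finite (J f)\<close> in auto)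
    also have "(\<Prod>b\<in>(\<lambda>i. (i, x i)) ` J f. c (f b)) = (\<Prod>i\<in>J f. c t)"
      by (subst prod.reindex) (auto simp: inj_on_def J_def)
    finally show ?case by (simp add: weight_def mult.commute)
  qed
  also have "\<dots> = (\<Sum>I\<in>strips d x y t. c t ^ card I *
       (\<Sum>g\<in>e_fillings d (lower x I) y t. weight c (boxes d (lower x I) y) g))"
    by (subst sum.Sigma[symmetric]) (simp_all add: sum_distrib_left)
  finally show ?thesis .
qed

lemma dt_add_rows: "dt n (\<lambda>i j. f i j + g i j) = (\<Sum>I\<in>Pow {..<n}. dt n (\<lambda>i j. if i \<in> I then g i j else f i j))"
proof -
  have "(\<Prod>i<n. f i (p i) + g i (p i)) = (\<Sum>I\<in>Pow {..<n}. \<Prod>i<n. if i \<in> I then g i (p i) else f i (p i))" for p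
  proof -
    have "(\<Prod>i<n. g i (p i) + f i (p i)) =
        (\<Sum>I\<in>Pow {..<n}. (\<Prod>i\<in>I. g i (p i)) * (\<Prod>i\<in>{..<n} - I. f i (p i)))"
      by (rule prod_add) simp
    also have "\<dots> = (\<Sum>I\<in>Pow {..<n}. \<Prod>i<n. if i \<in> I then g i (p i) else f i (p i))"
    proof (intro sum.cong refl)
      fix I assume "I \<in> Pow {..<n}"
      then have "{..<n} \<inter> {i. i \<in> I} = I" "{..<n} \<inter> - {i. i \<in> I} = {..<n} - I" by auto
      then show "(\<Prod>i\<in>I. g i (p i)) * (\<Prod>i\<in>{..<n} - I. f i (p i)) =
          (\<Prod>i<n. if i \<in> I then g i (p i) else f i (p i))"
        by (simp add: prod.If_cases)
    qed
    finally show ?thesis by (simp add: add.commute)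
  qed
  then show ?thesis
    unfolding dt_leibniz by (subst sum.swap) (simp add: sum_distrib_left)
qed

text \<open>Induction on the alphabet. Multilinearity in the rows splits the recursion into a sum
  over the sets I of lowered rows. If lowering makes two rows equal the determinant vanishes, and if
  it falls below y the induction hypothesis gives 0; the surviving I are exactly the strips that a
  filling can lose.\<close>

theorem e_determinant:
  assumes "strict_seq d x" "strict_seq d y"
  shows "dt d (\<lambda>i j. e_trunc c t (x i) (y j)) =
    (if \<forall>i<d. y i \<le> x i then \<Sum>f\<in>e_fillings d x y t. weight c (boxes d x y) f else 0)"
  using assms
proof (induction t arbitrary: x)
  case 0
  have id: "e_trunc c 0 a b = (if a = b then 1 else 0)" for a b
    by (auto simp: e_trunc_def)
  show ?case
  proof (cases "\<forall>i<d. x i = y i")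
    case True
    then have "boxes d x y = {}" by (auto simp: boxes_def)
    then have "e_fillings d x y 0 = {\<lambda>_. undefined}" by (simp add: e_fillings_def)
    then show ?thesis using True \<open>boxes d x y = {}\<close> dt_identity[OF 0] by (simp add: id weight_def)
  next
    case False
    have "e_fillings d x y 0 = {}" if "\<forall>i<d. y i \<le> x i"
    proof -
      from that False obtain i where "i < d" "y i < x i" by (metis le_neq_implies_less)
      then have b: "(i, x i) \<in> boxes d x y" by (simp add: boxes_iff)
      have "f (i, x i) < 0" if "f \<in> e_fillings d x y 0" for f
        using PiE_mem[OF _ b, of f "\<lambda>_. {..<0}"] that by (simp add: e_fillings_def)
      then show ?thesis by auto
    qed
    then have "(if \<forall>i<d. y i \<le> x i then \<Sum>f\<in>e_fillings d x y 0. weight c (boxes d x y) f else 0) = 0"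
      by simp
    then show ?thesis using dt_identity[OF 0] unfolding id by (simp only: if_not_P[OF False])
  qed
next
  case (Suc t)
  show ?case
  proof (cases "\<forall>i<d. y i \<le> x i")
    case False
    then obtain i where "i < d" "x i < y i" by (auto simp: not_le)
    then show ?thesis using False Suc.prems by (subst dt_not_le[of d x y _ i]) (auto simp: e_trunc_def)
  next
    case True
    let ?D = "\<lambda>x. dt d (\<lambda>i j. e_trunc c t (x i) (y j))"
    have step: "dt d (\<lambda>i j. if i \<in> I then (if t < x i then c t * e_trunc c t (x i - 1) (y j) else 0)
        else e_trunc c t (x i) (y j)) =
        (if I \<in> strips d x y t then c t ^ card I * ?D (lower x I) else 0)" if "I \<subseteq> {..<d}" for I
    proof (cases "\<forall>i\<in>I. t < x i")
      case False
      then obtain i where "i \<in> I" "\<not> t < x i" by blast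
      then show ?thesis
        using that by (subst dt_zero_block[of "{i}" d "{..<d}"]) (auto simp: strips_def)
    next
      case up: True
      have "dt d (\<lambda>i j. if i \<in> I then (if t < x i then c t * e_trunc c t (x i - 1) (y j) else 0)
          else e_trunc c t (x i) (y j)) =
          dt d (\<lambda>i j. (if i \<in> I then c t else 1) * e_trunc c t (lower x I i) (y j))"
        using up by (intro dt_cong) (auto simp: lower_def)
      also have "\<dots> = (\<Prod>i<d. if i \<in> I then c t else 1) * ?D (lower x I)"
        by (rule dt_scale_rows)
      also have "(\<Prod>i<d. if i \<in> I then c t else 1) = c t ^ card I"
        using that by (simp add: prod.If_cases Int_absorb1)
      finally have eq: "dt d (\<lambda>i j. if i \<in> I then (if t < x i then c t * e_trunc c t (x i - 1) (y j) else 0)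
          else e_trunc c t (x i) (y j)) = c t ^ card I * ?D (lower x I)" .
      show ?thesis
      proof (cases "strict_seq d (lower x I)")
        case strict: True
        show ?thesis
        proof (cases "\<forall>i<d. y i \<le> lower x I i")
          case True
          then show ?thesis using eq up strict that by (simp add: strips_def)
        next
          case False
          then show ?thesis using eq Suc.IH[OF strict Suc.prems(2)] by (auto simp: strips_def)
        qed
      next
        case False
        then obtain i j where ij: "i < j" "j < d" "lower x I i \<le> lower x I j"
          by (auto simp: strict_seq_def not_less)
        moreover have "x j < x i" using Suc.prems(1) ij unfolding strict_seq_def by blast
        ultimately have "lower x I i = lower x I j" by (auto simp: lower_def split: if_splits)
        then have "?D (lower x I) = 0" using ij by (intro dt_identical_rows[of i d j]) auto
        then show ?thesis using eq False by (simp add: strips_def)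
      qed
    qed
    have "dt d (\<lambda>i j. e_trunc c (Suc t) (x i) (y j)) =
        (\<Sum>I\<in>Pow {..<d}. if I \<in> strips d x y t then c t ^ card I * ?D (lower x I) else 0)"
      unfolding e_trunc_Suc dt_add_rows by (intro sum.cong refl step) simp
    also have "\<dots> = (\<Sum>I\<in>strips d x y t. c t ^ card I * ?D (lower x I))"
      by (rule sum.mono_neutral_cong_right) (auto simp: strips_def)
    also have "\<dots> = (\<Sum>I\<in>strips d x y t. c t ^ card I *
        (\<Sum>g\<in>e_fillings d (lower x I) y t. weight c (boxes d (lower x I) y) g))"
      by (intro sum.cong refl, subst Suc.IH) (use Suc.prems in \<open>auto simp: strips_def\<close>)
    also have "\<dots> = (\<Sum>f\<in>e_fillings d x y (Suc t). weight c (boxes d x y) f)"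
      by (rule e_fillings_Suc[symmetric]) (use Suc.prems True in auto)
    finally show ?thesis using True by simp
  qed
qed


section \<open>Complete case: removing the largest entry along horizontal strips\<close>

text \<open>The possible inner ends of row j after the boxes with entry t are removed. For
  \<open>y j < t\<close> the flag excludes t from the row; otherwise the end stays below
  \<open>y (j - 1)\<close>, because columns are strict. \<open>M\<close> is an artificial bound for
  the top row.\<close>

definition fills :: "nat \<Rightarrow> (nat \<Rightarrow> nat) \<Rightarrow> nat \<Rightarrow> nat \<Rightarrow> nat set" where
  "fills M y t j = (if y j < t then {y j} else {y j..<(if j = 0 then M else y (j - 1))})"

lemma fills_less:
  assumes "w \<in> PiE {..<d} (fills M y t)" "strict_seq d y" "i < j" "j < d"
  shows "w j < y i"
proof -
  have "w j \<in> fills M y t j" using assms by (auto dest: PiE_mem)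
  moreover have "y j < y i" using assms(2-4) unfolding strict_seq_def by blast
  moreover have "y (j - 1) \<le> y i" by (rule strict_seq_le[OF assms(2)]) (use assms(3,4) in auto)
  ultimately show ?thesis using assms(3) by (auto simp: fills_def split: if_splits)
qed

lemma fills_ge: "w \<in> PiE {..<d} (fills M y t) \<Longrightarrow> i < d \<Longrightarrow> y i \<le> w i"
  by (drule PiE_mem[of _ _ _ i]) (auto simp: fills_def split: if_splits)

lemma fills_small: "w \<in> PiE {..<d} (fills M y t) \<Longrightarrow> i < d \<Longrightarrow> y i < t \<Longrightarrow> w i = y i"
  by (drule PiE_mem[of _ _ _ i]) (auto simp: fills_def)

lemma fills_strict:
  assumes "w \<in> PiE {..<d} (fills M y t)" "strict_seq d y"
  shows "strict_seq d w"
  unfolding strict_seq_def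
proof (intro allI impI)
  fix i j assume ij: "i < j" "j < d"
  have "w j < y i" by (rule fills_less[OF assms ij])
  also have "y i \<le> w i" by (rule fills_ge[OF assms(1)]) (use ij in simp)
  finally show "w j < w i" .
qed

lemma finite_fills [simp]: "finite (PiE {..<d} (fills M y t))"
  by (rule finite_PiE) (auto simp: fills_def)

lemma downward_closed_interval:
  fixes A :: "nat set"
  assumes "A \<subseteq> {y<..x}" "\<And>p q. p \<in> A \<Longrightarrow> y < q \<Longrightarrow> q \<le> p \<Longrightarrow> q \<in> A"
  shows "A = {y<..y + card A}"
proof (cases "A = {}")
  case False
  have fin: "finite A" using assms(1) by (rule finite_subset) simp
  define m where "m = Max A"
  have m: "m \<in> A" "\<And>a. a \<in> A \<Longrightarrow> a \<le> m" using False fin by (auto simp: m_def)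
  have A: "A = {y<..m}"
  proof (intro equalityI subsetI)
    fix p assume "p \<in> A"
    then show "p \<in> {y<..m}" using assms(1) m(2)[of p] by auto
  next
    fix q assume "q \<in> {y<..m}"
    then show "q \<in> A" using assms(2)[OF m(1), of q] by simp
  qed
  then have "card A = card {y<..m}" by (rule arg_cong)
  moreover have "y < m" using assms(1) m(1) by auto
  ultimately have "y + card A = m" by simp
  then show ?thesis by (simp only: A)
qed simp

text \<open>Rows decrease weakly, so the entries t fill an interval that starts right after
  \<open>y i\<close>; its end is the new inner boundary. The restriction to \<open>{..<d}\<close>
  makes the result an element of the \<open>PiE\<close> set.\<close>

definition height :: "nat \<Rightarrow> (nat \<Rightarrow> nat) \<Rightarrow> (nat \<Rightarrow> nat) \<Rightarrow> nat \<Rightarrow> (nat \<times> nat \<Rightarrow> nat) \<Rightarrow> nat \<Rightarrow> nat" where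
  "height d x y t f = (\<lambda>i\<in>{..<d}. y i + card {p. (i, p) \<in> boxes d x y \<and> f (i, p) = t})"

lemma h_fillings_remove:
  assumes x: "strict_seq d x" and y: "strict_seq d y" and le: "\<And>i. i < d \<Longrightarrow> y i \<le> x i"
    and M: "\<And>i. i < d \<Longrightarrow> x i < M" and f: "f \<in> h_fillings d x y (Suc t)"
  defines "w \<equiv> height d x y t f"
  shows "w \<in> PiE {..<d} (fills M y t)" and "\<forall>i<d. w i \<le> x i"
    and "restrict f (boxes d x w) \<in> h_fillings d x w t"
    and "\<And>i p. (i, p) \<in> boxes d x y \<Longrightarrow> f (i, p) = t \<longleftrightarrow> p \<le> w i"
proof -
  note f' = f[unfolded h_fillings_def, simplified]
  have lt: "f (i, p) < Suc t" if "(i, p) \<in> boxes d x y" for i p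
    using f' that by (auto dest: PiE_mem)
  have row: "f (i, p') \<le> f (i, p)" if "p < p'" "(i, p) \<in> boxes d x y" "(i, p') \<in> boxes d x y" for i p p'
    using f' that by blast
  have col: "f (i', p') < f (i, p)"
    if "i < i'" "i + p = i' + p'" "(i, p) \<in> boxes d x y" "(i', p') \<in> boxes d x y" for i i' p p'
    using f' that by blast
  have flag: "f (i, p) \<le> y i" if "(i, p) \<in> boxes d x y" for i p
    using f' that by blast
  have interval: "{p. (i, p) \<in> boxes d x y \<and> f (i, p) = t} = {y i<..w i}" if "i < d" for i
  proof -
    let ?A = "{p. (i, p) \<in> boxes d x y \<and> f (i, p) = t}"
    have "?A = {y i<..y i + card ?A}"
    proof (rule downward_closed_interval[of _ _ "x i"])
      show "?A \<subseteq> {y i<..x i}" by (auto simp: boxes_iff)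
      fix p q assume pq: "p \<in> ?A" "y i < q" "q \<le> p"
      then have b: "(i, q) \<in> boxes d x y" "(i, p) \<in> boxes d x y" by (auto simp: boxes_iff)
      have "t \<le> f (i, q)" using row[OF _ b] pq by (cases "q = p") auto
      then show "q \<in> ?A" using lt[OF b(1)] b(1) by simp
    qed
    then show ?thesis using that by (simp add: w_def height_def)
  qed
  show top: "f (i, p) = t \<longleftrightarrow> p \<le> w i" if b: "(i, p) \<in> boxes d x y" for i p
  proof -
    have "i < d" "y i < p" using b by (auto simp: boxes_iff)
    then show ?thesis using interval[of i] b by (auto simp: set_eq_iff)
  qed
  have wge: "y i \<le> w i" if "i < d" for i using that by (simp add: w_def height_def)
  show wle: "\<forall>i<d. w i \<le> x i"
  proof (intro allI impI)
    fix i assume i: "i < d"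
    show "w i \<le> x i"
    proof (cases "y i = w i")
      case False
      then have "w i \<in> {y i<..w i}" using wge[OF i] by simp
      then show ?thesis unfolding interval[OF i, symmetric] by (simp add: boxes_iff)
    qed (use le[OF i] in simp)
  qed
  have box: "(i, w i) \<in> boxes d x y \<and> f (i, w i) = t" if "i < d" "w i \<noteq> y i" for i
  proof -
    have "w i \<in> {y i<..w i}" using wge[OF that(1)] that(2) by simp
    then show ?thesis unfolding interval[OF that(1), symmetric] by simp
  qed
  show "w \<in> PiE {..<d} (fills M y t)"
  proof (rule PiE_I)
    fix i assume "i \<in> {..<d}"
    then have i: "i < d" by simp
    show "w i \<in> fills M y t i"
    proof (cases "w i = y i")
      case True
      show ?thesis
      proof (cases i)
        case 0
        then show ?thesis using True le[OF i] M[OF i] by (simp add: fills_def)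
      next
        case (Suc k)
        then have "y i < y k" using y i unfolding strict_seq_def by blast
        then show ?thesis using True Suc by (simp add: fills_def)
      qed
    next
      case False
      note b = box[OF i False]
      have t: "t \<le> y i" using flag b by fastforce
      show ?thesis
      proof (cases i)
        case 0
        then show ?thesis using t wge[OF i] wle M[OF i] i by (auto simp: fills_def intro: le_less_trans)
      next
        case (Suc k)
        \<comment> \<open>Otherwise the box of row k directly above the last t of row i belongs to
          the shape, and strictness down the column would give it an entry larger than t.\<close>
        have "w i < y k"
        proof (rule ccontr)
          assume n: "\<not> w i < y k"
          have "x i < x k" using x i Suc unfolding strict_seq_def by blast
          moreover have "w i \<le> x i" using b by (simp add: boxes_iff)
          ultimately have bk: "(k, Suc (w i)) \<in> boxes d x y" using n i Suc by (simp add: boxes_iff)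
          have "t < f (k, Suc (w i))" using col[OF _ _ bk, of i "w i"] b Suc by simp
          then show False using lt[OF bk] by simp
        qed
        then show ?thesis using t wge[OF i] Suc by (simp add: fills_def)
      qed
    qed
  qed (simp add: w_def height_def)
  have sub: "(i, p) \<in> boxes d x y" if "(i, p) \<in> boxes d x w" for i p
    using that wge[of i] by (auto simp: boxes_iff)
  have small: "f (i, p) < t \<and> f (i, p) \<le> w i" if b: "(i, p) \<in> boxes d x w" for i p
  proof -
    have "f (i, p) \<noteq> t" using top[OF sub[OF b]] b by (simp add: boxes_iff)
    then show ?thesis using lt[OF sub[OF b]] flag[OF sub[OF b]] wge[of i] b by (auto simp: boxes_iff)
  qed
  show "restrict f (boxes d x w) \<in> h_fillings d x w t"
    unfolding h_fillings_def using small sub row col by auto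
qed

lemma h_fillings_insert:
  assumes y: "strict_seq d y" and w: "w \<in> PiE {..<d} (fills M y t)" and wx: "\<forall>i<d. w i \<le> x i"
    and g: "g \<in> h_fillings d x w t"
  defines "f \<equiv> (\<lambda>b\<in>boxes d x y. if b \<in> boxes d x w then g b else t)"
  shows "f \<in> h_fillings d x y (Suc t)" and "height d x y t f = w" and "restrict f (boxes d x w) = g"
proof -
  note g' = g[unfolded h_fillings_def, simplified]
  have lt: "g (i, p) < t" if "(i, p) \<in> boxes d x w" for i p
    using g' that by (auto dest: PiE_mem)
  have row: "g (i, p') \<le> g (i, p)" if "p < p'" "(i, p) \<in> boxes d x w" "(i, p') \<in> boxes d x w" for i p p'
    using g' that by blast
  have col: "g (i', p') < g (i, p)"
    if "i < i'" "i + p = i' + p'" "(i, p) \<in> boxes d x w" "(i', p') \<in> boxes d x w" for i i' p p'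
    using g' that by blast
  have flag: "g (i, p) \<le> w i" if "(i, p) \<in> boxes d x w" for i p
    using g' that by blast
  have sub: "(i, p) \<in> boxes d x y" if "(i, p) \<in> boxes d x w" for i p
    using that fills_ge[OF w, of i] by (auto simp: boxes_iff)
  have old: "(i, p) \<in> boxes d x w \<longleftrightarrow> w i < p" if "(i, p) \<in> boxes d x y" for i p
    using that by (auto simp: boxes_iff)
  have fg: "f (i, p) = (if w i < p then g (i, p) else t)" if "(i, p) \<in> boxes d x y" for i p
    using that old[OF that] by (simp add: f_def)
  show "f \<in> h_fillings d x y (Suc t)"
    unfolding h_fillings_def mem_Collect_eq
  proof (intro conjI allI impI)
    show "f \<in> boxes d x y \<rightarrow>\<^sub>E {..<Suc t}"
      unfolding f_def using lt by (auto simp: less_SucI)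
  next
    fix i p p' assume *: "p < p' \<and> (i, p) \<in> boxes d x y \<and> (i, p') \<in> boxes d x y"
    show "f (i, p') \<le> f (i, p)"
    proof (cases "w i < p")
      case True
      then show ?thesis using * row old by (simp add: fg)
    next
      case False
      then show ?thesis using * lt[of i p'] old[of i p'] by (simp add: fg less_imp_le)
    qed
  next
    fix i i' p p' assume *: "i < i' \<and> i + p = i' + p' \<and> (i, p) \<in> boxes d x y \<and> (i', p') \<in> boxes d x y"
    have d: "i' < d" using * by (simp add: boxes_iff)
    have "w i' < p'"
    proof (rule ccontr)
      assume n: "\<not> w i' < p'"
      have "w i' < y (i' - 1)" using fills_less[OF w y, of "i' - 1" i'] * d by simp
      moreover have "y (i' - 1) + (i' - 1 - i) \<le> y i" by (rule strict_seq_gap[OF y]) (use * d in auto)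
      moreover have "y i < p" using * by (simp add: boxes_iff)
      ultimately show False using n * by linarith
    qed
    then have new: "f (i', p') = g (i', p')" "(i', p') \<in> boxes d x w" using * fg old by auto
    show "f (i', p') < f (i, p)"
    proof (cases "w i < p")
      case True
      then show ?thesis using * new col old by (simp add: fg)
    next
      case False
      then show ?thesis using * new lt by (simp add: fg)
    qed
  next
    fix i p assume *: "(i, p) \<in> boxes d x y"
    have i: "i < d" using * by (simp add: boxes_iff)
    show "f (i, p) \<le> y i"
    proof (cases "w i < p")
      case True
      then have b: "(i, p) \<in> boxes d x w" using old[OF *] by simp
      \<comment> \<open>The flag of g only bounds by \<open>w i\<close>. For \<open>y i < t\<close>
        the two bounds coincide; otherwise the entry is below t \<le> \<open>y i\<close>
        anyway.\<close>
      have "g (i, p) \<le> y i"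
        using flag[OF b] lt[OF b] fills_small[OF w i] by (cases "y i < t") auto
      then show ?thesis using True * by (simp add: fg)
    next
      case False
      then have "w i \<noteq> y i" using * by (auto simp: boxes_iff)
      then show ?thesis using fills_small[OF w i] * False by (auto simp: fg not_less[symmetric])
    qed
  qed
  have "{p. (i, p) \<in> boxes d x y \<and> f (i, p) = t} = {y i<..w i}" if i: "i < d" for i
  proof (intro equalityI subsetI)
    fix p assume "p \<in> {p. (i, p) \<in> boxes d x y \<and> f (i, p) = t}"
    then have p: "(i, p) \<in> boxes d x y" "f (i, p) = t" by auto
    then have "\<not> w i < p" using lt[of i p] old[OF p(1)] by (auto simp: fg)
    then show "p \<in> {y i<..w i}" using p(1) by (simp add: boxes_iff)
  next
    fix p assume p: "p \<in> {y i<..w i}"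
    then have "(i, p) \<in> boxes d x y" using i wx by (auto simp: boxes_iff intro: order_trans)
    then show "p \<in> {p. (i, p) \<in> boxes d x y \<and> f (i, p) = t}" using p by (simp add: fg)
  qed
  then show "height d x y t f = w"
    using fills_ge[OF w] PiE_arb[OF w] by (intro ext) (simp add: height_def restrict_def)
  show "restrict f (boxes d x w) = g"
  proof
    fix b
    have ext: "g \<in> extensional (boxes d x w)" using g by (simp add: h_fillings_def PiE_def)
    show "restrict f (boxes d x w) b = g b"
    proof (cases "b \<in> boxes d x w")
      case True
      then have "b \<in> boxes d x y" using sub by (cases b) auto
      then show ?thesis using True by (simp add: f_def)
    qed (simp add: extensional_arb[OF ext])
  qed
qed

lemma h_fillings_Suc:
  assumes x: "strict_seq d x" and y: "strict_seq d y" and le: "\<And>i. i < d \<Longrightarrow> y i \<le> x i"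
    and M: "\<And>i. i < d \<Longrightarrow> x i < M"
  shows "(\<Sum>f\<in>h_fillings d x y (Suc t). weight c (boxes d x y) f) =
    (\<Sum>w\<in>{w \<in> PiE {..<d} (fills M y t). \<forall>i<d. w i \<le> x i}. (\<Prod>i<d. c t ^ (w i - y i)) *
       (\<Sum>g\<in>h_fillings d x w t. weight c (boxes d x w) g))"
proof -
  let ?W = "{w \<in> PiE {..<d} (fills M y t). \<forall>i<d. w i \<le> x i}"
  define F where "F w g = (\<lambda>b\<in>boxes d x y. if b \<in> boxes d x w then g b else t)"
    for w :: "nat \<Rightarrow> nat" and g :: "nat \<times> nat \<Rightarrow> nat"
  note remove = h_fillings_remove[OF x y le M]
  have "(\<Sum>f\<in>h_fillings d x y (Suc t). weight c (boxes d x y) f) =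
      (\<Sum>(w, g)\<in>(SIGMA w:?W. h_fillings d x w t). (\<Prod>i<d. c t ^ (w i - y i)) * weight c (boxes d x w) g)"
  proof (rule sum.reindex_bij_witness[of _ "\<lambda>(w, g). F w g"
        "\<lambda>f. (height d x y t f, restrict f (boxes d x (height d x y t f)))"], goal_cases)
    case (1 f)
    let ?w = "height d x y t f"
    have ext: "f \<in> extensional (boxes d x y)" using 1 by (simp add: h_fillings_def PiE_def)
    have "F ?w (restrict f (boxes d x ?w)) b = f b" for b
    proof (cases "b \<in> boxes d x y")
      case True
      obtain i p where b: "b = (i, p)" by (cases b)
      have "f b = t" if "b \<notin> boxes d x ?w"
        using remove(4)[OF _ _ 1 True[unfolded b]] that True by (auto simp: b boxes_iff)
      then show ?thesis using True by (simp add: F_def)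
    qed (simp add: F_def extensional_arb[OF ext])
    then show ?case by auto
  next
    case (2 f)
    then show ?case using remove(1-3)[OF _ _ 2] by simp
  next
    case (3 q)
    then obtain w g where q: "q = (w, g)" "w \<in> PiE {..<d} (fills M y t)" "\<forall>i<d. w i \<le> x i"
      "g \<in> h_fillings d x w t" by auto
    have "height d x y t (F w g) = w" unfolding F_def by (rule h_fillings_insert(2)[OF y q(2-4)])
    moreover have "restrict (F w g) (boxes d x w) = g"
      unfolding F_def by (rule h_fillings_insert(3)[OF y q(2-4)])
    ultimately show ?case by (simp add: q(1))
  next
    case (4 q)
    then show ?case using h_fillings_insert(1)[OF y] by (auto simp: F_def)
  next
    case (5 f)
    let ?w = "height d x y t f"
    have w: "?w \<in> PiE {..<d} (fills M y t)" "\<forall>i<d. ?w i \<le> x i" using remove(1-2)[OF _ _ 5] by auto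
    have split: "boxes d x y = boxes d x ?w \<union> boxes d ?w y" "boxes d x ?w \<inter> boxes d ?w y = {}"
      using fills_ge[OF w(1)] w(2) by (auto simp: boxes_def intro: le_less_trans order_trans)
    have "weight c (boxes d x y) f = weight c (boxes d x ?w) f * (\<Prod>b\<in>boxes d ?w y. c (f b))"
      unfolding weight_def split(1) by (rule prod.union_disjoint) (use split(2) in auto)
    also have "(\<Prod>b\<in>boxes d ?w y. c (f b)) = (\<Prod>b\<in>boxes d ?w y. c t)"
    proof (intro prod.cong refl)
      fix b assume b: "b \<in> boxes d ?w y"
      obtain i p where [simp]: "b = (i, p)" by (cases b)
      have "(i, p) \<in> boxes d x y" "p \<le> ?w i" using b split(1) by (auto simp: boxes_iff)
      then have "f (i, p) = t" using remove(4)[OF _ _ 5, of i p] by simp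
      then show "c (f b) = c t" by simp
    qed
    also have "\<dots> = (\<Prod>i<d. c t ^ (?w i - y i))"
      by (simp add: boxes_Sigma power_sum)
    finally show ?case by (simp add: weight_def mult.commute)
  qed
  also have "\<dots> = (\<Sum>w\<in>?W. (\<Prod>i<d. c t ^ (w i - y i)) *
       (\<Sum>g\<in>h_fillings d x w t. weight c (boxes d x w) g))"
    by (subst sum.Sigma[symmetric]) (simp_all add: sum_distrib_left)
  finally show ?thesis .
qed

lemma dt_sum_cols:
  "dt n (\<lambda>i j. \<Sum>q\<in>Q j. a j q * F i q) =
    (\<Sum>w\<in>PiE {..<n} Q. (\<Prod>j<n. a j (w j)) * dt n (\<lambda>i j. F i (w j)))"
  if "\<And>j. j < n \<Longrightarrow> finite (Q j)"
proof -
  have "dt n (\<lambda>i j. \<Sum>q\<in>Q j. a j q * F i q) = dt n (\<lambda>j i. \<Sum>q\<in>Q j. a j q * F i q)"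
    by (rule dt_transpose)
  also have "\<dots> = (\<Sum>w\<in>PiE {..<n} Q. dt n (\<lambda>j i. a j (w j) * F i (w j)))"
  proof -
    have "(\<Prod>i<n. \<Sum>q\<in>Q i. a i q * F (p i) q) = (\<Sum>w\<in>PiE {..<n} Q. \<Prod>i<n. a i (w i) * F (p i) (w i))" for p
      by (rule prod_sum_PiE) (use that in auto)
    then show ?thesis unfolding dt_leibniz by (simp only: sum_distrib_left) (rule sum.swap)
  qed
  also have "\<dots> = (\<Sum>w\<in>PiE {..<n} Q. (\<Prod>j<n. a j (w j)) * dt n (\<lambda>i j. F i (w j)))"
    unfolding dt_scale_rows by (intro sum.cong refl arg_cong2[of _ _ _ _ "(*)"] dt_transpose)
  finally show ?thesis .
qed

text \<open>Induction on the alphabet with the columns varying. A plain expansion would let the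
  index q of column j run over everything from y_j on. The unitriangular column operation
  \<open>U\<close> subtracts c_t^(y_(j-1) - y_j) times column j - 1, which cuts the range to q <
  y_(j-1). Every resulting w is then strictly decreasing, and no terms have to cancel.\<close>

theorem h_determinant:
  assumes "strict_seq d x" "strict_seq d y"
  shows "dt d (\<lambda>i j. h_trunc c t (x i) (y j)) =
    (if \<forall>i<d. y i \<le> x i then \<Sum>f\<in>h_fillings d x y t. weight c (boxes d x y) f else 0)"
  using assms
proof (induction t arbitrary: y)
  case 0
  have id: "h_trunc c 0 a b = (if a = b then 1 else 0)" for a b
    by (auto simp: h_trunc_def)
  show ?case
  proof (cases "\<forall>i<d. x i = y i")
    case True
    then have "boxes d x y = {}" by (auto simp: boxes_def)
    then have "h_fillings d x y 0 = {\<lambda>_. undefined}" by (simp add: h_fillings_def)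
    then show ?thesis using True \<open>boxes d x y = {}\<close> dt_identity[OF 0] by (simp add: id weight_def)
  next
    case False
    have "h_fillings d x y 0 = {}" if "\<forall>i<d. y i \<le> x i"
    proof -
      from that False obtain i where "i < d" "y i < x i" by (metis le_neq_implies_less)
      then have b: "(i, x i) \<in> boxes d x y" by (simp add: boxes_iff)
      have "f (i, x i) < 0" if "f \<in> h_fillings d x y 0" for f
        using PiE_mem[OF _ b, of f "\<lambda>_. {..<0}"] that by (simp add: h_fillings_def)
      then show ?thesis by auto
    qed
    then have "(if \<forall>i<d. y i \<le> x i then \<Sum>f\<in>h_fillings d x y 0. weight c (boxes d x y) f else 0) = 0"
      by simp
    then show ?thesis using dt_identity[OF 0] unfolding id by (simp only: if_not_P[OF False])
  qed
next
  case (Suc t)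
  show ?case
  proof (cases "\<forall>i<d. y i \<le> x i")
    case False
    then obtain i where "i < d" "x i < y i" by (auto simp: not_le)
    then show ?thesis using False Suc.prems by (subst dt_not_le[of d x y _ i]) (auto simp: h_trunc_def)
  next
    case True
    define M where "M = Suc (x 0)"
    have M: "x i < M" if "i < d" for i
      using strict_seq_gap[OF Suc.prems(1), of 0 i] that by (simp add: M_def)
    let ?D = "\<lambda>w. dt d (\<lambda>i j. h_trunc c t (x i) (w j))"
    let ?Q = "fills M y t"
    define U where "U k j = (if k = j then 1 else if Suc k = j \<and> t \<le> y j then - (c t ^ (y k - y j)) else 0)"
      for k j
    have U: "dt d U = 1" by (subst dt_upper_triangular) (auto simp: U_def)
    have ydec: "y (Suc k) < y k" if "Suc k < d" for k
      using Suc.prems(2) that unfolding strict_seq_def by blast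
    have col: "(\<Sum>k<d. h_trunc c (Suc t) a (y k) * U k j) = (\<Sum>q\<in>?Q j. c t ^ (q - y j) * h_trunc c t a q)"
      if j: "j < d" and a: "a < M" for j a
    proof -
      have big: "h_trunc c (Suc t) a (y k) = (\<Sum>q\<in>{y k..<M}. c t ^ (q - y k) * h_trunc c t a q)" if "t \<le> y k" for k
        unfolding h_trunc_Suc[OF that] using a
        by (intro sum.mono_neutral_left) (auto simp: h_trunc_def)
      show ?thesis
      proof (cases j)
        case 0
        have "(\<Sum>k<d. h_trunc c (Suc t) a (y k) * U k j) = (\<Sum>k<d. if k = j then h_trunc c (Suc t) a (y k) else 0)"
          by (intro sum.cong) (auto simp: U_def 0)
        also have "\<dots> = h_trunc c (Suc t) a (y j)" using j by simp
        also have "\<dots> = (\<Sum>q\<in>?Q j. c t ^ (q - y j) * h_trunc c t a q)"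
          using big[of j] h_trunc_stable[of "y j" t c a] by (auto simp: fills_def 0)
        finally show ?thesis .
      next
        case (Suc l)
        have "(\<Sum>k<d. h_trunc c (Suc t) a (y k) * U k j) = (\<Sum>k<d. (if k = j then h_trunc c (Suc t) a (y k) else 0) +
            (if k = l then if t \<le> y j then - (c t ^ (y k - y j)) * h_trunc c (Suc t) a (y k) else 0 else 0))"
          by (intro sum.cong) (auto simp: U_def Suc)
        also have "\<dots> = h_trunc c (Suc t) a (y j) -
            (if t \<le> y j then c t ^ (y l - y j) * h_trunc c (Suc t) a (y l) else 0)"
          using j Suc by (simp add: sum.distrib)
        also have "\<dots> = (\<Sum>q\<in>?Q j. c t ^ (q - y j) * h_trunc c t a q)"
        proof (cases "t \<le> y j")
          case True
          have lt: "y j < y l" using ydec[of l] j Suc by simp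
          have "c t ^ (y l - y j) * h_trunc c (Suc t) a (y l) = (\<Sum>q\<in>{y l..<M}. c t ^ (q - y j) * h_trunc c t a q)"
            using big[of l] True lt
            by (auto simp: sum_distrib_left mult.assoc[symmetric] power_add[symmetric] intro!: sum.cong)
          moreover have "h_trunc c (Suc t) a (y j) = (\<Sum>q\<in>{y j..<M}. c t ^ (q - y j) * h_trunc c t a q)"
            by (rule big[OF True])
          moreover have "(\<Sum>q\<in>{y j..<M}. c t ^ (q - y j) * h_trunc c t a q) =
              (\<Sum>q\<in>{y j..<y l}. c t ^ (q - y j) * h_trunc c t a q) + (\<Sum>q\<in>{y l..<M}. c t ^ (q - y j) * h_trunc c t a q)"
            if "y l \<le> M" using lt that by (simp add: sum.atLeastLessThan_concat)
          moreover have "y l \<le> M" using \<open>\<forall>i<d. y i \<le> x i\<close> M[of l] j Suc by (meson Suc_lessD le_less_trans less_imp_le)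
          ultimately show ?thesis using True by (simp add: fills_def Suc)
        next
          case False
          then show ?thesis using h_trunc_stable[of "y j" t c a] by (simp add: fills_def)
        qed
        finally show ?thesis .
      qed
    qed
    have "dt d (\<lambda>i j. h_trunc c (Suc t) (x i) (y j)) = dt d (\<lambda>i j. \<Sum>k<d. h_trunc c (Suc t) (x i) (y k) * U k j)"
      unfolding dt_mult U by simp
    also have "\<dots> = dt d (\<lambda>i j. \<Sum>q\<in>?Q j. c t ^ (q - y j) * h_trunc c t (x i) q)"
      by (rule dt_cong) (simp add: col M)
    also have "\<dots> = (\<Sum>w\<in>PiE {..<d} ?Q. (\<Prod>j<d. c t ^ (w j - y j)) * ?D w)"
      by (rule dt_sum_cols) (simp add: fills_def)
    also have "\<dots> = (\<Sum>w\<in>{w \<in> PiE {..<d} ?Q. \<forall>i<d. w i \<le> x i}. (\<Prod>j<d. c t ^ (w j - y j)) *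
        (\<Sum>g\<in>h_fillings d x w t. weight c (boxes d x w) g))"
      using Suc.IH[OF Suc.prems(1) fills_strict[OF _ Suc.prems(2)]]
      by (intro sum.mono_neutral_cong_right) (auto split: if_splits)
    also have "\<dots> = (\<Sum>f\<in>h_fillings d x y (Suc t). weight c (boxes d x y) f)"
      by (rule h_fillings_Suc[symmetric]) (use Suc.prems True M in auto)
    finally show ?thesis using True by simp
  qed
qed

section \<open>Complete symmetric functions in \<open>\<Lambda>(x\<parallel>a)\<close>\<close>

lemma component_simps [simp]:
  "component (P + Q) n = component P n + component Q n"
  "component (P - Q) n = component P n - component Q n"
  "component (P * Q) n = component P n * component Q n"
  "component (- P) n = - component P n"
  "component 0 n = 0" "component 1 n = 1"
  "component (scale_Lambda c P) n = mconst c * component P n"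
  by (simp_all add: plus_Lambda.rep_eq minus_Lambda.rep_eq times_Lambda.rep_eq uminus_Lambda.rep_eq
      zero_Lambda.rep_eq one_Lambda.rep_eq scale_Lambda.rep_eq)

lemma Lambda_eqI: "(\<And>n. component P n = component Q n) \<Longrightarrow> P = Q"
  by (metis component_inject ext)

lemma component_sum: "component (sum f A) n = (\<Sum>a\<in>A. component (f a) n)"
  by (induction A rule: infinite_finite_induct) simp_all

lemma comm_ring_hom_component: "comm_ring_hom (\<lambda>P. component P n)"
  by unfold_locales simp_all

text \<open>Each component is obtained from the next one by substituting a parameter for the last
  variable, so one component determines all smaller ones.\<close>

lemma component_restrict:
  assumes "component X m = component Y m" "n \<le> m"
  shows "component X n = component Y n"
  using assms(2)
proof (induction rule: inc_induct)
  case (step k)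
  have "component Z k = msubst (mvar(Suc k := mconst (avar (int (Suc k))))) (component Z (Suc k))" for Z
  proof -
    have "\<forall>n\<ge>1. msubst (mvar(n := mconst (avar (int n)))) (component Z n) = component Z (n - 1)"
      using component[of Z] by (simp add: Lambda_carrier_def)
    then have "msubst (mvar(Suc k := mconst (avar (int (Suc k))))) (component Z (Suc k)) = component Z (Suc k - 1)"
      by (metis One_nat_def Suc_le_mono le0)
    then show ?thesis by simp
  qed
  then show ?case using step by metis
qed (rule assms(1))

lemma comm_ring_hom_mconst: "comm_ring_hom (mconst :: 'r::comm_ring_1 \<Rightarrow> ('v, 'r) mvpoly)"
  by unfold_locales simp_all

lemma mconst_power: "mconst (c ^ k) = (mconst c ^ k :: ('v, 'r::comm_ring_1) mvpoly)"
  by (induction k) simp_all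

definition scalar :: "Qa \<Rightarrow> Lambda" where
  "scalar c = scale_Lambda c 1"

lemma scale_Lambda_scalar: "scale_Lambda c P = scalar c * P"
  by (rule Lambda_eqI) (simp add: scalar_def)

lemma component_scalar [simp]: "component (scalar c) n = mconst c"
  by (simp add: scalar_def)

lemma scalar_simps [simp]:
  "scalar 0 = 0" "scalar 1 = 1" "scalar (c + d) = scalar c + scalar d" "scalar (c * d) = scalar c * scalar d"
  "scalar (- c) = - scalar c"
  by (rule Lambda_eqI; simp)+

lemma comm_ring_hom_scalar: "comm_ring_hom scalar"
  by unfold_locales simp_all

lemma scalar_sum: "scalar (sum f A) = (\<Sum>a\<in>A. scalar (f a))"
  by (induction A rule: infinite_finite_induct) simp_all

lemma scalar_of_int: "scalar (of_int k) = of_int k"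
proof -
  interpret comm_ring_hom scalar by (rule comm_ring_hom_scalar)
  show ?thesis by (rule hom_of_int)
qed

fun complete :: "nat \<Rightarrow> Lambda" where
  "complete 0 = 1"
| "complete (Suc r) = scale_Lambda (mconst (1 / of_nat (Suc r))) (\<Sum>k\<le>r. power_sum (Suc k) * complete (r - k))"

declare complete.simps(2) [simp del]

lemma newton: "of_nat (Suc r) * complete (Suc r) = (\<Sum>k\<le>r. power_sum (Suc k) * complete (r - k))"
proof -
  have "of_nat (Suc r) = scalar (mconst (of_nat (Suc r)))"
  proof -
    interpret s: comm_ring_hom scalar by (rule comm_ring_hom_scalar)
    interpret m: comm_ring_hom "mconst :: rat \<Rightarrow> Qa" by (rule comm_ring_hom_mconst)
    show ?thesis by (simp only: m.hom_of_nat s.hom_of_nat)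
  qed
  moreover have "mconst (of_nat (Suc r)) * mconst (1 / of_nat (Suc r)) = (1 :: Qa)"
    unfolding mconst_simps(4)[symmetric] by (simp del: of_nat_Suc)
  then have "scalar (mconst (of_nat (Suc r))) * scalar (mconst (1 / of_nat (Suc r))) = 1"
    unfolding scalar_simps(4)[symmetric] by simp
  ultimately show ?thesis
    by (simp only: complete.simps(2) scale_Lambda_scalar mult.assoc[symmetric] mult_1_left)
qed

definition complete_series :: "Lambda fps" where
  "complete_series = Abs_fps complete"

lemma complete_series_nth [simp]: "fps_nth complete_series r = complete r"
  by (simp add: complete_series_def)

subsection \<open>Logarithmic derivatives\<close>

text \<open>The equation F' = P F expresses P = F'/F without a quotient. Read coefficientwise it is
  Newton's recursion (\<open>has_log_deriv_iff\<close>), and products of F correspond to sums of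
  P.\<close>

definition has_log_deriv :: "'a::comm_ring_1 fps \<Rightarrow> 'a fps \<Rightarrow> bool" where
  "has_log_deriv F P \<longleftrightarrow> fps_deriv F = P * F"

lemma has_log_deriv_mult: "has_log_deriv F P \<Longrightarrow> has_log_deriv G Q \<Longrightarrow> has_log_deriv (F * G) (P + Q)"
  by (simp add: has_log_deriv_def algebra_simps)

lemma has_log_deriv_prod:
  "(\<And>k. k \<in> A \<Longrightarrow> has_log_deriv (F k) (P k)) \<Longrightarrow> has_log_deriv (\<Prod>k\<in>A. F k) (\<Sum>k\<in>A. P k)"
proof (induction A rule: infinite_finite_induct)
  case (insert a A)
  then show ?case by (simp add: has_log_deriv_mult)
qed (simp_all add: has_log_deriv_def)

lemma has_log_deriv_linfac: "has_log_deriv (linfac x) (- (fps_const x * geo x))"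
  by (simp add: has_log_deriv_def mult.assoc) (simp add: linfac_def)

lemma has_log_deriv_geo: "has_log_deriv (geo x) (fps_const x * geo x)"
proof -
  have "fps_deriv (linfac x) = - fps_const x" by (simp add: linfac_def)
  moreover have "linfac x * fps_deriv (geo x) + fps_deriv (linfac x) * geo x = 0"
    using fps_deriv_mult[of "linfac x" "geo x"] by simp
  ultimately have eq: "linfac x * fps_deriv (geo x) = fps_const x * geo x"
    by (metis add.commute add.right_inverse add_left_cancel mult_minus_left)
  have "fps_deriv (geo x) = geo x * (linfac x * fps_deriv (geo x))"
    by (simp only: mult.assoc[symmetric] geo_linfac mult_1_left)
  then show ?thesis by (simp only: eq has_log_deriv_def mult_ac)
qed

lemma has_log_deriv_iff:
  "has_log_deriv F P \<longleftrightarrow> (\<forall>r. of_nat (Suc r) * fps_nth F (Suc r) = (\<Sum>k\<le>r. fps_nth P k * fps_nth F (r - k)))"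
  unfolding has_log_deriv_def fps_eq_iff by (simp add: fps_mult_nth atLeast0AtMost)

lemma has_log_deriv_unique:
  fixes F G :: "'a::{idom, ring_char_0} fps"
  assumes "has_log_deriv F P" "has_log_deriv G P" "fps_nth F 0 = fps_nth G 0"
  shows "fps_nth F r = fps_nth G r"
proof (induction r rule: less_induct)
  case (less r)
  show ?case
  proof (cases r)
    case (Suc s)
    have "of_nat (Suc s) * fps_nth F (Suc s) = (\<Sum>k\<le>s. fps_nth P k * fps_nth F (s - k))"
      using assms(1) unfolding has_log_deriv_iff by blast
    also have "\<dots> = (\<Sum>k\<le>s. fps_nth P k * fps_nth G (s - k))"
      by (intro sum.cong refl) (simp add: less Suc)
    also have "\<dots> = of_nat (Suc s) * fps_nth G (Suc s)"
      using assms(2) unfolding has_log_deriv_iff by simp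
    finally show ?thesis using Suc by (metis mult_cancel_left of_nat_neq_0)
  qed (use assms(3) in simp)
qed

lemma has_log_deriv_complete: "has_log_deriv complete_series (Abs_fps (\<lambda>k. power_sum (Suc k)))"
  unfolding has_log_deriv_iff by (simp add: newton del: of_nat_Suc)

definition abar :: "nat \<Rightarrow> Qa fps" where
  "abar n = (\<Prod>k<n. linfac (avar (int (Suc k))))"

definition abarx :: "nat \<Rightarrow> Qax fps" where
  "abarx n = (\<Prod>k<n. linfac (mconst (avar (int (Suc k)))))"

lemma abar_0 [simp]: "fps_nth (abar n) 0 = 1" "fps_nth (abarx n) 0 = 1"
  by (simp_all add: abar_def abarx_def)

context comm_ring_hom begin

lemma hom_prod_linfac:
  fixes n :: nat
  shows "hom (fps_nth (\<Prod>k<n. linfac (x k)) r) = fps_nth (\<Prod>k<n. linfac (hom (x k))) r"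
proof (induction n arbitrary: r)
  case (Suc n)
  then show ?case by (simp add: linfac_nth mult.commute[of _ "linfac _"] hom_minus hom_mult)
qed simp

end

lemma abarx_nth: "fps_nth (abarx n) r = mconst (fps_nth (abar n) r)"
proof -
  interpret comm_ring_hom "mconst :: Qa \<Rightarrow> Qax" by (rule comm_ring_hom_mconst)
  show ?thesis unfolding abarx_def abar_def hom_prod_linfac ..
qed

text \<open>Both series have constant term 1, and the logarithmic derivative of each has the double
  power sums in n variables as coefficients. Over an integral domain of characteristic 0 this
  determines the series.\<close>

lemma component_complete: "component (complete r) n = fps_nth (abarx n * eta n xv) r"
proof -
  define P where "P = Abs_fps (\<lambda>k. component (power_sum (Suc k)) n)"
  have 1: "has_log_deriv (Abs_fps (\<lambda>r. component (complete r) n)) P"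
    unfolding has_log_deriv_iff
  proof
    fix r
    have "component (of_nat (Suc r) * complete (Suc r)) n = component (\<Sum>k\<le>r. power_sum (Suc k) * complete (r - k)) n"
      by (simp only: newton)
    moreover have "component (of_nat k) n = of_nat k" for k
      by (induction k) simp_all
    ultimately show "of_nat (Suc r) * fps_nth (Abs_fps (\<lambda>r. component (complete r) n)) (Suc r) =
        (\<Sum>k\<le>r. fps_nth P k * fps_nth (Abs_fps (\<lambda>r. component (complete r) n)) (r - k))"
      by (simp add: component_sum P_def del: of_nat_Suc)
  qed
  have "has_log_deriv (abarx n * eta n xv)
     ((\<Sum>k<n. - (fps_const (mconst (avar (int (Suc k)))) * geo (mconst (avar (int (Suc k)))))) +
      (\<Sum>k<n. fps_const (xv k) * geo (xv k)))"
    unfolding abarx_def eta_def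
    by (intro has_log_deriv_mult has_log_deriv_prod has_log_deriv_linfac has_log_deriv_geo)
  also have "(\<Sum>k<n. - (fps_const (mconst (avar (int (Suc k)))) * geo (mconst (avar (int (Suc k)))))) +
      (\<Sum>k<n. fps_const (xv k) * geo (xv k)) = P"
  proof (rule fps_ext)
    fix r
    have "component (power_sum (Suc r)) n = (\<Sum>i = 1..n. mvar i ^ Suc r - mconst (avar (int i)) ^ Suc r)"
      by (simp add: power_sum.rep_eq mconst_power del: power_Suc)
    also have "\<dots> = (\<Sum>k<n. xv k ^ Suc r - mconst (avar (int (Suc k))) ^ Suc r)"
      by (rule sum.reindex_bij_witness[of _ Suc "\<lambda>i. i - 1"]) auto
    finally show "fps_nth ((\<Sum>k<n. - (fps_const (mconst (avar (int (Suc k)))) * geo (mconst (avar (int (Suc k)))))) +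
      (\<Sum>k<n. fps_const (xv k) * geo (xv k))) r = fps_nth P r"
      by (simp add: P_def fps_sum_nth geo_def sum_subtractf sum_negf)
  qed
  finally have 2: "has_log_deriv (abarx n * eta n xv) P" .
  have "fps_nth (Abs_fps (\<lambda>r. component (complete r) n)) r = fps_nth (abarx n * eta n xv) r"
    by (rule has_log_deriv_unique[OF 1 2]) simp
  then show ?thesis by simp
qed

section \<open>A basis of \<open>\<Lambda>(x\<parallel>a)\<close>\<close>

definition schurL :: "partition \<Rightarrow> Lambda" where
  "schurL \<gamma> = schur_det complete_series \<gamma>"

lemma component_schurL: "component (schurL \<gamma>) n = schur_det (abarx n * eta n xv) \<gamma>"
proof -
  interpret comm_ring_hom "\<lambda>P. component P n" by (rule comm_ring_hom_component)
  show ?thesis unfolding schurL_def by (rule hom_schur_det) (simp add: component_complete)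
qed

text \<open>The coefficient of the ordinary Schur polynomial s_\<mu> in P_n, if \<mu> has at most n
  parts. It is \<rat>[a]-linear in P, which allows its use on tensors.\<close>

definition leading :: "nat \<Rightarrow> partition \<Rightarrow> Lambda \<Rightarrow> Qa" where
  "leading n \<mu> P = Poly_Mapping.lookup (component P n * vandermonde n) (mon n (pos n \<mu>))"

lemma leading_simps [simp]:
  "leading n \<mu> (P + Q) = leading n \<mu> P + leading n \<mu> Q"
  "leading n \<mu> (scalar c * P) = c * leading n \<mu> P"
  "leading n \<mu> 0 = 0"
  by (simp_all add: leading_def distrib_right lookup_add lookup_mconst_mult mult.assoc)

lemma leading_scale: "leading n \<mu> (scale_Lambda c P) = c * leading n \<mu> P"
  by (simp add: scale_Lambda_scalar)

lemma leading_sum: "leading n \<mu> (sum f A) = (\<Sum>a\<in>A. leading n \<mu> (f a))"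
  by (induction A rule: infinite_finite_induct) simp_all

text \<open>Separating the factors \<open>abarx n\<close> and \<open>eta n xv\<close> of the
  complete series expands \<open>schurL \<gamma>\<close> in ordinary Schur polynomials; the
  coefficients are minors of a lower unitriangular matrix.\<close>

lemma leading_schurL:
  assumes "length (parts \<gamma>) \<le> n" "length (parts \<mu>) \<le> n"
  shows "leading n \<mu> (schurL \<gamma>) = minor n (toeplitz (abar n)) \<gamma> \<mu>"
proof -
  interpret comm_ring_hom "mconst :: Qa \<Rightarrow> Qax" by (rule comm_ring_hom_mconst)
  have len: "length (parts \<beta>) \<le> n" if "contained \<beta> \<gamma>" for \<beta>
    using contained_length[OF that] assms(1) by simp
  have m: "minor n (toeplitz (abarx n)) \<gamma> \<beta> = mconst (minor n (toeplitz (abar n)) \<gamma> \<beta>)" for \<beta>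
    unfolding minor_def hom_dt by (rule dt_cong) (simp add: row_series_def abarx_nth)
  have "component (schurL \<gamma>) n * vandermonde n =
      (\<Sum>\<beta> | contained \<beta> \<gamma>. mconst (minor n (toeplitz (abar n)) \<gamma> \<beta>) * (schur_det (eta n xv) \<beta> * vandermonde n))"
    unfolding component_schurL
    by (subst schur_det_mult[of _ _ _ n]) (simp_all add: assms m sum_distrib_right mult.assoc)
  also have "\<dots> = (\<Sum>\<beta> | contained \<beta> \<gamma>. mconst (minor n (toeplitz (abar n)) \<gamma> \<beta>) * alt n (pos n \<beta>))"
    by (intro sum.cong refl) (simp add: len alt_schur_det vandermonde_eq_alt)
  finally have "leading n \<mu> (schurL \<gamma>) =
      (\<Sum>\<beta> | contained \<beta> \<gamma>. minor n (toeplitz (abar n)) \<gamma> \<beta> * (if \<beta> = \<mu> then 1 else 0))"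
    unfolding leading_def by (simp add: lookup_sum lookup_mconst_mult lookup_alt len assms(2))
  also have "\<dots> = (\<Sum>\<beta> | contained \<beta> \<gamma>. if \<beta> = \<mu> then minor n (toeplitz (abar n)) \<gamma> \<mu> else 0)"
    by (intro sum.cong) auto
  also have "\<dots> = minor n (toeplitz (abar n)) \<gamma> \<mu>"
    using minor_not_contained[of "toeplitz (abar n)" \<mu> n \<gamma>] assms(2) by simp
  finally show ?thesis .
qed

lemma leading_schurL_contained:
  "length (parts \<gamma>) \<le> n \<Longrightarrow> length (parts \<mu>) \<le> n \<Longrightarrow> leading n \<mu> (schurL \<gamma>) \<noteq> 0 \<Longrightarrow> contained \<mu> \<gamma>"
  using minor_not_contained[of "toeplitz (abar n)" \<mu> n \<gamma>] by (auto simp: leading_schurL)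

lemma leading_schurL_same: "length (parts \<gamma>) \<le> n \<Longrightarrow> leading n \<gamma> (schurL \<gamma>) = 1"
  unfolding leading_schurL by (rule minor_diagonal) (simp_all add: row_series_def)

definition psize :: "partition \<Rightarrow> nat" where
  "psize \<gamma> = (\<Sum>i<length (parts \<gamma>). part \<gamma> (Suc i))"

lemma psize_eq: "length (parts \<gamma>) \<le> n \<Longrightarrow> psize \<gamma> = (\<Sum>i<n. part \<gamma> (Suc i))"
  unfolding psize_def by (rule sum.mono_neutral_left) (auto simp: part_beyond)

lemma psize_less:
  assumes "contained \<mu> \<gamma>" "\<mu> \<noteq> \<gamma>"
  shows "psize \<mu> < psize \<gamma>"
proof -
  define n where "n = length (parts \<gamma>)"
  have len: "length (parts \<mu>) \<le> n" using contained_length[OF assms(1)] by (simp add: n_def)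
  have le: "part \<mu> (Suc i) \<le> part \<gamma> (Suc i)" for i using assms(1) by (simp add: contained_iff)
  obtain i where i: "part \<mu> (Suc i) \<noteq> part \<gamma> (Suc i)" using assms(2) partition_eqI by blast
  then have "part \<gamma> (Suc i) > 0" using le[of i] by linarith
  then have "i < n" by (simp add: part_pos_iff n_def)
  then have "(\<Sum>i<n. part \<mu> (Suc i)) < (\<Sum>i<n. part \<gamma> (Suc i))"
    using le i by (intro sum_strict_mono_ex1) (auto intro!: bexI[of _ i] simp: order_less_le)
  then show ?thesis using len by (simp add: psize_eq[of _ n] n_def)
qed

lemma length_le_psize: "length (parts \<gamma>) \<le> psize \<gamma>"
proof -
  have "(\<Sum>i<length (parts \<gamma>). 1) \<le> (\<Sum>i<length (parts \<gamma>). part \<gamma> (Suc i))"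
    by (rule sum_mono) (use part_pos_iff[of \<gamma>] in \<open>auto simp: Suc_le_eq\<close>)
  then show ?thesis by (simp add: psize_def)
qed

lemma finite_psize [simp]: "finite {\<gamma>. psize \<gamma> \<le> D}"
proof (rule finite_subset)
  show "{\<gamma>. psize \<gamma> \<le> D} \<subseteq> parts_below D (Suc (D + D))"
  proof
    fix \<gamma> assume "\<gamma> \<in> {\<gamma>. psize \<gamma> \<le> D}"
    then have D: "psize \<gamma> \<le> D" "length (parts \<gamma>) \<le> D" using length_le_psize[of \<gamma>] by auto
    have "part \<gamma> (Suc i) \<le> D" if "i < D" for i
    proof -
      have "part \<gamma> (Suc i) \<le> (\<Sum>i<D. part \<gamma> (Suc i))" by (rule member_le_sum) (use that in auto)
      then show ?thesis using D psize_eq[of \<gamma> D] by simp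
    qed
    then have "pos D \<gamma> i < Suc (D + D)" if "i < D" for i
      using that by (fastforce simp: pos_def)
    then show "\<gamma> \<in> parts_below D (Suc (D + D))" using D by (simp add: parts_below_def)
  qed
qed simp

text \<open>Take an index l of maximal size among those with d l \<noteq> 0; in the equation with
  index l all other terms vanish and d l = 0 remains.\<close>

lemma unitriangular_independent:
  fixes d :: "'k \<Rightarrow> 'r::comm_ring_1" and size :: "'k \<Rightarrow> nat"
  assumes "finite K" "\<And>j k. j \<in> K \<Longrightarrow> k \<in> K \<Longrightarrow> A k j \<noteq> 0 \<Longrightarrow> j \<noteq> k \<Longrightarrow> size k < size j"
    "\<And>k. k \<in> K \<Longrightarrow> A k k = 1" "\<And>k. k \<in> K \<Longrightarrow> (\<Sum>j\<in>K. d j * A k j) = 0" "k \<in> K"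
  shows "d k = 0"
proof (rule ccontr)
  assume "d k \<noteq> 0"
  define S where "S = {j \<in> K. d j \<noteq> 0}"
  have "finite S" "S \<noteq> {}" using assms(1,5) \<open>d k \<noteq> 0\<close> by (auto simp: S_def)
  then have "Max (size ` S) \<in> size ` S" by (intro Max_in) auto
  then obtain l where l: "l \<in> S" "Max (size ` S) = size l" by blast
  have max: "size j \<le> size l" if "j \<in> S" for j
    unfolding l(2)[symmetric] using \<open>finite S\<close> that by simp
  have lK: "l \<in> K" "d l \<noteq> 0" using l(1) by (auto simp: S_def)
  have "(\<Sum>j\<in>K. d j * A l j) = (\<Sum>j\<in>K. if j = l then d l else 0)"
  proof (intro sum.cong refl)
    fix j assume j: "j \<in> K"
    show "d j * A l j = (if j = l then d l else 0)"
    proof (cases "j = l")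
      case False
      have "d j * A l j = 0"
      proof (rule ccontr)
        assume n: "d j * A l j \<noteq> 0"
        then have "d j \<noteq> 0" "A l j \<noteq> 0" by auto
        then show False using assms(2)[OF j lK(1) _ False] max[of j] j by (simp add: S_def)
      qed
      then show ?thesis using False by simp
    qed (use assms(3) lK in simp)
  qed
  then show False using assms(1,4) lK by simp
qed

text \<open>A single component suffices, provided that n bounds the lengths of all partitions
  involved; \<open>schurL_spans\<close> relies on this.\<close>

lemma schurL_independent:
  assumes "finite K" "\<And>\<gamma>. \<gamma> \<in> K \<Longrightarrow> length (parts \<gamma>) \<le> n"
    "component (\<Sum>\<gamma>\<in>K. scalar (d \<gamma>) * schurL \<gamma>) n = 0" "\<mu> \<in> K"
  shows "d \<mu> = 0"
proof (rule unitriangular_independent[of K "\<lambda>\<mu> \<gamma>. leading n \<mu> (schurL \<gamma>)" psize])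
  fix \<mu> assume "\<mu> \<in> K"
  have "leading n \<mu> (\<Sum>\<gamma>\<in>K. scalar (d \<gamma>) * schurL \<gamma>) = 0"
    unfolding leading_def assms(3) by simp
  then show "(\<Sum>\<gamma>\<in>K. d \<gamma> * leading n \<mu> (schurL \<gamma>)) = 0" by (simp add: leading_sum)
next
  fix j k assume "j \<in> K" "k \<in> K" "leading n k (schurL j) \<noteq> 0" "j \<noteq> k"
  then show "psize k < psize j" using leading_schurL_contained[of j n k] assms(2) by (intro psize_less) auto
qed (use assms(1,2,4) leading_schurL_same in simp_all)

subsection \<open>Symmetric polynomials\<close>

lemma vars_in_mon:
  assumes "vars_in n f" "m \<in> Poly_Mapping.keys f"
  shows "m = mon n (\<lambda>k. Poly_Mapping.lookup m (Suc k))"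
proof (rule poly_mapping_eqI)
  fix i
  have sub: "Poly_Mapping.keys m \<subseteq> {1..n}" using assms by (auto simp: vars_in_def)
  show "Poly_Mapping.lookup m i = Poly_Mapping.lookup (mon n (\<lambda>k. Poly_Mapping.lookup m (Suc k))) i"
  proof (cases "i \<in> {1..n}")
    case True
    then obtain k where "i = Suc k" "k < n" by (cases i) auto
    then show ?thesis by (simp add: lookup_mon)
  next
    case False
    then have "Poly_Mapping.lookup m i = 0" using sub by (auto simp: in_keys_iff)
    moreover have "Poly_Mapping.lookup (mon n (\<lambda>k. Poly_Mapping.lookup m (Suc k))) i = 0"
      using False by (auto simp: mon_def lookup_sum lookup_single when_def intro!: sum.neutral)
    ultimately show ?thesis by simp
  qed
qed

lemma poly_expand:
  assumes "vars_in n f"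
  shows "f = (\<Sum>m\<in>Poly_Mapping.keys f. mconst (Poly_Mapping.lookup f m) *
    (\<Prod>k<n. xv k ^ Poly_Mapping.lookup m (Suc k)))"
proof (rule poly_mapping_eqI)
  fix l
  have m: "(\<Prod>k<n. xv k ^ Poly_Mapping.lookup m (Suc k)) = (Poly_Mapping.single m 1 :: Qax)"
    if "m \<in> Poly_Mapping.keys f" for m
    using prod_monomial[of "\<lambda>_. 1 :: Qa" "\<lambda>k. Poly_Mapping.lookup m (Suc k)" n] vars_in_mon[OF assms that]
    by simp
  have "Poly_Mapping.lookup (\<Sum>m\<in>Poly_Mapping.keys f. mconst (Poly_Mapping.lookup f m) *
      (\<Prod>k<n. xv k ^ Poly_Mapping.lookup m (Suc k))) l =
      (\<Sum>m\<in>Poly_Mapping.keys f. if m = l then Poly_Mapping.lookup f m else 0)"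
    unfolding lookup_sum lookup_mconst_mult
    by (intro sum.cong refl) (simp add: m lookup_single when_def)
  also have "\<dots> = Poly_Mapping.lookup f l" by (simp add: in_keys_iff)
  finally show "Poly_Mapping.lookup f l = Poly_Mapping.lookup (\<Sum>m\<in>Poly_Mapping.keys f. mconst (Poly_Mapping.lookup f m) *
      (\<Prod>k<n. xv k ^ Poly_Mapping.lookup m (Suc k))) l" ..
qed

lemma msubst_prod: "msubst \<sigma> (prod f A) = (\<Prod>a\<in>A. msubst \<sigma> (f a))"
  by (induction A rule: infinite_finite_induct) simp_all

text \<open>Invariance under the inverse of \<pi>, transported from \<open>{..<n}\<close> to the
  variable indices \<open>{1..n}\<close>. In this form \<pi> permutes exponents instead of
  variables.\<close>

lemma symmetric_permute:
  assumes "vars_in n f" "symmetric_in n f" "\<pi> permutes {..<n}"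
  shows "f = (\<Sum>m\<in>Poly_Mapping.keys f. mconst (Poly_Mapping.lookup f m) *
    (\<Prod>k<n. xv k ^ Poly_Mapping.lookup m (Suc (\<pi> k))))"
proof -
  define \<rho> where "\<rho> = inv_into UNIV \<pi>"
  have \<rho>: "\<rho> permutes {..<n}" unfolding \<rho>_def by (rule permutes_inv[OF assms(3)])
  define \<sigma> where "\<sigma> i = (if i \<in> {1..n} then Suc (\<rho> (i - 1)) else i)" for i
  have \<sigma>S: "\<sigma> (Suc k) = Suc (\<rho> k)" if "k < n" for k using that by (simp add: \<sigma>_def)
  have "bij_betw \<sigma> {1..n} {1..n}"
  proof (rule bij_betw_byWitness[of _ "\<lambda>i. Suc (\<pi> (i - 1))"])
    show "\<forall>i\<in>{1..n}. Suc (\<pi> (\<sigma> i - 1)) = i"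
    proof
      fix i assume "i \<in> {1..n}"
      then obtain k where "i = Suc k" "k < n" by (cases i) auto
      then show "Suc (\<pi> (\<sigma> i - 1)) = i"
        using permutes_inverses(1)[OF assms(3), of k] by (simp add: \<sigma>S \<rho>_def)
    qed
    show "\<forall>i\<in>{1..n}. \<sigma> (Suc (\<pi> (i - 1))) = i"
    proof
      fix i assume i: "i \<in> {1..n}"
      then have "\<pi> (i - 1) < n" using permutes_less[OF assms(3), of "i - 1"] by auto
      then show "\<sigma> (Suc (\<pi> (i - 1))) = i"
        using i permutes_inverses(2)[OF assms(3), of "i - 1"] by (simp add: \<sigma>S \<rho>_def)
    qed
    show "\<sigma> ` {1..n} \<subseteq> {1..n}"
    proof
      fix j assume "j \<in> \<sigma> ` {1..n}"
      then obtain i where i: "i \<in> {1..n}" "j = \<sigma> i" by blast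
      then have "\<rho> (i - 1) < n" using permutes_less[OF \<rho>, of "i - 1"] by auto
      then show "j \<in> {1..n}" using i by (simp add: \<sigma>_def)
    qed
    show "(\<lambda>i. Suc (\<pi> (i - 1))) ` {1..n} \<subseteq> {1..n}"
    proof
      fix j assume "j \<in> (\<lambda>i. Suc (\<pi> (i - 1))) ` {1..n}"
      then obtain i where i: "i \<in> {1..n}" "j = Suc (\<pi> (i - 1))" by blast
      then have "\<pi> (i - 1) < n" using permutes_less[OF assms(3), of "i - 1"] by auto
      then show "j \<in> {1..n}" using i by simp
    qed
  qed
  then have \<sigma>: "\<sigma> permutes {1..n}" by (rule bij_imp_permutes) (auto simp: \<sigma>_def)
  have "f = msubst (\<lambda>i. mvar (\<sigma> i)) f"
    using assms(2) \<sigma> by (simp add: symmetric_in_def)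
  also have "\<dots> = msubst (\<lambda>i. mvar (\<sigma> i)) (\<Sum>m\<in>Poly_Mapping.keys f. mconst (Poly_Mapping.lookup f m) *
    (\<Prod>k<n. xv k ^ Poly_Mapping.lookup m (Suc k)))"
    using poly_expand[OF assms(1)] by (rule arg_cong)
  also have "\<dots> = (\<Sum>m\<in>Poly_Mapping.keys f. mconst (Poly_Mapping.lookup f m) *
    (\<Prod>k<n. mvar (\<sigma> (Suc k)) ^ Poly_Mapping.lookup m (Suc k)))"
    by (simp add: msubst_sum msubst_prod)
  also have "\<dots> = (\<Sum>m\<in>Poly_Mapping.keys f. mconst (Poly_Mapping.lookup f m) *
    (\<Prod>k<n. xv k ^ Poly_Mapping.lookup m (Suc (\<pi> k))))"
  proof (intro sum.cong refl arg_cong2[of _ _ _ _ "(*)"])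
    fix m
    have "(\<Prod>k<n. mvar (\<sigma> (Suc k)) ^ Poly_Mapping.lookup m (Suc k)) =
        (\<Prod>k<n. (\<lambda>k. xv (\<rho> k) ^ Poly_Mapping.lookup m (Suc k) :: Qax) k)"
      by (intro prod.cong refl) (simp add: \<sigma>S)
    also have "\<dots> = (\<Prod>k<n. ((\<lambda>k. xv (\<rho> k) ^ Poly_Mapping.lookup m (Suc k)) \<circ> \<pi>) k)"
      by (subst prod.permute[OF assms(3)]) (rule refl)
    also have "\<dots> = (\<Prod>k<n. xv k ^ Poly_Mapping.lookup m (Suc (\<pi> k)))"
      by (intro prod.cong refl) (simp add: \<rho>_def permutes_inverses[OF assms(3)])
    finally show "(\<Prod>k<n. mvar (\<sigma> (Suc k)) ^ Poly_Mapping.lookup m (Suc k)) =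
        (\<Prod>k<n. xv k ^ Poly_Mapping.lookup m (Suc (\<pi> k)) :: Qax)" .
  qed
  finally show ?thesis .
qed

lemma alt_leibniz:
  "alt n l = (\<Sum>\<pi> | \<pi> permutes {..<n}. of_int (sign \<pi>) * (\<Prod>k<n. xv k ^ l (\<pi> k)))"
  unfolding alt_def
  unfolding dt_transpose[of n "\<lambda>k i. xv k ^ l i"]
  unfolding dt_leibniz by (rule refl)

text \<open>In the \<pi>-term of the alternant the symmetric factor is written with its exponents
  permuted by the same \<pi>, so that the exponents of m and l simply add.\<close>

lemma symmetric_times_alt:
  assumes "vars_in n f" "symmetric_in n f"
  shows "f * alt n l = (\<Sum>m\<in>Poly_Mapping.keys f. mconst (Poly_Mapping.lookup f m) *
    alt n (\<lambda>i. Poly_Mapping.lookup m (Suc i) + l i))"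
proof -
  have "f * alt n l = (\<Sum>\<pi> | \<pi> permutes {..<n}. f * (of_int (sign \<pi>) * (\<Prod>k<n. xv k ^ l (\<pi> k))))"
    unfolding alt_leibniz by (rule sum_distrib_left)
  also have "\<dots> = (\<Sum>\<pi> | \<pi> permutes {..<n}. (\<Sum>m\<in>Poly_Mapping.keys f. mconst (Poly_Mapping.lookup f m) *
    (\<Prod>k<n. xv k ^ Poly_Mapping.lookup m (Suc (\<pi> k)))) * (of_int (sign \<pi>) * (\<Prod>k<n. xv k ^ l (\<pi> k))))"
    by (intro sum.cong refl arg_cong2[of _ _ _ _ "(*)"] symmetric_permute assms) simp
  also have "\<dots> = (\<Sum>\<pi> | \<pi> permutes {..<n}. \<Sum>m\<in>Poly_Mapping.keys f. mconst (Poly_Mapping.lookup f m) *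
    (of_int (sign \<pi>) * (\<Prod>k<n. xv k ^ (Poly_Mapping.lookup m (Suc (\<pi> k)) + l (\<pi> k)))))"
    unfolding sum_distrib_right by (intro sum.cong refl) (simp add: power_add prod.distrib mult_ac)
  also have "\<dots> = (\<Sum>m\<in>Poly_Mapping.keys f. mconst (Poly_Mapping.lookup f m) *
    alt n (\<lambda>i. Poly_Mapping.lookup m (Suc i) + l i))"
    unfolding alt_leibniz sum_distrib_left by (rule sum.swap)
  finally show ?thesis .
qed

lemma symmetric_expand:
  assumes "vars_in n f" "symmetric_in n f"
  shows "f = (\<Sum>m\<in>Poly_Mapping.keys f. mconst (Poly_Mapping.lookup f m) *
    dt n (\<lambda>i j. toeplitz (eta n xv) (Poly_Mapping.lookup m (Suc i) + (n - Suc i)) (n - Suc j)))"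
    (is "f = (\<Sum>m\<in>_. _ * ?T m)")
proof -
  have "alt n (\<lambda>i. Poly_Mapping.lookup m (Suc i) + (n - Suc i)) = ?T m * (vandermonde n :: Qax)" for m
    unfolding vandermonde_eq_alt alt_def by (rule alternant_jacobi_trudi)
  then have "f * vandermonde n = (\<Sum>m\<in>Poly_Mapping.keys f. mconst (Poly_Mapping.lookup f m) * ?T m) * vandermonde n"
    using symmetric_times_alt[OF assms, of "\<lambda>i. n - Suc i"]
    by (simp add: vandermonde_eq_alt sum_distrib_right mult.assoc)
  then show ?thesis using vandermonde_nonzero[of n, where 'r = Qa] by simp
qed

text \<open>Writing \<open>eta\<close> as the inverse of \<open>abarx\<close> times
  \<open>abarx * eta\<close> expands a determinant of ordinary complete polynomials in the elements
  \<open>schurL\<close>. The degree bound D survives, so the index set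
  \<open>psize \<beta> \<le> D\<close> is the same for all n.\<close>

lemma complete_to_schurL:
  fixes l :: "nat \<Rightarrow> nat"
  assumes D: "(\<Sum>i<n. l i) \<le> D + (\<Sum>i<n. n - Suc i)"
  shows "\<exists>d. dt n (\<lambda>i j. toeplitz (eta n xv) (l i) (n - Suc j)) =
      (\<Sum>\<beta> | psize \<beta> \<le> D. mconst (d \<beta>) * component (schurL \<beta>) n)"
proof -
  interpret comm_ring_hom "mconst :: Qa \<Rightarrow> Qax" by (rule comm_ring_hom_mconst)
  define G where "G = eta n (\<lambda>k. avar (int (Suc k)))"
  define Gx where "Gx = eta n (\<lambda>k. mconst (avar (int (Suc k))) :: Qax)"
  have Gx: "fps_nth Gx r = mconst (fps_nth G r)" for r unfolding Gx_def G_def hom_eta ..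
  have eta: "eta n xv = Gx * (abarx n * eta n xv)"
  proof -
    have "abarx n * Gx = 1" unfolding Gx_def abarx_def by (rule linfac_prod_eta)
    then have "Gx * abarx n = 1" by (simp only: mult.commute)
    then show ?thesis by (simp only: mult.assoc[symmetric] mult_1_left)
  qed
  define L where "L = Suc (\<Sum>i<n. l i)"
  have L: "l i < L" if "i < n" for i
    using member_le_sum[of i "{..<n}" l] that by (simp add: L_def)
  define d where "d \<beta> = dt n (\<lambda>i j. toeplitz G (l i) (pos n \<beta> j))" for \<beta>
  have "dt n (\<lambda>i j. toeplitz (eta n xv) (l i) (n - Suc j)) =
      dt n (\<lambda>i k. \<Sum>p<L. toeplitz Gx (l i) p * toeplitz (abarx n * eta n xv) p (n - Suc k))"
  proof (rule dt_cong)
    fix i j assume "i < n" "j < n"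
    have "toeplitz (eta n xv) (l i) (n - Suc j) = (\<Sum>b\<le>l i. toeplitz Gx (l i) b * toeplitz (abarx n * eta n xv) b (n - Suc j))"
      by (subst eta) (simp add: row_series_mult)
    also have "\<dots> = (\<Sum>p<L. toeplitz Gx (l i) p * toeplitz (abarx n * eta n xv) p (n - Suc j))"
      by (rule sum.mono_neutral_left) (use L[OF \<open>i < n\<close>] in auto)
    finally show "toeplitz (eta n xv) (l i) (n - Suc j) =
        (\<Sum>p<L. toeplitz Gx (l i) p * toeplitz (abarx n * eta n xv) p (n - Suc j))" .
  qed
  also have "\<dots> = (\<Sum>\<beta>\<in>parts_below n L. mconst (d \<beta>) * component (schurL \<beta>) n)"
    unfolding cauchy_binet
  proof (intro sum.cong refl arg_cong2[of _ _ _ _ "(*)"])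
    fix \<beta> assume "\<beta> \<in> parts_below n L"
    then have "minor n (toeplitz (abarx n * eta n xv)) \<beta> empty_partition = component (schurL \<beta>) n"
      unfolding component_schurL by (intro schur_det_eq) (simp_all add: parts_below_def)
    then show "dt n (\<lambda>j k. toeplitz (abarx n * eta n xv) (pos n \<beta> j) (n - Suc k)) = component (schurL \<beta>) n"
      by (simp add: minor_def)
    show "dt n (\<lambda>i j. toeplitz Gx (l i) (pos n \<beta> j)) = mconst (d \<beta>)"
      unfolding d_def hom_dt by (rule dt_cong) (simp add: row_series_def Gx)
  qed
  also have "\<dots> = (\<Sum>\<beta> | psize \<beta> \<le> D. mconst (if \<beta> \<in> parts_below n L then d \<beta> else 0) * component (schurL \<beta>) n)"
  proof (rule sum.mono_neutral_cong)
    fix \<beta> assume b: "\<beta> \<in> parts_below n L - {\<beta>. psize \<beta> \<le> D}"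
    have len: "length (parts \<beta>) \<le> n" using b by (simp add: parts_below_def)
    have "d \<beta> = 0"
      unfolding d_def dt_leibniz
    proof (intro sum.neutral ballI, clarify)
      fix \<pi> assume p: "\<pi> permutes {..<n}"
      \<comment> \<open>A nonzero Leibniz term requires
        \<open>pos n \<beta> (\<pi> i) \<le> l i\<close> for all i; summing over i contradicts the
        degree bound.\<close>
      have "(\<Sum>i<n. pos n \<beta> (\<pi> i)) = (\<Sum>i<n. pos n \<beta> i)"
        using sum.permute[OF p, of "pos n \<beta>"] by (simp add: o_def)
      also have "\<dots> = (\<Sum>i<n. part \<beta> (Suc i) + (n - Suc i))"
        by (intro sum.cong refl) (simp add: pos_def)
      also have "\<dots> = psize \<beta> + (\<Sum>i<n. n - Suc i)"
        by (simp only: sum.distrib psize_eq[OF len])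
      finally have "(\<Sum>i<n. l i) < (\<Sum>i<n. pos n \<beta> (\<pi> i))" using D b by simp
      then obtain i where "i < n" "l i < pos n \<beta> (\<pi> i)"
        using sum_mono[of "{..<n}" "\<lambda>i. pos n \<beta> (\<pi> i)" l] by (auto simp: not_le[symmetric])
      then have "(\<Prod>i<n. toeplitz G (l i) (pos n \<beta> (\<pi> i))) = 0"
        by (intro prod_zero bexI[of _ i]) auto
      then show "of_int (sign \<pi>) * (\<Prod>i<n. toeplitz G (l i) (pos n \<beta> (\<pi> i))) = 0" by simp
    qed
    then show "mconst (d \<beta>) * component (schurL \<beta>) n = 0" by simp
  qed auto
  finally show ?thesis by (rule exI[of _ "\<lambda>\<beta>. if \<beta> \<in> parts_below n L then d \<beta> else 0"])
qed

lemma symmetric_combination: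
  assumes "vars_in n f" "symmetric_in n f" "degree_le D f"
  shows "\<exists>d. f = component (\<Sum>\<beta> | psize \<beta> \<le> D. scalar (d \<beta>) * schurL \<beta>) n"
proof -
  have "\<forall>m\<in>Poly_Mapping.keys f. \<exists>d. dt n (\<lambda>i j. toeplitz (eta n xv) (Poly_Mapping.lookup m (Suc i) + (n - Suc i)) (n - Suc j)) =
      (\<Sum>\<beta> | psize \<beta> \<le> D. mconst (d \<beta>) * component (schurL \<beta>) n)"
  proof (rule ballI, rule complete_to_schurL)
    fix m assume that: "m \<in> Poly_Mapping.keys f"
    have "(\<Sum>i<n. Poly_Mapping.lookup m (Suc i)) = (\<Sum>i\<in>{1..n}. Poly_Mapping.lookup m i)"
      by (rule sum.reindex_bij_witness[of _ "\<lambda>i. i - 1" Suc]) auto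
    also have "\<dots> = monom_degree m"
      by (rule monom_degree_superset[symmetric]) (use assms(1) that in \<open>auto simp: vars_in_def\<close>)
    also have "\<dots> \<le> D" using assms(3) that by (simp add: degree_le_def)
    finally show "(\<Sum>i<n. Poly_Mapping.lookup m (Suc i) + (n - Suc i)) \<le> D + (\<Sum>i<n. n - Suc i)"
      by (simp only: sum.distrib add_le_mono1)
  qed
  from bchoice[OF this] obtain d where d: "\<forall>m\<in>Poly_Mapping.keys f.
      dt n (\<lambda>i j. toeplitz (eta n xv) (Poly_Mapping.lookup m (Suc i) + (n - Suc i)) (n - Suc j)) =
      (\<Sum>\<beta> | psize \<beta> \<le> D. mconst (d m \<beta>) * component (schurL \<beta>) n)" ..
  define e where "e \<beta> = (\<Sum>m\<in>Poly_Mapping.keys f. Poly_Mapping.lookup f m * d m \<beta>)" for \<beta>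
  have mc: "mconst (e \<beta>) = (\<Sum>m\<in>Poly_Mapping.keys f. mconst (Poly_Mapping.lookup f m) * mconst (d m \<beta>) :: Qax)" for \<beta>
  proof -
    interpret comm_ring_hom "mconst :: Qa \<Rightarrow> Qax" by (rule comm_ring_hom_mconst)
    show ?thesis by (simp only: e_def hom_sum mconst_simps)
  qed
  have "f = (\<Sum>m\<in>Poly_Mapping.keys f. mconst (Poly_Mapping.lookup f m) *
      (\<Sum>\<beta> | psize \<beta> \<le> D. mconst (d m \<beta>) * component (schurL \<beta>) n))"
    by (subst symmetric_expand[OF assms(1,2)]) (intro sum.cong refl arg_cong2[of _ _ _ _ "(*)"] d[rule_format])
  also have "\<dots> = (\<Sum>\<beta> | psize \<beta> \<le> D. mconst (e \<beta>) * component (schurL \<beta>) n)"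
    unfolding mc sum_distrib_left sum_distrib_right by (subst sum.swap) (simp only: mult.assoc)
  also have "\<dots> = component (\<Sum>\<beta> | psize \<beta> \<le> D. scalar (e \<beta>) * schurL \<beta>) n"
    by (simp add: component_sum)
  finally show ?thesis by blast
qed

text \<open>Every component expands separately over the same finite set of partitions. For n \<ge>
  D, restriction to D variables and independence there show that the coefficients agree, because a
  partition of size at most D has at most D parts.\<close>

theorem schurL_spans: "\<exists>D d. P = (\<Sum>\<beta> | psize \<beta> \<le> D. scalar (d \<beta>) * schurL \<beta>)"
proof -
  obtain D where D: "\<And>n. degree_le D (component P n)" "\<And>n. vars_in n (component P n)"
    "\<And>n. symmetric_in n (component P n)"
    using component[of P] by (auto simp: Lambda_carrier_def)
  define X where "X d = (\<Sum>\<beta> | psize \<beta> \<le> D. scalar (d \<beta>) * schurL \<beta>)" for d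
  have "\<forall>n. \<exists>d. component P n = component (X d) n"
    using symmetric_combination[OF D(2,3,1)] unfolding X_def by blast
  from choice[OF this] obtain d where d: "\<And>n. component P n = component (X (d n)) n" by blast
  have eq: "X (d n) = X (d D)" if "n \<ge> D" for n
  proof -
    have "component (X (d n)) D = component (X (d D)) D"
      using component_restrict[OF d that] d[of D] by simp
    moreover have "X (d n) - X (d D) = (\<Sum>\<beta> | psize \<beta> \<le> D. scalar (d n \<beta> - d D \<beta>) * schurL \<beta>)"
    proof -
      interpret comm_ring_hom scalar by (rule comm_ring_hom_scalar)
      show ?thesis by (simp add: X_def hom_minus left_diff_distrib sum_subtractf)
    qed
    ultimately have 0: "component (\<Sum>\<beta> | psize \<beta> \<le> D. scalar (d n \<beta> - d D \<beta>) * schurL \<beta>) D = 0"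
      by (metis component_simps(2) right_minus_eq)
    have "d n \<beta> - d D \<beta> = 0" if "psize \<beta> \<le> D" for \<beta>
      by (rule schurL_independent[OF finite_psize _ 0]) (use that length_le_psize order_trans in auto)
    then show ?thesis unfolding X_def by (intro sum.cong) auto
  qed
  have "component P n = component (X (d D)) n" for n
  proof (cases "D \<le> n")
    case True
    then show ?thesis using d[of n] eq[OF True] by simp
  next
    case False
    then show ?thesis using component_restrict[OF d[of D]] by simp
  qed
  then have "P = X (d D)" by (rule Lambda_eqI)
  then show ?thesis unfolding X_def by blast
qed

section \<open>The tensor square\<close>

lemma tensor_eq_refl: "tensor_eq f f"
  by (simp add: tensor_eq_def free_module.span_zero)

lemma tensor_relation: "f - g \<in> bilinearity_relations \<Longrightarrow> tensor_eq f g"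
  unfolding tensor_eq_def by (rule free_module.span_base)

lemma tensor_mult: "tensor p q * tensor p' q' = tensor (p * p') (q * q')"
  by transfer (simp add: free_tensor_mult tensor_eq_refl)

lemma tensor_1: "tensor 1 1 = 1"
proof -
  have "free_tensor 1 1 = 1" by (simp add: free_tensor_def flip: zero_pair_def)
  then show ?thesis by transfer (simp add: tensor_eq_refl)
qed

lemma tensor_add_left: "tensor (p + p') q = tensor p q + tensor p' q"
proof transfer
  fix p p' q
  have "free_tensor (p + p') q - (free_tensor p q + free_tensor p' q) \<in> bilinearity_relations"
    unfolding bilinearity_relations_def by (fastforce simp: diff_diff_add)
  then show "tensor_eq (free_tensor (p + p') q) (free_tensor p q + free_tensor p' q)"
    by (rule tensor_relation)
qed

lemma tensor_add_right: "tensor p (q + q') = tensor p q + tensor p q'"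
proof transfer
  fix p q q'
  have "free_tensor p (q + q') - (free_tensor p q + free_tensor p q') \<in> bilinearity_relations"
    unfolding bilinearity_relations_def by (fastforce simp: diff_diff_add)
  then show "tensor_eq (free_tensor p (q + q')) (free_tensor p q + free_tensor p q')"
    by (rule tensor_relation)
qed

lemma tensor_scale_left: "tensor (scale_Lambda c p) q = scale_Lambda2 c (tensor p q)"
proof transfer
  fix c p q
  have "free_tensor (scale_Lambda c p) q - free_scale c (free_tensor p q) \<in> bilinearity_relations"
    unfolding bilinearity_relations_def by blast
  then show "tensor_eq (free_tensor (scale_Lambda c p) q) (free_scale c (free_tensor p q))"
    by (rule tensor_relation)
qed

lemma tensor_scale_right: "tensor p (scale_Lambda c q) = scale_Lambda2 c (tensor p q)"
proof transfer
  fix c p q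
  have "free_tensor p (scale_Lambda c q) - free_scale c (free_tensor p q) \<in> bilinearity_relations"
    unfolding bilinearity_relations_def by blast
  then show "tensor_eq (free_tensor p (scale_Lambda c q)) (free_scale c (free_tensor p q))"
    by (rule tensor_relation)
qed

lemma tensor_sum:
  "tensor (sum f A) q = (\<Sum>a\<in>A. tensor (f a) q)" "tensor p (sum f A) = (\<Sum>a\<in>A. tensor p (f a))"
proof -
  have "tensor 0 q = 0" for q using tensor_add_left[of 0 0 q] by simp
  then show "tensor (sum f A) q = (\<Sum>a\<in>A. tensor (f a) q)"
    by (induction A rule: infinite_finite_induct) (simp_all add: tensor_add_left)
  have "tensor p 0 = 0" for p using tensor_add_right[of p 0 0] by simp
  then show "tensor p (sum f A) = (\<Sum>a\<in>A. tensor p (f a))"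
    by (induction A rule: infinite_finite_induct) (simp_all add: tensor_add_right)
qed

definition scalar2 :: "Qa \<Rightarrow> Lambda2" where
  "scalar2 c = scale_Lambda2 c 1"

lemma scale_Lambda2_mult: "scale_Lambda2 c x * y = scale_Lambda2 c (x * y)"
  by transfer (simp add: free_scale_conv_mult mult.assoc tensor_eq_refl)

lemma scale_Lambda2_scalar2: "scale_Lambda2 c x = scalar2 c * x"
  unfolding scalar2_def scale_Lambda2_mult by simp

lemma scale_Lambda2_laws:
  "scale_Lambda2 0 x = 0" "scale_Lambda2 1 x = x" "scale_Lambda2 (c + d) x = scale_Lambda2 c x + scale_Lambda2 d x"
  "scale_Lambda2 (c * d) x = scale_Lambda2 c (scale_Lambda2 d x)"
  by (transfer, simp add: free_scale_conv_mult tensor_eq_refl single_add distrib_right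
      mult_single mult.assoc[symmetric])+

lemma scalar2_simps [simp]:
  "scalar2 0 = 0" "scalar2 1 = 1" "scalar2 (c + d) = scalar2 c + scalar2 d" "scalar2 (c * d) = scalar2 c * scalar2 d"
proof -
  show "scalar2 0 = 0" "scalar2 1 = 1" "scalar2 (c + d) = scalar2 c + scalar2 d"
    by (simp_all add: scalar2_def scale_Lambda2_laws)
  show "scalar2 (c * d) = scalar2 c * scalar2 d"
    unfolding scale_Lambda2_scalar2[symmetric] by (simp add: scalar2_def scale_Lambda2_laws)
qed

lemma comm_ring_hom_scalar2: "comm_ring_hom scalar2"
  by unfold_locales simp_all

lemma scalar2_of_int: "scalar2 (of_int k) = of_int k"
proof -
  interpret comm_ring_hom scalar2 by (rule comm_ring_hom_scalar2)
  show ?thesis by (rule hom_of_int)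
qed

lemma comm_ring_hom_left: "comm_ring_hom (\<lambda>p. tensor p 1)"
proof
  show "tensor (0::Lambda) 1 = 0"
    using tensor_add_left[of 0 0 1] by simp
qed (simp_all add: tensor_1 tensor_add_left tensor_mult)

lemma comm_ring_hom_right: "comm_ring_hom (\<lambda>p. tensor 1 p)"
proof
  show "tensor 1 (0::Lambda) = 0"
    using tensor_add_right[of 1 0 0] by simp
qed (simp_all add: tensor_1 tensor_add_right tensor_mult)

lemma tensor_split: "tensor p q = tensor p 1 * tensor 1 q"
  by (simp add: tensor_mult)

subsection \<open>Bilinear functionals\<close>

definition free_bilinear :: "(Lambda \<Rightarrow> Qa) \<Rightarrow> (Lambda \<Rightarrow> Qa) \<Rightarrow> (pair \<Rightarrow>\<^sub>0 Qa) \<Rightarrow> Qa" where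
  "free_bilinear F G f = (\<Sum>k\<in>Poly_Mapping.keys f. Poly_Mapping.lookup f k * (F (left k) * G (right k)))"

lemma free_bilinear_superset:
  assumes "finite A" "Poly_Mapping.keys f \<subseteq> A"
  shows "free_bilinear F G f = (\<Sum>k\<in>A. Poly_Mapping.lookup f k * (F (left k) * G (right k)))"
  unfolding free_bilinear_def using assms
  by (intro sum.mono_neutral_left) (auto simp: in_keys_iff)

lemma free_bilinear_add: "free_bilinear F G (f + g) = free_bilinear F G f + free_bilinear F G g"
proof -
  let ?A = "Poly_Mapping.keys f \<union> Poly_Mapping.keys g"
  have "Poly_Mapping.keys (f + g) \<subseteq> ?A" by (rule keys_add)
  then show ?thesis
    by (simp add: free_bilinear_superset[of ?A] lookup_add sum.distrib distrib_right)
qed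

lemma free_bilinear_diff: "free_bilinear F G (f - g) = free_bilinear F G f - free_bilinear F G g"
  using free_bilinear_add[of F G "f - g" g] by simp

lemma free_bilinear_scale: "free_bilinear F G (free_scale c f) = c * free_bilinear F G f"
proof -
  have "Poly_Mapping.keys (free_scale c f) \<subseteq> Poly_Mapping.keys f"
    by (auto simp: in_keys_iff free_scale_def map.rep_eq when_def)
  then show ?thesis
    by (simp add: free_bilinear_superset[of "Poly_Mapping.keys f"] free_scale_def map.rep_eq
        sum_distrib_left mult.assoc when_def in_keys_iff cong: if_cong)
qed

lemma free_bilinear_tensor: "free_bilinear F G (free_tensor p q) = F p * G q"
  by (simp add: free_bilinear_def free_tensor_def)

lemma free_bilinear_tensor_eq:
  assumes "\<And>p q. F (p + q) = F p + F q" "\<And>c p. F (scale_Lambda c p) = c * F p"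
    and "\<And>p q. G (p + q) = G p + G q" "\<And>c p. G (scale_Lambda c p) = c * G p"
    and "tensor_eq f g"
  shows "free_bilinear F G f = free_bilinear F G g"
proof -
  have rel: "free_bilinear F G r = 0" if "r \<in> bilinearity_relations" for r
  proof -
    have "(\<exists>p p' q. r = free_tensor (p + p') q - free_tensor p q - free_tensor p' q) \<or>
        (\<exists>p q q'. r = free_tensor p (q + q') - free_tensor p q - free_tensor p q') \<or>
        (\<exists>c p q. r = free_tensor (scale_Lambda c p) q - free_scale c (free_tensor p q)) \<or>
        (\<exists>c p q. r = free_tensor p (scale_Lambda c q) - free_scale c (free_tensor p q))"
      using that unfolding bilinearity_relations_def by blast
    then show ?thesis
      by (elim disjE exE) (simp_all only: free_bilinear_diff free_bilinear_scale free_bilinear_tensor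
          assms(1-4), simp_all add: algebra_simps)
  qed
  have "free_bilinear F G r = 0" if "r \<in> free_module.span bilinearity_relations" for r
    using that by (induction rule: free_module.span_induct_alt)
      (auto simp: free_bilinear_add free_bilinear_scale rel, simp add: free_bilinear_def)
  then have "free_bilinear F G (f - g) = 0" using assms(5) by (simp add: tensor_eq_def)
  then show ?thesis by (simp add: free_bilinear_diff)
qed

text \<open>The tensor product of two \<rat>[a]-linear functionals annihilates the bilinearity
  relations and so descends to the quotient, where it separates tensors of basis elements.\<close>

lift_definition leading2 :: "nat \<Rightarrow> partition \<Rightarrow> partition \<Rightarrow> Lambda2 \<Rightarrow> Qa" is
  "\<lambda>n \<mu> \<nu>. free_bilinear (leading n \<mu>) (leading n \<nu>)"
  by (rule free_bilinear_tensor_eq) (simp_all add: leading_scale)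

lemma leading2_add: "leading2 n \<mu> \<nu> (x + y) = leading2 n \<mu> \<nu> x + leading2 n \<mu> \<nu> y"
  by transfer (rule free_bilinear_add)

lemma leading2_scale: "leading2 n \<mu> \<nu> (scale_Lambda2 c x) = c * leading2 n \<mu> \<nu> x"
  by transfer (rule free_bilinear_scale)

lemma leading2_tensor: "leading2 n \<mu> \<nu> (tensor p q) = leading n \<mu> p * leading n \<nu> q"
  by transfer (rule free_bilinear_tensor)

lemma leading2_0: "leading2 n \<mu> \<nu> 0 = 0"
  using leading2_add[of n \<mu> \<nu> 0 0] by simp

lemma leading2_sum: "leading2 n \<mu> \<nu> (sum f A) = (\<Sum>a\<in>A. leading2 n \<mu> \<nu> (f a))"
  by (induction A rule: infinite_finite_induct) (simp_all add: leading2_0 leading2_add)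

section \<open>The comultiplication\<close>

definition combination :: "(partition \<Rightarrow>\<^sub>0 Qa) \<Rightarrow> Lambda" where
  "combination c = (\<Sum>\<gamma>\<in>Poly_Mapping.keys c. scalar (Poly_Mapping.lookup c \<gamma>) * schurL \<gamma>)"

lemma combination_superset:
  "finite A \<Longrightarrow> Poly_Mapping.keys c \<subseteq> A \<Longrightarrow>
    combination c = (\<Sum>\<gamma>\<in>A. scalar (Poly_Mapping.lookup c \<gamma>) * schurL \<gamma>)"
  unfolding combination_def by (intro sum.mono_neutral_left) (auto simp: in_keys_iff)

lemma combination_surj: "\<exists>c. P = combination c"
proof -
  obtain D d where P: "P = (\<Sum>\<beta> | psize \<beta> \<le> D. scalar (d \<beta>) * schurL \<beta>)"
    using schurL_spans[of P] by blast
  define c where "c = Abs_poly_mapping (\<lambda>\<beta>. if psize \<beta> \<le> D then d \<beta> else 0)"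
  have c: "Poly_Mapping.lookup c = (\<lambda>\<beta>. if psize \<beta> \<le> D then d \<beta> else 0)"
    unfolding c_def by (rule lookup_Abs_poly_mapping) (rule finite_subset[OF _ finite_psize[of D]], auto)
  have "Poly_Mapping.keys c \<subseteq> {\<beta>. psize \<beta> \<le> D}" by (auto simp: in_keys_iff c split: if_splits)
  then have "combination c = P"
    unfolding P by (subst combination_superset[OF finite_psize]) (auto simp: c intro!: sum.cong)
  then show ?thesis by blast
qed

lemma combination_inj:
  assumes "combination c = combination d"
  shows "c = d"
proof (rule poly_mapping_eqI)
  fix \<gamma>
  define K where "K = insert \<gamma> (Poly_Mapping.keys c \<union> Poly_Mapping.keys d)"
  have K: "finite K" "Poly_Mapping.keys c \<subseteq> K" "Poly_Mapping.keys d \<subseteq> K" "\<gamma> \<in> K" by (auto simp: K_def)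
  interpret comm_ring_hom scalar by (rule comm_ring_hom_scalar)
  have "(\<Sum>\<gamma>\<in>K. scalar (Poly_Mapping.lookup c \<gamma> - Poly_Mapping.lookup d \<gamma>) * schurL \<gamma>) = combination c - combination d"
    using K by (simp add: combination_superset[of K] hom_minus left_diff_distrib sum_subtractf)
  then have *: "component (\<Sum>\<gamma>\<in>K. scalar (Poly_Mapping.lookup c \<gamma> - Poly_Mapping.lookup d \<gamma>) * schurL \<gamma>)
      (Max (length ` parts ` K)) = 0"
    using assms by simp
  have "length (parts \<gamma>) \<le> Max (length ` parts ` K)" if "\<gamma> \<in> K" for \<gamma>
    using K(1) that by simp
  from schurL_independent[OF K(1) this * K(4)]
  show "Poly_Mapping.lookup c \<gamma> = Poly_Mapping.lookup d \<gamma>" by simp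
qed

definition coords :: "Lambda \<Rightarrow> partition \<Rightarrow>\<^sub>0 Qa" where
  "coords P = (THE c. P = combination c)"

lemma coords_combination: "coords (combination c) = c"
  unfolding coords_def using combination_inj by (intro the_equality) auto

lemma combination_coords: "combination (coords P) = P"
  using combination_surj[of P] coords_combination by metis

section \<open>Existence and uniqueness of the comultiplication\<close>

definition h_left :: "Lambda2 fps" where
  "h_left = Abs_fps (\<lambda>r. tensor (complete r) 1)"

definition h_right :: "Lambda2 fps" where
  "h_right = Abs_fps (\<lambda>r. tensor 1 (complete r))"

lemma h_left_0 [simp]: "fps_nth h_left 0 = 1" "fps_nth h_right 0 = 1"
  by (simp_all add: h_left_def h_right_def tensor_1)

lemma schur_det_h_left: "schur_det h_left \<gamma> = tensor (schurL \<gamma>) 1"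
proof -
  interpret comm_ring_hom "\<lambda>p. tensor p 1" by (rule comm_ring_hom_left)
  show ?thesis unfolding schurL_def by (rule hom_schur_det[symmetric]) (simp add: h_left_def)
qed

lemma schur_det_h_right: "schur_det h_right \<gamma> = tensor 1 (schurL \<gamma>)"
proof -
  interpret comm_ring_hom "\<lambda>p. tensor 1 p" by (rule comm_ring_hom_right)
  show ?thesis unfolding schurL_def by (rule hom_schur_det[symmetric]) (simp add: h_right_def)
qed

text \<open>The prospective image of \<open>schurL \<gamma>\<close>: the same determinant in the
  product of the two copies of the complete series.\<close>

definition schur2 :: "partition \<Rightarrow> Lambda2" where
  "schur2 \<gamma> = schur_det (h_left * h_right) \<gamma>"

lemma schur2_expand:
  "schur2 \<gamma> = (\<Sum>\<alpha> | contained \<alpha> \<gamma>. \<Sum>\<beta> | contained \<beta> \<gamma>.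
     of_int (LR_coeff \<beta> \<alpha> \<gamma>) * tensor (schurL \<alpha>) (schurL \<beta>))"
  unfolding schur2_def schur_det_coproduct[OF h_left_0] schur_det_h_left schur_det_h_right
  by (simp add: mult.assoc flip: tensor_split)

text \<open>The linear extension of \<open>schurL \<gamma>\<close> \<mapsto>
  \<open>schur2 \<gamma>\<close>; linearity is built in, multiplicativity has to be proved.\<close>

definition comul :: "Lambda \<Rightarrow> Lambda2" where
  "comul P = (\<Sum>\<gamma>\<in>Poly_Mapping.keys (coords P). scalar2 (Poly_Mapping.lookup (coords P) \<gamma>) * schur2 \<gamma>)"

lemma comul_superset:
  "finite A \<Longrightarrow> Poly_Mapping.keys (coords P) \<subseteq> A \<Longrightarrow>
    comul P = (\<Sum>\<gamma>\<in>A. scalar2 (Poly_Mapping.lookup (coords P) \<gamma>) * schur2 \<gamma>)"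
  unfolding comul_def by (intro sum.mono_neutral_left) (auto simp: in_keys_iff)

lemma combination_add: "combination (c + d) = combination c + combination d"
proof -
  let ?A = "Poly_Mapping.keys c \<union> Poly_Mapping.keys d"
  have "Poly_Mapping.keys (c + d) \<subseteq> ?A" by (rule keys_add)
  then show ?thesis
    by (simp add: combination_superset[of ?A] lookup_add sum.distrib distrib_right)
qed

lemma combination_single: "combination (Poly_Mapping.single \<gamma> c) = scalar c * schurL \<gamma>"
  by (simp add: combination_def)

lemma coords_add: "coords (P + Q) = coords P + coords Q"
  using coords_combination[of "coords P + coords Q"] by (simp add: combination_add combination_coords)

lemma coords_single: "coords (scalar c * schurL \<gamma>) = Poly_Mapping.single \<gamma> c"
  using coords_combination[of "Poly_Mapping.single \<gamma> c"] by (simp add: combination_single)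

lemma comul_add: "comul (P + Q) = comul P + comul Q"
proof -
  let ?A = "Poly_Mapping.keys (coords P) \<union> Poly_Mapping.keys (coords Q)"
  have "Poly_Mapping.keys (coords (P + Q)) \<subseteq> ?A" unfolding coords_add by (rule keys_add)
  then show ?thesis
    by (simp add: comul_superset[of ?A] coords_add lookup_add sum.distrib distrib_right)
qed

lemma comul_single: "comul (scalar c * schurL \<gamma>) = scalar2 c * schur2 \<gamma>"
  by (simp add: comul_def coords_single)

lemma comul_0: "comul 0 = 0"
  using comul_add[of 0 0] by simp

lemma comul_sum: "comul (sum f A) = (\<Sum>a\<in>A. comul (f a))"
  by (induction A rule: infinite_finite_induct) (simp_all add: comul_0 comul_add)

lemma complete_series_0: "fps_nth complete_series 0 = 1"
  by simp

text \<open>The families \<open>schurL\<close> and \<open>schur2\<close> are both Jacobi--Trudi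
  determinants of a series with constant term 1, hence have the same structure constants
  \<open>LR_coeff\<close>.\<close>

lemma comul_mult_schurL: "comul (scalar c * schurL \<alpha> * (scalar d * schurL \<beta>)) =
    scalar2 c * schur2 \<alpha> * (scalar2 d * schur2 \<beta>)"
proof -
  let ?K = "{\<sigma>. LR_coeff \<alpha> \<beta> \<sigma> \<noteq> 0}"
  have "scalar c * schurL \<alpha> * (scalar d * schurL \<beta>) = scalar (c * d) * (schurL \<alpha> * schurL \<beta>)"
    by (simp add: mult_ac)
  also have "\<dots> = (\<Sum>\<sigma>\<in>?K. scalar (c * d * of_int (LR_coeff \<alpha> \<beta> \<sigma>)) * schurL \<sigma>)"
    unfolding schurL_def schur_det_product[OF complete_series_0] sum_distrib_left
    by (simp add: scalar_of_int mult.assoc)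
  finally have "comul (scalar c * schurL \<alpha> * (scalar d * schurL \<beta>)) =
      (\<Sum>\<sigma>\<in>?K. scalar2 (c * d * of_int (LR_coeff \<alpha> \<beta> \<sigma>)) * schur2 \<sigma>)"
    by (simp only: comul_sum comul_single)
  also have "\<dots> = scalar2 (c * d) * (\<Sum>\<sigma>\<in>?K. of_int (LR_coeff \<alpha> \<beta> \<sigma>) * schur2 \<sigma>)"
    by (simp add: sum_distrib_left scalar2_of_int mult.assoc)
  also have "(\<Sum>\<sigma>\<in>?K. of_int (LR_coeff \<alpha> \<beta> \<sigma>) * schur2 \<sigma>) = schur2 \<alpha> * schur2 \<beta>"
    unfolding schur2_def by (rule schur_det_product[symmetric]) simp
  finally show ?thesis by (simp add: mult_ac)
qed

lemma comul_mult: "comul (P * Q) = comul P * comul Q"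
proof -
  have P: "P = (\<Sum>\<gamma>\<in>Poly_Mapping.keys (coords P). scalar (Poly_Mapping.lookup (coords P) \<gamma>) * schurL \<gamma>)" for P
    using combination_coords[of P] by (simp add: combination_def)
  have "comul (P * Q) = comul ((\<Sum>\<gamma>\<in>Poly_Mapping.keys (coords P). scalar (Poly_Mapping.lookup (coords P) \<gamma>) * schurL \<gamma>) *
      (\<Sum>\<gamma>\<in>Poly_Mapping.keys (coords Q). scalar (Poly_Mapping.lookup (coords Q) \<gamma>) * schurL \<gamma>))"
    by (rule arg_cong2[of _ _ _ _ "\<lambda>P Q. comul (P * Q)"]) (rule P)+
  also have "\<dots> = comul P * comul Q"
    unfolding sum_product comul_sum comul_mult_schurL
    by (simp add: comul_def sum_product)
  finally show ?thesis .
qed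

lemma schur_det_empty: "schur_det H empty_partition = 1"
  by (simp add: schur_det_def minor_def)

lemma comul_scalar: "comul (scalar c) = scalar2 c"
  using comul_single[of c empty_partition] by (simp add: schurL_def schur2_def schur_det_empty)

lemma ex_row_partition: "\<exists>\<gamma>. length (parts \<gamma>) \<le> Suc 0 \<and> part \<gamma> (Suc 0) = r"
proof -
  have "\<exists>\<gamma>. length (parts \<gamma>) \<le> Suc 0 \<and> (\<forall>i. part \<gamma> (Suc i) = (if i = 0 then r else 0))"
    by (rule ex_partition) auto
  then obtain \<gamma> where "length (parts \<gamma>) \<le> Suc 0" "\<And>i. part \<gamma> (Suc i) = (if i = 0 then r else 0)" by blast
  then show ?thesis by (intro exI[of _ \<gamma>]) simp
qed

text \<open>One-row shapes give the coefficients of the series itself; through them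
  \<open>comul\<close> becomes known on \<open>complete r\<close>.\<close>

lemma schur_det_row:
  assumes "length (parts \<gamma>) \<le> Suc 0" "fps_nth H 0 = 1"
  shows "schur_det H \<gamma> = fps_nth H (part \<gamma> (Suc 0))"
proof -
  have "schur_det H \<gamma> = minor (Suc 0) (toeplitz H) \<gamma> empty_partition"
    using assms by (intro schur_det_eq[symmetric])
  also have "\<dots> = toeplitz H (part \<gamma> (Suc 0)) 0"
    unfolding minor_def by (subst dt_upper_triangular) (simp_all add: pos_def)
  finally show ?thesis by (simp add: row_series_def)
qed

lemma comul_complete: "comul (complete r) = fps_nth (h_left * h_right) r"
proof -
  obtain \<gamma> where \<gamma>: "length (parts \<gamma>) \<le> Suc 0" "part \<gamma> (Suc 0) = r" using ex_row_partition by blast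
  have "comul (schurL \<gamma>) = schur2 \<gamma>" using comul_single[of 1 \<gamma>] by simp
  moreover have "schurL \<gamma> = complete r" unfolding schurL_def by (subst schur_det_row) (simp_all add: \<gamma>)
  moreover have "schur2 \<gamma> = fps_nth (h_left * h_right) r" unfolding schur2_def by (subst schur_det_row) (simp_all add: \<gamma>)
  ultimately show ?thesis by simp
qed

lemma has_log_deriv_hom:
  assumes "comm_ring_hom \<phi>" "has_log_deriv F P" "\<And>r. fps_nth G r = \<phi> (fps_nth F r)"
    "\<And>r. fps_nth Q r = \<phi> (fps_nth P r)"
  shows "has_log_deriv G Q"
proof -
  interpret comm_ring_hom \<phi> by (rule assms(1))
  show ?thesis
    unfolding has_log_deriv_iff
  proof
    fix r
    have "\<phi> (of_nat (Suc r) * fps_nth F (Suc r)) = \<phi> (\<Sum>k\<le>r. fps_nth P k * fps_nth F (r - k))"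
      using assms(2) unfolding has_log_deriv_iff by simp
    then show "of_nat (Suc r) * fps_nth G (Suc r) = (\<Sum>k\<le>r. fps_nth Q k * fps_nth G (r - k))"
      by (simp only: hom_mult hom_sum hom_of_nat assms(3,4))
  qed
qed

definition power2 :: "nat \<Rightarrow> Lambda2" where
  "power2 k = tensor (power_sum k) 1 + tensor 1 (power_sum k)"

lemma has_log_deriv_h2: "has_log_deriv (h_left * h_right) (Abs_fps (\<lambda>k. power2 (Suc k)))"
proof -
  have "has_log_deriv (h_left * h_right)
      (Abs_fps (\<lambda>k. tensor (power_sum (Suc k)) 1) + Abs_fps (\<lambda>k. tensor 1 (power_sum (Suc k))))"
    by (intro has_log_deriv_mult has_log_deriv_hom[OF comm_ring_hom_left has_log_deriv_complete]
        has_log_deriv_hom[OF comm_ring_hom_right has_log_deriv_complete])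
      (simp_all add: h_left_def h_right_def)
  also have "Abs_fps (\<lambda>k. tensor (power_sum (Suc k)) 1) + Abs_fps (\<lambda>k. tensor 1 (power_sum (Suc k))) =
      Abs_fps (\<lambda>k. power2 (Suc k))"
    by (rule fps_ext) (simp add: power2_def)
  finally show ?thesis .
qed

text \<open>Newton's identity holds for the complete functions and, since logarithmic derivatives
  add, for their images with \<open>power2\<close>. The term k = r is isolated by h_0 = 1, and the
  other terms agree by induction.\<close>

lemma comul_power_sum: "comul (power_sum (Suc r)) = power2 (Suc r)"
proof (induction r rule: less_induct)
  case (less r)
  let ?h = "fps_nth (h_left * h_right)"
  have sum: "(\<Sum>k\<le>r. f k) = f r + (\<Sum>k<r. f k)" for f :: "nat \<Rightarrow> Lambda2"
    by (simp flip: lessThan_Suc_atMost)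
  have cn: "comul (of_nat k) = of_nat k" for k
  proof -
    interpret s: comm_ring_hom scalar by (rule comm_ring_hom_scalar)
    interpret s2: comm_ring_hom scalar2 by (rule comm_ring_hom_scalar2)
    show ?thesis using comul_scalar[of "of_nat k"] by (simp add: s.hom_of_nat s2.hom_of_nat)
  qed
  have "comul (of_nat (Suc r) * complete (Suc r)) = comul (\<Sum>k\<le>r. power_sum (Suc k) * complete (r - k))"
    by (simp only: newton)
  then have "of_nat (Suc r) * ?h (Suc r) = (\<Sum>k\<le>r. comul (power_sum (Suc k)) * ?h (r - k))"
    by (simp only: comul_mult comul_sum comul_complete cn)
  also have "\<dots> = comul (power_sum (Suc r)) + (\<Sum>k<r. power2 (Suc k) * ?h (r - k))"
    unfolding sum using less by simp
  finally have 1: "of_nat (Suc r) * ?h (Suc r) = comul (power_sum (Suc r)) + (\<Sum>k<r. power2 (Suc k) * ?h (r - k))" .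
  have "of_nat (Suc r) * ?h (Suc r) = (\<Sum>k\<le>r. power2 (Suc k) * ?h (r - k))"
    using has_log_deriv_h2 unfolding has_log_deriv_iff by simp
  also have "\<dots> = power2 (Suc r) + (\<Sum>k<r. power2 (Suc k) * ?h (r - k))"
    unfolding sum by simp
  finally show ?case using 1 by simp
qed

lemma is_comultiplication_comul: "is_comultiplication comul"
  unfolding is_comultiplication_def
proof (intro conjI allI impI)
  show "comul 1 = 1" using comul_scalar[of 1] by simp
  show "comul (scale_Lambda c p) = scale_Lambda2 c (comul p)" for c p
    by (simp only: scale_Lambda_scalar scale_Lambda2_scalar2 comul_mult comul_scalar)
  show "comul (power_sum k) = tensor (power_sum k) 1 + tensor 1 (power_sum k)" if "1 \<le> k" for k
    using comul_power_sum[of "k - 1"] that by (simp add: power2_def)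
qed (simp_all only: comul_add comul_mult)

text \<open>The values on power sums determine those on the complete functions through Newton's
  recursion, then those on the determinants \<open>schurL\<close>, which span.\<close>

lemma is_comultiplication_unique:
  assumes "is_comultiplication D"
  shows "D = comul"
proof -
  have D: "D 1 = 1" "\<And>p q. D (p + q) = D p + D q" "\<And>p q. D (p * q) = D p * D q"
    "\<And>c p. D (scale_Lambda c p) = scale_Lambda2 c (D p)"
    "\<And>k. D (power_sum (Suc k)) = power2 (Suc k)"
    using assms unfolding is_comultiplication_def power2_def by auto
  have D0: "D 0 = 0" using D(2)[of 0 0] by simp
  interpret comm_ring_hom D by unfold_locales (simp_all add: D D0)
  have complete: "D (complete r) = comul (complete r)" for r
  proof (induction r rule: less_induct)
    case (less r)
    show ?case
    proof (cases r)
      case 0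
      then show ?thesis using D(1) is_comultiplication_comul by (simp add: is_comultiplication_def)
    next
      case (Suc s)
      have comul_scale: "comul (scale_Lambda c p) = scale_Lambda2 c (comul p)" for c p
        using is_comultiplication_comul unfolding is_comultiplication_def by blast
      have "D (power_sum (Suc k) * complete (s - k)) = comul (power_sum (Suc k) * complete (s - k))" for k
        unfolding D(3,5) comul_mult comul_power_sum using less Suc by simp
      then show ?thesis unfolding Suc complete.simps(2) D(4) comul_scale hom_sum comul_sum by simp
    qed
  qed
  have "D (schurL \<gamma>) = schur2 \<gamma>" for \<gamma>
    unfolding schurL_def schur2_def by (rule hom_schur_det) (simp add: complete comul_complete)
  then have single: "D (scalar c * schurL \<gamma>) = comul (scalar c * schurL \<gamma>)" for c \<gamma>
    unfolding comul_single by (simp flip: scale_Lambda_scalar scale_Lambda2_scalar2 add: D(4))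
  show ?thesis
  proof
    fix P
    have "D (combination (coords P)) = comul (combination (coords P))"
      unfolding combination_def hom_sum comul_sum single ..
    then show "D P = comul P" by (simp add: combination_coords)
  qed
qed

theorem comultiplication_eq: "comultiplication = comul"
  unfolding comultiplication_def using is_comultiplication_comul is_comultiplication_unique
  by (rule the_equality)

theorem comultiplication_schurL: "comultiplication (scalar c * schurL \<gamma>) =
    (\<Sum>\<alpha> | contained \<alpha> \<gamma>. \<Sum>\<beta> | contained \<beta> \<gamma>.
     scale_Lambda2 (c * of_int (LR_coeff \<beta> \<alpha> \<gamma>)) (tensor (schurL \<alpha>) (schurL \<beta>)))"
  unfolding comultiplication_eq comul_single schur2_expand scale_Lambda2_scalar2
  by (simp add: sum_distrib_left scalar2_of_int mult.assoc)

section \<open>Transition matrices\<close>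

definition e_kernel :: "(nat \<Rightarrow> 'a::comm_ring_1) \<Rightarrow> nat \<Rightarrow> nat \<Rightarrow> 'a" where
  "e_kernel c x y = (if y \<le> x then fps_nth (\<Prod>k<x. linfac (c k)) (x - y) else 0)"

definition h_kernel :: "(nat \<Rightarrow> 'a::comm_ring_1) \<Rightarrow> nat \<Rightarrow> nat \<Rightarrow> 'a" where
  "h_kernel c x y = (if y \<le> x then fps_nth (\<Prod>k<Suc y. geo (c k)) (x - y) else 0)"

text \<open>Compares coefficients of z^y when (z - c_0)\<cdots>(z - c_(p-1)) is multiplied by the
  next factor z - c_p.\<close>

lemma e_kernel_Suc:
  "e_kernel c (Suc p) y = (if y = 0 then 0 else e_kernel c p (y - 1)) - c p * e_kernel c p y"
proof -
  let ?F = "\<Prod>k<p. linfac (c k)"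
  have F: "fps_nth ?F (Suc p) = 0" by (rule linfac_prod_nth) auto
  have 0: "fps_nth (linfac (c p)) 0 = 1" by (simp add: linfac_def)
  consider "y = 0" | "0 < y" "y \<le> p" | "y = Suc p" | "y > Suc p" by linarith
  then show ?thesis
    by cases (simp_all add: e_kernel_def linfac_nth mult.commute[of _ "linfac _"] F 0 Suc_diff_le)
qed

lemma geo_nth_Suc: "fps_nth (F * geo x) (Suc r) = fps_nth F (Suc r) + x * fps_nth (F * geo x) r"
proof -
  have "F = linfac x * (F * geo x)" by (simp add: mult.left_commute)
  then have "fps_nth F (Suc r) = fps_nth (linfac x * (F * geo x)) (Suc r)" by simp
  then show ?thesis unfolding linfac_nth by simp
qed

text \<open>Multiplies the expansion of z^x by z, using that z times the product of the z - c_k with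
  k < y is the next product plus c_y times the given one.\<close>

lemma h_kernel_Suc:
  "h_kernel c (Suc x) y = (if y = 0 then 0 else h_kernel c x (y - 1)) + c y * h_kernel c x y"
proof -
  consider "y = 0" | "0 < y" "y \<le> x" | "y = Suc x" | "y > Suc x" by linarith
  then show ?thesis
  proof cases
    case 1
    then show ?thesis using geo_nth_Suc[of 1 "c 0" x] by (simp add: h_kernel_def)
  next
    case 2
    let ?F = "\<Prod>k<y. geo (c k)"
    have "h_kernel c (Suc x) y = fps_nth (?F * geo (c y)) (Suc (x - y))"
      using 2 by (simp add: h_kernel_def Suc_diff_le)
    also have "\<dots> = fps_nth ?F (Suc (x - y)) + c y * fps_nth (?F * geo (c y)) (x - y)"
      by (rule geo_nth_Suc)
    finally show ?thesis using 2 by (simp add: h_kernel_def Suc_diff_le)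
  next
    case 3
    have "fps_nth (\<Prod>k<m. geo (c k)) 0 = 1" for m using eta_0[of m c] by (simp add: eta_def)
    then show ?thesis using 3 by (simp add: h_kernel_def del: prod.lessThan_Suc)
  next
    case 4
    then show ?thesis by (simp add: h_kernel_def)
  qed
qed

text \<open>Both kernels are transition matrices between the powers \<open>z\<^sup>x\<close> and the products
  \<open>(z - c\<^sub>0)\<cdots>(z - c\<^bsub>x-1\<^esub>)\<close>, hence mutually inverse.\<close>

lemma h_kernel_e_kernel: "(\<Sum>p\<le>x. h_kernel c x p * e_kernel c p y) = (if x = y then 1 else 0)"
proof (induction x arbitrary: y)
  case 0
  show ?case by (simp add: h_kernel_def e_kernel_def geo_def)
next
  case (Suc x)
  have top: "h_kernel c x (Suc x) = 0" by (simp add: h_kernel_def)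
  have "(\<Sum>p\<le>Suc x. h_kernel c (Suc x) p * e_kernel c p y) =
      (\<Sum>p\<le>Suc x. (if p = 0 then 0 else h_kernel c x (p - 1)) * e_kernel c p y) +
      (\<Sum>p\<le>Suc x. c p * h_kernel c x p * e_kernel c p y)"
    unfolding h_kernel_Suc by (simp only: distrib_right sum.distrib)
  also have "(\<Sum>p\<le>Suc x. (if p = 0 then 0 else h_kernel c x (p - 1)) * e_kernel c p y) =
      (\<Sum>p\<le>x. h_kernel c x p * e_kernel c (Suc p) y)"
    by (subst sum.atMost_Suc_shift) simp
  \<comment> \<open>The terms with \<open>c p\<close> that the two recursions produce are the same
    up to sign and cancel.\<close>
  also have "\<dots> = (\<Sum>p\<le>x. h_kernel c x p * (if y = 0 then 0 else e_kernel c p (y - 1))) -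
      (\<Sum>p\<le>x. c p * h_kernel c x p * e_kernel c p y)"
    unfolding e_kernel_Suc by (simp add: right_diff_distrib sum_subtractf mult_ac)
  also have "(\<Sum>p\<le>Suc x. c p * h_kernel c x p * e_kernel c p y) = (\<Sum>p\<le>x. c p * h_kernel c x p * e_kernel c p y)"
    by (simp add: top)
  finally have "(\<Sum>p\<le>Suc x. h_kernel c (Suc x) p * e_kernel c p y) =
      (\<Sum>p\<le>x. h_kernel c x p * (if y = 0 then 0 else e_kernel c p (y - 1)))" by simp
  then show ?case using Suc.IH[of "y - 1"] by (cases y) auto
qed

text \<open>Block diagonal, split at the exponent n. In the lower block the coordinate n - 1 - a
  decreases as a increases; interchanging the arguments of \<open>V\<close> keeps the matrix lower
  triangular.\<close>

definition hook_kernel :: "nat \<Rightarrow> (nat \<Rightarrow> nat \<Rightarrow> 'a::comm_ring_1) \<Rightarrow> (nat \<Rightarrow> nat \<Rightarrow> 'a) \<Rightarrow> nat \<Rightarrow> nat \<Rightarrow> 'a" where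
  "hook_kernel n U V a b =
     (if n \<le> a \<and> n \<le> b then U (a - n) (b - n) else if a < n \<and> b < n then V (n - 1 - b) (n - 1 - a) else 0)"

definition a_up :: "nat \<Rightarrow> Qa" where
  "a_up t = avar (- int t)"

definition a_low :: "nat \<Rightarrow> Qa" where
  "a_low t = avar (int t + 1)"

definition to_schur :: "nat \<Rightarrow> nat \<Rightarrow> nat \<Rightarrow> Qa" where
  "to_schur n = hook_kernel n (e_kernel a_up) (h_kernel a_low)"

definition from_schur :: "nat \<Rightarrow> nat \<Rightarrow> nat \<Rightarrow> Qa" where
  "from_schur n = hook_kernel n (h_kernel a_up) (e_kernel a_low)"

lemma hook_kernel_upper:
  "(\<And>x y. x < y \<Longrightarrow> U x y = 0) \<Longrightarrow> (\<And>x y. x < y \<Longrightarrow> V x y = 0) \<Longrightarrow> a < b \<Longrightarrow> hook_kernel n U V a b = 0"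
  by (simp add: hook_kernel_def)

lemma kernel_upper: "x < y \<Longrightarrow> e_kernel c x y = 0" "x < y \<Longrightarrow> h_kernel c x y = 0"
  by (simp_all add: e_kernel_def h_kernel_def)

lemma kernel_diagonal: "e_kernel c x x = 1" "h_kernel c x x = 1"
proof -
  have "fps_nth (\<Prod>k<m. geo (c k)) 0 = 1" for m using eta_0[of m c] by (simp add: eta_def)
  then show "e_kernel c x x = 1" "h_kernel c x x = 1"
    by (simp_all add: e_kernel_def h_kernel_def del: prod.lessThan_Suc)
qed

lemma schur_upper: "a < b \<Longrightarrow> to_schur n a b = 0" "a < b \<Longrightarrow> from_schur n a b = 0"
  unfolding to_schur_def from_schur_def by (rule hook_kernel_upper; simp add: kernel_upper)+

lemma schur_diagonal: "to_schur n a a = 1" "from_schur n a a = 1"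
  by (simp_all add: to_schur_def from_schur_def hook_kernel_def kernel_diagonal not_le)

text \<open>The kernels are inverse in each block. In the lower one the transposition reverses the
  order of the factors, so \<open>h_kernel\<close> again stands before
  \<open>e_kernel\<close>.\<close>

lemma from_to_schur: "(\<Sum>p\<le>a. from_schur n a p * to_schur n p b) = (if a = b then 1 else 0)"
proof (cases "n \<le> a")
  case True
  show ?thesis
  proof (cases "n \<le> b")
    case b: True
    have "(\<Sum>p\<le>a. from_schur n a p * to_schur n p b) =
        (\<Sum>p\<in>{n..a}. h_kernel a_up (a - n) (p - n) * e_kernel a_up (p - n) (b - n))"
      by (rule sum.mono_neutral_cong_right)
        (use True b in \<open>auto simp: from_schur_def to_schur_def hook_kernel_def\<close>)
    also have "\<dots> = (\<Sum>p\<le>a - n. h_kernel a_up (a - n) p * e_kernel a_up p (b - n))"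
      by (rule sum.reindex_bij_witness[of _ "\<lambda>p. p + n" "\<lambda>p. p - n"]) (use True in auto)
    finally show ?thesis using True b by (auto simp: h_kernel_e_kernel)
  next
    case False
    have "(\<Sum>p\<le>a. from_schur n a p * to_schur n p b) = 0"
      by (rule sum.neutral) (use True False in \<open>auto simp: from_schur_def to_schur_def hook_kernel_def\<close>)
    then show ?thesis using True False by simp
  qed
next
  case False
  show ?thesis
  proof (cases "n \<le> b")
    case True
    have "(\<Sum>p\<le>a. from_schur n a p * to_schur n p b) = 0"
      by (rule sum.neutral) (use True False in \<open>auto simp: from_schur_def to_schur_def hook_kernel_def\<close>)
    then show ?thesis using True False by simp
  next
    case b: False
    let ?x = "n - 1 - b" and ?y = "n - 1 - a"
    have "(\<Sum>p\<le>a. from_schur n a p * to_schur n p b) =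
        (\<Sum>p\<le>a. e_kernel a_low (n - 1 - p) ?y * h_kernel a_low ?x (n - 1 - p))"
      by (intro sum.cong) (use False b in \<open>auto simp: from_schur_def to_schur_def hook_kernel_def\<close>)
    also have "\<dots> = (\<Sum>q\<in>{?y..n - 1}. e_kernel a_low q ?y * h_kernel a_low ?x q)"
      by (rule sum.reindex_bij_witness[of _ "\<lambda>q. n - 1 - q" "\<lambda>p. n - 1 - p"]) (use False in auto)
    also have "\<dots> = (\<Sum>q\<le>n - 1. h_kernel a_low ?x q * e_kernel a_low q ?y)"
      by (rule sum.mono_neutral_cong_left) (auto simp: kernel_upper mult.commute)
    also have "\<dots> = (\<Sum>q\<le>?x. h_kernel a_low ?x q * e_kernel a_low q ?y)"
      by (rule sum.mono_neutral_right) (auto simp: kernel_upper)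
    finally show ?thesis using False b by (auto simp: h_kernel_e_kernel)
  qed
qed

definition schur_row :: "nat \<Rightarrow> nat \<Rightarrow> Qa fps" where
  "schur_row n a = (if n \<le> a then \<Prod>k<a - n. linfac (a_up k) else \<Prod>k<n - a. geo (a_low k))"

text \<open>The zero block needs the argument: for b < n \<le> a the series of row a is a polynomial
  of degree at most a - n < a - b.\<close>

lemma to_schur_row_series: "to_schur n = row_series (schur_row n)"
proof (intro ext)
  fix a b
  consider "a < b" | "b \<le> a" "n \<le> b" | "b < n" "n \<le> a" | "b \<le> a" "a < n" by linarith
  then show "to_schur n a b = row_series (schur_row n) a b"
  proof cases
    case 1
    then show ?thesis by (simp add: schur_upper)
  next
    case 2
    then have "a - n - (b - n) = a - b" by simp
    then show ?thesis using 2 by (simp add: to_schur_def hook_kernel_def e_kernel_def row_series_def schur_row_def)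
  next
    case 3
    then have "fps_nth (\<Prod>k<a - n. linfac (a_up k)) (a - b) = 0" by (intro linfac_prod_nth) auto
    then show ?thesis using 3 by (simp add: to_schur_def hook_kernel_def row_series_def schur_row_def)
  next
    case 4
    then have "n - 1 - b - (n - 1 - a) = a - b" "Suc (n - 1 - a) = n - a" by simp_all
    then show ?thesis
      using 4 by (simp add: to_schur_def hook_kernel_def h_kernel_def row_series_def schur_row_def del: prod.lessThan_Suc)
  qed
qed

text \<open>The right side is the reversed double power with exponent a. For a \<ge> n it contains
  all n factors of \<open>abar n\<close>; for a < n the inverse factors in \<open>schur_row\<close>
  cancel those of a_1, ..., a_(n-a) in \<open>abar n\<close>.\<close>

lemma schur_row_abar: "schur_row n a * abar n = (\<Prod>k<a. linfac (avar (int n - int k)))"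
proof (cases "n \<le> a")
  case True
  have "(\<Prod>k<a. linfac (avar (int n - int k))) =
      (\<Prod>k<n. linfac (avar (int n - int k))) * (\<Prod>k\<in>{n..<a}. linfac (avar (int n - int k)))"
    using True by (subst prod.union_disjoint[symmetric]) (auto intro!: prod.cong)
  also have "(\<Prod>k<n. linfac (avar (int n - int k))) = abar n"
    unfolding abar_def by (rule prod.reindex_bij_witness[of _ "\<lambda>k. n - 1 - k" "\<lambda>k. n - 1 - k"])
      (auto simp: of_nat_diff)
  also have "(\<Prod>k\<in>{n..<a}. linfac (avar (int n - int k))) = (\<Prod>k<a - n. linfac (a_up k))"
    by (rule prod.reindex_bij_witness[of _ "\<lambda>k. k + n" "\<lambda>k. k - n"]) (auto simp: a_up_def of_nat_diff)
  finally show ?thesis using True by (simp add: schur_row_def mult.commute)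
next
  case False
  have "abar n = (\<Prod>k<n - a. linfac (a_low k)) * (\<Prod>k\<in>{n - a..<n}. linfac (a_low k))"
    unfolding abar_def
    by (subst prod.union_disjoint[symmetric]) (auto simp: a_low_def add.commute intro!: prod.cong)
  moreover have "(\<Prod>k<n - a. geo (a_low k)) * (\<Prod>k<n - a. linfac (a_low k)) = 1"
    by (simp flip: prod.distrib)
  ultimately have "schur_row n a * abar n = (\<Prod>k\<in>{n - a..<n}. linfac (a_low k))"
    using False by (simp add: schur_row_def mult.assoc[symmetric])
  also have "\<dots> = (\<Prod>k<a. linfac (avar (int n - int k)))"
    by (rule prod.reindex_bij_witness[of _ "\<lambda>k. n - 1 - k" "\<lambda>k. n - 1 - k"])
      (use False in \<open>auto simp: a_low_def of_nat_diff add.commute\<close>)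
  finally show ?thesis .
qed

section \<open>Double Schur functions\<close>

lemma double_power_expand:
  assumes "r < L"
  shows "double_power n i r =
    (\<Sum>p<L. row_series (\<lambda>a. \<Prod>k<a. linfac (mconst (avar (int n - int k)))) r p * mvar i ^ p)"
proof -
  let ?F = "\<Prod>k<r. linfac (mconst (avar (int n - int k)) :: Qax)"
  have "double_power n i r = (\<Sum>s\<le>r. fps_nth ?F s * mvar i ^ (r - s))"
    unfolding double_power_def by (subst prod_diff_expand) auto
  also have "\<dots> = (\<Sum>p\<le>r. fps_nth ?F (r - p) * mvar i ^ p)"
    by (rule sum.reindex_bij_witness[of _ "\<lambda>p. r - p" "\<lambda>s. r - s"]) auto
  also have "\<dots> = (\<Sum>p<L. row_series (\<lambda>a. \<Prod>k<a. linfac (mconst (avar (int n - int k)))) r p * mvar i ^ p)"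
    by (rule sum.mono_neutral_cong_left) (use assms in \<open>auto simp: row_series_def\<close>)
  finally show ?thesis .
qed

text \<open>The coefficient series of the double powers factor as \<open>R a * abarx n\<close>.
  Cauchy--Binet expands the alternant in ordinary Schur polynomials; regrouping (R
  \<open>abarx\<close>) \<open>eta\<close> as R (\<open>abarx\<close> \<open>eta\<close>) and
  splitting again puts the elements \<open>schurL\<close> in their place.\<close>

lemma double_alternant:
  assumes "length (parts \<nu>) \<le> n"
  shows "dt n (\<lambda>i k. double_power n (Suc k) (pos n \<nu> i)) =
    (\<Sum>\<gamma> | contained \<gamma> \<nu>. mconst (minor n (to_schur n) \<nu> \<gamma>) * component (schurL \<gamma>) n) * vandermonde n"
proof -
  interpret comm_ring_hom "mconst :: Qa \<Rightarrow> Qax" by (rule comm_ring_hom_mconst)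
  define C where "C = row_series (\<lambda>a. \<Prod>k<a. linfac (mconst (avar (int n - int k)) :: Qax))"
  define R where "R a = Abs_fps (\<lambda>r. mconst (fps_nth (schur_row n a) r) :: Qax)" for a
  have C0: "C a b = 0" if "a < b" for a b using that by (simp add: C_def)
  have C: "C = row_series (\<lambda>a. R a * abarx n)"
  proof -
    have "(\<Prod>k<a. linfac (mconst (avar (int n - int k)) :: Qax)) = R a * abarx n" for a
    proof (rule fps_ext)
      fix r
      have "fps_nth (\<Prod>k<a. linfac (mconst (avar (int n - int k)) :: Qax)) r =
          mconst (fps_nth (schur_row n a * abar n) r)"
        unfolding schur_row_abar hom_prod_linfac ..
      then show "fps_nth (\<Prod>k<a. linfac (mconst (avar (int n - int k)) :: Qax)) r = fps_nth (R a * abarx n) r"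
        by (simp add: fps_mult_nth hom_sum hom_mult abarx_nth R_def)
    qed
    then show ?thesis by (simp add: C_def)
  qed
  have len: "length (parts \<beta>) \<le> n" if "contained \<beta> \<nu>" for \<beta>
    using contained_length[OF that] assms by simp
  define L where "L = part \<nu> (Suc 0) + n"
  have L: "pos n \<nu> i < L" if "i < n" for i using pos_less[OF that] by (simp add: L_def)
  have "dt n (\<lambda>i k. double_power n (Suc k) (pos n \<nu> i)) = dt n (\<lambda>i k. \<Sum>p<L. C (pos n \<nu> i) p * xv k ^ p)"
    unfolding C_def by (rule dt_cong) (rule double_power_expand[OF L])
  also have "\<dots> = (\<Sum>\<beta>\<in>parts_below n L. minor n C \<nu> \<beta> * alt n (pos n \<beta>))"
    unfolding cauchy_binet minor_def alt_def ..
  also have "\<dots> = (\<Sum>\<beta> | contained \<beta> \<nu>. minor n C \<nu> \<beta> * alt n (pos n \<beta>))"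
  proof (rule sum.mono_neutral_right)
    show "{\<beta>. contained \<beta> \<nu>} \<subseteq> parts_below n L"
      using assms L by (auto intro: contained_parts_below)
    show "\<forall>\<beta>\<in>parts_below n L - {\<beta>. contained \<beta> \<nu>}. minor n C \<nu> \<beta> * alt n (pos n \<beta>) = 0"
      using minor_not_contained[of C _ n \<nu>] C0 by (auto simp: parts_below_def)
  qed simp
  also have "\<dots> = (\<Sum>\<beta> | contained \<beta> \<nu>. minor n C \<nu> \<beta> * minor n (toeplitz (eta n xv)) \<beta> empty_partition) * vandermonde n"
    unfolding sum_distrib_right
    by (intro sum.cong refl) (simp add: len alt_schur_det vandermonde_eq_alt schur_det_eq mult.assoc)
  also have "(\<Sum>\<beta> | contained \<beta> \<nu>. minor n C \<nu> \<beta> * minor n (toeplitz (eta n xv)) \<beta> empty_partition) =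
      minor n (row_series (\<lambda>a. R a * (abarx n * eta n xv))) \<nu> empty_partition"
    unfolding C mult.assoc[symmetric] by (rule minor_series_mult[symmetric, OF assms])
  also have "\<dots> = (\<Sum>\<gamma> | contained \<gamma> \<nu>. minor n (row_series R) \<nu> \<gamma> *
      minor n (toeplitz (abarx n * eta n xv)) \<gamma> empty_partition)"
    by (rule minor_series_mult[OF assms])
  also have "\<dots> = (\<Sum>\<gamma> | contained \<gamma> \<nu>. mconst (minor n (to_schur n) \<nu> \<gamma>) * component (schurL \<gamma>) n)"
  proof (intro sum.cong refl arg_cong2[of _ _ _ _ "(*)"])
    fix \<gamma> assume "\<gamma> \<in> {\<gamma>. contained \<gamma> \<nu>}"
    then show "minor n (toeplitz (abarx n * eta n xv)) \<gamma> empty_partition = component (schurL \<gamma>) n"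
      unfolding component_schurL by (intro schur_det_eq) (simp_all add: len)
    show "minor n (row_series R) \<nu> \<gamma> = mconst (minor n (to_schur n) \<nu> \<gamma>)"
      unfolding minor_def hom_dt to_schur_row_series by (rule dt_cong) (simp add: row_series_def R_def)
  qed
  finally show ?thesis .
qed

lemma double_schur_poly_eq:
  assumes "length (parts \<nu>) \<le> n"
  shows "double_schur_poly n \<nu> =
    (\<Sum>\<gamma> | contained \<gamma> \<nu>. mconst (minor n (to_schur n) \<nu> \<gamma>) * component (schurL \<gamma>) n)" (is "_ = ?X")
proof -
  have "det (mat n n (\<lambda>(i, j). double_power n (i + 1) (part \<nu> (j + 1) + n - (j + 1)))) =
      dt n (\<lambda>i k. double_power n (Suc k) (pos n \<nu> i))"
    by (subst dt_transpose[symmetric]) (simp add: dt_def pos_def)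
  then have det: "det (mat n n (\<lambda>(i, j). double_power n (i + 1) (part \<nu> (j + 1) + n - (j + 1)))) =
      ?X * vandermonde n" by (simp only: double_alternant[OF assms])
  show ?thesis
    unfolding double_schur_poly_def det using assms vandermonde_nonzero[of n, where 'r = Qa]
    by (auto intro!: the_equality)
qed

lemma comm_ring_hom_msubst: "comm_ring_hom (msubst \<sigma>)"
  by unfold_locales simp_all

text \<open>Below the length of \<open>\<nu>\<close>, stability forces the expansion to vanish: the factor
  \<open>x\<^sub>N - a\<^sub>N\<close> occurs in a whole column of the alternant.\<close>

lemma double_expansion_vanishes:
  assumes N: "N = length (parts \<nu>)" and "n < N"
    and X: "component X N * vandermonde N = dt N (\<lambda>i k. double_power N (Suc k) (pos N \<nu> i))"
  shows "component X n = 0"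
proof -
  define \<sigma> where "\<sigma> = mvar(N := mconst (avar (int N)) :: Qax)"
  interpret comm_ring_hom "msubst \<sigma>" by (rule comm_ring_hom_msubst)
  obtain M where M: "N = Suc M" using \<open>n < N\<close> by (cases N) auto
  have "\<forall>n\<ge>1. msubst (mvar(n := mconst (avar (int n)))) (component X n) = component X (n - 1)"
    using component[of X] by (simp add: Lambda_carrier_def)
  moreover have "1 \<le> N" "N - 1 = M" using M by simp_all
  ultimately have "msubst \<sigma> (component X N) = component X M"
    unfolding \<sigma>_def by (simp only:)
  moreover have "msubst \<sigma> (dt N (\<lambda>i k. double_power N (Suc k) (pos N \<nu> i))) = 0"
    unfolding hom_dt
  proof (rule dt_zero_block[of "{..<N}" _ "{M}"])
    fix i j assume ij: "i \<in> {..<N}" "j \<in> {M}"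
    then have "part \<nu> (Suc i) > 0" by (simp add: part_pos_iff N)
    then have "0 < pos N \<nu> i" using ij by (simp add: pos_def)
    then have "(\<Prod>k<pos N \<nu> i. msubst \<sigma> (mvar N - mconst (avar (int N - int k)))) = 0"
      by (intro prod_zero bexI[of _ 0]) (simp_all add: \<sigma>_def)
    then show "msubst \<sigma> (double_power N (Suc j) (pos N \<nu> i)) = 0"
      using ij M by (simp add: double_power_def msubst_prod del: msubst_diff)
  qed (use M in auto)
  \<comment> \<open>The substituted constant differs from every variable, so no factor of the
    Vandermonde product becomes zero and it can be cancelled.\<close>
  moreover have "msubst \<sigma> (vandermonde N) \<noteq> 0"
  proof -
    have fin: "finite {(i, j). 1 \<le> i \<and> i < j \<and> j \<le> N}"
      by (rule finite_subset[of _ "{..N} \<times> {..N}"]) auto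
    have ne: "mvar i \<noteq> (mconst c :: Qax)" for i c
    proof
      assume "mvar i = (mconst c :: Qax)"
      then have "Poly_Mapping.keys (mvar i :: Qax) \<subseteq> {0}" using keys_mconst[of c] by simp
      then have "Poly_Mapping.single i (1 :: nat) = 0" by (simp add: keys_mvar)
      then have "Poly_Mapping.lookup (Poly_Mapping.single i (1 :: nat)) i = 0" by simp
      then show False by simp
    qed
    have "\<sigma> i - \<sigma> j \<noteq> 0" if "i < j" "j \<le> N" for i j
      using that ne by (auto simp: \<sigma>_def mvar_inject)
    then show ?thesis
      unfolding vandermonde_def msubst_prod using fin by (auto simp: prod_zero_iff)
  qed
  ultimately have "component X M = component 0 M"
    using arg_cong[OF X, of "msubst \<sigma>"] by simp
  then have "component X n = component 0 n"
    by (rule component_restrict) (use \<open>n < N\<close> M in simp)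
  then show ?thesis by simp
qed

text \<open>Coefficients M free of n exhibit one element X of the ring whose components are the
  polynomials \<open>double_schur_poly n \<nu>\<close>; in particular the sequence under
  \<open>Abs_Lambda\<close> is a legitimate one.\<close>

theorem double_schur_expansion:
  assumes M: "\<And>n \<gamma>. length (parts \<nu>) \<le> n \<Longrightarrow> contained \<gamma> \<nu> \<Longrightarrow> minor n (to_schur n) \<nu> \<gamma> = M \<gamma>"
  shows "double_schur \<nu> = (\<Sum>\<gamma> | contained \<gamma> \<nu>. scalar (M \<gamma>) * schurL \<gamma>)"
proof -
  define X where "X = (\<Sum>\<gamma> | contained \<gamma> \<nu>. scalar (M \<gamma>) * schurL \<gamma>)"
  have X: "component X n = (\<Sum>\<gamma> | contained \<gamma> \<nu>. mconst (minor n (to_schur n) \<nu> \<gamma>) * component (schurL \<gamma>) n)"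
    if "length (parts \<nu>) \<le> n" for n
    unfolding X_def component_sum by (intro sum.cong refl) (simp add: M that)
  have "double_schur_poly n \<nu> = component X n" for n
  proof (cases "length (parts \<nu>) \<le> n")
    case True
    then show ?thesis by (simp add: X double_schur_poly_eq)
  next
    case False
    then have "component X n = 0"
      by (intro double_expansion_vanishes[where \<nu> = \<nu>, OF refl]) (simp_all add: X double_alternant)
    then show ?thesis using False by (simp add: double_schur_poly_def)
  qed
  then have "double_schur \<nu> = Abs_Lambda (component X)" by (simp add: double_schur_def)
  then show ?thesis by (simp add: component_inverse X_def)
qed

section \<open>Minors of hook kernels\<close>

lemma diagonal_iff: "1 \<le> i \<Longrightarrow> i \<le> diagonal \<kappa> \<longleftrightarrow> i \<le> part \<kappa> i"
proof -
  assume "1 \<le> i"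
  let ?A = "{i. (i, i) \<in> diagram \<kappa>}"
  have "?A = {0<..0 + card ?A}"
  proof (rule downward_closed_interval)
    show "?A \<subseteq> {0<..length (parts \<kappa>)}"
      by (auto simp: diagram_def part_def split: if_splits)
    fix p q assume "p \<in> ?A" "0 < q" "q \<le> p"
    then show "q \<in> ?A" using part_mono[of q p \<kappa>] by (auto simp: diagram_def)
  qed
  then have "i \<in> ?A \<longleftrightarrow> i \<in> {0<..diagonal \<kappa>}" by (simp add: diagonal_def)
  then show ?thesis using \<open>1 \<le> i\<close> by (auto simp: diagram_def)
qed

lemma diagonal_le_length: "diagonal \<kappa> \<le> length (parts \<kappa>)"
proof (cases "diagonal \<kappa>")
  case (Suc i)
  then have "Suc i \<le> part \<kappa> (Suc i)" using diagonal_iff[of "Suc i" \<kappa>] by simp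
  then have "i < length (parts \<kappa>)" using part_pos_iff[of \<kappa> i] by linarith
  then show ?thesis using Suc by simp
qed simp

lemma conjugate_iff: "1 \<le> j \<Longrightarrow> (i, j) \<in> diagram \<kappa> \<longleftrightarrow> 1 \<le> i \<and> i \<le> conjugate_part \<kappa> j"
proof -
  assume "1 \<le> j"
  let ?A = "{i. (i, j) \<in> diagram \<kappa>}"
  have "?A = {0<..0 + card ?A}"
  proof (rule downward_closed_interval)
    show "?A \<subseteq> {0<..length (parts \<kappa>)}"
      by (auto simp: diagram_def part_def split: if_splits)
    fix p q assume "p \<in> ?A" "0 < q" "q \<le> p"
    then show "q \<in> ?A" using part_mono[of q p \<kappa>] by (auto simp: diagram_def)
  qed
  then have "i \<in> ?A \<longleftrightarrow> i \<in> {0<..conjugate_part \<kappa> j}" by (simp add: conjugate_part_def)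
  then show ?thesis by auto
qed

text \<open>Frobenius coordinates of the rows above and below the main diagonal; the rows below are
  listed from the bottom, so that both sequences decrease.\<close>

definition arm :: "partition \<Rightarrow> nat \<Rightarrow> nat" where
  "arm \<kappa> i = part \<kappa> (Suc i) - Suc i"

definition leg :: "nat \<Rightarrow> partition \<Rightarrow> nat \<Rightarrow> nat" where
  "leg n \<kappa> i = n - Suc i - part \<kappa> (n - i)"

lemma dt_reverse: "dt n (\<lambda>i j. f (n - Suc i) (n - Suc j)) = dt n f"
proof -
  define p where "p i = (if i < n then n - Suc i else i)" for i
  have "bij_betw p {..<n} {..<n}"
    by (rule bij_betw_byWitness[of _ p]) (auto simp: p_def)
  then have p: "p permutes {..<n}" by (rule bij_imp_permutes) (simp add: p_def)
  have "dt n (\<lambda>i j. f (n - Suc i) (n - Suc j)) = dt n (\<lambda>i j. f (p i) (p j))"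
    by (rule dt_cong) (simp add: p_def)
  also have "\<dots> = of_int (sign p) * (of_int (sign p) * dt n f)"
    using dt_permute_rows[OF p, of "\<lambda>i j. f i (p j)"] dt_permute_cols[OF p, of f] by simp
  also have "\<dots> = of_int (sign p * sign p) * dt n f" by (simp only: mult.assoc of_int_mult)
  finally show ?thesis by (simp only: sign_idempotent of_int_1 mult_1_left)
qed

lemma pos_above: "i < n \<Longrightarrow> i < diagonal \<kappa> \<Longrightarrow> n \<le> pos n \<kappa> i \<and> pos n \<kappa> i - n = arm \<kappa> i"
  using diagonal_iff[of "Suc i" \<kappa>] by (auto simp: pos_def arm_def)

lemma pos_below: "i < n \<Longrightarrow> diagonal \<kappa> \<le> i \<Longrightarrow> pos n \<kappa> i < n \<and> n - 1 - pos n \<kappa> i = i - part \<kappa> (Suc i) \<and> part \<kappa> (Suc i) \<le> i"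
  using diagonal_iff[of "Suc i" \<kappa>] by (auto simp: pos_def)

text \<open>A position is \<ge> n exactly for the rows that meet the main diagonal. With unequal
  diagonals one of the zero blocks is too large. With equal ones the minor splits; reversing the
  lower rows and columns makes the coordinates decrease, and the transposition in
  \<open>hook_kernel\<close> interchanges \<gamma> and \<nu>.\<close>

lemma minor_hook_kernel:
  assumes len: "length (parts \<nu>) \<le> n" "length (parts \<gamma>) \<le> n"
  shows "minor n (hook_kernel n U V) \<nu> \<gamma> = (if diagonal \<nu> = diagonal \<gamma>
    then dt (diagonal \<gamma>) (\<lambda>i j. U (arm \<nu> i) (arm \<gamma> j)) *
      dt (n - diagonal \<gamma>) (\<lambda>i j. V (leg n \<gamma> i) (leg n \<nu> j)) else 0)"
proof -
  let ?K = "\<lambda>i j. hook_kernel n U V (pos n \<nu> i) (pos n \<gamma> j)"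
  have dn: "diagonal \<nu> \<le> n" "diagonal \<gamma> \<le> n" using diagonal_le_length len order_trans by blast+
  consider "diagonal \<nu> < diagonal \<gamma>" | "diagonal \<gamma> < diagonal \<nu>" | "diagonal \<nu> = diagonal \<gamma>" by linarith
  then show ?thesis
  proof cases
    case 1
    have "minor n (hook_kernel n U V) \<nu> \<gamma> = 0"
      unfolding minor_def
    proof (rule dt_zero_block[of "{diagonal \<nu>..<n}" _ "{..<diagonal \<gamma>}"])
      fix i j assume "i \<in> {diagonal \<nu>..<n}" "j \<in> {..<diagonal \<gamma>}"
      then show "?K i j = 0" using pos_below[of i n \<nu>] pos_above[of j n \<gamma>] dn by (simp add: hook_kernel_def)
    qed (use 1 dn in auto)
    then show ?thesis using 1 by simp
  next
    case 2
    have "minor n (hook_kernel n U V) \<nu> \<gamma> = 0"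
      unfolding minor_def
    proof (rule dt_zero_block[of "{..<diagonal \<nu>}" _ "{diagonal \<gamma>..<n}"])
      fix i j assume "i \<in> {..<diagonal \<nu>}" "j \<in> {diagonal \<gamma>..<n}"
      then show "?K i j = 0" using pos_above[of i n \<nu>] pos_below[of j n \<gamma>] dn by (simp add: hook_kernel_def)
    qed (use 2 dn in auto)
    then show ?thesis using 2 by simp
  next
    case 3
    define d k where "d = diagonal \<gamma>" and "k = n - d"
    have n: "n = d + k" using dn by (simp add: k_def d_def)
    have "minor n (hook_kernel n U V) \<nu> \<gamma> = dt (d + k) ?K" by (simp add: minor_def n)
    also have "\<dots> = dt d ?K * dt k (\<lambda>i j. ?K (d + i) (d + j))"
    proof (rule dt_block_triangular)
      fix i j assume "d \<le> i" "i < d + k" "j < d"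
      then show "?K i j = 0" using pos_below[of i n \<nu>] pos_above[of j n \<gamma>] 3 dn
        by (simp add: hook_kernel_def n d_def)
    qed
    also have "dt d ?K = dt d (\<lambda>i j. U (arm \<nu> i) (arm \<gamma> j))"
    proof (rule dt_cong)
      fix i j assume "i < d" "j < d"
      then show "?K i j = U (arm \<nu> i) (arm \<gamma> j)"
        using pos_above[of i n \<nu>] pos_above[of j n \<gamma>] 3 n by (simp add: hook_kernel_def d_def)
    qed
    also have "dt k (\<lambda>i j. ?K (d + i) (d + j)) = dt k (\<lambda>i j. V (leg n \<gamma> i) (leg n \<nu> j))"
    proof -
      have leg: "n - 1 - pos n \<kappa> (d + (k - Suc i)) = leg n \<kappa> i \<and> pos n \<kappa> (d + (k - Suc i)) < n"
        if "i < k" "diagonal \<kappa> = d" for i \<kappa>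
      proof -
        define r where "r = d + (k - Suc i)"
        have r: "n - i = Suc r" "n - Suc i = r" "r < n" "diagonal \<kappa> \<le> r" using that n by (simp_all add: r_def)
        show ?thesis unfolding leg_def r(1,2) r_def[symmetric]
          using pos_below[OF r(3,4)] by blast
      qed
      have "dt k (\<lambda>i j. ?K (d + i) (d + j)) = dt k (\<lambda>i j. ?K (d + (k - Suc i)) (d + (k - Suc j)))"
        by (rule dt_reverse[symmetric, of k "\<lambda>i j. ?K (d + i) (d + j)"])
      also have "\<dots> = dt k (\<lambda>j i. V (leg n \<gamma> i) (leg n \<nu> j))"
      proof (rule dt_cong)
        fix i j assume ij: "i < k" "j < k"
        have "diagonal \<nu> = d" "diagonal \<gamma> = d" using 3 by (simp_all add: d_def)
        note l = leg[OF ij(1) this(1)] leg[OF ij(2) this(2)]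
        show "?K (d + (k - Suc i)) (d + (k - Suc j)) = V (leg n \<gamma> j) (leg n \<nu> i)"
          unfolding hook_kernel_def using l by (auto simp only: not_le[symmetric] if_False simp_thms if_True)
      qed
      also have "\<dots> = dt k (\<lambda>i j. V (leg n \<gamma> i) (leg n \<nu> j))" by (rule dt_transpose[of k "\<lambda>i j. V (leg n \<gamma> i) (leg n \<nu> j)"])
      finally show ?thesis .
    qed
    finally show ?thesis using 3 by (simp add: d_def k_def)
  qed
qed

lemma strict_arm: "strict_seq (diagonal \<kappa>) (arm \<kappa>)"
  unfolding strict_seq_def
proof (intro allI impI)
  fix i j assume "i < j" "j < diagonal \<kappa>"
  then show "arm \<kappa> j < arm \<kappa> i"
    using diagonal_iff[of "Suc j" \<kappa>] part_mono[of "Suc i" "Suc j" \<kappa>] by (auto simp: arm_def)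
qed

text \<open>For the row r = n - i the value is r - 1 - \<open>part \<kappa> r\<close>. If \<kappa>
  has at most n parts, these numbers form the complement in {0, ..., n - 1} of the Frobenius legs,
  so they get smaller as the partition grows (\<open>leg_le\<close>).\<close>

lemma leg_part: "i < n - diagonal \<kappa> \<Longrightarrow> leg n \<kappa> i + part \<kappa> (n - i) + Suc i = n"
proof -
  assume "i < n - diagonal \<kappa>"
  then have "part \<kappa> (n - i) < n - i" using diagonal_iff[of "n - i" \<kappa>] by linarith
  then show ?thesis unfolding leg_def by linarith
qed

lemma strict_leg: "strict_seq (n - diagonal \<kappa>) (leg n \<kappa>)"
  unfolding strict_seq_def
proof (intro allI impI)
  fix i j assume ij: "i < j" "j < n - diagonal \<kappa>"
  then show "leg n \<kappa> j < leg n \<kappa> i"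
    using leg_part[of i n \<kappa>] leg_part[of j n \<kappa>] part_mono[of "n - j" "n - i" \<kappa>] by linarith
qed

lemma arm_le: "contained \<gamma> \<nu> \<Longrightarrow> arm \<gamma> i \<le> arm \<nu> i"
  by (simp add: arm_def contained_iff diff_le_mono)

lemma leg_le: "contained \<gamma> \<nu> \<Longrightarrow> i < n \<Longrightarrow> leg n \<nu> i \<le> leg n \<gamma> i"
  unfolding leg_def contained_iff by (metis Suc_diff_Suc diff_le_mono2)

text \<open>For t \<ge> \<open>x i\<close> the truncation has no effect. The kernel consists of
  coefficients of products of 1 - c_k z, hence one sign for each box.\<close>

lemma e_kernel_determinant:
  assumes "strict_seq d x" "strict_seq d y" "\<And>i. i < d \<Longrightarrow> y i \<le> x i" "\<And>i. i < d \<Longrightarrow> x i \<le> t"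
  shows "dt d (\<lambda>i j. e_kernel c (x i) (y j)) =
    (- 1) ^ card (boxes d x y) * (\<Sum>f\<in>e_fillings d x y t. weight c (boxes d x y) f)"
proof -
  have "dt d (\<lambda>i j. e_kernel c (x i) (y j)) = dt d (\<lambda>i j. e_trunc (\<lambda>k. - c k) t (x i) (y j))"
    by (rule dt_cong) (simp add: e_kernel_def e_trunc_def assms(4) min_absorb1)
  also have "\<dots> = (\<Sum>f\<in>e_fillings d x y t. weight (\<lambda>k. - c k) (boxes d x y) f)"
    using e_determinant[OF assms(1,2)] assms(3) by simp
  also have "\<dots> = (\<Sum>f\<in>e_fillings d x y t. (- 1) ^ card (boxes d x y) * weight c (boxes d x y) f)"
    by (intro sum.cong refl) (simp add: weight_def prod_uminus)
  finally show ?thesis by (simp add: sum_distrib_left)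
qed

lemma h_kernel_determinant:
  assumes "strict_seq d x" "strict_seq d y" "\<And>i. i < d \<Longrightarrow> y i \<le> x i" "\<And>i. i < d \<Longrightarrow> y i < t"
  shows "dt d (\<lambda>i j. h_kernel c (x i) (y j)) = (\<Sum>f\<in>h_fillings d x y t. weight c (boxes d x y) f)"
proof -
  have "dt d (\<lambda>i j. h_kernel c (x i) (y j)) = dt d (\<lambda>i j. h_trunc c t (x i) (y j))"
    by (rule dt_cong) (simp add: h_kernel_def h_trunc_def assms(4) min_absorb1 Suc_leI del: prod.lessThan_Suc)
  also have "\<dots> = (\<Sum>f\<in>h_fillings d x y t. weight c (boxes d x y) f)"
    using h_determinant[OF assms(1,2)] assms(3) by simp
  finally show ?thesis .
qed

section \<open>Hook tableaux\<close>

definition up_box :: "nat \<times> nat \<Rightarrow> nat \<times> nat" where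
  "up_box = (\<lambda>(i, p). (Suc i, p + Suc i))"

text \<open>Here i counts rows upwards from row n, and p is the distance to the left of the main
  diagonal. Both orders are reversed in the diagram, while equal i + p still means equal
  columns.\<close>

definition low_box :: "nat \<Rightarrow> nat \<times> nat \<Rightarrow> nat \<times> nat" where
  "low_box n = (\<lambda>(i, p). (n - i, n - i - p))"

locale frobenius_skew =
  fixes \<xi> \<eta> :: partition and n d :: nat
  assumes cont: "contained \<eta> \<xi>" and diag: "diagonal \<eta> = d" "diagonal \<xi> = d"
    and len: "length (parts \<xi>) \<le> n"
begin

abbreviation "S \<equiv> skew \<xi> \<eta>"
abbreviation "BU \<equiv> boxes d (arm \<xi>) (arm \<eta>)"
abbreviation "BL \<equiv> boxes (n - d) (leg n \<eta>) (leg n \<xi>)"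

lemma skew_iff: "(r, c) \<in> S \<longleftrightarrow> 1 \<le> r \<and> part \<eta> r < c \<and> c \<le> part \<xi> r"
  by (auto simp: skew_def diagram_def)

lemma part_above: "1 \<le> r \<Longrightarrow> r \<le> d \<Longrightarrow> r \<le> part \<eta> r \<and> r \<le> part \<xi> r"
  using diagonal_iff[of r \<eta>] diagonal_iff[of r \<xi>] diag by simp

lemma part_below: "d < r \<Longrightarrow> part \<eta> r < r \<and> part \<xi> r < r"
  using diagonal_iff[of r \<eta>] diagonal_iff[of r \<xi>] diag by (simp add: not_le[symmetric])

lemma up_box_iff: "(i, p) \<in> BU \<longleftrightarrow> i < d \<and> (Suc i, p + Suc i) \<in> S"
proof (cases "i < d")
  case True
  then show ?thesis using part_above[of "Suc i"] by (auto simp: boxes_iff skew_iff arm_def)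
qed (simp add: boxes_iff)

lemma low_box_iff: "(i, p) \<in> BL \<longleftrightarrow> i < n - d \<and> (n - i, n - i - p) \<in> S"
proof (cases "i < n - d")
  case True
  have "leg n \<eta> i + part \<eta> (n - i) + Suc i = n" "leg n \<xi> i + part \<xi> (n - i) + Suc i = n"
    using leg_part[of i n \<eta>] leg_part[of i n \<xi>] True diag by simp_all
  then show ?thesis using True unfolding boxes_iff skew_iff by linarith
qed (simp add: boxes_iff)

lemma upperE:
  assumes "(r, c) \<in> S" "r \<le> d"
  obtains i p where "r = Suc i" "c = p + Suc i" "(i, p) \<in> BU"
proof -
  have "r \<le> part \<eta> r" "1 \<le> r" "part \<eta> r < c" using assms part_above[of r] by (auto simp: skew_iff)
  then obtain i p where ip: "r = Suc i" "c = p + Suc i"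
    by (metis Suc_le_D One_nat_def add.commute le_Suc_ex less_imp_le_nat order_trans)
  then have "(i, p) \<in> BU" using assms by (simp add: up_box_iff)
  then show ?thesis using ip that by blast
qed

lemma lowerE:
  assumes "(r, c) \<in> S" "d < r"
  obtains i p where "r = n - i" "c = n - i - p" "(i, p) \<in> BL" "i < n" "p < n - i"
proof -
  have rc: "c \<le> part \<xi> r" "0 < c" "1 \<le> r" using assms by (auto simp: skew_iff)
  have "c < r" using rc(1) part_below[OF assms(2)] by linarith
  have "r \<le> n"
  proof (rule ccontr)
    assume "\<not> r \<le> n"
    then have "part \<xi> r = 0" using part_beyond[of \<xi> "r - 1"] rc(3) len by simp
    then show False using rc by simp
  qed
  define i p where "i = n - r" and "p = r - c"
  have ip: "r = n - i" "c = n - i - p" "i < n" "p < n - i" "i < n - d"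
    using \<open>r \<le> n\<close> \<open>c < r\<close> \<open>0 < c\<close> assms(2) by (simp_all add: i_def p_def)
  then have "(i, p) \<in> BL" using assms(1) by (simp add: low_box_iff)
  then show ?thesis using ip that by blast
qed

text \<open>Both diagrams contain the d by d square and neither contains the box (d+1, d+1), so
  every box of the difference lies either to the right of the square or below it.\<close>

lemma column_iff: "(r, c) \<in> S \<Longrightarrow> c \<le> d \<longleftrightarrow> d < r"
proof -
  assume rc: "(r, c) \<in> S"
  show ?thesis
  proof (cases "r \<le> d")
    case True
    then have "part \<eta> d \<le> part \<eta> r" "d \<le> part \<eta> d"
      using part_mono[of r d \<eta>] part_above[of d] rc by (auto simp: skew_iff)
    then show ?thesis using rc True by (auto simp: skew_iff)
  next
    case False
    then have "part \<xi> r \<le> part \<xi> (Suc d)" "part \<xi> (Suc d) < Suc d"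
      using part_mono[of "Suc d" r \<xi>] part_below[of "Suc d"] by auto
    then show ?thesis using rc False by (auto simp: skew_iff)
  qed
qed

lemma low_less: "(i, p) \<in> BL \<Longrightarrow> i < n \<and> p < n - i"
  using low_box_iff[of i p] by (auto simp: skew_iff)

section \<open>Transport of the filling conditions to the skew diagram\<close>

lemma up_rows:
  "(\<forall>i p p'. p < p' \<and> (i, p) \<in> BU \<and> (i, p') \<in> BU \<longrightarrow> Q (up_box (i, p)) (up_box (i, p'))) \<longleftrightarrow>
   (\<forall>r c c'. r \<le> d \<and> c < c' \<and> (r, c) \<in> S \<and> (r, c') \<in> S \<longrightarrow> Q (r, c) (r, c'))" (is "?A \<longleftrightarrow> ?B")
proof
  assume ?A
  show ?B
  proof (intro allI impI, elim conjE)
    fix r c c' assume *: "r \<le> d" "c < c'" "(r, c) \<in> S" "(r, c') \<in> S"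
    obtain i p where ip: "r = Suc i" "c = p + Suc i" "(i, p) \<in> BU" using upperE *(1,3) by blast
    obtain i' p' where ip': "r = Suc i'" "c' = p' + Suc i'" "(i', p') \<in> BU" using upperE *(1,4) by blast
    show "Q (r, c) (r, c')" using \<open>?A\<close>[rule_format, of p p' i] ip ip' *(2) by (simp add: up_box_def)
  qed
qed (auto simp: up_box_def up_box_iff)

lemma up_columns:
  "(\<forall>i i' p p'. i < i' \<and> i + p = i' + p' \<and> (i, p) \<in> BU \<and> (i', p') \<in> BU \<longrightarrow> Q (up_box (i, p)) (up_box (i', p'))) \<longleftrightarrow>
   (\<forall>r r' c. r < r' \<and> r' \<le> d \<and> (r, c) \<in> S \<and> (r', c) \<in> S \<longrightarrow> Q (r, c) (r', c))" (is "?A \<longleftrightarrow> ?B")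
proof
  assume ?A
  show ?B
  proof (intro allI impI, elim conjE)
    fix r r' c assume *: "r < r'" "r' \<le> d" "(r, c) \<in> S" "(r', c) \<in> S"
    obtain i p where ip: "r = Suc i" "c = p + Suc i" "(i, p) \<in> BU" using upperE[OF *(3)] *(1,2) by auto
    obtain i' p' where ip': "r' = Suc i'" "c = p' + Suc i'" "(i', p') \<in> BU" using upperE *(2,4) by blast
    have "i + p = i' + p'" using ip(2) ip'(2) by simp
    then show "Q (r, c) (r', c)" using \<open>?A\<close>[rule_format, of i i' p p'] ip ip' *(1) by (simp add: up_box_def)
  qed
next
  assume ?B
  show ?A
  proof (intro allI impI, elim conjE)
    fix i i' p p' assume *: "i < i'" "i + p = i' + p'" "(i, p) \<in> BU" "(i', p') \<in> BU"
    define c where "c = p + Suc i"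
    have c: "c = p' + Suc i'" using *(2) by (simp add: c_def)
    have "(Suc i, c) \<in> S" using *(3) unfolding up_box_iff c_def by blast
    moreover have "(Suc i', c) \<in> S" "Suc i' \<le> d" using *(4) unfolding up_box_iff c by auto
    ultimately have "Q (Suc i, c) (Suc i', c)" using \<open>?B\<close> *(1) by blast
    then show "Q (up_box (i, p)) (up_box (i', p'))" unfolding up_box_def prod.case c_def[symmetric] c[symmetric] .
  qed
qed

lemma up_all:
  "(\<forall>i p. (i, p) \<in> BU \<longrightarrow> Q i (up_box (i, p))) \<longleftrightarrow> (\<forall>r c. r \<le> d \<and> (r, c) \<in> S \<longrightarrow> Q (r - 1) (r, c))"
  (is "?A \<longleftrightarrow> ?B")
proof
  assume ?A
  show ?B
  proof (intro allI impI, elim conjE)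
    fix r c assume "r \<le> d" "(r, c) \<in> S"
    then obtain i p where "r = Suc i" "c = p + Suc i" "(i, p) \<in> BU" using upperE by blast
    then show "Q (r - 1) (r, c)" using \<open>?A\<close>[rule_format, of i p] by (simp add: up_box_def)
  qed
next
  assume ?B
  show ?A
  proof (intro allI impI)
    fix i p assume "(i, p) \<in> BU"
    then show "Q i (up_box (i, p))"
      using \<open>?B\<close>[rule_format, of "Suc i" "p + Suc i"] by (simp add: up_box_def up_box_iff)
  qed
qed

text \<open>The relation \<open>Q\<close> is arbitrary, so that one statement serves both kinds of
  fillings. Since p counts leftwards, the arguments of \<open>Q\<close> are interchanged.\<close>

lemma low_rows:
  "(\<forall>i p p'. p < p' \<and> (i, p) \<in> BL \<and> (i, p') \<in> BL \<longrightarrow> Q (low_box n (i, p)) (low_box n (i, p'))) \<longleftrightarrow>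
   (\<forall>r c c'. d < r \<and> c < c' \<and> (r, c) \<in> S \<and> (r, c') \<in> S \<longrightarrow> Q (r, c') (r, c))" (is "?A \<longleftrightarrow> ?B")
proof
  assume ?A
  show ?B
  proof (intro allI impI, elim conjE)
    fix r c c' assume *: "d < r" "c < c'" "(r, c) \<in> S" "(r, c') \<in> S"
    obtain i p where ip: "r = n - i" "c = n - i - p" "(i, p) \<in> BL" "i < n" "p < n - i" using lowerE *(1,3) by blast
    obtain i' p' where ip': "r = n - i'" "c' = n - i' - p'" "(i', p') \<in> BL" "i' < n" "p' < n - i'" using lowerE *(1,4) by blast
    have "i' = i" using ip(1,4) ip'(1,4) by linarith
    moreover have "p' < p" using ip ip' *(2) \<open>i' = i\<close> by linarith
    ultimately show "Q (r, c') (r, c)" using \<open>?A\<close>[rule_format, of p' p i] ip ip' by (simp add: low_box_def)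
  qed
next
  assume ?B
  show ?A
  proof (intro allI impI, elim conjE)
    fix i p p' assume *: "p < p'" "(i, p) \<in> BL" "(i, p') \<in> BL"
    have "d < n - i" "n - i - p' < n - i - p" using * low_less[of i p'] by (auto simp: low_box_iff)
    then show "Q (low_box n (i, p)) (low_box n (i, p'))"
      using \<open>?B\<close>[rule_format, of "n - i" "n - i - p'" "n - i - p"] * by (simp add: low_box_def low_box_iff)
  qed
qed

lemma low_columns:
  "(\<forall>i i' p p'. i < i' \<and> i + p = i' + p' \<and> (i, p) \<in> BL \<and> (i', p') \<in> BL \<longrightarrow> Q (low_box n (i, p)) (low_box n (i', p'))) \<longleftrightarrow>
   (\<forall>r r' c. d < r \<and> r < r' \<and> (r, c) \<in> S \<and> (r', c) \<in> S \<longrightarrow> Q (r', c) (r, c))" (is "?A \<longleftrightarrow> ?B")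
proof
  assume ?A
  show ?B
  proof (intro allI impI, elim conjE)
    fix r r' c assume *: "d < r" "r < r'" "(r, c) \<in> S" "(r', c) \<in> S"
    obtain i p where ip: "r = n - i" "c = n - i - p" "(i, p) \<in> BL" "i < n" "p < n - i" using lowerE *(1,3) by blast
    obtain i' p' where ip': "r' = n - i'" "c = n - i' - p'" "(i', p') \<in> BL" "i' < n" "p' < n - i'"
      using lowerE[OF *(4)] *(1,2) by (metis less_trans)
    have "i' < i" "i' + p' = i + p" using ip ip' *(2) by linarith+
    then show "Q (r', c) (r, c)" using \<open>?A\<close>[rule_format, of i' i p' p] ip ip' by (simp add: low_box_def)
  qed
next
  assume ?B
  show ?A
  proof (intro allI impI, elim conjE)
    fix i i' p p' assume *: "i < i'" "i + p = i' + p'" "(i, p) \<in> BL" "(i', p') \<in> BL"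
    have "d < n - i'" "n - i' < n - i" "n - i' - p' = n - i - p"
      using * low_less[of i' p'] by (auto simp: low_box_iff)
    then show "Q (low_box n (i, p)) (low_box n (i', p'))"
      using \<open>?B\<close>[rule_format, of "n - i'" "n - i" "n - i - p"] * by (simp add: low_box_def low_box_iff)
  qed
qed

lemma low_all:
  "(\<forall>i p. (i, p) \<in> BL \<longrightarrow> Q i (low_box n (i, p))) \<longleftrightarrow> (\<forall>r c. d < r \<and> (r, c) \<in> S \<longrightarrow> Q (n - r) (r, c))"
  (is "?A \<longleftrightarrow> ?B")
proof
  assume ?A
  show ?B
  proof (intro allI impI, elim conjE)
    fix r c assume *: "d < r" "(r, c) \<in> S"
    obtain i p where ip: "r = n - i" "c = n - i - p" "(i, p) \<in> BL" "i < n" "p < n - i" using lowerE * by blast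
    then have "n - r = i" by linarith
    then show "Q (n - r) (r, c)" using \<open>?A\<close>[rule_format, of i p] ip by (simp add: low_box_def)
  qed
next
  assume ?B
  show ?A
  proof (intro allI impI)
    fix i p assume *: "(i, p) \<in> BL"
    then have "d < n - i" "n - (n - i) = i" by (auto simp: low_box_iff)
    then show "Q i (low_box n (i, p))"
      using \<open>?B\<close>[rule_format, of "n - i" "n - i - p"] * by (simp add: low_box_def low_box_iff)
  qed
qed

section \<open>Hook tableaux as pairs of fillings\<close>

definition up_filling :: "(nat \<times> nat \<Rightarrow> int) \<Rightarrow> nat \<times> nat \<Rightarrow> nat" where
  "up_filling T = (\<lambda>b\<in>BU. nat (- T (up_box b)))"

definition low_filling :: "(nat \<times> nat \<Rightarrow> int) \<Rightarrow> nat \<times> nat \<Rightarrow> nat" where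
  "low_filling T = (\<lambda>b\<in>BL. nat (T (low_box n b) - 1))"

definition assemble :: "(nat \<times> nat \<Rightarrow> nat) \<Rightarrow> (nat \<times> nat \<Rightarrow> nat) \<Rightarrow> nat \<times> nat \<Rightarrow> int" where
  "assemble f g = (\<lambda>(r, c)\<in>S. if r \<le> d then - int (f (r - 1, c - r)) else int (g (n - r, r - c)) + 1)"

text \<open>On such functions the conversions t = - T above and t = T - 1 below stay nonnegative, so
  \<open>nat\<close> loses nothing and T is recovered from its two fillings.\<close>

definition signed :: "(nat \<times> nat \<Rightarrow> int) \<Rightarrow> bool" where
  "signed T \<longleftrightarrow> T \<in> S \<rightarrow>\<^sub>E UNIV \<and> (\<forall>r c. (r, c) \<in> S \<longrightarrow> (r \<le> d \<longrightarrow> T (r, c) \<le> 0) \<and> (d < r \<longrightarrow> 1 \<le> T (r, c)))"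

lemma assemble_up: "b \<in> BU \<Longrightarrow> assemble f g (up_box b) = - int (f b)"
  by (cases b) (auto simp: assemble_def up_box_def up_box_iff)

lemma assemble_low: "b \<in> BL \<Longrightarrow> assemble f g (low_box n b) = int (g b) + 1"
proof -
  assume b: "b \<in> BL"
  obtain i p where ip: "b = (i, p)" by (cases b)
  then have "i < n" "p < n - i" "i < n - d" "(n - i, n - i - p) \<in> S"
    using low_less[of i p] low_box_iff[of i p] b by auto
  moreover from this have "n - (n - i) = i" "n - i - (n - i - p) = p" "\<not> n - i \<le> d" by linarith+
  ultimately show ?thesis unfolding ip assemble_def low_box_def prod.case by (simp only: restrict_apply if_True if_False prod.case)
qed

lemma signed_assemble: "signed (assemble f g)"
  unfolding signed_def
proof (intro conjI allI impI)
  show "assemble f g \<in> S \<rightarrow>\<^sub>E UNIV" unfolding assemble_def by (simp only: restrict_PiE_iff UNIV_I) (rule ballI, rule TrueI)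
qed (simp_all add: assemble_def)

lemma up_filling_assemble: "f \<in> BU \<rightarrow>\<^sub>E A \<Longrightarrow> up_filling (assemble f g) = f"
proof
  fix b assume "f \<in> BU \<rightarrow>\<^sub>E A"
  then show "up_filling (assemble f g) b = f b"
    using PiE_arb[of f BU "\<lambda>_. A" b] by (cases "b \<in> BU") (simp_all add: up_filling_def assemble_up)
qed

lemma low_filling_assemble: "g \<in> BL \<rightarrow>\<^sub>E A \<Longrightarrow> low_filling (assemble f g) = g"
proof
  fix b assume "g \<in> BL \<rightarrow>\<^sub>E A"
  then show "low_filling (assemble f g) b = g b"
    using PiE_arb[of g BL "\<lambda>_. A" b] by (cases "b \<in> BL") (simp_all add: low_filling_def assemble_low)
qed

lemma assemble_fillings:
  assumes "signed T"
  shows "assemble (up_filling T) (low_filling T) = T"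
proof
  fix b :: "nat \<times> nat"
  obtain r c where b: "b = (r, c)" by (cases b)
  consider "b \<notin> S" | "b \<in> S" "r \<le> d" | "b \<in> S" "d < r" by linarith
  then show "assemble (up_filling T) (low_filling T) b = T b"
  proof cases
    case 1
    then have "assemble (up_filling T) (low_filling T) b = undefined" by (simp add: assemble_def)
    also have "\<dots> = T b" using 1 assms PiE_arb[of T S "\<lambda>_. UNIV" b] by (simp add: signed_def)
    finally show ?thesis .
  next
    case 2
    then obtain i p where ip: "r = Suc i" "c = p + Suc i" "(i, p) \<in> BU" using upperE b by blast
    then have "b = up_box (i, p)" by (simp add: b up_box_def)
    moreover have "T b \<le> 0" using assms 2 b by (auto simp: signed_def)
    ultimately show ?thesis using ip(3) by (simp add: assemble_up up_filling_def)
  next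
    case 3
    then obtain i p where ip: "r = n - i" "c = n - i - p" "(i, p) \<in> BL" using lowerE b by blast
    then have "b = low_box n (i, p)" by (simp add: b low_box_def)
    moreover have "1 \<le> T b" using assms 3 b by (auto simp: signed_def)
    ultimately show ?thesis using ip(3) by (simp add: assemble_low low_filling_def)
  qed
qed

lemma up_image: "up_box ` BU = {(r, c) \<in> S. r \<le> d}"
proof (intro equalityI subsetI)
  fix b assume "b \<in> {(r, c) \<in> S. r \<le> d}"
  then obtain r c where b: "b = (r, c)" "(r, c) \<in> S" "r \<le> d" by blast
  then obtain i p where "r = Suc i" "c = p + Suc i" "(i, p) \<in> BU" using upperE by blast
  then show "b \<in> up_box ` BU" using b(1) by (intro image_eqI[of _ _ "(i, p)"]) (simp_all add: up_box_def)
qed (auto simp: up_box_def up_box_iff)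

lemma low_image: "low_box n ` BL = {(r, c) \<in> S. d < r}"
proof (intro equalityI subsetI)
  fix b assume "b \<in> {(r, c) \<in> S. d < r}"
  then obtain r c where b: "b = (r, c)" "(r, c) \<in> S" "d < r" by blast
  then obtain i p where "r = n - i" "c = n - i - p" "(i, p) \<in> BL" using lowerE by blast
  then show "b \<in> low_box n ` BL" using b(1) by (intro image_eqI[of _ _ "(i, p)"]) (simp_all add: low_box_def)
qed (auto simp: low_box_def low_box_iff)

lemma inj_up_box: "inj_on up_box A"
  by (auto simp: inj_on_def up_box_def)

lemma inj_low_box: "inj_on (low_box n) BL"
proof (rule inj_onI)
  fix b b' assume *: "b \<in> BL" "b' \<in> BL" "low_box n b = low_box n b'"
  obtain i p i' p' where b: "b = (i, p)" "b' = (i', p')" by (cases b, cases b')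
  have "i < n" "p < n - i" "i' < n" "p' < n - i'" using *(1,2) low_less unfolding b by blast+
  moreover have "n - i = n - i'" "n - i - p = n - i' - p'"
    using *(3) unfolding b low_box_def prod.case prod.inject by blast+
  ultimately have "i = i'" "p = p'" by linarith+
  then show "b = b'" using b by simp
qed

lemma card_boxes: "card BU = boxes_upper \<xi> \<eta>" "card BL = boxes_lower \<xi> \<eta>"
  using card_image[OF inj_up_box, of BU] card_image[OF inj_low_box]
  unfolding up_image low_image boxes_upper_def boxes_lower_def diag by simp_all

lemma prod_skew: "(\<Prod>b\<in>S. F b) = (\<Prod>b\<in>BU. F (up_box b)) * (\<Prod>b\<in>BL. F (low_box n b))"
proof -
  have "S = up_box ` BU \<union> low_box n ` BL" unfolding up_image low_image by auto
  moreover have "up_box ` BU \<inter> low_box n ` BL = {}" unfolding up_image low_image by auto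
  ultimately show ?thesis
    by (simp add: prod.union_disjoint prod.reindex[OF inj_up_box] prod.reindex[OF inj_low_box])
qed

text \<open>The upper and the lower part share neither rows nor columns, so a tableau is an
  arbitrary pair of fillings and the sum factors.\<close>

lemma assemble_sum:
  assumes \<T>: "\<And>T. T \<in> \<T> \<longleftrightarrow> signed T \<and> up_filling T \<in> F \<and> low_filling T \<in> G"
    and F: "F \<subseteq> BU \<rightarrow>\<^sub>E A" and G: "G \<subseteq> BL \<rightarrow>\<^sub>E B"
  shows "(\<Sum>T\<in>\<T>. \<Prod>b\<in>S. avar (T b)) =
    (\<Sum>f\<in>F. weight a_up BU f) * (\<Sum>g\<in>G. weight a_low BL g)"
proof -
  have "(\<Sum>T\<in>\<T>. \<Prod>b\<in>S. avar (T b)) = (\<Sum>(f, g)\<in>F \<times> G. weight a_up BU f * weight a_low BL g)"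
  proof (rule sum.reindex_bij_witness[of _ "\<lambda>(f, g). assemble f g" "\<lambda>T. (up_filling T, low_filling T)"])
    fix T assume "T \<in> \<T>"
    then have T: "signed T" "up_filling T \<in> F" "low_filling T \<in> G" using \<T> by auto
    show "(case (up_filling T, low_filling T) of (f, g) \<Rightarrow> assemble f g) = T" using T by (simp add: assemble_fillings)
    show "(up_filling T, low_filling T) \<in> F \<times> G" using T by simp
    have u: "avar (T (up_box b)) = a_up (up_filling T b)" if "b \<in> BU" for b
      using assemble_up[OF that, of "up_filling T" "low_filling T"] by (simp add: assemble_fillings T a_up_def)
    have l: "avar (T (low_box n b)) = a_low (low_filling T b)" if "b \<in> BL" for b
      using assemble_low[OF that, of "up_filling T" "low_filling T"] by (simp add: assemble_fillings T a_low_def)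
    have "(\<Prod>b\<in>S. avar (T b)) = (\<Prod>b\<in>BU. avar (T (up_box b))) * (\<Prod>b\<in>BL. avar (T (low_box n b)))"
      by (rule prod_skew)
    also have "(\<Prod>b\<in>BU. avar (T (up_box b))) = weight a_up BU (up_filling T)"
      unfolding weight_def by (rule prod.cong[OF refl u])
    also have "(\<Prod>b\<in>BL. avar (T (low_box n b))) = weight a_low BL (low_filling T)"
      unfolding weight_def by (rule prod.cong[OF refl l])
    finally show "(case (up_filling T, low_filling T) of (f, g) \<Rightarrow> weight a_up BU f * weight a_low BL g) =
        (\<Prod>b\<in>S. avar (T b))" by (simp only: prod.case)
  next
    fix b assume "b \<in> F \<times> G"
    then obtain f g where fg: "b = (f, g)" "f \<in> F" "g \<in> G" by blast
    have "up_filling (assemble f g) = f" by (rule up_filling_assemble[OF subsetD[OF F fg(2)]])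
    moreover have "low_filling (assemble f g) = g" by (rule low_filling_assemble[OF subsetD[OF G fg(3)]])
    ultimately show "(up_filling (case b of (f, g) \<Rightarrow> assemble f g), low_filling (case b of (f, g) \<Rightarrow> assemble f g)) = b"
      and "(case b of (f, g) \<Rightarrow> assemble f g) \<in> \<T>"
      using fg by (simp_all add: \<T> signed_assemble)
  qed
  then show ?thesis by (simp add: sum_product sum.cartesian_product)
qed

text \<open>Since \<open>arm \<xi> (r - 1)\<close> is \<open>part \<xi> r\<close> - r, the flag
  becomes the row bound. In the upper part the sign reverses the order of the entries; in the lower
  part, as in \<open>low_h_fillings\<close>, the order of the boxes is reversed instead.\<close>

lemma up_e_fillings:
  assumes T: "signed T" and t: "\<forall>i<d. arm \<xi> i \<le> t"
  shows "up_filling T \<in> e_fillings d (arm \<xi>) (arm \<eta>) t \<longleftrightarrow>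
    (\<forall>r c c'. r \<le> d \<and> c < c' \<and> (r, c) \<in> S \<and> (r, c') \<in> S \<longrightarrow> T (r, c) > T (r, c')) \<and>
    (\<forall>r r' c. r < r' \<and> r' \<le> d \<and> (r, c) \<in> S \<and> (r', c) \<in> S \<longrightarrow> T (r, c) \<ge> T (r', c)) \<and>
    (\<forall>r c. r \<le> d \<and> (r, c) \<in> S \<longrightarrow> T (r, c) \<in> {int r - int (part \<xi> r) + 1..0})" (is "_ \<longleftrightarrow> ?R \<and> ?C \<and> ?F")
proof -
  let ?f = "\<lambda>b. nat (- T b)"
  have neg: "T (r, c) \<le> 0" if "r \<le> d" "(r, c) \<in> S" for r c using T that by (auto simp: signed_def)
  have val: "up_filling T b = ?f (up_box b)" if "b \<in> BU" for b using that by (simp add: up_filling_def)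
  have "(\<forall>i p. (i, p) \<in> BU \<longrightarrow> up_filling T (i, p) < arm \<xi> i) \<longrightarrow> up_filling T \<in> BU \<rightarrow>\<^sub>E {..<t}"
  proof
    assume *: "\<forall>i p. (i, p) \<in> BU \<longrightarrow> up_filling T (i, p) < arm \<xi> i"
    have "up_filling T (i, p) < t" if "(i, p) \<in> BU" for i p
      using *[rule_format, OF that] t[rule_format, of i] that by (simp add: boxes_iff)
    then show "up_filling T \<in> BU \<rightarrow>\<^sub>E {..<t}" by (auto simp: up_filling_def)
  qed
  then have "up_filling T \<in> e_fillings d (arm \<xi>) (arm \<eta>) t \<longleftrightarrow>
     (\<forall>i p p'. p < p' \<and> (i, p) \<in> BU \<and> (i, p') \<in> BU \<longrightarrow> up_filling T (i, p) < up_filling T (i, p')) \<and>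
     (\<forall>i i' p p'. i < i' \<and> i + p = i' + p' \<and> (i, p) \<in> BU \<and> (i', p') \<in> BU \<longrightarrow> up_filling T (i, p) \<le> up_filling T (i', p')) \<and>
     (\<forall>i p. (i, p) \<in> BU \<longrightarrow> up_filling T (i, p) < arm \<xi> i)"
    by (auto simp only: e_fillings_def mem_Collect_eq)
  also have "\<dots> \<longleftrightarrow>
     (\<forall>i p p'. p < p' \<and> (i, p) \<in> BU \<and> (i, p') \<in> BU \<longrightarrow> ?f (up_box (i, p)) < ?f (up_box (i, p'))) \<and>
     (\<forall>i i' p p'. i < i' \<and> i + p = i' + p' \<and> (i, p) \<in> BU \<and> (i', p') \<in> BU \<longrightarrow> ?f (up_box (i, p)) \<le> ?f (up_box (i', p'))) \<and>
     (\<forall>i p. (i, p) \<in> BU \<longrightarrow> ?f (up_box (i, p)) < arm \<xi> i)"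
    by (simp add: val cong: conj_cong imp_cong)
  also have "\<dots> \<longleftrightarrow>
     (\<forall>r c c'. r \<le> d \<and> c < c' \<and> (r, c) \<in> S \<and> (r, c') \<in> S \<longrightarrow> ?f (r, c) < ?f (r, c')) \<and>
     (\<forall>r r' c. r < r' \<and> r' \<le> d \<and> (r, c) \<in> S \<and> (r', c) \<in> S \<longrightarrow> ?f (r, c) \<le> ?f (r', c)) \<and>
     (\<forall>r c. r \<le> d \<and> (r, c) \<in> S \<longrightarrow> ?f (r, c) < arm \<xi> (r - 1))"
    by (simp only: up_rows[where Q = "\<lambda>b b'. ?f b < ?f b'"] up_columns[where Q = "\<lambda>b b'. ?f b \<le> ?f b'"]
        up_all[where Q = "\<lambda>i b. ?f b < arm \<xi> i"])
  also have "\<dots> \<longleftrightarrow> ?R \<and> ?C \<and> ?F"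
  proof (intro arg_cong2[where f = "(\<and>)"] arg_cong[where f = All] ext imp_cong refl)
    fix r c c' assume "r \<le> d \<and> c < c' \<and> (r, c) \<in> S \<and> (r, c') \<in> S"
    then show "?f (r, c) < ?f (r, c') \<longleftrightarrow> T (r, c') < T (r, c)" using neg[of r c] neg[of r c'] by auto
  next
    fix r r' c assume "r < r' \<and> r' \<le> d \<and> (r, c) \<in> S \<and> (r', c) \<in> S"
    then show "?f (r, c) \<le> ?f (r', c) \<longleftrightarrow> T (r', c) \<le> T (r, c)" using neg[of r c] neg[of r' c] by auto
  next
    fix r c assume rc: "r \<le> d \<and> (r, c) \<in> S"
    then have "arm \<xi> (r - 1) + r = part \<xi> r" using part_above[of r] by (auto simp: arm_def skew_iff)
    then show "?f (r, c) < arm \<xi> (r - 1) \<longleftrightarrow> T (r, c) \<in> {int r - int (part \<xi> r) + 1..0}"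
      using neg[of r c] rc by auto
  qed
  finally show ?thesis .
qed

lemma up_h_fillings:
  assumes T: "signed T" and t: "\<forall>i<d. arm \<eta> i < t"
  shows "up_filling T \<in> h_fillings d (arm \<xi>) (arm \<eta>) t \<longleftrightarrow>
    (\<forall>r c c'. r \<le> d \<and> c < c' \<and> (r, c) \<in> S \<and> (r, c') \<in> S \<longrightarrow> T (r, c) \<le> T (r, c')) \<and>
    (\<forall>r r' c. r < r' \<and> r' \<le> d \<and> (r, c) \<in> S \<and> (r', c) \<in> S \<longrightarrow> T (r, c) < T (r', c)) \<and>
    (\<forall>r c. r \<le> d \<and> (r, c) \<in> S \<longrightarrow> T (r, c) \<in> {int r - int (part \<eta> r)..0})" (is "_ \<longleftrightarrow> ?R \<and> ?C \<and> ?F")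
proof -
  let ?f = "\<lambda>b. nat (- T b)"
  have neg: "T (r, c) \<le> 0" if "r \<le> d" "(r, c) \<in> S" for r c using T that by (auto simp: signed_def)
  have val: "up_filling T b = ?f (up_box b)" if "b \<in> BU" for b using that by (simp add: up_filling_def)
  have "(\<forall>i p. (i, p) \<in> BU \<longrightarrow> up_filling T (i, p) \<le> arm \<eta> i) \<longrightarrow> up_filling T \<in> BU \<rightarrow>\<^sub>E {..<t}"
  proof
    assume *: "\<forall>i p. (i, p) \<in> BU \<longrightarrow> up_filling T (i, p) \<le> arm \<eta> i"
    have "up_filling T (i, p) < t" if "(i, p) \<in> BU" for i p
      using *[rule_format, OF that] t[rule_format, of i] that by (simp add: boxes_iff)
    then show "up_filling T \<in> BU \<rightarrow>\<^sub>E {..<t}" by (auto simp: up_filling_def)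
  qed
  then have "up_filling T \<in> h_fillings d (arm \<xi>) (arm \<eta>) t \<longleftrightarrow>
     (\<forall>i p p'. p < p' \<and> (i, p) \<in> BU \<and> (i, p') \<in> BU \<longrightarrow> up_filling T (i, p') \<le> up_filling T (i, p)) \<and>
     (\<forall>i i' p p'. i < i' \<and> i + p = i' + p' \<and> (i, p) \<in> BU \<and> (i', p') \<in> BU \<longrightarrow> up_filling T (i', p') < up_filling T (i, p)) \<and>
     (\<forall>i p. (i, p) \<in> BU \<longrightarrow> up_filling T (i, p) \<le> arm \<eta> i)"
    by (auto simp only: h_fillings_def mem_Collect_eq)
  also have "\<dots> \<longleftrightarrow>
     (\<forall>i p p'. p < p' \<and> (i, p) \<in> BU \<and> (i, p') \<in> BU \<longrightarrow> ?f (up_box (i, p')) \<le> ?f (up_box (i, p))) \<and>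
     (\<forall>i i' p p'. i < i' \<and> i + p = i' + p' \<and> (i, p) \<in> BU \<and> (i', p') \<in> BU \<longrightarrow> ?f (up_box (i', p')) < ?f (up_box (i, p))) \<and>
     (\<forall>i p. (i, p) \<in> BU \<longrightarrow> ?f (up_box (i, p)) \<le> arm \<eta> i)"
    by (simp add: val cong: conj_cong imp_cong)
  also have "\<dots> \<longleftrightarrow>
     (\<forall>r c c'. r \<le> d \<and> c < c' \<and> (r, c) \<in> S \<and> (r, c') \<in> S \<longrightarrow> ?f (r, c') \<le> ?f (r, c)) \<and>
     (\<forall>r r' c. r < r' \<and> r' \<le> d \<and> (r, c) \<in> S \<and> (r', c) \<in> S \<longrightarrow> ?f (r', c) < ?f (r, c)) \<and>
     (\<forall>r c. r \<le> d \<and> (r, c) \<in> S \<longrightarrow> ?f (r, c) \<le> arm \<eta> (r - 1))"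
    by (simp only: up_rows[where Q = "\<lambda>b b'. ?f b' \<le> ?f b"] up_columns[where Q = "\<lambda>b b'. ?f b' < ?f b"]
        up_all[where Q = "\<lambda>i b. ?f b \<le> arm \<eta> i"])
  also have "\<dots> \<longleftrightarrow> ?R \<and> ?C \<and> ?F"
  proof (intro arg_cong2[where f = "(\<and>)"] arg_cong[where f = All] ext imp_cong refl)
    fix r c c' assume "r \<le> d \<and> c < c' \<and> (r, c) \<in> S \<and> (r, c') \<in> S"
    then show "?f (r, c') \<le> ?f (r, c) \<longleftrightarrow> T (r, c) \<le> T (r, c')" using neg[of r c] neg[of r c'] by auto
  next
    fix r r' c assume "r < r' \<and> r' \<le> d \<and> (r, c) \<in> S \<and> (r', c) \<in> S"
    then show "?f (r', c) < ?f (r, c) \<longleftrightarrow> T (r, c) < T (r', c)" using neg[of r c] neg[of r' c] by auto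
  next
    fix r c assume rc: "r \<le> d \<and> (r, c) \<in> S"
    then have "arm \<eta> (r - 1) + r = part \<eta> r" using part_above[of r] by (auto simp: arm_def skew_iff)
    then show "?f (r, c) \<le> arm \<eta> (r - 1) \<longleftrightarrow> T (r, c) \<in> {int r - int (part \<eta> r)..0}"
      using neg[of r c] rc by auto
  qed
  finally show ?thesis .
qed

lemma low_h_fillings:
  assumes T: "signed T" and t: "\<forall>i<n - d. leg n \<xi> i < t"
  shows "low_filling T \<in> h_fillings (n - d) (leg n \<eta>) (leg n \<xi>) t \<longleftrightarrow>
    (\<forall>r r' c. d < r \<and> r < r' \<and> (r, c) \<in> S \<and> (r', c) \<in> S \<longrightarrow> T (r, c) < T (r', c)) \<and>
    (\<forall>r c c'. d < r \<and> c < c' \<and> (r, c) \<in> S \<and> (r, c') \<in> S \<longrightarrow> T (r, c) \<le> T (r, c')) \<and>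
    (\<forall>r c. d < r \<and> (r, c) \<in> S \<longrightarrow> T (r, c) \<le> int r - int (part \<xi> r))" (is "_ \<longleftrightarrow> ?C \<and> ?R \<and> ?F")
proof -
  let ?f = "\<lambda>b. nat (T b - 1)"
  have pos: "1 \<le> T (r, c)" if "d < r" "(r, c) \<in> S" for r c using T that by (auto simp: signed_def)
  have val: "low_filling T b = ?f (low_box n b)" if "b \<in> BL" for b using that by (simp add: low_filling_def)
  have "(\<forall>i p. (i, p) \<in> BL \<longrightarrow> low_filling T (i, p) \<le> leg n \<xi> i) \<longrightarrow> low_filling T \<in> BL \<rightarrow>\<^sub>E {..<t}"
  proof
    assume *: "\<forall>i p. (i, p) \<in> BL \<longrightarrow> low_filling T (i, p) \<le> leg n \<xi> i"
    have "low_filling T (i, p) < t" if "(i, p) \<in> BL" for i p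
      using *[rule_format, OF that] t[rule_format, of i] that by (simp add: boxes_iff)
    then show "low_filling T \<in> BL \<rightarrow>\<^sub>E {..<t}" by (auto simp: low_filling_def)
  qed
  then have "low_filling T \<in> h_fillings (n - d) (leg n \<eta>) (leg n \<xi>) t \<longleftrightarrow>
     (\<forall>i i' p p'. i < i' \<and> i + p = i' + p' \<and> (i, p) \<in> BL \<and> (i', p') \<in> BL \<longrightarrow> low_filling T (i', p') < low_filling T (i, p)) \<and>
     (\<forall>i p p'. p < p' \<and> (i, p) \<in> BL \<and> (i, p') \<in> BL \<longrightarrow> low_filling T (i, p') \<le> low_filling T (i, p)) \<and>
     (\<forall>i p. (i, p) \<in> BL \<longrightarrow> low_filling T (i, p) \<le> leg n \<xi> i)"
    by (auto simp only: h_fillings_def mem_Collect_eq)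
  also have "\<dots> \<longleftrightarrow>
     (\<forall>i i' p p'. i < i' \<and> i + p = i' + p' \<and> (i, p) \<in> BL \<and> (i', p') \<in> BL \<longrightarrow> ?f (low_box n (i', p')) < ?f (low_box n (i, p))) \<and>
     (\<forall>i p p'. p < p' \<and> (i, p) \<in> BL \<and> (i, p') \<in> BL \<longrightarrow> ?f (low_box n (i, p')) \<le> ?f (low_box n (i, p))) \<and>
     (\<forall>i p. (i, p) \<in> BL \<longrightarrow> ?f (low_box n (i, p)) \<le> leg n \<xi> i)"
    by (simp add: val cong: conj_cong imp_cong)
  also have "\<dots> \<longleftrightarrow>
     (\<forall>r r' c. d < r \<and> r < r' \<and> (r, c) \<in> S \<and> (r', c) \<in> S \<longrightarrow> ?f (r, c) < ?f (r', c)) \<and>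
     (\<forall>r c c'. d < r \<and> c < c' \<and> (r, c) \<in> S \<and> (r, c') \<in> S \<longrightarrow> ?f (r, c) \<le> ?f (r, c')) \<and>
     (\<forall>r c. d < r \<and> (r, c) \<in> S \<longrightarrow> ?f (r, c) \<le> leg n \<xi> (n - r))"
    by (simp only: low_rows[where Q = "\<lambda>b b'. ?f b' \<le> ?f b"] low_columns[where Q = "\<lambda>b b'. ?f b' < ?f b"]
        low_all[where Q = "\<lambda>i b. ?f b \<le> leg n \<xi> i"])
  also have "\<dots> \<longleftrightarrow> ?C \<and> ?R \<and> ?F"
  proof (intro arg_cong2[where f = "(\<and>)"] arg_cong[where f = All] ext imp_cong refl)
    fix r r' c assume "d < r \<and> r < r' \<and> (r, c) \<in> S \<and> (r', c) \<in> S"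
    then show "?f (r, c) < ?f (r', c) \<longleftrightarrow> T (r, c) < T (r', c)" using pos[of r c] pos[of r' c] by auto
  next
    fix r c c' assume "d < r \<and> c < c' \<and> (r, c) \<in> S \<and> (r, c') \<in> S"
    then show "?f (r, c) \<le> ?f (r, c') \<longleftrightarrow> T (r, c) \<le> T (r, c')" using pos[of r c] pos[of r c'] by auto
  next
    fix r c assume rc: "d < r \<and> (r, c) \<in> S"
    obtain i p where "r = n - i" "i < n" "(i, p) \<in> BL" using lowerE rc by metis
    then have "leg n \<xi> (n - r) + part \<xi> r + 1 = r" using leg_part[of i n \<xi>] diag by (auto simp: boxes_iff)
    then show "?f (r, c) \<le> leg n \<xi> (n - r) \<longleftrightarrow> T (r, c) \<le> int r - int (part \<xi> r)"
      using pos[of r c] rc by auto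
  qed
  finally show ?thesis .
qed

lemma low_e_fillings:
  assumes T: "signed T" and t: "\<forall>i<n - d. leg n \<eta> i \<le> t"
  shows "low_filling T \<in> e_fillings (n - d) (leg n \<eta>) (leg n \<xi>) t \<longleftrightarrow>
    (\<forall>r r' c. d < r \<and> r < r' \<and> (r, c) \<in> S \<and> (r', c) \<in> S \<longrightarrow> T (r, c) \<ge> T (r', c)) \<and>
    (\<forall>r c c'. d < r \<and> c < c' \<and> (r, c) \<in> S \<and> (r, c') \<in> S \<longrightarrow> T (r, c) > T (r, c')) \<and>
    (\<forall>r c. d < r \<and> (r, c) \<in> S \<longrightarrow> T (r, c) < int r - int (part \<eta> r))" (is "_ \<longleftrightarrow> ?C \<and> ?R \<and> ?F")
proof -
  let ?f = "\<lambda>b. nat (T b - 1)"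
  have pos: "1 \<le> T (r, c)" if "d < r" "(r, c) \<in> S" for r c using T that by (auto simp: signed_def)
  have val: "low_filling T b = ?f (low_box n b)" if "b \<in> BL" for b using that by (simp add: low_filling_def)
  have "(\<forall>i p. (i, p) \<in> BL \<longrightarrow> low_filling T (i, p) < leg n \<eta> i) \<longrightarrow> low_filling T \<in> BL \<rightarrow>\<^sub>E {..<t}"
  proof
    assume *: "\<forall>i p. (i, p) \<in> BL \<longrightarrow> low_filling T (i, p) < leg n \<eta> i"
    have "low_filling T (i, p) < t" if "(i, p) \<in> BL" for i p
      using *[rule_format, OF that] t[rule_format, of i] that by (simp add: boxes_iff)
    then show "low_filling T \<in> BL \<rightarrow>\<^sub>E {..<t}" by (auto simp: low_filling_def)
  qed
  then have "low_filling T \<in> e_fillings (n - d) (leg n \<eta>) (leg n \<xi>) t \<longleftrightarrow>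
     (\<forall>i i' p p'. i < i' \<and> i + p = i' + p' \<and> (i, p) \<in> BL \<and> (i', p') \<in> BL \<longrightarrow> low_filling T (i, p) \<le> low_filling T (i', p')) \<and>
     (\<forall>i p p'. p < p' \<and> (i, p) \<in> BL \<and> (i, p') \<in> BL \<longrightarrow> low_filling T (i, p) < low_filling T (i, p')) \<and>
     (\<forall>i p. (i, p) \<in> BL \<longrightarrow> low_filling T (i, p) < leg n \<eta> i)"
    by (auto simp only: e_fillings_def mem_Collect_eq)
  also have "\<dots> \<longleftrightarrow>
     (\<forall>i i' p p'. i < i' \<and> i + p = i' + p' \<and> (i, p) \<in> BL \<and> (i', p') \<in> BL \<longrightarrow> ?f (low_box n (i, p)) \<le> ?f (low_box n (i', p'))) \<and>
     (\<forall>i p p'. p < p' \<and> (i, p) \<in> BL \<and> (i, p') \<in> BL \<longrightarrow> ?f (low_box n (i, p)) < ?f (low_box n (i, p'))) \<and>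
     (\<forall>i p. (i, p) \<in> BL \<longrightarrow> ?f (low_box n (i, p)) < leg n \<eta> i)"
    by (simp add: val cong: conj_cong imp_cong)
  also have "\<dots> \<longleftrightarrow>
     (\<forall>r r' c. d < r \<and> r < r' \<and> (r, c) \<in> S \<and> (r', c) \<in> S \<longrightarrow> ?f (r', c) \<le> ?f (r, c)) \<and>
     (\<forall>r c c'. d < r \<and> c < c' \<and> (r, c) \<in> S \<and> (r, c') \<in> S \<longrightarrow> ?f (r, c') < ?f (r, c)) \<and>
     (\<forall>r c. d < r \<and> (r, c) \<in> S \<longrightarrow> ?f (r, c) < leg n \<eta> (n - r))"
    by (simp only: low_rows[where Q = "\<lambda>b b'. ?f b < ?f b'"] low_columns[where Q = "\<lambda>b b'. ?f b \<le> ?f b'"]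
        low_all[where Q = "\<lambda>i b. ?f b < leg n \<eta> i"])
  also have "\<dots> \<longleftrightarrow> ?C \<and> ?R \<and> ?F"
  proof (intro arg_cong2[where f = "(\<and>)"] arg_cong[where f = All] ext imp_cong refl)
    fix r r' c assume "d < r \<and> r < r' \<and> (r, c) \<in> S \<and> (r', c) \<in> S"
    then show "?f (r', c) \<le> ?f (r, c) \<longleftrightarrow> T (r', c) \<le> T (r, c)" using pos[of r c] pos[of r' c] by auto
  next
    fix r c c' assume "d < r \<and> c < c' \<and> (r, c) \<in> S \<and> (r, c') \<in> S"
    then show "?f (r, c') < ?f (r, c) \<longleftrightarrow> T (r, c') < T (r, c)" using pos[of r c] pos[of r c'] by auto
  next
    fix r c assume rc: "d < r \<and> (r, c) \<in> S"
    obtain i p where "r = n - i" "i < n" "(i, p) \<in> BL" using lowerE rc by metis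
    then have "leg n \<eta> (n - r) + part \<eta> r + 1 = r" using leg_part[of i n \<eta>] diag by (auto simp: boxes_iff)
    then show "?f (r, c) < leg n \<eta> (n - r) \<longleftrightarrow> T (r, c) < int r - int (part \<eta> r)"
      using pos[of r c] rc by auto
  qed
  finally show ?thesis .
qed

section \<open>Row bounds against column bounds\<close>

lemma low_column_conditions:
  "(\<forall>r r' c. d < r \<and> r < r' \<and> (r, c) \<in> S \<and> (r', c) \<in> S \<longrightarrow> Q (r, c) (r', c)) \<longleftrightarrow>
   (\<forall>r r' c. c \<le> d \<and> r < r' \<and> (r, c) \<in> S \<and> (r', c) \<in> S \<longrightarrow> Q (r, c) (r', c))"
  using column_iff by blast

lemma low_row_conditions:
  "(\<forall>r c c'. d < r \<and> c < c' \<and> (r, c) \<in> S \<and> (r, c') \<in> S \<longrightarrow> Q (r, c) (r, c')) \<longleftrightarrow>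
   (\<forall>r c c'. c < c' \<and> c' \<le> d \<and> (r, c) \<in> S \<and> (r, c') \<in> S \<longrightarrow> Q (r, c) (r, c'))"
  using column_iff by blast

text \<open>The bounds in the definition of the dual hook tableaux are imposed on columns, those of the
  fillings on rows. Strictness down the columns makes them equivalent.\<close>

lemma dual_column_bound:
  assumes C: "\<And>r r' c. d < r \<Longrightarrow> r < r' \<Longrightarrow> (r, c) \<in> S \<Longrightarrow> (r', c) \<in> S \<Longrightarrow> T (r, c) < (T (r', c) :: int)"
    and R: "\<And>r c c'. d < r \<Longrightarrow> c < c' \<Longrightarrow> (r, c) \<in> S \<Longrightarrow> (r, c') \<in> S \<Longrightarrow> T (r, c) \<le> T (r, c')"
  shows "(\<forall>r c. d < r \<and> (r, c) \<in> S \<longrightarrow> T (r, c) \<le> int r - int (part \<xi> r)) \<longleftrightarrow>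
    (\<forall>r c. c \<le> d \<and> (r, c) \<in> S \<longrightarrow> T (r, c) \<le> int (conjugate_part \<xi> c) - int c)" (is "?A \<longleftrightarrow> ?B")
proof
  assume ?A
  show ?B
  proof (intro allI impI, elim conjE)
    fix r c assume "c \<le> d" and rc: "(r, c) \<in> S"
    then have "d < r" using column_iff by blast
    then have "T (r, c) \<le> int r - int (part \<xi> r)" using \<open>?A\<close> rc by blast
    moreover have "c \<le> part \<xi> r" "0 < c" using rc by (auto simp: skew_iff)
    moreover have "r \<le> conjugate_part \<xi> c"
      using conjugate_iff[of c r \<xi>] rc \<open>0 < c\<close> by (simp add: skew_def)
    ultimately show "T (r, c) \<le> int (conjugate_part \<xi> c) - int c" by linarith
  qed
next
  assume ?B
  show ?A
  proof (intro allI impI, elim conjE)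
    fix r c assume "d < r" and rc: "(r, c) \<in> S"
    \<comment> \<open>The last box of the row: entries grow weakly towards it, and from there
      strictly down the column to its bottom box, where the column bound applies.\<close>
    define c' where "c' = part \<xi> r"
    have "c \<le> c'" "0 < c'" using rc by (auto simp: skew_iff c'_def)
    have rc': "(r, c') \<in> S" using rc by (auto simp: skew_iff c'_def)
    have le: "T (r, c) \<le> T (r, c')" using R[OF \<open>d < r\<close> _ rc rc'] \<open>c \<le> c'\<close> by (cases "c = c'") auto
    have in_S: "(r', c') \<in> S" if "r \<le> r'" "r' \<le> conjugate_part \<xi> c'" for r'
    proof -
      have "(r', c') \<in> diagram \<xi>" using conjugate_iff[of c' r' \<xi>] \<open>0 < c'\<close> that rc by (simp add: skew_iff)
      moreover have "part \<eta> r' \<le> part \<eta> r" using part_mono[of r r' \<eta>] that rc by (simp add: skew_iff)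
      ultimately show ?thesis using rc' that by (auto simp: skew_iff diagram_def)
    qed
    have "r \<le> conjugate_part \<xi> c'" using conjugate_iff[of c' r \<xi>] rc' \<open>0 < c'\<close> by (simp add: skew_def)
    then have "T (r, c') + (int (conjugate_part \<xi> c') - int r) \<le> T (conjugate_part \<xi> c', c')"
    proof (induction rule: dec_induct)
      case (step m)
      then have "T (m, c') < T (Suc m, c')" using C[of m "Suc m" c'] in_S \<open>d < r\<close> by simp
      then show ?case using step.IH by simp
    qed simp
    also have "\<dots> \<le> int (conjugate_part \<xi> c') - int c'"
      using \<open>?B\<close> in_S[OF \<open>r \<le> conjugate_part \<xi> c'\<close>] column_iff[OF rc'] \<open>d < r\<close> by auto
    finally show "T (r, c) \<le> int r - int (part \<xi> r)" using le by (simp add: c'_def)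
  qed
qed

text \<open>The mirror argument, with strictness along the rows: from a box one moves up to the top
  box of its column in the skew diagram and then left to the first box of that row, gaining at least
  1 with each step to the left. Conversely, the column bound at the first box of a row already gives
  the row bound.\<close>

lemma column_bound:
  assumes C: "\<And>r r' c. d < r \<Longrightarrow> r < r' \<Longrightarrow> (r, c) \<in> S \<Longrightarrow> (r', c) \<in> S \<Longrightarrow> (T (r', c) :: int) \<le> T (r, c)"
    and R: "\<And>r c c'. d < r \<Longrightarrow> c < c' \<Longrightarrow> (r, c) \<in> S \<Longrightarrow> (r, c') \<in> S \<Longrightarrow> T (r, c') < T (r, c)"
  shows "(\<forall>r c. d < r \<and> (r, c) \<in> S \<longrightarrow> T (r, c) < int r - int (part \<eta> r)) \<longleftrightarrow>
    (\<forall>r c. c \<le> d \<and> (r, c) \<in> S \<longrightarrow> T (r, c) \<le> int (conjugate_part \<eta> c) - int c + 1)" (is "?A \<longleftrightarrow> ?B")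
proof
  assume ?B
  show ?A
  proof (intro allI impI, elim conjE)
    fix r c assume "d < r" and rc: "(r, c) \<in> S"
    define c' where "c' = Suc (part \<eta> r)"
    have "c' \<le> c" using rc by (auto simp: skew_iff c'_def)
    have rc': "(r, c') \<in> S" using rc by (auto simp: skew_iff c'_def)
    have "T (r, c) \<le> T (r, c')" using R[OF \<open>d < r\<close> _ rc' rc] \<open>c' \<le> c\<close> by (cases "c = c'") auto
    moreover have "T (r, c') \<le> int (conjugate_part \<eta> c') - int c' + 1"
      using \<open>?B\<close> rc' column_iff[OF rc'] \<open>d < r\<close> by auto
    moreover have "conjugate_part \<eta> c' < r"
      using conjugate_iff[of c' r \<eta>] rc' by (auto simp: skew_iff c'_def skew_def diagram_def)
    ultimately show "T (r, c) < int r - int (part \<eta> r)" by (simp add: c'_def)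
  qed
next
  assume ?A
  show ?B
  proof (intro allI impI, elim conjE)
    fix r c assume "c \<le> d" and rc: "(r, c) \<in> S"
    have "0 < c" using rc by (auto simp: skew_iff)
    define r' where "r' = Suc (conjugate_part \<eta> c)"
    have "(r, c) \<notin> diagram \<eta>" using rc by (simp add: skew_def)
    then have "r' \<le> r" using conjugate_iff[of c r \<eta>] rc \<open>0 < c\<close> by (simp add: r'_def skew_iff)
    have "(r', c) \<notin> diagram \<eta>" using conjugate_iff[of c r' \<eta>] \<open>0 < c\<close> by (simp add: r'_def)
    moreover have "part \<xi> r \<le> part \<xi> r'" using part_mono[of r' r \<xi>] \<open>r' \<le> r\<close> by (simp add: r'_def)
    ultimately have rc': "(r', c) \<in> S" using rc \<open>0 < c\<close> by (auto simp: skew_iff diagram_def r'_def)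
    then have "d < r'" using column_iff \<open>c \<le> d\<close> by blast
    have le: "T (r, c) \<le> T (r', c)" using C[OF \<open>d < r'\<close> _ rc' rc] \<open>r' \<le> r\<close> by (cases "r' = r") auto
    have in_S: "(r', m) \<in> S" if "Suc (part \<eta> r') \<le> m" "m \<le> c" for m
      using that rc' by (auto simp: skew_iff)
    have "Suc (part \<eta> r') \<le> c" using rc' by (simp add: skew_iff)
    then have "T (r', c) + (int c - int (Suc (part \<eta> r'))) \<le> T (r', Suc (part \<eta> r'))"
      using in_S
    proof (induction rule: dec_induct)
      case (step m)
      have "T (r', Suc m) < T (r', m)" using R[OF \<open>d < r'\<close>, of m "Suc m"] step.prems step.hyps by simp
      moreover have "T (r', m) + (int m - int (Suc (part \<eta> r'))) \<le> T (r', Suc (part \<eta> r'))"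
        using step.IH step.prems by simp
      ultimately show ?case by simp
    qed simp
    also have "\<dots> < int r' - int (part \<eta> r')"
      using \<open>?A\<close> in_S[OF order_refl \<open>Suc (part \<eta> r') \<le> c\<close>] \<open>d < r'\<close> by blast
    finally show "T (r, c) \<le> int (conjugate_part \<eta> c) - int c + 1" using le by (simp add: r'_def)
  qed
qed

lemma low_bounds:
  assumes "signed T"
  shows "(\<forall>r c. c \<le> d \<and> (r, c) \<in> S \<longrightarrow> T (r, c) \<in> {1..B c}) \<longleftrightarrow>
    (\<forall>r c. c \<le> d \<and> (r, c) \<in> S \<longrightarrow> T (r, c) \<le> B c)"
proof -
  have "1 \<le> T (r, c)" if "c \<le> d" "(r, c) \<in> S" for r c
    using assms column_iff that unfolding signed_def by blast
  then show ?thesis by simp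
qed

lemma signedI:
  assumes "T \<in> S \<rightarrow>\<^sub>E UNIV" "\<forall>r c. r \<le> d \<and> (r, c) \<in> S \<longrightarrow> T (r, c) \<in> {A r..0}"
    "\<forall>r c. c \<le> d \<and> (r, c) \<in> S \<longrightarrow> T (r, c) \<in> {1..B c}"
  shows "signed T"
  unfolding signed_def
proof (intro conjI allI impI)
  fix r c assume rc: "(r, c) \<in> S"
  show "T (r, c) \<le> 0" if "r \<le> d" using assms(2)[rule_format, of r c] rc that by simp
  show "1 \<le> T (r, c)" if "d < r" using assms(3)[rule_format, of c r] column_iff[OF rc] rc that by simp
qed (rule assms(1))

text \<open>The tableau bounds imply \<open>signed\<close>, which may therefore replace mere
  extensionality. The numbers t and t' only cap the alphabets and lie beyond all flags.\<close>

lemma dual_hook_tableaux_iff: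
  assumes "\<forall>i<d. arm \<xi> i \<le> t" "\<forall>i<n - d. leg n \<xi> i < t'"
  shows "T \<in> dual_hook_tableaux \<xi> \<eta> \<longleftrightarrow> signed T \<and> up_filling T \<in> e_fillings d (arm \<xi>) (arm \<eta>) t \<and>
    low_filling T \<in> h_fillings (n - d) (leg n \<eta>) (leg n \<xi>) t'" (is "_ \<longleftrightarrow> ?R")
proof -
  let ?UR = "\<forall>r c c'. r \<le> d \<and> c < c' \<and> (r, c) \<in> S \<and> (r, c') \<in> S \<longrightarrow> T (r, c) > T (r, c')"
  let ?UC = "\<forall>r r' c. r < r' \<and> r' \<le> d \<and> (r, c) \<in> S \<and> (r', c) \<in> S \<longrightarrow> T (r, c) \<ge> T (r', c)"
  let ?UF = "\<forall>r c. r \<le> d \<and> (r, c) \<in> S \<longrightarrow> T (r, c) \<in> {int r - int (part \<xi> r) + 1..0}"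
  let ?LC = "\<forall>r r' c. c \<le> d \<and> r < r' \<and> (r, c) \<in> S \<and> (r', c) \<in> S \<longrightarrow> T (r, c) < T (r', c)"
  let ?LR = "\<forall>r c c'. c < c' \<and> c' \<le> d \<and> (r, c) \<in> S \<and> (r, c') \<in> S \<longrightarrow> T (r, c) \<le> T (r, c')"
  let ?LF = "\<forall>r c. c \<le> d \<and> (r, c) \<in> S \<longrightarrow> T (r, c) \<in> {1..int (conjugate_part \<xi> c) - int c}"
  have exchange: "(A \<Longrightarrow> U3 \<Longrightarrow> L3 \<Longrightarrow> B) \<Longrightarrow> (B \<Longrightarrow> A) \<Longrightarrow>
      (A \<and> U1 \<and> U2 \<and> U3 \<and> L1 \<and> L2 \<and> L3) = (B \<and> U1 \<and> U2 \<and> U3 \<and> L1 \<and> L2 \<and> L3)"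
    for A B U1 U2 U3 L1 L2 L3 by blast
  have "T \<in> dual_hook_tableaux \<xi> \<eta> \<longleftrightarrow> T \<in> S \<rightarrow>\<^sub>E UNIV \<and> ?UR \<and> ?UC \<and> ?UF \<and> ?LC \<and> ?LR \<and> ?LF"
    by (simp only: dual_hook_tableaux_def mem_Collect_eq diag)
  also have "\<dots> \<longleftrightarrow> signed T \<and> ?UR \<and> ?UC \<and> ?UF \<and> ?LC \<and> ?LR \<and> ?LF"
    by (rule exchange) (erule (2) signedI, simp add: signed_def)
  also have "\<dots> \<longleftrightarrow> ?R"
  proof (cases "signed T")
    case True
    have "?LC \<and> ?LR \<and> ?LF \<longleftrightarrow> low_filling T \<in> h_fillings (n - d) (leg n \<eta>) (leg n \<xi>) t'"
      unfolding low_h_fillings[OF True assms(2)]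
        low_column_conditions[of "\<lambda>b b'. T b < T b'", symmetric] low_row_conditions[of "\<lambda>b b'. T b \<le> T b'", symmetric]
        low_bounds[OF True]
      by (intro conj_cong refl) (rule dual_column_bound[symmetric]; blast)
    from this[symmetric] show ?thesis unfolding up_e_fillings[OF True assms(1)] by (simp only: conj_assoc)
  qed simp
  finally show ?thesis .
qed

lemma hook_tableaux_iff:
  assumes "\<forall>i<d. arm \<eta> i < t" "\<forall>i<n - d. leg n \<eta> i \<le> t'"
  shows "T \<in> hook_tableaux \<xi> \<eta> \<longleftrightarrow> signed T \<and> up_filling T \<in> h_fillings d (arm \<xi>) (arm \<eta>) t \<and>
    low_filling T \<in> e_fillings (n - d) (leg n \<eta>) (leg n \<xi>) t'" (is "_ \<longleftrightarrow> ?R")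
proof -
  let ?UR = "\<forall>r c c'. r \<le> d \<and> c < c' \<and> (r, c) \<in> S \<and> (r, c') \<in> S \<longrightarrow> T (r, c) \<le> T (r, c')"
  let ?UC = "\<forall>r r' c. r < r' \<and> r' \<le> d \<and> (r, c) \<in> S \<and> (r', c) \<in> S \<longrightarrow> T (r, c) < T (r', c)"
  let ?UF = "\<forall>r c. r \<le> d \<and> (r, c) \<in> S \<longrightarrow> T (r, c) \<in> {int r - int (part \<eta> r)..0}"
  let ?LC = "\<forall>r r' c. c \<le> d \<and> r < r' \<and> (r, c) \<in> S \<and> (r', c) \<in> S \<longrightarrow> T (r, c) \<ge> T (r', c)"
  let ?LR = "\<forall>r c c'. c < c' \<and> c' \<le> d \<and> (r, c) \<in> S \<and> (r, c') \<in> S \<longrightarrow> T (r, c) > T (r, c')"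
  let ?LF = "\<forall>r c. c \<le> d \<and> (r, c) \<in> S \<longrightarrow> T (r, c) \<in> {1..int (conjugate_part \<eta> c) - int c + 1}"
  have exchange: "(A \<Longrightarrow> U3 \<Longrightarrow> L3 \<Longrightarrow> B) \<Longrightarrow> (B \<Longrightarrow> A) \<Longrightarrow>
      (A \<and> U1 \<and> U2 \<and> U3 \<and> L1 \<and> L2 \<and> L3) = (B \<and> U1 \<and> U2 \<and> U3 \<and> L1 \<and> L2 \<and> L3)"
    for A B U1 U2 U3 L1 L2 L3 by blast
  have "T \<in> hook_tableaux \<xi> \<eta> \<longleftrightarrow> T \<in> S \<rightarrow>\<^sub>E UNIV \<and> ?UR \<and> ?UC \<and> ?UF \<and> ?LC \<and> ?LR \<and> ?LF"
    by (simp only: hook_tableaux_def mem_Collect_eq diag)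
  also have "\<dots> \<longleftrightarrow> signed T \<and> ?UR \<and> ?UC \<and> ?UF \<and> ?LC \<and> ?LR \<and> ?LF"
    by (rule exchange) (erule (2) signedI, simp add: signed_def)
  also have "\<dots> \<longleftrightarrow> ?R"
  proof (cases "signed T")
    case True
    have "?LC \<and> ?LR \<and> ?LF \<longleftrightarrow> low_filling T \<in> e_fillings (n - d) (leg n \<eta>) (leg n \<xi>) t'"
      unfolding low_e_fillings[OF True assms(2)]
        low_column_conditions[of "\<lambda>b b'. T b' \<le> T b", symmetric] low_row_conditions[of "\<lambda>b b'. T b' < T b", symmetric]
        low_bounds[OF True]
      by (intro conj_cong refl) (rule column_bound[symmetric]; blast)
    from this[symmetric] show ?thesis unfolding up_h_fillings[OF True assms(1)] by (simp only: conj_assoc)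
  qed simp
  finally show ?thesis .
qed

end

lemma arm_bound: "arm \<kappa> i \<le> part \<kappa> (Suc 0)"
  using part_mono[of "Suc 0" "Suc i" \<kappa>] by (simp add: arm_def)

lemma leg_bound: "i < n \<Longrightarrow> leg n \<kappa> i < n"
  by (simp add: leg_def)

text \<open>The sign comes with the elementary kernel: in \<open>to_schur\<close> it acts on the
  arms and counts boxes in the first d rows, in \<open>from_schur\<close> it acts below and counts
  the remaining boxes, as in \<open>phi_signed\<close>.\<close>

definition psi_signed :: "partition \<Rightarrow> partition \<Rightarrow> Qa" where
  "psi_signed \<nu> \<gamma> = (- 1) ^ boxes_upper \<nu> \<gamma> * psi \<nu> \<gamma>"

definition phi_signed :: "partition \<Rightarrow> partition \<Rightarrow> Qa" where
  "phi_signed \<alpha> \<kappa> = (- 1) ^ boxes_lower \<alpha> \<kappa> * phi \<alpha> \<kappa>"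

lemma signed_not_contained:
  "\<not> contained \<gamma> \<nu> \<Longrightarrow> psi_signed \<nu> \<gamma> = 0" "\<not> contained \<gamma> \<nu> \<Longrightarrow> phi_signed \<nu> \<gamma> = 0"
  by (simp_all add: psi_signed_def phi_signed_def psi_def phi_def)

text \<open>In the lower part the coordinates of \<gamma> dominate those of \<nu>, so \<gamma> plays
  the outer shape for \<open>h_fillings\<close>. The resulting value is free of n.\<close>

theorem minor_to_schur:
  assumes "length (parts \<nu>) \<le> n" "length (parts \<gamma>) \<le> n"
  shows "minor n (to_schur n) \<nu> \<gamma> = psi_signed \<nu> \<gamma>"
proof (cases "contained \<gamma> \<nu> \<and> diagonal \<gamma> = diagonal \<nu>")
  case True
  define d where "d = diagonal \<nu>"
  interpret frobenius_skew \<nu> \<gamma> n d by unfold_locales (use True assms in \<open>simp_all add: d_def\<close>)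
  have arm: "\<forall>i<d. arm \<nu> i \<le> part \<nu> (Suc 0)" by (simp add: arm_bound)
  have leg: "\<forall>i<n - d. leg n \<nu> i < n" by (simp add: leg_bound)
  have strict: "strict_seq d (arm \<nu>)" "strict_seq d (arm \<gamma>)" "strict_seq (n - d) (leg n \<nu>)" "strict_seq (n - d) (leg n \<gamma>)"
    using strict_arm[of \<nu>] strict_arm[of \<gamma>] strict_leg[of n \<nu>] strict_leg[of n \<gamma>] diag by simp_all
  let ?E = "\<Sum>f\<in>e_fillings d (arm \<nu>) (arm \<gamma>) (part \<nu> (Suc 0)). weight a_up BU f"
  let ?H = "\<Sum>g\<in>h_fillings (n - d) (leg n \<gamma>) (leg n \<nu>) n. weight a_low BL g"
  have "minor n (to_schur n) \<nu> \<gamma> = dt d (\<lambda>i j. e_kernel a_up (arm \<nu> i) (arm \<gamma> j)) *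
      dt (n - d) (\<lambda>i j. h_kernel a_low (leg n \<gamma> i) (leg n \<nu> j))"
    unfolding to_schur_def minor_hook_kernel[OF assms] diag by simp
  also have "dt d (\<lambda>i j. e_kernel a_up (arm \<nu> i) (arm \<gamma> j)) = (- 1) ^ card BU * ?E"
    by (rule e_kernel_determinant[OF strict(1,2)]) (use arm True in \<open>simp_all add: arm_le\<close>)
  also have "dt (n - d) (\<lambda>i j. h_kernel a_low (leg n \<gamma> i) (leg n \<nu> j)) = ?H"
    by (rule h_kernel_determinant[OF strict(4,3)]) (use leg True in \<open>simp_all add: leg_le\<close>)
  also have "(- 1) ^ card BU * ?E * ?H = (- 1) ^ boxes_upper \<nu> \<gamma> * (?E * ?H)"
    by (simp only: card_boxes mult.assoc)
  also have "?E * ?H = (\<Sum>T\<in>dual_hook_tableaux \<nu> \<gamma>. \<Prod>b\<in>S. avar (T b))"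
    by (rule assemble_sum[OF dual_hook_tableaux_iff[OF arm leg], symmetric])
      (auto simp: e_fillings_def h_fillings_def)
  finally show ?thesis using True by (simp add: psi_signed_def psi_def)
next
  case False
  have "minor n (to_schur n) \<nu> \<gamma> = 0"
  proof (cases "contained \<gamma> \<nu>")
    case True
    then show ?thesis using False unfolding to_schur_def minor_hook_kernel[OF assms] by simp
  next
    case False
    show ?thesis by (rule minor_not_contained[OF schur_upper(1) assms(2) False])
  qed
  then show ?thesis using False by (auto simp: psi_signed_def psi_def)
qed

theorem minor_from_schur:
  assumes "length (parts \<alpha>) \<le> n" "length (parts \<kappa>) \<le> n"
  shows "minor n (from_schur n) \<alpha> \<kappa> = phi_signed \<alpha> \<kappa>"
proof (cases "contained \<kappa> \<alpha> \<and> diagonal \<kappa> = diagonal \<alpha>")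
  case True
  define d where "d = diagonal \<alpha>"
  interpret frobenius_skew \<alpha> \<kappa> n d by unfold_locales (use True assms in \<open>simp_all add: d_def\<close>)
  have arm: "\<forall>i<d. arm \<kappa> i < Suc (part \<kappa> (Suc 0))" by (simp add: arm_bound less_Suc_eq_le)
  have leg: "\<forall>i<n - d. leg n \<kappa> i \<le> n" by (simp add: leg_bound less_imp_le)
  have strict: "strict_seq d (arm \<alpha>)" "strict_seq d (arm \<kappa>)" "strict_seq (n - d) (leg n \<alpha>)" "strict_seq (n - d) (leg n \<kappa>)"
    using strict_arm[of \<alpha>] strict_arm[of \<kappa>] strict_leg[of n \<alpha>] strict_leg[of n \<kappa>] diag by simp_all
  let ?H = "\<Sum>f\<in>h_fillings d (arm \<alpha>) (arm \<kappa>) (Suc (part \<kappa> (Suc 0))). weight a_up BU f"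
  let ?E = "\<Sum>g\<in>e_fillings (n - d) (leg n \<kappa>) (leg n \<alpha>) n. weight a_low BL g"
  have "minor n (from_schur n) \<alpha> \<kappa> = dt d (\<lambda>i j. h_kernel a_up (arm \<alpha> i) (arm \<kappa> j)) *
      dt (n - d) (\<lambda>i j. e_kernel a_low (leg n \<kappa> i) (leg n \<alpha> j))"
    unfolding from_schur_def minor_hook_kernel[OF assms] diag by simp
  also have "dt d (\<lambda>i j. h_kernel a_up (arm \<alpha> i) (arm \<kappa> j)) = ?H"
    by (rule h_kernel_determinant[OF strict(1,2)]) (use arm True in \<open>simp_all add: arm_le\<close>)
  also have "dt (n - d) (\<lambda>i j. e_kernel a_low (leg n \<kappa> i) (leg n \<alpha> j)) = (- 1) ^ card BL * ?E"
    by (rule e_kernel_determinant[OF strict(4,3)]) (use leg True in \<open>simp_all add: leg_le\<close>)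
  also have "?H * ((- 1) ^ card BL * ?E) = (- 1) ^ boxes_lower \<alpha> \<kappa> * (?H * ?E)"
    by (simp only: card_boxes mult.left_commute)
  also have "?H * ?E = (\<Sum>T\<in>hook_tableaux \<alpha> \<kappa>. \<Prod>b\<in>S. avar (T b))"
    by (rule assemble_sum[OF hook_tableaux_iff[OF arm leg], symmetric])
      (auto simp: e_fillings_def h_fillings_def)
  finally show ?thesis using True by (simp add: phi_signed_def phi_def)
next
  case False
  have "minor n (from_schur n) \<alpha> \<kappa> = 0"
  proof (cases "contained \<kappa> \<alpha>")
    case True
    then show ?thesis using False unfolding from_schur_def minor_hook_kernel[OF assms] by simp
  next
    case False
    show ?thesis by (rule minor_not_contained[OF schur_upper(2) assms(2) False])
  qed
  then show ?thesis using False by (auto simp: phi_signed_def phi_def)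
qed

section \<open>The dual Littlewood--Richardson polynomials\<close>

lemma double_schur_eq: "double_schur \<nu> = (\<Sum>\<gamma> | contained \<gamma> \<nu>. scalar (psi_signed \<nu> \<gamma>) * schurL \<gamma>)"
  by (rule double_schur_expansion) (meson contained_length minor_to_schur order_trans)

text \<open>Minors of two inverse lower triangular matrices are again inverse, by
  \<open>minor_mult\<close>.\<close>

lemma phi_psi:
  assumes "contained \<gamma> \<alpha>"
  shows "(\<Sum>\<kappa> | contained \<kappa> \<alpha>. phi_signed \<alpha> \<kappa> * psi_signed \<kappa> \<gamma>) = (if \<alpha> = \<gamma> then 1 else 0)"
proof -
  define n where "n = length (parts \<alpha>)"
  have len: "length (parts \<kappa>) \<le> n" if "contained \<kappa> \<alpha>" for \<kappa> using contained_length[OF that] by (simp add: n_def)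
  have "(\<Sum>\<kappa> | contained \<kappa> \<alpha>. phi_signed \<alpha> \<kappa> * psi_signed \<kappa> \<gamma>) =
      (\<Sum>\<kappa> | contained \<kappa> \<alpha>. minor n (from_schur n) \<alpha> \<kappa> * minor n (to_schur n) \<kappa> \<gamma>)"
  proof (rule sum.cong[OF refl])
    fix \<kappa> assume "\<kappa> \<in> {\<kappa>. contained \<kappa> \<alpha>}"
    then have "length (parts \<kappa>) \<le> n" using len by blast
    then show "phi_signed \<alpha> \<kappa> * psi_signed \<kappa> \<gamma> = minor n (from_schur n) \<alpha> \<kappa> * minor n (to_schur n) \<kappa> \<gamma>"
      using len[OF contained_refl] len[OF assms] by (simp only: minor_from_schur minor_to_schur)
  qed
  also have "\<dots> = minor n (\<lambda>a c. \<Sum>b\<le>a. from_schur n a b * to_schur n b c) \<alpha> \<gamma>"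
    by (rule minor_mult[symmetric]) (simp_all add: schur_upper n_def)
  also have "\<dots> = minor n (\<lambda>a b. if a = b then 1 else 0) \<alpha> \<gamma>" by (simp only: from_to_schur)
  also have "\<dots> = (if \<alpha> = \<gamma> then 1 else 0)" by (rule minor_identity) (simp_all add: len assms)
  finally show ?thesis .
qed

text \<open>The sum runs over all \<kappa> inside a fixed \<nu>, the additional terms being 0, so
  that all \<alpha> inside \<nu> share one index set.\<close>

lemma schurL_eq:
  assumes "contained \<alpha> \<nu>"
  shows "schurL \<alpha> = (\<Sum>\<kappa> | contained \<kappa> \<nu>. scalar (phi_signed \<alpha> \<kappa>) * double_schur \<kappa>)"
proof -
  let ?K = "\<lambda>\<alpha>. {\<kappa>. contained \<kappa> \<alpha>}"
  have "(\<Sum>\<kappa>\<in>?K \<nu>. scalar (phi_signed \<alpha> \<kappa>) * double_schur \<kappa>) =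
      (\<Sum>\<kappa>\<in>?K \<alpha>. scalar (phi_signed \<alpha> \<kappa>) * double_schur \<kappa>)"
    by (rule sum.mono_neutral_right) (use assms in \<open>auto simp: signed_not_contained intro: contained_trans\<close>)
  also have "\<dots> = (\<Sum>\<kappa>\<in>?K \<alpha>. \<Sum>\<gamma>\<in>?K \<alpha>. scalar (phi_signed \<alpha> \<kappa> * psi_signed \<kappa> \<gamma>) * schurL \<gamma>)"
  proof (rule sum.cong[OF refl])
    fix \<kappa> assume "\<kappa> \<in> ?K \<alpha>"
    then have "double_schur \<kappa> = (\<Sum>\<gamma>\<in>?K \<alpha>. scalar (psi_signed \<kappa> \<gamma>) * schurL \<gamma>)"
      unfolding double_schur_eq
      by (intro sum.mono_neutral_left) (auto simp: signed_not_contained intro: contained_trans)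
    then show "scalar (phi_signed \<alpha> \<kappa>) * double_schur \<kappa> =
        (\<Sum>\<gamma>\<in>?K \<alpha>. scalar (phi_signed \<alpha> \<kappa> * psi_signed \<kappa> \<gamma>) * schurL \<gamma>)"
      by (simp only: scalar_simps sum_distrib_left mult.assoc)
  qed
  also have "\<dots> = (\<Sum>\<gamma>\<in>?K \<alpha>. scalar (\<Sum>\<kappa>\<in>?K \<alpha>. phi_signed \<alpha> \<kappa> * psi_signed \<kappa> \<gamma>) * schurL \<gamma>)"
    by (subst sum.swap) (simp only: scalar_sum sum_distrib_right)
  also have "\<dots> = (\<Sum>\<gamma>\<in>?K \<alpha>. if \<alpha> = \<gamma> then schurL \<gamma> else 0)"
    by (intro sum.cong refl) (simp add: phi_psi)
  also have "\<dots> = schurL \<alpha>" by simp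
  finally show ?thesis ..
qed

lemma leading_double_schur:
  assumes "length (parts \<nu>) \<le> n" "length (parts \<mu>) \<le> n"
  shows "leading n \<mu> (double_schur \<nu>) \<noteq> 0 \<Longrightarrow> contained \<mu> \<nu>"
    and "leading n \<nu> (double_schur \<nu>) = 1"
proof -
  have eq: "leading n \<mu> (double_schur \<nu>) = (\<Sum>\<gamma> | contained \<gamma> \<nu>. psi_signed \<nu> \<gamma> * leading n \<mu> (schurL \<gamma>))" for \<mu>
    unfolding double_schur_eq leading_sum by simp
  have len: "length (parts \<gamma>) \<le> n" if "contained \<gamma> \<nu>" for \<gamma>
    using contained_length[OF that] assms(1) by simp
  show "contained \<mu> \<nu>" if nz: "leading n \<mu> (double_schur \<nu>) \<noteq> 0"
  proof -
    obtain \<gamma> where "\<gamma> \<in> {\<gamma>. contained \<gamma> \<nu>}" "psi_signed \<nu> \<gamma> * leading n \<mu> (schurL \<gamma>) \<noteq> 0"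
      using nz unfolding eq by (rule sum.not_neutral_contains_not_neutral)
    then have "contained \<gamma> \<nu>" "leading n \<mu> (schurL \<gamma>) \<noteq> 0" by auto
    then show ?thesis using leading_schurL_contained[OF len assms(2)] contained_trans by blast
  qed
  have "psi_signed \<nu> \<nu> = 1"
    using minor_to_schur[OF assms(1,1)] minor_diagonal[of "to_schur n" n \<nu>] by (simp add: schur_upper schur_diagonal)
  moreover have "leading n \<nu> (schurL \<gamma>) = 0" if "contained \<gamma> \<nu>" "\<gamma> \<noteq> \<nu>" for \<gamma>
    using leading_schurL_contained[OF len[OF that(1)] assms(1)] contained_antisym that by blast
  then have "leading n \<nu> (double_schur \<nu>) = (\<Sum>\<gamma>\<in>{\<nu>}. psi_signed \<nu> \<gamma> * leading n \<nu> (schurL \<gamma>))"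
    unfolding eq by (intro sum.mono_neutral_right) auto
  ultimately show "leading n \<nu> (double_schur \<nu>) = 1" by (simp add: leading_schurL_same assms(1))
qed

definition index_triples :: "partition \<Rightarrow> (partition \<times> partition \<times> partition) set" where
  "index_triples \<nu> = {(\<alpha>, \<beta>, \<gamma>). contained \<gamma> \<nu> \<and> contained \<alpha> \<gamma> \<and> contained \<beta> \<gamma>}"

definition dual_coeff :: "partition \<Rightarrow> partition \<Rightarrow> partition \<Rightarrow> Qa" where
  "dual_coeff \<nu> \<kappa> \<mu> = (\<Sum>(\<alpha>, \<beta>, \<gamma>)\<in>index_triples \<nu>.
     psi_signed \<nu> \<gamma> * of_int (LR_coeff \<alpha> \<beta> \<gamma>) * phi_signed \<alpha> \<kappa> * phi_signed \<beta> \<mu>)"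

lemma finite_index_triples [simp]: "finite (index_triples \<nu>)"
  by (rule finite_subset[of _ "{\<alpha>. contained \<alpha> \<nu>} \<times> {\<beta>. contained \<beta> \<nu>} \<times> {\<gamma>. contained \<gamma> \<nu>}"])
    (use contained_trans in \<open>auto simp: index_triples_def\<close>)

lemma dual_coeff_not_contained: "\<not> (contained \<kappa> \<nu> \<and> contained \<mu> \<nu>) \<Longrightarrow> dual_coeff \<nu> \<kappa> \<mu> = 0"
proof -
  assume *: "\<not> (contained \<kappa> \<nu> \<and> contained \<mu> \<nu>)"
  have "phi_signed \<alpha> \<kappa> * phi_signed \<beta> \<mu> = 0" if "(\<alpha>, \<beta>, \<gamma>) \<in> index_triples \<nu>" for \<alpha> \<beta> \<gamma>
  proof -
    have "contained \<alpha> \<nu>" "contained \<beta> \<nu>" using that contained_trans unfolding index_triples_def by blast+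
    then have "\<not> contained \<kappa> \<alpha> \<or> \<not> contained \<mu> \<beta>" using * contained_trans by blast
    then show ?thesis using signed_not_contained(2) by auto
  qed
  then show ?thesis unfolding dual_coeff_def by (intro sum.neutral) (auto simp: mult.assoc)
qed

lemma LR_coeff_commute: "LR_coeff \<alpha> \<beta> \<gamma> = LR_coeff \<beta> \<alpha> \<gamma>"
  by (simp add: LR_coeff_def mult.commute)

text \<open>Three expansions are composed: \<open>psi_signed\<close> leads to the elements
  \<open>schurL\<close>, the classical coefficients describe their coproduct, and
  \<open>phi_signed\<close> leads back in each tensor factor.\<close>

lemma comultiplication_double_schur:
  "comultiplication (double_schur \<nu>) = (\<Sum>(\<kappa>, \<mu>)\<in>{\<kappa>. contained \<kappa> \<nu>} \<times> {\<mu>. contained \<mu> \<nu>}.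
     scale_Lambda2 (dual_coeff \<nu> \<kappa> \<mu>) (tensor (double_schur \<kappa>) (double_schur \<mu>)))"
proof -
  interpret s: comm_ring_hom scalar2 by (rule comm_ring_hom_scalar2)
  let ?K = "{\<kappa>. contained \<kappa> \<nu>}"
  let ?t = "\<lambda>\<kappa> \<mu>. tensor (double_schur \<kappa>) (double_schur \<mu>)"
  let ?w = "\<lambda>\<alpha> \<beta> \<gamma>. psi_signed \<nu> \<gamma> * of_int (LR_coeff \<alpha> \<beta> \<gamma>)"
  have tensor: "tensor (schurL \<alpha>) (schurL \<beta>) =
      (\<Sum>(\<kappa>, \<mu>)\<in>?K \<times> ?K. scalar2 (phi_signed \<alpha> \<kappa> * phi_signed \<beta> \<mu>) * ?t \<kappa> \<mu>)"
    if "contained \<alpha> \<nu>" "contained \<beta> \<nu>" for \<alpha> \<beta>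
  proof -
    have "tensor (schurL \<alpha>) 1 = (\<Sum>\<kappa>\<in>?K. scalar2 (phi_signed \<alpha> \<kappa>) * tensor (double_schur \<kappa>) 1)"
      by (subst schurL_eq[OF that(1)])
        (simp only: tensor_sum scale_Lambda_scalar[symmetric] tensor_scale_left scale_Lambda2_scalar2)
    moreover have "tensor 1 (schurL \<beta>) = (\<Sum>\<mu>\<in>?K. scalar2 (phi_signed \<beta> \<mu>) * tensor 1 (double_schur \<mu>))"
      by (subst schurL_eq[OF that(2)])
        (simp only: tensor_sum scale_Lambda_scalar[symmetric] tensor_scale_right scale_Lambda2_scalar2)
    ultimately have "tensor (schurL \<alpha>) (schurL \<beta>) =
        (\<Sum>\<kappa>\<in>?K. \<Sum>\<mu>\<in>?K. scalar2 (phi_signed \<alpha> \<kappa>) * tensor (double_schur \<kappa>) 1 *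
          (scalar2 (phi_signed \<beta> \<mu>) * tensor 1 (double_schur \<mu>)))"
      by (subst tensor_split) (simp only: sum_product)
    also have "\<dots> = (\<Sum>\<kappa>\<in>?K. \<Sum>\<mu>\<in>?K. scalar2 (phi_signed \<alpha> \<kappa> * phi_signed \<beta> \<mu>) * ?t \<kappa> \<mu>)"
      by (intro sum.cong refl, subst tensor_split) (simp only: scalar2_simps mult_ac)
    finally show ?thesis by (simp only: sum.cartesian_product)
  qed
  have comul: "comul (scalar c * schurL \<gamma>) = (\<Sum>\<alpha> | contained \<alpha> \<gamma>. \<Sum>\<beta> | contained \<beta> \<gamma>.
      scalar2 (c * of_int (LR_coeff \<alpha> \<beta> \<gamma>)) * tensor (schurL \<alpha>) (schurL \<beta>))" for c \<gamma>
    using comultiplication_schurL[of c \<gamma>] unfolding comultiplication_eq scale_Lambda2_scalar2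
    by (simp only: LR_coeff_commute)
  have "comultiplication (double_schur \<nu>) = (\<Sum>\<gamma>\<in>?K. \<Sum>\<alpha> | contained \<alpha> \<gamma>. \<Sum>\<beta> | contained \<beta> \<gamma>.
      scalar2 (?w \<alpha> \<beta> \<gamma>) * tensor (schurL \<alpha>) (schurL \<beta>))"
    unfolding double_schur_eq comultiplication_eq comul_sum
    by (simp only: comul)
  also have "\<dots> = (\<Sum>(\<alpha>, \<beta>, \<gamma>)\<in>index_triples \<nu>. scalar2 (?w \<alpha> \<beta> \<gamma>) * tensor (schurL \<alpha>) (schurL \<beta>))"
  proof -
    have "(\<Sum>\<gamma>\<in>?K. \<Sum>\<alpha> | contained \<alpha> \<gamma>. \<Sum>\<beta> | contained \<beta> \<gamma>. f \<alpha> \<beta> \<gamma>) =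
        (\<Sum>(\<alpha>, \<beta>, \<gamma>)\<in>index_triples \<nu>. f \<alpha> \<beta> \<gamma>)" for f :: "_ \<Rightarrow> _ \<Rightarrow> _ \<Rightarrow> Lambda2"
    proof -
      have "(\<Sum>\<gamma>\<in>?K. \<Sum>\<alpha> | contained \<alpha> \<gamma>. \<Sum>\<beta> | contained \<beta> \<gamma>. f \<alpha> \<beta> \<gamma>) =
          (\<Sum>(\<gamma>, \<alpha>, \<beta>)\<in>(SIGMA \<gamma>:?K. {\<alpha>. contained \<alpha> \<gamma>} \<times> {\<beta>. contained \<beta> \<gamma>}). f \<alpha> \<beta> \<gamma>)"
        by (simp add: sum.cartesian_product sum.Sigma)
      also have "\<dots> = (\<Sum>(\<alpha>, \<beta>, \<gamma>)\<in>index_triples \<nu>. f \<alpha> \<beta> \<gamma>)"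
        by (rule sum.reindex_bij_witness[of _ "\<lambda>(\<alpha>, \<beta>, \<gamma>). (\<gamma>, \<alpha>, \<beta>)" "\<lambda>(\<gamma>, \<alpha>, \<beta>). (\<alpha>, \<beta>, \<gamma>)"])
          (auto simp: index_triples_def)
      finally show ?thesis .
    qed
    then show ?thesis .
  qed
  also have "\<dots> = (\<Sum>(\<alpha>, \<beta>, \<gamma>)\<in>index_triples \<nu>. \<Sum>(\<kappa>, \<mu>)\<in>?K \<times> ?K.
      scalar2 (?w \<alpha> \<beta> \<gamma> * phi_signed \<alpha> \<kappa> * phi_signed \<beta> \<mu>) * ?t \<kappa> \<mu>)"
  proof (intro sum.cong refl, clarify)
    fix \<alpha> \<beta> \<gamma> assume "(\<alpha>, \<beta>, \<gamma>) \<in> index_triples \<nu>"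
    then have "contained \<alpha> \<nu>" "contained \<beta> \<nu>" using contained_trans unfolding index_triples_def by blast+
    note t = tensor[OF this]
    show "scalar2 (?w \<alpha> \<beta> \<gamma>) * tensor (schurL \<alpha>) (schurL \<beta>) =
        (\<Sum>(\<kappa>, \<mu>)\<in>?K \<times> ?K. scalar2 (?w \<alpha> \<beta> \<gamma> * phi_signed \<alpha> \<kappa> * phi_signed \<beta> \<mu>) * ?t \<kappa> \<mu>)"
      unfolding t case_prod_beta sum_distrib_left by (simp only: scalar2_simps mult.assoc)
  qed
  also have "\<dots> = (\<Sum>(\<kappa>, \<mu>)\<in>?K \<times> ?K. \<Sum>(\<alpha>, \<beta>, \<gamma>)\<in>index_triples \<nu>.
      scalar2 (?w \<alpha> \<beta> \<gamma> * phi_signed \<alpha> \<kappa> * phi_signed \<beta> \<mu>) * ?t \<kappa> \<mu>)"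
    unfolding case_prod_beta by (rule sum.swap)
  also have "\<dots> = (\<Sum>(\<kappa>, \<mu>)\<in>?K \<times> ?K. scale_Lambda2 (dual_coeff \<nu> \<kappa> \<mu>) (?t \<kappa> \<mu>))"
    unfolding dual_coeff_def scale_Lambda2_scalar2 case_prod_beta s.hom_sum sum_distrib_right ..
  finally show ?thesis .
qed

text \<open>With n bounding all lengths, the functionals \<open>leading2\<close> are unitriangular
  on these tensors with respect to the sum of the two sizes.\<close>

lemma double_schur_independent:
  assumes P: "finite P"
    and zero: "(\<Sum>(\<kappa>, \<mu>)\<in>P. scale_Lambda2 (e (\<kappa>, \<mu>)) (tensor (double_schur \<kappa>) (double_schur \<mu>))) = 0"
    and "k \<in> P"
  shows "e k = 0"
proof -
  define n where "n = Max ((\<lambda>(\<kappa>, \<mu>). length (parts \<kappa>) + length (parts \<mu>)) ` P)"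
  have len: "length (parts (fst p)) \<le> n" "length (parts (snd p)) \<le> n" if "p \<in> P" for p
  proof -
    have "length (parts (fst p)) + length (parts (snd p)) \<le> n"
      unfolding n_def by (rule Max_ge) (use P that in \<open>auto simp: case_prod_beta image_iff\<close>)
    then show "length (parts (fst p)) \<le> n" "length (parts (snd p)) \<le> n" by simp_all
  qed
  define A where "A k j = leading n (fst k) (double_schur (fst j)) * leading n (snd k) (double_schur (snd j))" for k j
  show ?thesis
  proof (rule unitriangular_independent[of P A "\<lambda>p. psize (fst p) + psize (snd p)"])
    fix j k assume *: "j \<in> P" "k \<in> P" "A k j \<noteq> 0" "j \<noteq> k"
    have "leading n (fst k) (double_schur (fst j)) \<noteq> 0" "leading n (snd k) (double_schur (snd j)) \<noteq> 0"
      using *(3) by (auto simp: A_def)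
    then have "contained (fst k) (fst j)" "contained (snd k) (snd j)"
      by (auto intro: leading_double_schur(1)[of _ n] len *(1,2))
    moreover have "fst k \<noteq> fst j \<or> snd k \<noteq> snd j" using *(4) by (auto simp: prod_eq_iff)
    ultimately show "psize (fst k) + psize (snd k) < psize (fst j) + psize (snd j)"
      using psize_less[of "fst k" "fst j"] psize_less[of "snd k" "snd j"]
      by (cases "fst k = fst j"; cases "snd k = snd j") auto
  next
    fix k assume "k \<in> P"
    then have "leading n (fst k) (double_schur (fst k)) = 1" "leading n (snd k) (double_schur (snd k)) = 1"
      by (auto intro: leading_double_schur(2)[of _ n] len)
    then show "A k k = 1" by (simp add: A_def)
    have "0 = leading2 n (fst k) (snd k) (\<Sum>(\<kappa>, \<mu>)\<in>P. scale_Lambda2 (e (\<kappa>, \<mu>)) (tensor (double_schur \<kappa>) (double_schur \<mu>)))"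
      by (simp only: zero leading2_0)
    also have "\<dots> = (\<Sum>j\<in>P. e j * A k j)"
      by (simp add: leading2_sum case_prod_beta leading2_scale leading2_tensor A_def)
    finally show "(\<Sum>j\<in>P. e j * A k j) = 0" ..
  qed (use assms in auto)
qed

text \<open>The difference of two candidates for the description, taken over the union of their
  supports, is a relation among the tensors of double Schur functions and therefore zero.\<close>

theorem dual_LR_eq: "dual_LR \<kappa> \<mu> \<nu> = dual_coeff \<nu> \<kappa> \<mu>"
proof -
  let ?K = "{\<kappa>. contained \<kappa> \<nu>}"
  let ?t = "\<lambda>(\<kappa>, \<mu>). tensor (double_schur \<kappa>) (double_schur \<mu>)"
  let ?P = "\<lambda>c :: partition \<times> partition \<Rightarrow>\<^sub>0 Qa. comultiplication (double_schur \<nu>) =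
       (\<Sum>(\<alpha>, \<beta>)\<in>Poly_Mapping.keys c. scale_Lambda2 (Poly_Mapping.lookup c (\<alpha>, \<beta>))
          (tensor (double_schur \<alpha>) (double_schur \<beta>)))"
  define c where "c = Abs_poly_mapping (\<lambda>(\<kappa>, \<mu>). dual_coeff \<nu> \<kappa> \<mu>)"
  have sub: "{p. (\<lambda>(\<kappa>, \<mu>). dual_coeff \<nu> \<kappa> \<mu>) p \<noteq> 0} \<subseteq> ?K \<times> ?K"
    using dual_coeff_not_contained by auto
  have lookup: "Poly_Mapping.lookup c = (\<lambda>(\<kappa>, \<mu>). dual_coeff \<nu> \<kappa> \<mu>)"
    unfolding c_def by (rule lookup_Abs_poly_mapping) (rule finite_subset[OF sub], simp)
  have keys: "Poly_Mapping.keys c = {p. Poly_Mapping.lookup c p \<noteq> 0}" by (auto simp: in_keys_iff)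
  have sub': "Poly_Mapping.keys c \<subseteq> ?K \<times> ?K"
    using sub by (simp only: keys lookup)
  have c: "?P c"
    unfolding comultiplication_double_schur
    by (rule sum.mono_neutral_cong_right[OF _ sub'])
      (auto simp: in_keys_iff lookup scale_Lambda2_laws)
  have "c' = c" if c': "?P c'" for c'
  proof (rule poly_mapping_eqI)
    fix p
    define Q where "Q = Poly_Mapping.keys c \<union> Poly_Mapping.keys c'"
    have Q: "comultiplication (double_schur \<nu>) = (\<Sum>p\<in>Q. scale_Lambda2 (Poly_Mapping.lookup d p) (?t p))"
      if "?P d" "Poly_Mapping.keys d \<subseteq> Q" for d
      unfolding that(1) case_prod_beta prod.collapse
      by (rule sum.mono_neutral_left) (use that(2) in \<open>auto simp: Q_def in_keys_iff scale_Lambda2_laws\<close>)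
    have "(\<Sum>p\<in>Q. scale_Lambda2 (Poly_Mapping.lookup c' p - Poly_Mapping.lookup c p) (?t p)) =
        (\<Sum>p\<in>Q. scale_Lambda2 (Poly_Mapping.lookup c' p) (?t p)) - (\<Sum>p\<in>Q. scale_Lambda2 (Poly_Mapping.lookup c p) (?t p))"
      unfolding sum_subtractf[symmetric]
    proof (rule sum.cong[OF refl])
      fix p
      show "scale_Lambda2 (Poly_Mapping.lookup c' p - Poly_Mapping.lookup c p) (?t p) =
          scale_Lambda2 (Poly_Mapping.lookup c' p) (?t p) - scale_Lambda2 (Poly_Mapping.lookup c p) (?t p)"
        using scale_Lambda2_laws(3)[of "Poly_Mapping.lookup c' p - Poly_Mapping.lookup c p" "Poly_Mapping.lookup c p" "?t p"]
        by simp
    qed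
    also have "\<dots> = 0" using Q[OF c] Q[OF c'] by (simp add: Q_def)
    finally have zero: "(\<Sum>(\<kappa>, \<mu>)\<in>Q. scale_Lambda2 ((\<lambda>p. Poly_Mapping.lookup c' p - Poly_Mapping.lookup c p) (\<kappa>, \<mu>))
        (tensor (double_schur \<kappa>) (double_schur \<mu>))) = 0" by (simp only: split_def prod.collapse)
    show "Poly_Mapping.lookup c' p = Poly_Mapping.lookup c p"
    proof (cases "p \<in> Q")
      case True
      have "finite Q" by (simp add: Q_def)
      from double_schur_independent[OF this zero True] show ?thesis by simp
    qed (simp add: Q_def in_keys_iff)
  qed
  then have "(THE c. ?P c) = c" using c by (intro the_equality)
  then show ?thesis by (simp add: dual_LR_def lookup)
qed

text \<open>A nonzero term forces \<gamma> inside \<nu> and \<alpha>, \<beta> inside \<gamma>, so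
  the sum over all diagrams has finitely many nonzero terms and is taken over these.\<close>

theorem corollary4p4:
  fixes \<kappa> \<mu> \<nu> :: partition
  shows "finite {(\<alpha>, \<beta>, \<gamma>). LR_coeff \<alpha> \<beta> \<gamma> \<noteq> 0 \<and>
             phi \<alpha> \<kappa> \<noteq> 0 \<and> phi \<beta> \<mu> \<noteq> 0 \<and> psi \<nu> \<gamma> \<noteq> 0} \<and>
         dual_LR \<kappa> \<mu> \<nu> =
           (\<Sum>(\<alpha>, \<beta>, \<gamma>) \<in> {(\<alpha>, \<beta>, \<gamma>). LR_coeff \<alpha> \<beta> \<gamma> \<noteq> 0 \<and>
               phi \<alpha> \<kappa> \<noteq> 0 \<and> phi \<beta> \<mu> \<noteq> 0 \<and> psi \<nu> \<gamma> \<noteq> 0}.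
             (- 1) ^ (boxes_lower \<alpha> \<kappa> + boxes_lower \<beta> \<mu> + boxes_upper \<nu> \<gamma>) *
             of_int (LR_coeff \<alpha> \<beta> \<gamma>) * phi \<alpha> \<kappa> * phi \<beta> \<mu> * psi \<nu> \<gamma>) \<and>
         (\<not> (contained \<kappa> \<nu> \<and> contained \<mu> \<nu>) \<longrightarrow> dual_LR \<kappa> \<mu> \<nu> = 0)"
proof -
  let ?Z = "{(\<alpha>, \<beta>, \<gamma>). LR_coeff \<alpha> \<beta> \<gamma> \<noteq> 0 \<and> phi \<alpha> \<kappa> \<noteq> 0 \<and> phi \<beta> \<mu> \<noteq> 0 \<and> psi \<nu> \<gamma> \<noteq> 0}"
  have Z: "?Z \<subseteq> index_triples \<nu>"
    using LR_coeff_contained by (auto simp: index_triples_def psi_def split: if_splits)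
  have "dual_LR \<kappa> \<mu> \<nu> = (\<Sum>(\<alpha>, \<beta>, \<gamma>) \<in> ?Z.
      (- 1) ^ (boxes_lower \<alpha> \<kappa> + boxes_lower \<beta> \<mu> + boxes_upper \<nu> \<gamma>) *
      of_int (LR_coeff \<alpha> \<beta> \<gamma>) * phi \<alpha> \<kappa> * phi \<beta> \<mu> * psi \<nu> \<gamma>)"
    unfolding dual_LR_eq dual_coeff_def
    by (rule sum.mono_neutral_cong_right[OF finite_index_triples Z])
      (auto simp: psi_signed_def phi_signed_def power_add mult_ac)
  moreover have "finite ?Z" by (rule finite_subset[OF Z finite_index_triples])
  moreover have "\<not> (contained \<kappa> \<nu> \<and> contained \<mu> \<nu>) \<longrightarrow> dual_LR \<kappa> \<mu> \<nu> = 0"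
    unfolding dual_LR_eq using dual_coeff_not_contained by blast
  ultimately show ?thesis by (intro conjI)
qed

end
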